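(* Let $R$ be a ring which is free as a $\mathbb{Z}$-module and let $I$ be a $\mathbb{Z}$-basis of $R$. The $\mathbb{Q}$-algebra $\mathcal{G}_\infty^{\mathbb{Q}}(R)$ admits the following presentation. The generators are $e_r(U)$ for $U\in I$ and $r\in\mathbb{Z}_{>0}$. Writing $E_U(t)=\sum_{i\ge 0}e_i(U)t^i$, where $e_0(U)$ is the multiplicative identity, the relations are given by the following equalities of generating functions: for $U,V\in R$, $$E_U(u)\,E_{VU}(-uv)^{-1}\,E_V(v)=E_V(v)\,E_{UV}(-uv)^{-1}\,E_U(u),\qquad (1)$$ and, whenever $W=\sum_{U\in I}a_UU$ in $R$ with $a_U\in\mathbb{Z}$, $$\sum_{r\ge 1}\frac{\mu(r)}{r}\log\big(E_{W^r}(-t^r)\big)=\sum_{U\in I}a_U\sum_{r\ge 1}\frac{\mu(r)}{r}\log\big(E_{U^r}(-t^r)\big).\qquad (2)$$ Here, for $W\in R\setminus I$, the elements $e_r(W)$ appearing in these relations are the polynomials in the generators $e_s(U)$ ($U\in I$, $s\leq r$) determined recursively by the coefficients of powers of $t$ in (2). Further, $\mathcal{G}_\infty^{\mathbb{Z}}(R)$ is the $\mathbb{Z}$-subalgebra of $\mathcal{G}_\infty^{\mathbb{Q}}(R)$ generated by the $e_i(U)$.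
   Context: Rings are associative with unit. $\mu$ is the Möbius function. $\mathcal{G}_\infty^{\mathbb{Q}}(R)=\bigotimes_{i\ge 1}U(\mathbb{Q}\otimes_{\mathbb{Z}}R_i)$, where each $R_i$ is a copy of $R$, $\mathbb{Q}\otimes R$ is viewed as a Lie algebra via the commutator, $U(-)$ is the universal enveloping algebra, and the infinite tensor product is spanned by pure tensors with all but finitely many factors equal to $1$. For $r\in\mathbb{Q}\otimes R$, $T_i(r)$ is the image of $r$ under the canonical map $\mathbb{Q}\otimes R\to U(\mathbb{Q}\otimes R_i)\subset\mathcal{G}_\infty^{\mathbb{Q}}(R)$. $\Lambda$ is the ring of symmetric functions over $\mathbb{Z}$, with power sums $p_n$ and Schur functions $s_\lambda$. For each $U\in I$, $\Lambda^{(U)}$ is a copy of $\Lambda$ with variable set $\mathbf{x}_U$, and $f^{(U)}=f(\mathbf{x}_U)$. $\mathcal{P}$ is the set of partitions; $\mathcal{P}^I$ is the set of functions $\vec\lambda:I\to\mathcal{P}$ with $\sum_{U}|\vec\lambda(U)|<\infty$. For a $\mathbb{Q}$-algebra $A$ one works with (possibly infinite) formal sums $\sum_{\vec\mu\in\mathcal{P}^I}\left(\prod_U p_{\vec\mu(U)}^{(U)}\right)a_{\vec\mu}$, $a_{\vec\mu}\in A$, and $T_l$ is applied coefficientwise to such series with coefficients in $\mathbb{Q}\otimes R$. The elements $Z_{\vec\lambda}\in\mathcal{G}_\infty^{\mathbb{Q}}(R)$ are defined by $$\sum_{\vec\lambda\in\mathcal{P}^I}\Big(\prod_{U\in I}s_{\vec\lambda(U)}^{(U)}\Big)\otimes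 Z_{\vec\lambda}=\prod_{l=1}^\infty\exp\Big(T_l\Big(\log\Big(1+\sum_{U\in I}p_l^{(U)}U\Big)\Big)\Big),$$ and $\mathcal{G}_\infty^{\mathbb{Z}}(R)$ is the $\mathbb{Z}$-span of the $Z_{\vec\lambda}$; it is a subring of $\mathcal{G}_\infty^{\mathbb{Q}}(R)$, independent of $I$. The elements of $\mathcal{G}_\infty^{\mathbb{Q}}(R)$ to which the generators correspond are the following: for a formal power series $x$ with coefficients in $\mathbb{Q}\otimes R$ and constant term $1$, $\Theta_l(x)=\exp(T_l(\log x))$ ($T_l$ applied coefficientwise), and for $U\in R$, $$\sum_{r\ge 0}e_r(U)t^r=\prod_{l\ge 1}\Theta_l(1-(-t)^lU).$$ *)

theory Defs
  imports
    Complex_Main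
    "HOL-Computational_Algebra.Squarefree"
    "HOL-Library.Poly_Mapping"
    "HOL-Library.Groups_Big_Fun"
    "HOL-Library.Product_Plus"
    "HOL-Library.Multiset"
    "HOL-Library.FuncSet"
begin

text \<open>
  Rings with unit have the sort \<open>{ring, monoid_mult}\<close> rather than \<open>ring_1\<close>, because the latter
  excludes the zero ring.
\<close>


section \<open>\<open>\<int>\<close>-modules and \<open>\<rat>\<close>-algebras\<close>

definition zscale :: "int \<Rightarrow> 'a::ab_group_add \<Rightarrow> 'a" where
  "zscale n x = (\<Sum>_<nat n. x) - (\<Sum>_<nat (- n). x)"

lemma const_sum_add: "(\<Sum>_<m + n. x) = (\<Sum>_<m. x) + (\<Sum>_<(n::nat). x::'a::ab_group_add)"
  by (induction n) (auto simp: add_ac)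

lemma zscale_diff: "zscale (int p - int q) x = (\<Sum>_<p. x) - (\<Sum>_<q. x)"
proof (cases "q \<le> p")
  case True
  then obtain d where "p = q + d" using le_Suc_ex by blast
  then show ?thesis by (simp add: zscale_def const_sum_add)
next
  case False
  then obtain d where "q = p + d" using le_Suc_ex nat_le_linear by blast
  then show ?thesis by (simp add: zscale_def const_sum_add)
qed

lemma const_sum_mult: "(\<Sum>_<m * n. x) = (\<Sum>_<m. \<Sum>_<(n::nat). x::'a::ab_group_add)"
  by (induction m) (auto simp: const_sum_add add_ac)

global_interpretation int_module: module "zscale :: int \<Rightarrow> 'a::ab_group_add \<Rightarrow> 'a"
proof
  fix a b :: int and x y :: 'a
  obtain p q where a: "a = int p - int q" by (metis int_diff_cases)
  obtain r s where b: "b = int r - int s" by (metis int_diff_cases)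
  show "zscale a (x + y) = zscale a x + zscale a y"
    by (simp add: zscale_def sum.distrib)
  have "a + b = int (p + r) - int (q + s)" by (simp add: a b)
  then show "zscale (a + b) x = zscale a x + zscale b x"
    by (simp only: zscale_diff a b const_sum_add) (simp add: algebra_simps)
  have "a * b = int (p * r + q * s) - int (p * s + q * r)" by (simp add: a b algebra_simps)
  then show "zscale a (zscale b x) = zscale (a * b) x"
    by (simp only: zscale_diff a b const_sum_add const_sum_mult sum_subtractf)
      (simp add: algebra_simps)
  show "zscale 1 x = x" by (simp add: zscale_def)
qed

definition is_int_basis :: "'a::ab_group_add set \<Rightarrow> bool" where
  "is_int_basis I \<longleftrightarrow> \<not> int_module.dependent I \<and> int_module.span I = UNIV"

class rat_algebra = ring + monoid_mult +
  fixes scaleQ :: "rat \<Rightarrow> 'a \<Rightarrow> 'a"  (infixr \<open>*\<^sub>Q\<close> 75)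
  assumes scaleQ_add_right: "c *\<^sub>Q (x + y) = c *\<^sub>Q x + c *\<^sub>Q y"
    and scaleQ_add_left: "(c + d) *\<^sub>Q x = c *\<^sub>Q x + d *\<^sub>Q x"
    and scaleQ_scaleQ: "c *\<^sub>Q d *\<^sub>Q x = (c * d) *\<^sub>Q x"
    and scaleQ_one: "1 *\<^sub>Q x = x"
    and scaleQ_mult_left: "(c *\<^sub>Q x) * y = c *\<^sub>Q (x * y)"
    and scaleQ_mult_right: "x * (c *\<^sub>Q y) = c *\<^sub>Q (x * y)"

lemma scaleQ_zero_right [simp]: "c *\<^sub>Q (0::'a::rat_algebra) = 0"
  using scaleQ_add_right[of c 0 "0::'a"] by simp

lemma scaleQ_zero_left [simp]: "0 *\<^sub>Q (x::'a::rat_algebra) = 0"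
  using scaleQ_add_left[of 0 0 x] by simp

lemma scaleQ_minus_right: "c *\<^sub>Q (- x) = - (c *\<^sub>Q (x::'a::rat_algebra))"
  using scaleQ_add_right[of c x "- x"] by (simp add: eq_neg_iff_add_eq_0 add.commute)

lemma scaleQ_diff_right: "c *\<^sub>Q (x - y) = c *\<^sub>Q x - c *\<^sub>Q (y::'a::rat_algebra)"
  using scaleQ_add_right[of c x "- y"] by (simp add: scaleQ_minus_right)

lemma scaleQ_conv_mult: "c *\<^sub>Q x = (c *\<^sub>Q 1) * (x::'a::rat_algebra)"
  by (simp add: scaleQ_mult_left)

instantiation rat :: rat_algebra
begin
definition scaleQ_rat :: "rat \<Rightarrow> rat \<Rightarrow> rat" where "scaleQ_rat c x = c * x"
instance by standard (simp_all add: scaleQ_rat_def algebra_simps)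
end

definition is_subring :: "'a::{ring,monoid_mult} set \<Rightarrow> bool" where
  "is_subring A \<longleftrightarrow> 1 \<in> A \<and> (\<forall>x\<in>A. \<forall>y\<in>A. x - y \<in> A \<and> x * y \<in> A)"

text \<open>Two-sided ideals \<open>J\<close> of a subring \<open>A\<close>.\<close>

definition is_ideal :: "'a::{ring,monoid_mult} set \<Rightarrow> 'a set \<Rightarrow> bool" where
  "is_ideal A J \<longleftrightarrow> J \<subseteq> A \<and> 0 \<in> J \<and> (\<forall>x\<in>J. \<forall>y\<in>J. x - y \<in> J) \<and>
     (\<forall>a\<in>A. \<forall>x\<in>J. a * x \<in> J \<and> x * a \<in> J)"

definition same_mod :: "'a::{ring,monoid_mult} set \<Rightarrow> 'a \<Rightarrow> 'a \<Rightarrow> bool" where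
  "same_mod S x y \<longleftrightarrow> x - y \<in> is_ideal UNIV hull S"

lemma is_ideal_hull: "is_ideal UNIV (is_ideal UNIV hull S)"
  by (rule hull_in) (auto simp: is_ideal_def)

lemma hull_ideal_diff:
  "x \<in> is_ideal UNIV hull S \<Longrightarrow> y \<in> is_ideal UNIV hull S \<Longrightarrow> x - y \<in> is_ideal UNIV hull S"
  using is_ideal_hull[of S] by (auto simp: is_ideal_def)

lemma hull_ideal_zero [simp]: "0 \<in> is_ideal UNIV hull S"
  using is_ideal_hull[of S] by (auto simp: is_ideal_def)

lemma hull_ideal_minus: "x \<in> is_ideal UNIV hull S \<Longrightarrow> - x \<in> is_ideal UNIV hull S"
  using hull_ideal_diff[of 0 S x] by simp

lemma hull_ideal_add:
  "x \<in> is_ideal UNIV hull S \<Longrightarrow> y \<in> is_ideal UNIV hull S \<Longrightarrow> x + y \<in> is_ideal UNIV hull S"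
  using hull_ideal_diff[of x S "- y"] hull_ideal_minus[of y S] by simp

lemma hull_ideal_mult:
  "x \<in> is_ideal UNIV hull S \<Longrightarrow> a * x \<in> is_ideal UNIV hull S"
  "x \<in> is_ideal UNIV hull S \<Longrightarrow> x * a \<in> is_ideal UNIV hull S"
  using is_ideal_hull[of S] by (auto simp: is_ideal_def)

lemma equivp_same_mod: "equivp (same_mod S)"
proof (rule equivpI)
  show "reflp (same_mod S)" by (simp add: reflp_def same_mod_def)
  show "symp (same_mod S)"
    unfolding symp_def same_mod_def by (metis hull_ideal_minus minus_diff_eq)
  show "transp (same_mod S)"
    unfolding transp_def same_mod_def by (metis hull_ideal_add diff_add_cancel add_diff_eq)
qed

lemma same_mod_refl: "same_mod S x x" by (simp add: same_mod_def)

lemma same_mod_eq: "x = y \<Longrightarrow> same_mod S x y" by (simp add: same_mod_refl)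

lemma same_mod_gen: "x - y \<in> S \<Longrightarrow> same_mod S x y"
  by (simp add: same_mod_def hull_inc)

lemma same_mod_add: "same_mod S x y \<Longrightarrow> same_mod S x' y' \<Longrightarrow> same_mod S (x + x') (y + y')"
  using hull_ideal_add[of "x - y" S "x' - y'"] by (simp add: same_mod_def algebra_simps)

lemma same_mod_diff: "same_mod S x y \<Longrightarrow> same_mod S x' y' \<Longrightarrow> same_mod S (x - x') (y - y')"
  using hull_ideal_diff[of "x - y" S "x' - y'"] by (simp add: same_mod_def algebra_simps)

lemma same_mod_minus: "same_mod S x y \<Longrightarrow> same_mod S (- x) (- y)"
  using hull_ideal_minus[of "x - y" S] by (simp add: same_mod_def algebra_simps)

lemma same_mod_mult:
  assumes "same_mod S x y" "same_mod S x' y'"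
  shows "same_mod S (x * x') (y * y')"
proof -
  have "(x - y) * x' + y * (x' - y') \<in> is_ideal UNIV hull S"
    using assms by (intro hull_ideal_add hull_ideal_mult) (auto simp: same_mod_def)
  then show ?thesis by (simp add: same_mod_def algebra_simps)
qed

lemma same_mod_scaleQ:
  fixes x y :: "'a::rat_algebra"
  assumes "same_mod S x y" shows "same_mod S (c *\<^sub>Q x) (c *\<^sub>Q y)"
  using same_mod_mult[OF same_mod_refl assms, of "c *\<^sub>Q 1"]
  by (simp add: scaleQ_conv_mult[symmetric])


section \<open>Monoid algebras\<close>

text \<open>
  For an (additively written) monoid \<open>M\<close>, the type \<open>M \<Rightarrow>\<^sub>0 \<rat>\<close> with convolution is the monoid algebra
  of \<open>M\<close>.
\<close>

lemma commute_with_singles: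
  fixes z p :: "'m::monoid_add \<Rightarrow>\<^sub>0 'k::ring_1"
  assumes "\<And>k v. z * Poly_Mapping.single k v = Poly_Mapping.single k v * z"
  shows "z * p = p * z"
proof -
  have "p = (\<Sum>k\<in>Poly_Mapping.keys p. Poly_Mapping.single k (Poly_Mapping.lookup p k))"
    by (rule poly_mapping_eqI)
      (simp add: lookup_sum lookup_single when_def in_keys_iff sum.delta)
  then obtain A :: "'m set" and f where "p = (\<Sum>k\<in>A. Poly_Mapping.single k (f k))" by blast
  then show ?thesis by (simp add: sum_distrib_left sum_distrib_right assms)
qed

instantiation poly_mapping :: (monoid_add, "{rat_algebra,ring_1}") rat_algebra
begin

definition scaleQ_poly_mapping :: "rat \<Rightarrow> ('a \<Rightarrow>\<^sub>0 'b) \<Rightarrow> 'a \<Rightarrow>\<^sub>0 'b" where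
  "scaleQ_poly_mapping c = Poly_Mapping.map (scaleQ c)"

instance
proof
  fix c d :: rat and x y :: "'a \<Rightarrow>\<^sub>0 'b"
  have conv: "c *\<^sub>Q x = Poly_Mapping.single 0 (c *\<^sub>Q 1) * x" for c and x :: "'a \<Rightarrow>\<^sub>0 'b"
    unfolding scaleQ_poly_mapping_def mult_map_scale_conv_mult[symmetric]
    by (rule arg_cong[of _ _ "\<lambda>f. Poly_Mapping.map f x"]) (auto simp: scaleQ_mult_left)
  show "c *\<^sub>Q (x + y) = c *\<^sub>Q x + c *\<^sub>Q y" by (simp add: conv distrib_left)
  show "(c + d) *\<^sub>Q x = c *\<^sub>Q x + d *\<^sub>Q x"
    by (simp add: conv scaleQ_add_left single_add distrib_right)
  show "c *\<^sub>Q d *\<^sub>Q x = (c * d) *\<^sub>Q x"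
    by (simp add: conv mult.assoc[symmetric] mult_single scaleQ_mult_left scaleQ_scaleQ)
  show "1 *\<^sub>Q x = x" by (simp add: conv scaleQ_one)
  show "(c *\<^sub>Q x) * y = c *\<^sub>Q (x * y)" by (simp add: conv mult.assoc)
  have "Poly_Mapping.single 0 (c *\<^sub>Q 1) * x = x * Poly_Mapping.single 0 (c *\<^sub>Q 1)"
    by (rule commute_with_singles)
      (simp add: mult_single scaleQ_mult_left scaleQ_mult_right)
  then show "x * (c *\<^sub>Q y) = c *\<^sub>Q (x * y)" by (simp add: conv mult.assoc[symmetric])
qed

end

abbreviation mon :: "'m \<Rightarrow> 'm \<Rightarrow>\<^sub>0 'k::{zero,one}" where
  "mon k \<equiv> Poly_Mapping.single k 1"

text \<open>Words under concatenation; their monoid algebra is the free associative \<open>\<rat>\<close>-algebra.\<close>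

datatype 'x word = Word (letters: "'x list")

instantiation word :: (type) monoid_add
begin
definition zero_word :: "'a word" where "0 = Word []"
definition plus_word :: "'a word \<Rightarrow> 'a word \<Rightarrow> 'a word" where
  "v + w = Word (letters v @ letters w)"
instance by standard (simp_all add: zero_word_def plus_word_def)
end

type_synonym 'x free_alg = "'x word \<Rightarrow>\<^sub>0 rat"

definition free_gen :: "'x \<Rightarrow> 'x free_alg" where
  "free_gen x = mon (Word [x])"

text \<open>The free algebra on a set of generators, as a subalgebra of the one on the whole type.\<close>

definition free_on :: "'x set \<Rightarrow> 'x free_alg set" where
  "free_on X = {p. \<forall>w\<in>Poly_Mapping.keys p. set (letters w) \<subseteq> X}"

definition free_eval :: "('x \<Rightarrow> 'b::rat_algebra) \<Rightarrow> 'x free_alg \<Rightarrow> 'b" where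
  "free_eval f p =
    (\<Sum>w\<in>Poly_Mapping.keys p. Poly_Mapping.lookup p w *\<^sub>Q prod_list (map f (letters w)))"

text \<open>
  The algebra \<open>'b\<close> is presented by generators \<open>X\<close> and relators \<open>S\<close>: the homomorphism from the free
  algebra determined by \<open>f\<close> induces an isomorphism from the quotient by the ideal generated by \<open>S\<close>.
\<close>

definition is_presentation ::
    "'x set \<Rightarrow> 'x free_alg set \<Rightarrow> ('x \<Rightarrow> 'b::rat_algebra) \<Rightarrow> bool" where
  "is_presentation X S f \<longleftrightarrow>
     S \<subseteq> free_on X \<and>
     free_eval f ` free_on X = UNIV \<and>
     {p \<in> free_on X. free_eval f p = 0} = is_ideal (free_on X) hull S"


section \<open>The algebra \<open>\<rat> \<otimes> R\<close>\<close>

text \<open>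
  \<open>\<rat> \<otimes>\<^sub>\<int> R\<close> is the free abelian group on pairs, which is the integral monoid ring of the
  multiplicative monoid \<open>\<rat> \<times> R\<close>, modulo biadditivity.
\<close>

datatype 'r qpair = QPair rat 'r

instantiation qpair :: (monoid_mult) monoid_add
begin
definition zero_qpair :: "'a qpair" where "0 = QPair 1 1"
fun plus_qpair :: "'a qpair \<Rightarrow> 'a qpair \<Rightarrow> 'a qpair" where
  "QPair a x + QPair b y = QPair (a * b) (x * y)"
instance
proof
  fix a b c :: "'a qpair"
  show "a + b + c = a + (b + c)" by (cases a; cases b; cases c) (simp add: mult.assoc)
  show "0 + a = a" "a + 0 = a" by (cases a; simp add: zero_qpair_def)+
qed
end

definition biadditive_rels :: "('r::{ring,monoid_mult} qpair \<Rightarrow>\<^sub>0 int) set" where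
  "biadditive_rels =
     {mon (QPair (a + b) x) - (mon (QPair a x) + mon (QPair b x)) | a b x. True} \<union>
     {mon (QPair a (x + y)) - (mon (QPair a x) + mon (QPair a y)) | a x y. True}"

quotient_type (overloaded) 'r rat_tensor =
    "'r::{ring,monoid_mult} qpair \<Rightarrow>\<^sub>0 int" / "same_mod biadditive_rels"
  by (rule equivp_same_mod)

lemma mon_qpair_central: "mon (QPair c 1) * p = p * (mon (QPair c 1) :: 'r::monoid_mult qpair \<Rightarrow>\<^sub>0 int)"
proof (rule commute_with_singles)
  fix k :: "'r qpair" and v :: int
  show "mon (QPair c 1) * Poly_Mapping.single k v = Poly_Mapping.single k v * mon (QPair c 1)"
    by (cases k) (simp add: mult_single mult.commute)
qed

instantiation rat_tensor :: ("{ring,monoid_mult}") rat_algebra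
begin

lift_definition zero_rat_tensor :: "'a rat_tensor" is 0 .
lift_definition one_rat_tensor :: "'a rat_tensor" is 1 .
lift_definition plus_rat_tensor :: "'a rat_tensor \<Rightarrow> 'a rat_tensor \<Rightarrow> 'a rat_tensor" is "(+)"
  by (rule same_mod_add)
lift_definition minus_rat_tensor :: "'a rat_tensor \<Rightarrow> 'a rat_tensor \<Rightarrow> 'a rat_tensor" is "(-)"
  by (rule same_mod_diff)
lift_definition uminus_rat_tensor :: "'a rat_tensor \<Rightarrow> 'a rat_tensor" is "uminus"
  by (rule same_mod_minus)
lift_definition times_rat_tensor :: "'a rat_tensor \<Rightarrow> 'a rat_tensor \<Rightarrow> 'a rat_tensor" is "(*)"
  by (rule same_mod_mult)
lift_definition scaleQ_rat_tensor :: "rat \<Rightarrow> 'a rat_tensor \<Rightarrow> 'a rat_tensor"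
  is "\<lambda>c p. mon (QPair c 1) * p"
  by (rule same_mod_mult[OF same_mod_refl])

instance
proof
  fix a b c :: "'a rat_tensor" and r s :: rat
  show "a + b + c = a + (b + c)" "a + b = b + a" "0 + a = a" "- a + a = 0" "a - b = a + - b"
    "a * b * c = a * (b * c)" "(a + b) * c = a * c + b * c" "a * (b + c) = a * b + a * c"
    "1 * a = a" "a * 1 = a"
    by (transfer, rule same_mod_eq, simp add: algebra_simps)+
  show "r *\<^sub>Q (a + b) = r *\<^sub>Q a + r *\<^sub>Q b" "(r *\<^sub>Q a) * b = r *\<^sub>Q (a * b)"
    by (transfer, rule same_mod_eq, simp add: algebra_simps)+
  show "(r + s) *\<^sub>Q a = r *\<^sub>Q a + s *\<^sub>Q a"
  proof (transfer fixing: r s)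
    fix p :: "'a qpair \<Rightarrow>\<^sub>0 int"
    have "same_mod biadditive_rels (mon (QPair (r + s) (1::'a)))
            (mon (QPair r 1) + mon (QPair s 1))"
      by (rule same_mod_gen) (auto simp: biadditive_rels_def)
    from same_mod_mult[OF this same_mod_refl[of _ p]]
    show "same_mod biadditive_rels (mon (QPair (r + s) 1) * p)
            (mon (QPair r 1) * p + mon (QPair s 1) * p)"
      by (simp add: distrib_right)
  qed
  show "r *\<^sub>Q s *\<^sub>Q a = (r * s) *\<^sub>Q a"
    by (transfer, rule same_mod_eq, simp add: mult.assoc[symmetric] mult_single)
  show "1 *\<^sub>Q a = a"
    by (transfer, rule same_mod_eq) (simp add: zero_qpair_def[symmetric] single_one)
  show "a * r *\<^sub>Q b = r *\<^sub>Q (a * b)"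
    by (transfer, rule same_mod_eq) (metis mult.assoc mon_qpair_central)
qed

end

lift_definition tensor_one :: "'r::{ring,monoid_mult} \<Rightarrow> 'r rat_tensor" is "\<lambda>x. mon (QPair 1 x)" .


section \<open>Universal enveloping algebras\<close>

text \<open>
  The universal enveloping algebra of a \<open>\<rat>\<close>-algebra regarded as a Lie algebra under the commutator:
  the linearity relations cut the free algebra on the set \<open>'l\<close> down to the tensor algebra of the
  vector space \<open>'l\<close>.
\<close>

definition uea_rels :: "'l::rat_algebra free_alg set" where
  "uea_rels =
     {free_gen (x + y) - (free_gen x + free_gen y) | x y. True} \<union>
     {free_gen (c *\<^sub>Q x) - c *\<^sub>Q free_gen x | c x. True} \<union>
     {(free_gen x * free_gen y - free_gen y * free_gen x) - free_gen (x * y - y * x) | x y. True}"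

quotient_type (overloaded) 'l uea = "'l::rat_algebra free_alg" / "same_mod uea_rels"
  by (rule equivp_same_mod)

instantiation uea :: (rat_algebra) rat_algebra
begin

lift_definition zero_uea :: "'a uea" is 0 .
lift_definition one_uea :: "'a uea" is 1 .
lift_definition plus_uea :: "'a uea \<Rightarrow> 'a uea \<Rightarrow> 'a uea" is "(+)" by (rule same_mod_add)
lift_definition minus_uea :: "'a uea \<Rightarrow> 'a uea \<Rightarrow> 'a uea" is "(-)" by (rule same_mod_diff)
lift_definition uminus_uea :: "'a uea \<Rightarrow> 'a uea" is "uminus" by (rule same_mod_minus)
lift_definition times_uea :: "'a uea \<Rightarrow> 'a uea \<Rightarrow> 'a uea" is "(*)" by (rule same_mod_mult)
lift_definition scaleQ_uea :: "rat \<Rightarrow> 'a uea \<Rightarrow> 'a uea" is scaleQ by (rule same_mod_scaleQ)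

instance
  by standard
    (transfer, rule same_mod_eq, simp add: algebra_simps scaleQ_add_right scaleQ_add_left
      scaleQ_scaleQ scaleQ_one scaleQ_mult_left scaleQ_mult_right)+

end

lift_definition uea_gen :: "'l::rat_algebra \<Rightarrow> 'l uea" is free_gen .


section \<open>Infinite tensor powers\<close>

text \<open>
  The tensor product of copies of \<open>'a\<close> indexed by \<open>'i\<close>, spanned by the pure tensors with almost all
  factors equal to \<open>1\<close>. Such families form a monoid under pointwise multiplication (written
  additively); the tensor product is its monoid algebra modulo multilinearity.
\<close>

typedef (overloaded) ('i, 'a) family = "{f :: 'i \<Rightarrow> 'a::monoid_mult. finite {i. f i \<noteq> 1}}"
  morphisms factor Family
  by (rule exI[of _ "\<lambda>_. 1"]) simp

setup_lifting type_definition_family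

instantiation family :: (type, monoid_mult) monoid_add
begin
lift_definition zero_family :: "('a, 'b) family" is "\<lambda>_. 1" by simp
lift_definition plus_family :: "('a, 'b) family \<Rightarrow> ('a, 'b) family \<Rightarrow> ('a, 'b) family"
  is "\<lambda>f g i. f i * g i"
proof -
  fix f g :: "'a \<Rightarrow> 'b"
  assume "finite {i. f i \<noteq> 1}" "finite {i. g i \<noteq> 1}"
  then show "finite {i. f i * g i \<noteq> 1}"
    by (rule_tac finite_subset[of _ "{i. f i \<noteq> 1} \<union> {i. g i \<noteq> 1}"]) auto
qed
instance by standard (transfer, simp add: mult.assoc)+
end

lift_definition family_upd :: "('i, 'a::monoid_mult) family \<Rightarrow> 'i \<Rightarrow> 'a \<Rightarrow> ('i, 'a) family"
  is "\<lambda>f i x. f(i := x)"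
proof -
  fix f :: "'i \<Rightarrow> 'a" and i x
  assume "finite {j. f j \<noteq> 1}"
  then show "finite {j. (f(i := x)) j \<noteq> 1}"
    by (rule_tac finite_subset[of _ "insert i {j. f j \<noteq> 1}"]) auto
qed

definition multilinear_rels :: "(('i, 'a::rat_algebra) family \<Rightarrow>\<^sub>0 rat) set" where
  "multilinear_rels =
     {mon (family_upd f i (x + y)) - (mon (family_upd f i x) + mon (family_upd f i y))
        | f i x y. True} \<union>
     {mon (family_upd f i (c *\<^sub>Q x)) - c *\<^sub>Q mon (family_upd f i x) | f i c x. True}"

quotient_type (overloaded) ('i, 'a) tensor_power =
    "('i, 'a::rat_algebra) family \<Rightarrow>\<^sub>0 rat" / "same_mod multilinear_rels"
  by (rule equivp_same_mod)

instantiation tensor_power :: (type, rat_algebra) rat_algebra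
begin

lift_definition zero_tensor_power :: "('a, 'b) tensor_power" is 0 .
lift_definition one_tensor_power :: "('a, 'b) tensor_power" is 1 .
lift_definition plus_tensor_power ::
  "('a, 'b) tensor_power \<Rightarrow> ('a, 'b) tensor_power \<Rightarrow> ('a, 'b) tensor_power" is "(+)"
  by (rule same_mod_add)
lift_definition minus_tensor_power ::
  "('a, 'b) tensor_power \<Rightarrow> ('a, 'b) tensor_power \<Rightarrow> ('a, 'b) tensor_power" is "(-)"
  by (rule same_mod_diff)
lift_definition uminus_tensor_power :: "('a, 'b) tensor_power \<Rightarrow> ('a, 'b) tensor_power"
  is "uminus" by (rule same_mod_minus)
lift_definition times_tensor_power ::
  "('a, 'b) tensor_power \<Rightarrow> ('a, 'b) tensor_power \<Rightarrow> ('a, 'b) tensor_power" is "(*)"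
  by (rule same_mod_mult)
lift_definition scaleQ_tensor_power :: "rat \<Rightarrow> ('a, 'b) tensor_power \<Rightarrow> ('a, 'b) tensor_power"
  is scaleQ by (rule same_mod_scaleQ)

instance
  by standard
    (transfer, rule same_mod_eq, simp add: algebra_simps scaleQ_add_right scaleQ_add_left
      scaleQ_scaleQ scaleQ_one scaleQ_mult_left scaleQ_mult_right)+

end

lift_definition tensor_at :: "'i \<Rightarrow> 'a::rat_algebra \<Rightarrow> ('i, 'a) tensor_power"
  is "\<lambda>i x. mon (family_upd 0 i x)" .

text \<open>
  \<open>\<G>\<^sub>\<infinity>\<^sup>\<rat>(R)\<close>. The copies \<open>R\<^sub>1, R\<^sub>2, \<dots>\<close> sit at the indices \<open>0, 1, \<dots>\<close>; \<open>T_map l\<close> is only used for \<open>l \<ge> 1\<close>.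
\<close>

type_synonym 'r ginf = "(nat, 'r rat_tensor uea) tensor_power"

definition T_map :: "nat \<Rightarrow> 'r::{ring,monoid_mult} rat_tensor \<Rightarrow> 'r ginf" where
  "T_map l r = tensor_at (l - 1) (uea_gen r)"


section \<open>Formal series\<close>

text \<open>
  Formal series with coefficients in \<open>'a\<close>, whose exponents range over a commutative monoid in which
  every element is a sum in finitely many ways: \<open>nat\<close> for series in one variable, \<open>nat \<times> nat\<close> for two
  variables, \<open>'v multiset\<close> for variables indexed by \<open>'v\<close>. The variables commute with the coefficients.
\<close>

class finite_splits = comm_monoid_add +
  assumes finite_splits: "finite {(a, b). a + b = c}"

instance nat :: finite_splits
proof
  fix c :: nat
  show "finite {(a, b). a + b = c}"
    by (rule finite_subset[of _ "{..c} \<times> {..c}"]) auto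
qed

instance prod :: (finite_splits, finite_splits) finite_splits
proof
  fix c :: "'a \<times> 'b"
  let ?f = "\<lambda>((a, b), (a', b')). ((a, a'), (b, b'))"
  have "{(a, b). a + b = c} \<subseteq> ?f ` ({(a, b). a + b = fst c} \<times> {(a, b). a + b = snd c})"
    by (force simp: image_iff)
  then show "finite {(a, b). a + b = c}"
    by (rule finite_subset) (intro finite_imageI finite_cartesian_product finite_splits)
qed

instance multiset :: (type) finite_splits
proof
  fix c :: "'a multiset"
  have fin: "finite {a. a \<subseteq># c}"
    by (rule finite_subset[of _ "\<Union>n\<in>{..size c}. multisets_of_size (set_mset c) n"])
      (auto dest: size_mset_mono mset_subset_eqD simp: multisets_of_size_def
        intro!: finite_multisets_of_size[unfolded multisets_of_size_def])
  show "finite {(a, b). a + b = c}"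
    by (rule finite_subset[OF _ finite_cartesian_product[OF fin fin]]) auto
qed

typedef ('m, 'a) series = "UNIV :: ('m \<Rightarrow> 'a) set"
  morphisms coeff Series ..

setup_lifting type_definition_series

instantiation series :: (finite_splits, "{ring,monoid_mult}") "{ring,monoid_mult}"
begin

lift_definition zero_series :: "('a, 'b) series" is "\<lambda>_. 0" .
lift_definition one_series :: "('a, 'b) series" is "\<lambda>m. if m = 0 then 1 else 0" .
lift_definition plus_series :: "('a, 'b) series \<Rightarrow> ('a, 'b) series \<Rightarrow> ('a, 'b) series"
  is "\<lambda>f g m. f m + g m" .
lift_definition minus_series :: "('a, 'b) series \<Rightarrow> ('a, 'b) series \<Rightarrow> ('a, 'b) series"
  is "\<lambda>f g m. f m - g m" .
lift_definition uminus_series :: "('a, 'b) series \<Rightarrow> ('a, 'b) series" is "\<lambda>f m. - f m" .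
lift_definition times_series :: "('a, 'b) series \<Rightarrow> ('a, 'b) series \<Rightarrow> ('a, 'b) series"
  is "\<lambda>f g m. \<Sum>(a, b)\<in>{(a, b). a + b = m}. f a * g b" .

instance
proof
  fix f g h :: "('a, 'b) series"
  show "f + g + h = f + (g + h)" "f + g = g + f" "0 + f = f" "- f + f = 0" "f - g = f + - g"
    by (transfer, auto simp: add_ac)+
  show "(f + g) * h = f * h + g * h" "f * (g + h) = f * g + f * h"
    by (transfer, auto simp: algebra_simps sum.distrib case_prod_unfold)+
  show "1 * f = f"
  proof (transfer, rule ext)
    fix f :: "'a \<Rightarrow> 'b" and m :: 'a
    have "(\<Sum>(a, b)\<in>{(a, b). a + b = m}. (if a = 0 then 1 else 0) * f b) =
          (\<Sum>(a, b)\<in>{(0::'a, m)}. (if a = 0 then 1 else 0) * f b)"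
      by (rule sum.mono_neutral_right) (auto simp: finite_splits split: if_splits)
    then show "(\<Sum>(a, b)\<in>{(a, b). a + b = m}. (if a = 0 then 1 else 0) * f b) = f m" by simp
  qed
  show "f * 1 = f"
  proof (transfer, rule ext)
    fix f :: "'a \<Rightarrow> 'b" and m :: 'a
    have "(\<Sum>(a, b)\<in>{(a, b). a + b = m}. f a * (if b = 0 then 1 else 0)) =
          (\<Sum>(a, b)\<in>{(m, 0::'a)}. f a * (if b = 0 then 1 else 0))"
      by (rule sum.mono_neutral_right) (auto simp: finite_splits split: if_splits)
    then show "(\<Sum>(a, b)\<in>{(a, b). a + b = m}. f a * (if b = 0 then 1 else 0)) = f m" by simp
  qed
  show "f * g * h = f * (g * h)"
  proof (transfer, rule ext)
    fix f g h :: "'a \<Rightarrow> 'b" and m :: 'a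
    let ?S = "\<lambda>m::'a. {(a, b). a + b = m}"
    have fin: "finite {p. fst p + snd p = k}" for k :: 'a
      using finite_splits[of k] by (simp add: case_prod_unfold)
    have "(\<Sum>(a, b)\<in>?S m. (\<Sum>(c, d)\<in>?S a. f c * g d) * h b) =
          (\<Sum>((a, b), (c, d))\<in>(SIGMA p:?S m. ?S (fst p)). f c * g d * h b)"
      by (subst sum.Sigma[symmetric])
        (auto simp: fin sum_distrib_right case_prod_unfold)
    also have "\<dots> = (\<Sum>((a, b), (c, d))\<in>(SIGMA p:?S m. ?S (snd p)). f a * (g c * h d))"
      by (rule sum.reindex_bij_witness[of _ "\<lambda>((a, b), (c, d)). ((a + c, d), (a, c))"
            "\<lambda>((a, b), (c, d)). ((c, d + b), (d, b))"])
        (auto simp: add_ac mult.assoc)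
    also have "\<dots> = (\<Sum>(a, b)\<in>?S m. f a * (\<Sum>(c, d)\<in>?S b. g c * h d))"
      by (subst sum.Sigma[symmetric])
        (auto simp: fin sum_distrib_left case_prod_unfold)
    finally show "(\<Sum>(a, b)\<in>?S m. (\<Sum>(c, d)\<in>?S a. f c * g d) * h b) =
        (\<Sum>(a, b)\<in>?S m. f a * (\<Sum>(c, d)\<in>?S b. g c * h d))" .
  qed
qed

end

instantiation series :: (finite_splits, rat_algebra) rat_algebra
begin

lift_definition scaleQ_series :: "rat \<Rightarrow> ('a, 'b) series \<Rightarrow> ('a, 'b) series" is "\<lambda>c f m. c *\<^sub>Q f m" .

instance
proof
  fix c d :: rat and f g :: "('a, 'b) series"
  have scale_sum: "c *\<^sub>Q sum k A = (\<Sum>x\<in>A. c *\<^sub>Q k x)" for c A and k :: "'x \<Rightarrow> 'b"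
    by (induction A rule: infinite_finite_induct) (auto simp: scaleQ_add_right)
  show "c *\<^sub>Q (f + g) = c *\<^sub>Q f + c *\<^sub>Q g" "(c + d) *\<^sub>Q f = c *\<^sub>Q f + d *\<^sub>Q f"
    "c *\<^sub>Q d *\<^sub>Q f = (c * d) *\<^sub>Q f" "1 *\<^sub>Q f = f"
    by (transfer, simp add: scaleQ_add_right scaleQ_add_left scaleQ_scaleQ scaleQ_one)+
  show "(c *\<^sub>Q f) * g = c *\<^sub>Q (f * g)" "f * c *\<^sub>Q g = c *\<^sub>Q (f * g)"
    by (transfer, simp add: scale_sum scaleQ_mult_left scaleQ_mult_right case_prod_unfold)+
qed

end

definition monom :: "'m \<Rightarrow> 'a::zero \<Rightarrow> ('m, 'a) series" where
  "monom k a = Series (\<lambda>m. if m = k then a else 0)"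

definition map_series :: "('a \<Rightarrow> 'b) \<Rightarrow> ('m, 'a) series \<Rightarrow> ('m, 'b) series" where
  "map_series h f = Series (\<lambda>m. h (coeff f m))"

text \<open>
  Coefficientwise infinite sums, for families in which every coefficient is nonzero only finitely
  often (\<^const>\<open>Sum_any\<close> sums over the support).
\<close>

definition sum_series :: "('k \<Rightarrow> ('m, 'a::comm_monoid_add) series) \<Rightarrow> ('m, 'a) series" where
  "sum_series f = Series (\<lambda>m. \<Sum>k. coeff (f k) m)"

text \<open>The ordered product \<open>f 1 * f 2 * \<dots>\<close>, each coefficient of which is eventually constant.\<close>

definition prod_series ::
    "(nat \<Rightarrow> ('m::finite_splits, 'a::{ring,monoid_mult}) series) \<Rightarrow> ('m, 'a) series" where
  "prod_series f = Series (\<lambda>m. THE c.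
     \<forall>\<^sub>F N in sequentially. coeff (prod_list (map f [1..<N])) m = c)"

text \<open>The substitution \<open>f(c X\<^sup>k)\<close> of a monomial in a series in one variable.\<close>

definition subst_monom ::
    "rat \<Rightarrow> 'm::finite_splits \<Rightarrow> (nat, 'a::rat_algebra) series \<Rightarrow> ('m, 'a) series" where
  "subst_monom c k f = sum_series (\<lambda>n. monom (\<Sum>_<n. k) (c ^ n *\<^sub>Q coeff f n))"

text \<open>
  Rational power series evaluated at a series with vanishing constant term. The logarithm and the
  inverse are those of series with constant term \<open>1\<close>.
\<close>

definition eval_series ::
    "(nat \<Rightarrow> rat) \<Rightarrow> ('m::finite_splits, 'a::rat_algebra) series \<Rightarrow> ('m, 'a) series" where
  "eval_series c x = sum_series (\<lambda>n. c n *\<^sub>Q x ^ n)"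

definition exp_series :: "('m::finite_splits, 'a::rat_algebra) series \<Rightarrow> ('m, 'a) series" where
  "exp_series x = eval_series (\<lambda>n. 1 / fact n) x"

definition log_series :: "('m::finite_splits, 'a::rat_algebra) series \<Rightarrow> ('m, 'a) series" where
  "log_series x = eval_series (\<lambda>n. if n = 0 then 0 else (-1) ^ (n + 1) / of_nat n) (x - 1)"

definition inv_series :: "('m::finite_splits, 'a::rat_algebra) series \<Rightarrow> ('m, 'a) series" where
  "inv_series x = eval_series (\<lambda>n. (-1) ^ n) (x - 1)"

definition Theta ::
    "nat \<Rightarrow> ('m::finite_splits, 'r::{ring,monoid_mult} rat_tensor) series \<Rightarrow> ('m, 'r ginf) series"
  where "Theta l x = exp_series (map_series (T_map l) (log_series x))"


section \<open>Symmetric functions and the integral form\<close>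

text \<open>
  Symmetric functions are realised as series in their variables. The variable \<open>x\<^bsub>U,i\<^esub>\<close> of the set
  \<open>\<^bold>x\<^sub>U\<close> is the pair \<open>(U, i)\<close>, so a monomial is a multiset of such pairs. A formal sum of symmetric
  functions with coefficients in a \<open>\<rat>\<close>-algebra thus becomes a series in these variables, and applying
  \<open>T_map l\<close> to the coefficients of the power sum expansion amounts to applying it to the coefficients of
  the monomials, as \<open>T_map l\<close> is \<open>\<rat>\<close>-linear.
\<close>

definition power_sum :: "nat \<Rightarrow> 'r \<Rightarrow> (('r \<times> nat) multiset, rat) series" where
  "power_sum l U = sum_series (\<lambda>i. monom (replicate_mset l (U, i)) 1)"

text \<open>Partitions are the weakly decreasing lists of their (positive) parts.\<close>

definition is_partition :: "nat list \<Rightarrow> bool" where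
  "is_partition \<nu> \<longleftrightarrow> sorted_wrt (\<ge>) \<nu> \<and> 0 \<notin> set \<nu>"

definition cells :: "nat list \<Rightarrow> (nat \<times> nat) set" where
  "cells \<nu> = {(i, j). i < length \<nu> \<and> j < \<nu> ! i}"

definition ssyt :: "nat list \<Rightarrow> (nat \<times> nat \<Rightarrow> nat) set" where
  "ssyt \<nu> = {t \<in> extensional (cells \<nu>).
     (\<forall>i j. (i, j + 1) \<in> cells \<nu> \<longrightarrow> t (i, j) \<le> t (i, j + 1)) \<and>
     (\<forall>i j. (i + 1, j) \<in> cells \<nu> \<longrightarrow> t (i, j) < t (i + 1, j))}"

definition schur :: "nat list \<Rightarrow> 'r \<Rightarrow> (('r \<times> nat) multiset, rat) series" where
  "schur \<nu> U = Series (\<lambda>m. of_nat (card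
     {t \<in> ssyt \<nu>. m = image_mset (\<lambda>c. (U, t c)) (mset_set (cells \<nu>))}))"

instance series :: (finite_splits, "{comm_ring,monoid_mult}") comm_monoid_mult
proof
  fix f g :: "('a, 'b) series"
  show "f * g = g * f"
    by (transfer, rule ext, rule sum.reindex_bij_witness[of _ prod.swap prod.swap])
      (auto simp: add.commute mult.commute)
  show "1 * f = f" by simp
qed

definition multi_partitions :: "'r set \<Rightarrow> ('r \<Rightarrow> nat list) set" where
  "multi_partitions I = {\<nu>. (\<forall>U. is_partition (\<nu> U)) \<and> {U. \<nu> U \<noteq> []} \<subseteq> I \<and> finite {U. \<nu> U \<noteq> []}}"

definition schur_product :: "('r \<Rightarrow> nat list) \<Rightarrow> (('r \<times> nat) multiset, rat) series" where
  "schur_product \<nu> = (\<Prod>U | \<nu> U \<noteq> []. schur (\<nu> U) U)"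

definition Z_generating :: "'r::{ring,monoid_mult} set \<Rightarrow> (('r \<times> nat) multiset, 'r ginf) series" where
  "Z_generating I = prod_series (\<lambda>l.
     exp_series (map_series (T_map l) (log_series
       (1 + sum_series (\<lambda>U. if U \<in> I then map_series (\<lambda>c. c *\<^sub>Q tensor_one U) (power_sum l U) else 0)))))"

definition Z_elem :: "'r::{ring,monoid_mult} set \<Rightarrow> ('r \<Rightarrow> nat list) \<Rightarrow> 'r ginf" where
  "Z_elem I = (THE z. (\<forall>\<nu>. \<nu> \<notin> multi_partitions I \<longrightarrow> z \<nu> = 0) \<and>
     sum_series (\<lambda>\<nu>. map_series (\<lambda>c. c *\<^sub>Q z \<nu>) (schur_product \<nu>)) = Z_generating I)"

definition G_int :: "'r::{ring,monoid_mult} set \<Rightarrow> 'r ginf set" where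
  "G_int I = int_module.span (Z_elem I ` multi_partitions I)"


section \<open>Generators and relations\<close>

text \<open>The elements \<open>e\<^sub>r(U)\<close> of \<open>\<G>\<^sub>\<infinity>\<^sup>\<rat>(R)\<close>; here \<open>(-t)\<^sup>l U = (-1)\<^sup>l U t\<^sup>l\<close>.\<close>

definition e_ginf :: "nat \<Rightarrow> 'r::{ring,monoid_mult} \<Rightarrow> 'r ginf" where
  "e_ginf r U = coeff (prod_series (\<lambda>l. Theta l (1 - monom l ((-1) ^ l *\<^sub>Q tensor_one U)))) r"

definition moebius_mu :: "nat \<Rightarrow> int" where
  "moebius_mu n = (if squarefree n then (-1) ^ card (prime_factors n) else 0)"

definition moebius_log ::
    "('r::monoid_mult \<Rightarrow> (nat, 'a::rat_algebra) series) \<Rightarrow> 'r \<Rightarrow> (nat, 'a) series" where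
  "moebius_log E W = sum_series (\<lambda>r. if r \<ge> 1
     then (of_int (moebius_mu r) / of_nat r) *\<^sub>Q log_series (subst_monom (-1) r (E (W ^ r))) else 0)"

definition int_combinations :: "'r set \<Rightarrow> ('r \<Rightarrow> int) set" where
  "int_combinations I = {a. finite {U. a U \<noteq> 0} \<and> {U. a U \<noteq> 0} \<subseteq> I}"

definition commutation_relator ::
    "('r::{ring,monoid_mult} \<Rightarrow> (nat, 'a::rat_algebra) series) \<Rightarrow> 'r \<Rightarrow> 'r \<Rightarrow> (nat \<times> nat, 'a) series"
  where
  "commutation_relator E U V =
     (let u = (1, 0); v = (0, 1); uv = (1, 1) in
       subst_monom 1 u (E U) * inv_series (subst_monom (-1) uv (E (V * U))) * subst_monom 1 v (E V) -
       subst_monom 1 v (E V) * inv_series (subst_monom (-1) uv (E (U * V))) * subst_monom 1 u (E U))"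

definition additivity_relator ::
    "('r::{ring,monoid_mult} \<Rightarrow> (nat, 'a::rat_algebra) series) \<Rightarrow> ('r \<Rightarrow> int) \<Rightarrow> (nat, 'a) series"
  where
  "additivity_relator E a =
     moebius_log E (\<Sum>U | a U \<noteq> 0. zscale (a U) U) -
     (\<Sum>U | a U \<noteq> 0. of_int (a U) *\<^sub>Q moebius_log E U)"

text \<open>
  The series \<open>E\<^sub>W(t)\<close> for all \<open>W \<in> R\<close>, over the free algebra on the \<open>e\<^sub>r(U)\<close>, \<open>U \<in> I\<close>, \<open>r \<ge> 1\<close>: those of
  basis elements have the generators as coefficients, and the others are determined recursively by the
  additivity relation.
\<close>

definition E_free :: "'r::{ring,monoid_mult} set \<Rightarrow> 'r \<Rightarrow> (nat, ('r \<times> nat) free_alg) series" where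
  "E_free I = (THE E.
     (\<forall>W. coeff (E W) 0 = 1) \<and>
     (\<forall>U\<in>I. \<forall>r\<ge>1. coeff (E U) r = free_gen (U, r)) \<and>
     (\<forall>a\<in>int_combinations I. additivity_relator E a = 0))"

definition relators :: "'r::{ring,monoid_mult} set \<Rightarrow> ('r \<times> nat) free_alg set" where
  "relators I =
     {coeff (commutation_relator (E_free I) U V) k | U V k. True} \<union>
     {coeff (additivity_relator (E_free I) a) n | a n. a \<in> int_combinations I}"

end

theory Submission
  imports Defs "HOL-Computational_Algebra.Formal_Power_Series"
begin

text \<open>
  Since \<open>T\<^sub>l\<close> is a Lie map, \<open>\<Theta>\<^sub>l\<close> is multiplicative on series with constant term \<open>1\<close>. Factors with different
  \<open>l\<close> commute, so \<open>\<Phi>(X) = \<Prod>\<^sub>l \<Theta>\<^sub>l(\<psi>\<^sub>l X)\<close> is multiplicative as well, where \<open>\<psi>\<^sub>l\<close> raises the variables to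
  the power \<open>l\<close>, and (1) is the image under \<open>\<Phi>\<close> of an identity between series over \<open>\<rat> \<otimes> R\<close>.

  Conversely, by Moebius inversion any solution of (2) is \<open>E\<^sub>W(-t) = exp (- \<Sum>\<^sub>l\<^sub>,\<^sub>k t\<^sup>l\<^sup>k \<tau>\<^sub>l(W\<^sup>k) / k)\<close> for
  additive \<open>\<tau>\<^sub>l\<close>. Replacing \<open>U\<close> and \<open>V\<close> by integral multiples in (1), the part that is linear in both says
  that the \<open>\<tau>\<^sub>l\<close> are Lie maps with commuting images, which are the relations of \<open>\<Otimes>\<^sub>l U(\<rat> \<otimes> R\<^sub>l)\<close>.

  The generating series of the \<open>Z\<close> is \<open>\<Phi>(1 + \<Sum> x\<^bsub>U,i\<^esub> U)\<close>. It is symmetric in each set of variables and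
  Schur functions are unitriangular, so the \<open>Z\<close> and the coefficients of the monomials have the same span.
  Factoring series with constant term \<open>1\<close> into factors \<open>1 + x\<^sup>m A\<^sub>m\<close> compares these coefficients with products of
  elements \<open>g\<^sub>r(W) = (-1)\<^sup>r e\<^sub>r(-W)\<close>, modulo products of smaller total degree in \<open>r\<close>.
\<close>

section \<open>Series over graded monoids\<close>

text \<open>The obstacle in the integral part is that \<open>Phi\<close> is defined through
  logarithms and exponentials, which bring in denominators. Multiplicativity removes them: the
  factors 1 + x^m A have A in R, inverses stay over R by the geometric series, and naturality under
  t -> x^m shows that \<open>Phi\<close> of one factor is a series in x^m with coefficients
  \<open>g_elem r A\<close>. A factor whose m has degree at least 2 yields words of total index at
  most half the monomial degree. Hence every error term drops strictly and induction on the degree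
  closes.

  For the presentation, injectivity of the evaluation map comes from an inverse, which is produced
  by the universal properties of \<open>\<rat> \<otimes> R\<close>, of the enveloping algebra and of
  the tensor power. Every identification of two families E_W, be it an image under a homomorphism or
  a claim that coefficients lie in a subalgebra, is an instance of the single uniqueness statement
  \<open>E_family_unique\<close>.\<close>

class graded_splits = finite_splits +
  fixes mdeg :: "'a \<Rightarrow> nat"
  assumes mdeg_add: "mdeg (a + b) = mdeg a + mdeg b"
    and mdeg_eq_0: "mdeg a = 0 \<Longrightarrow> a = 0"

instantiation nat :: graded_splits
begin
definition mdeg_nat :: "nat \<Rightarrow> nat" where "mdeg_nat n = n"
instance by standard (simp_all add: mdeg_nat_def)
end

instantiation prod :: (graded_splits, graded_splits) graded_splits
begin
definition mdeg_prod :: "'a \<times> 'b \<Rightarrow> nat" where "mdeg_prod p = mdeg (fst p) + mdeg (snd p)"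
instance by standard (auto simp: mdeg_prod_def mdeg_add prod_eq_iff dest: mdeg_eq_0)
end

instantiation multiset :: (type) graded_splits
begin
definition mdeg_multiset :: "'a multiset \<Rightarrow> nat" where "mdeg_multiset m = size m"
instance by standard (simp_all add: mdeg_multiset_def)
end

lemma mdeg_0 [simp]: "mdeg (0::'m::graded_splits) = 0"
  using mdeg_add[of "0::'m" 0] by simp

lemma mdeg_eq_0_iff [simp]: "mdeg (m::'m::graded_splits) = 0 \<longleftrightarrow> m = 0"
  using mdeg_eq_0 by auto

lemma graded_add_eq_0 [simp]: "(a::'m::graded_splits) + b = 0 \<longleftrightarrow> a = 0 \<and> b = 0"
  by (metis add_is_0 mdeg_add mdeg_eq_0_iff)

abbreviation splits :: "'m::finite_splits \<Rightarrow> ('m \<times> 'm) set" where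
  "splits m \<equiv> {(a, b). a + b = m}"

section \<open>Scalars and coefficient extraction\<close>

lemma scaleQ_sum: "c *\<^sub>Q sum f A = (\<Sum>x\<in>A. c *\<^sub>Q (f x::'a::rat_algebra))"
  by (induction A rule: infinite_finite_induct) (auto simp: scaleQ_add_right)

lemma scaleQ_sum_left: "sum c A *\<^sub>Q x = (\<Sum>i\<in>A. c i *\<^sub>Q (x::'a::rat_algebra))"
  by (induction A rule: infinite_finite_induct) (auto simp: scaleQ_add_left)

lemma scaleQ_minus_left: "(- c) *\<^sub>Q (x::'a::rat_algebra) = - (c *\<^sub>Q x)"
  using scaleQ_add_left[of c "- c" x] by (simp add: eq_neg_iff_add_eq_0 add.commute)

lemma scaleQ_diff_left: "(c - d) *\<^sub>Q (x::'a::rat_algebra) = c *\<^sub>Q x - d *\<^sub>Q x"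
  using scaleQ_add_left[of c "- d" x] by (simp add: scaleQ_minus_left)

lemma scaleQ_cancel: "c \<noteq> 0 \<Longrightarrow> c *\<^sub>Q x = 0 \<longleftrightarrow> (x::'a::rat_algebra) = 0"
  using scaleQ_scaleQ[of "1 / c" c x] by (auto simp: scaleQ_one)

lemma coeff_Series [simp]: "coeff (Series f) = f"
  by (simp add: Series_inverse)

lemma series_eqI: "(\<And>m. coeff f m = coeff g m) \<Longrightarrow> f = g"
  by (metis coeff_inverse ext)

lemma coeff_0 [simp]: "coeff 0 m = 0"
  by (simp add: zero_series.rep_eq)

lemma coeff_1: "coeff 1 m = (if m = 0 then 1 else 0)"
  by (simp add: one_series.rep_eq)

lemma coeff_add [simp]: "coeff (f + g) m = coeff f m + coeff g m"
  by (simp add: plus_series.rep_eq)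

lemma coeff_diff [simp]: "coeff (f - g) m = coeff f m - coeff g m"
  by (simp add: minus_series.rep_eq)

lemma coeff_minus [simp]: "coeff (- f) m = - coeff f m"
  by (simp add: uminus_series.rep_eq)

lemma coeff_scaleQ [simp]: "coeff (c *\<^sub>Q f) m = c *\<^sub>Q coeff f m"
  by (simp add: scaleQ_series.rep_eq)

lemma coeff_mult: "coeff (f * g) m = (\<Sum>(a, b)\<in>splits m. coeff f a * coeff g b)"
  by (simp add: times_series.rep_eq)

lemma coeff_sum [simp]: "coeff (sum f A) m = (\<Sum>x\<in>A. coeff (f x) m)"
  by (induction A rule: infinite_finite_induct) auto

lemma coeff_monom: "coeff (monom k a) m = (if m = k then a else 0)"
  by (simp add: monom_def)

lemma coeff_map_series [simp]: "coeff (map_series h f) m = h (coeff f m)"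
  by (simp add: map_series_def)

lemma splits_0: "splits (0::'m::graded_splits) = {(0, 0)}"
  by auto

lemma coeff_mult_0 [simp]: "coeff (f * g) (0::'m::graded_splits) = coeff f 0 * coeff g 0"
  by (simp add: coeff_mult splits_0)

text \<open>The filtration by order of vanishing serves as the topology: identities between infinite
  products are proved modulo every \<open>ord_ge n\<close> and assembled by
  \<open>ord_ge_eqI\<close>.\<close>

definition ord_ge :: "nat \<Rightarrow> ('m::graded_splits, 'a::zero) series \<Rightarrow> bool" where
  "ord_ge n x \<longleftrightarrow> (\<forall>m. mdeg m < n \<longrightarrow> coeff x m = 0)"

lemma ord_ge_0 [simp]: "ord_ge 0 x" by (simp add: ord_ge_def)

lemma ord_ge_Suc_0: "ord_ge (Suc 0) x \<longleftrightarrow> coeff x 0 = 0"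
  by (auto simp: ord_ge_def)

lemma ord_ge_mono: "ord_ge n x \<Longrightarrow> k \<le> n \<Longrightarrow> ord_ge k x"
  by (auto simp: ord_ge_def)

lemma ord_ge_add: "ord_ge n x \<Longrightarrow> ord_ge n y \<Longrightarrow> ord_ge n (x + (y::('m::graded_splits,'a::{ring,monoid_mult}) series))"
  by (auto simp: ord_ge_def)

lemma ord_ge_diff: "ord_ge n x \<Longrightarrow> ord_ge n y \<Longrightarrow> ord_ge n (x - (y::('m::graded_splits,'a::{ring,monoid_mult}) series))"
  by (auto simp: ord_ge_def)

lemma ord_ge_scaleQ: "ord_ge n x \<Longrightarrow> ord_ge n (c *\<^sub>Q x)"
  by (auto simp: ord_ge_def)

lemma ord_ge_sum:
  "(\<And>i. i \<in> A \<Longrightarrow> ord_ge n (x i)) \<Longrightarrow> ord_ge n (\<Sum>i\<in>A. x i :: ('m::graded_splits,'a::{ring,monoid_mult}) series)"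
  by (auto simp: ord_ge_def intro!: sum.neutral)

lemma ord_ge_mult:
  assumes "ord_ge a x" "ord_ge b y"
  shows "ord_ge (a + b) (x * (y::('m::graded_splits,'a::{ring,monoid_mult}) series))"
  unfolding ord_ge_def
proof (intro allI impI)
  fix m :: 'm assume m: "mdeg m < a + b"
  show "coeff (x * y) m = 0"
    unfolding coeff_mult
  proof (rule sum.neutral, clarify)
    fix p q assume "m = p + q"
    then have "mdeg p < a \<or> mdeg q < b" using m by (auto simp: mdeg_add)
    then show "coeff x p * coeff y q = 0" using assms by (auto simp: ord_ge_def)
  qed
qed

lemma ord_ge_mult1: "ord_ge a x \<Longrightarrow> ord_ge a (x * (y::('m::graded_splits,'a::{ring,monoid_mult}) series))"
  using ord_ge_mult[of a x 0 y] by simp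

lemma ord_ge_mult2: "ord_ge a y \<Longrightarrow> ord_ge a (x * (y::('m::graded_splits,'a::{ring,monoid_mult}) series))"
  using ord_ge_mult[of 0 x a y] by simp

lemma ord_ge_power:
  assumes "ord_ge k x"
  shows "ord_ge (n * k) (x ^ n :: ('m::graded_splits,'a::{ring,monoid_mult}) series)"
  by (induction n) (auto intro: ord_ge_mult assms)

lemma ord_ge_power1:
  "coeff x 0 = 0 \<Longrightarrow> ord_ge n (x ^ n :: ('m::graded_splits,'a::{ring,monoid_mult}) series)"
  using ord_ge_power[of "Suc 0" x n] by (simp add: ord_ge_Suc_0)

lemma mult_coeff_ord_ge_1:
  assumes "coeff (x::('m::graded_splits,'a::{ring,monoid_mult}) series) 0 = 0" "ord_ge n y"
  shows "ord_ge (Suc n) (x * y)"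
  using ord_ge_mult[of "Suc 0" x n y] assms by (simp add: ord_ge_Suc_0)

text \<open>Convergence in its simplest form. The bound on the order of the n-th term reduces each
  coefficient of the infinite sum to finitely many terms, even when one degree contains infinitely
  many monomials.\<close>

definition ascending :: "(nat \<Rightarrow> ('m::graded_splits, 'a::zero) series) \<Rightarrow> bool" where
  "ascending u \<longleftrightarrow> (\<forall>n. ord_ge n (u n))"

lemma ascendingD: "ascending u \<Longrightarrow> mdeg m < n \<Longrightarrow> coeff (u n) m = 0"
  by (auto simp: ascending_def ord_ge_def)

text \<open>Any cutoff \<open>K\<close> past the degree is allowed, so that sums with different
  natural ranges, such as shifted ones, can be compared over one range.\<close>

lemma coeff_sum_series:
  assumes "ascending u" "mdeg m \<le> K"
  shows "coeff (sum_series u) m = (\<Sum>n\<le>K. coeff (u n) m)"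
proof -
  have "{n. coeff (u n) m \<noteq> 0} \<subseteq> {..K}"
  proof
    fix n assume "n \<in> {n. coeff (u n) m \<noteq> 0}"
    then have "\<not> mdeg m < n" using ascendingD[OF assms(1)] by blast
    then show "n \<in> {..K}" using assms(2) by simp
  qed
  then show ?thesis
    unfolding sum_series_def coeff_Series by (intro Sum_any.expand_superset) auto
qed

lemma ascending_mult_left:
  assumes "ascending u"
  shows "ascending (\<lambda>n. a * u n :: ('m::graded_splits,'a::{ring,monoid_mult}) series)"
  using assms by (auto simp: ascending_def intro: ord_ge_mult2)

lemma ascending_mult_right:
  assumes "ascending u"
  shows "ascending (\<lambda>n. u n * a :: ('m::graded_splits,'a::{ring,monoid_mult}) series)"
  using assms by (auto simp: ascending_def intro: ord_ge_mult1)

lemma sum_splits_le: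
  assumes "\<And>a b. a + b = m \<Longrightarrow> f a b = g a b"
  shows "(\<Sum>(a, b)\<in>splits m. f a b) = (\<Sum>(a, b)\<in>splits m. g a b)"
  using assms by (intro sum.cong) auto

lemma sum_series_mult_left:
  assumes "ascending u"
  shows "a * sum_series u = sum_series (\<lambda>n. a * u n :: ('m::graded_splits,'a::{ring,monoid_mult}) series)"
proof (rule series_eqI)
  fix m :: 'm
  have "coeff (a * sum_series u) m =
      (\<Sum>(p, q)\<in>splits m. coeff a p * (\<Sum>n\<le>mdeg m. coeff (u n) q))"
    unfolding coeff_mult
    by (rule sum_splits_le) (auto simp: coeff_sum_series[OF assms, of _ "mdeg m"] mdeg_add)
  also have "\<dots> = (\<Sum>n\<le>mdeg m. coeff (a * u n) m)"
    unfolding coeff_mult sum_distrib_left case_prod_unfold by (rule sum.swap)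
  finally show "coeff (a * sum_series u) m = coeff (sum_series (\<lambda>n. a * u n)) m"
    by (simp add: coeff_sum_series[OF ascending_mult_left[OF assms] order_refl])
qed

lemma sum_series_mult_right:
  assumes "ascending u"
  shows "sum_series u * a = sum_series (\<lambda>n. u n * a :: ('m::graded_splits,'a::{ring,monoid_mult}) series)"
proof (rule series_eqI)
  fix m :: 'm
  have "coeff (sum_series u * a) m =
      (\<Sum>(p, q)\<in>splits m. (\<Sum>n\<le>mdeg m. coeff (u n) p) * coeff a q)"
    unfolding coeff_mult
    by (rule sum_splits_le) (auto simp: coeff_sum_series[OF assms, of _ "mdeg m"] mdeg_add)
  also have "\<dots> = (\<Sum>n\<le>mdeg m. coeff (u n * a) m)"
    unfolding coeff_mult sum_distrib_right case_prod_unfold by (rule sum.swap)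
  finally show "coeff (sum_series u * a) m = coeff (sum_series (\<lambda>n. u n * a)) m"
    by (simp add: coeff_sum_series[OF ascending_mult_right[OF assms] order_refl])
qed

lemma ascending_cauchy_product:
  assumes "ascending u" "ascending v"
  shows "ascending (\<lambda>n. \<Sum>i\<le>n. u i * v (n - i) :: ('m::graded_splits,'a::{ring,monoid_mult}) series)"
  unfolding ascending_def
proof (intro allI ord_ge_sum)
  fix n i :: nat assume "i \<in> {..n}"
  then show "ord_ge n (u i * v (n - i))"
    using ord_ge_mult[of i "u i" "n - i" "v (n - i)"] assms by (simp add: ascending_def)
qed

lemma sum_series_cauchy_product:
  assumes "ascending u" "ascending v"
  shows "sum_series u * sum_series v =
    sum_series (\<lambda>n. \<Sum>i\<le>n. u i * v (n - i) :: ('m::graded_splits,'a::{ring,monoid_mult}) series)"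
proof (rule series_eqI)
  fix m :: 'm
  let ?K = "mdeg m"
  have v: "ascending (\<lambda>j. u i * v j)" for i by (rule ascending_mult_left[OF assms(2)])
  have "ascending (\<lambda>i. u i * sum_series v)" by (rule ascending_mult_right[OF assms(1)])
  then have "coeff (sum_series u * sum_series v) m = (\<Sum>i\<le>?K. coeff (u i * sum_series v) m)"
    unfolding sum_series_mult_right[OF assms(1)] by (rule coeff_sum_series) simp
  also have "\<dots> = (\<Sum>i\<le>?K. \<Sum>j\<le>?K. coeff (u i * v j) m)"
    unfolding sum_series_mult_left[OF assms(2)] coeff_sum_series[OF v order_refl] ..
  also have "\<dots> = (\<Sum>(i, j)\<in>{..?K} \<times> {..?K}. coeff (u i * v j) m)"
    by (simp add: sum.cartesian_product)
  \<comment> \<open>Outside the triangle the terms vanish for reasons of order, so the square can be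
    cut down before it is sorted by i + j.\<close>
  also have "\<dots> = (\<Sum>(i, j)\<in>{(i, j). i + j \<le> ?K}. coeff (u i * v j) m)"
  proof (rule sum.mono_neutral_right)
    have "coeff (u i * v j) m = 0" if "\<not> i + j \<le> ?K" for i j
      using ord_ge_mult[of i "u i" j "v j"] assms that by (auto simp: ascending_def ord_ge_def)
    then show "\<forall>p\<in>{..?K} \<times> {..?K} - {(i, j). i + j \<le> ?K}. (\<lambda>(i, j). coeff (u i * v j) m) p = 0"
      by auto
  qed auto
  also have "\<dots> = (\<Sum>n\<le>?K. \<Sum>i\<le>n. coeff (u i * v (n - i)) m)"
    by (rule sum.triangle_reindex_eq)
  finally show "coeff (sum_series u * sum_series v) m =
      coeff (sum_series (\<lambda>n. \<Sum>i\<le>n. u i * v (n - i))) m"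
    by (simp add: coeff_sum_series[OF ascending_cauchy_product[OF assms] order_refl])
qed

lemma ascending_powers: "coeff x 0 = 0 \<Longrightarrow> ascending (\<lambda>n. c n *\<^sub>Q x ^ n)"
  by (auto simp: ascending_def intro: ord_ge_scaleQ ord_ge_power1)

lemma coeff_eval_series:
  assumes "coeff x 0 = 0" "mdeg m \<le> K"
  shows "coeff (eval_series c x) m = (\<Sum>n\<le>K. c n *\<^sub>Q coeff (x ^ n) m)"
  using coeff_sum_series[OF ascending_powers[OF assms(1)] assms(2)] by (simp add: eval_series_def)

lemma coeff_eval_series_0: "coeff x 0 = 0 \<Longrightarrow> coeff (eval_series c x) (0::'m::graded_splits) = c 0 *\<^sub>Q 1"
  by (simp add: coeff_eval_series[of _ _ 0] coeff_1)

section \<open>Rational power series evaluated at a series\<close>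

abbreviation eval_fps :: "rat fps \<Rightarrow> ('m::graded_splits, 'a::rat_algebra) series \<Rightarrow> ('m, 'a) series" where
  "eval_fps f \<equiv> eval_series (fps_nth f)"

context
  fixes x :: "('m::graded_splits, 'a::rat_algebra) series"
  assumes x0: "coeff x 0 = 0"
begin

lemma eval_fps_add: "eval_fps (f + g) x = eval_fps f x + eval_fps g x"
  by (rule series_eqI) (simp add: coeff_eval_series[OF x0 order_refl] scaleQ_add_left sum.distrib)

lemma eval_fps_uminus: "eval_fps (- f) x = - eval_fps f x"
  by (rule series_eqI) (simp add: coeff_eval_series[OF x0 order_refl] scaleQ_minus_left sum_negf)

lemma eval_fps_diff: "eval_fps (f - g) x = eval_fps f x - eval_fps g x"
  using eval_fps_add[of f "- g"] by (simp add: eval_fps_uminus)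

lemma eval_fps_mult: "eval_fps (f * g) x = eval_fps f x * eval_fps g x"
proof -
  have "fps_nth (f * g) n *\<^sub>Q x ^ n =
      (\<Sum>i\<le>n. (fps_nth f i *\<^sub>Q x ^ i) * (fps_nth g (n - i) *\<^sub>Q x ^ (n - i)))" for n
    by (simp add: fps_mult_nth scaleQ_sum_left atLeast0AtMost scaleQ_mult_left scaleQ_mult_right
        scaleQ_scaleQ power_add[symmetric] mult.commute)
  then show ?thesis
    unfolding eval_series_def
    by (simp add: sum_series_cauchy_product[OF ascending_powers[OF x0] ascending_powers[OF x0]])
qed

lemma eval_fps_1: "eval_fps 1 x = 1"
proof (rule series_eqI)
  fix m :: 'm
  have "(\<Sum>n\<le>mdeg m. fps_nth 1 n *\<^sub>Q coeff (x ^ n) m) = (\<Sum>n\<in>{0}. fps_nth 1 n *\<^sub>Q coeff (x ^ n) m)"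
    by (rule sum.mono_neutral_right) auto
  then show "coeff (eval_fps 1 x) m = coeff 1 m"
    unfolding coeff_eval_series[OF x0 order_refl] by (simp add: scaleQ_one)
qed

lemma eval_fps_X: "eval_fps fps_X x = x"
proof (rule series_eqI)
  fix m :: 'm
  have "coeff (eval_fps fps_X x) m = (\<Sum>n\<le>Suc (mdeg m). fps_nth fps_X n *\<^sub>Q coeff (x ^ n) m)"
    by (rule coeff_eval_series[OF x0]) simp
  also have "\<dots> = (\<Sum>n\<in>{1}. fps_nth fps_X n *\<^sub>Q coeff (x ^ n) m)"
    by (rule sum.mono_neutral_right) auto
  finally show "coeff (eval_fps fps_X x) m = coeff x m" by (simp add: scaleQ_one)
qed

lemma eval_fps_power: "eval_fps (f ^ n) x = eval_fps f x ^ n"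
  by (induction n) (simp_all only: power_0 power_Suc eval_fps_1 eval_fps_mult)

text \<open>A single series commutes with its own powers, so evaluation at it is a homomorphism from
  the commutative ring of rational power series. Together with compatibility with composition this
  imports identities such as log after exp from \<open>rat fps\<close>, although the coefficient
  algebra is not commutative.\<close>

lemma eval_fps_compose:
  assumes "fps_nth g 0 = 0"
  shows "eval_fps (f oo g) x = eval_fps f (eval_fps g x)"
proof (rule series_eqI)
  fix m :: 'm
  let ?K = "mdeg m"
  have y0: "coeff (eval_fps g x) 0 = 0"
    by (simp add: coeff_eval_series_0[OF x0] assms)
  have "coeff (eval_fps (f oo g) x) m =
      (\<Sum>n\<le>?K. \<Sum>i\<le>n. (fps_nth f i * fps_nth (g ^ i) n) *\<^sub>Q coeff (x ^ n) m)"
    by (simp add: coeff_eval_series[OF x0 order_refl] fps_compose_nth scaleQ_sum_left atLeast0AtMost)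
  \<comment> \<open>The range of i is enlarged from n to the common bound: g has no constant term,
    so \<open>g ^ i\<close> has no coefficient below i. This decouples the two sums.\<close>
  also have "\<dots> = (\<Sum>n\<le>?K. \<Sum>i\<le>?K. (fps_nth f i * fps_nth (g ^ i) n) *\<^sub>Q coeff (x ^ n) m)"
    by (intro sum.cong sum.mono_neutral_left) (auto simp: startsby_zero_power_prefix[OF assms])
  also have "\<dots> = (\<Sum>i\<le>?K. fps_nth f i *\<^sub>Q (\<Sum>n\<le>?K. fps_nth (g ^ i) n *\<^sub>Q coeff (x ^ n) m))"
    by (subst sum.swap) (simp add: scaleQ_sum scaleQ_scaleQ)
  also have "\<dots> = coeff (eval_fps f (eval_fps g x)) m"
    by (simp add: coeff_eval_series[OF y0 order_refl] eval_fps_power[symmetric]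
        coeff_eval_series[OF x0 order_refl])
  finally show "coeff (eval_fps (f oo g) x) m = coeff (eval_fps f (eval_fps g x)) m" .
qed

end

section \<open>Exponential, logarithm and inverse\<close>

lemma exp_series_fps: "exp_series x = eval_fps (fps_exp 1) x"
  unfolding exp_series_def by (rule arg_cong[of _ _ "\<lambda>c. eval_series c x"]) (simp add: fun_eq_iff)

lemma log_series_fps: "log_series x = eval_fps (fps_ln 1) (x - 1)"
  unfolding log_series_def
  by (rule arg_cong[of _ _ "\<lambda>c. eval_series c (x - 1)"], rule ext, rename_tac n, case_tac n)
    (simp_all add: fps_ln_nth)

lemma inv_series_fps: "inv_series x = eval_fps (inverse (1 + fps_X)) (x - 1)"
  unfolding inv_series_def
  by (rule arg_cong[of _ _ "\<lambda>c. eval_series c (x - 1)"]) (simp add: fps_inverse_fps_X_plus1 fun_eq_iff)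

lemma coeff_exp_series_0: "coeff x 0 = 0 \<Longrightarrow> coeff (exp_series x) (0::'m::graded_splits) = 1"
  by (simp add: exp_series_def coeff_eval_series_0 scaleQ_one)

lemma coeff_log_series_0: "coeff x 0 = 1 \<Longrightarrow> coeff (log_series x) (0::'m::graded_splits) = 0"
  by (simp add: log_series_def coeff_eval_series_0 coeff_1)

lemma coeff_inv_series_0: "coeff x 0 = 1 \<Longrightarrow> coeff (inv_series x) (0::'m::graded_splits) = 1"
  by (simp add: inv_series_def coeff_eval_series_0 coeff_1 scaleQ_one)

lemma fps_ln_exp: "fps_ln (1::rat) oo (fps_exp 1 - 1) = fps_X"
  by (simp add: fps_ln_fps_exp_inv fps_inv)

lemma fps_exp_ln: "(fps_exp (1::rat) - 1) oo fps_ln 1 = fps_X"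
  by (simp add: fps_ln_fps_exp_inv fps_inv_right)

lemma log_exp_series:
  assumes "coeff x (0::'m::graded_splits) = 0" shows "log_series (exp_series x) = x"
proof -
  have "exp_series x - 1 = eval_fps (fps_exp 1 - 1) x"
    by (simp add: exp_series_fps eval_fps_diff[OF assms] eval_fps_1[OF assms])
  then have "log_series (exp_series x) = eval_fps (fps_ln 1) (eval_fps (fps_exp 1 - 1) x)"
    by (simp add: log_series_fps)
  also have "\<dots> = x"
    by (subst eval_fps_compose[symmetric, OF assms]) (simp_all add: fps_ln_exp eval_fps_X[OF assms])
  finally show ?thesis .
qed

lemma exp_log_series:
  assumes "coeff x (0::'m::graded_splits) = 1" shows "exp_series (log_series x) = x"
proof -
  have x1: "coeff (x - 1) 0 = 0" and l0: "coeff (log_series x) 0 = 0"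
    using assms by (simp_all add: coeff_1 coeff_log_series_0)
  have "exp_series (log_series x) - 1 = eval_fps (fps_exp 1 - 1) (log_series x)"
    by (simp add: exp_series_fps eval_fps_diff[OF l0] eval_fps_1[OF l0])
  also have "\<dots> = x - 1"
    unfolding log_series_fps
    by (subst eval_fps_compose[symmetric, OF x1]) (simp_all add: fps_exp_ln eval_fps_X[OF x1])
  finally show ?thesis by simp
qed

lemma inv_series_inverse:
  assumes "coeff x (0::'m::graded_splits) = 1"
  shows "inv_series x * x = 1" "x * inv_series x = 1"
proof -
  have x1: "coeff (x - 1) 0 = 0" using assms by (simp add: coeff_1)
  have x: "x = eval_fps (1 + fps_X) (x - 1)"
    by (simp add: eval_fps_add[OF x1] eval_fps_1[OF x1] eval_fps_X[OF x1])
  have i: "inverse (1 + fps_X) * (1 + fps_X) = (1 :: rat fps)" by (rule inverse_mult_eq_1) simp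
  have "inv_series x * x = eval_fps (inverse (1 + fps_X)) (x - 1) * eval_fps (1 + fps_X) (x - 1)"
    using x by (simp add: inv_series_fps)
  then show "inv_series x * x = 1"
    by (simp only: eval_fps_mult[OF x1, symmetric] i eval_fps_1[OF x1])
  have "x * inv_series x = eval_fps (1 + fps_X) (x - 1) * eval_fps (inverse (1 + fps_X)) (x - 1)"
    using x by (simp add: inv_series_fps)
  then show "x * inv_series x = 1"
    by (simp only: eval_fps_mult[OF x1, symmetric] i mult.commute[of "1 + fps_X"] eval_fps_1[OF x1])
qed

lemma inv_series_unique:
  assumes "coeff x (0::'m::graded_splits) = 1" "x * y = 1"
  shows "inv_series x = y"
  by (metis assms inv_series_inverse(1) mult.assoc mult_1_left mult_1_right)

text \<open>The binomial theorem in divided powers, for two commuting elements of a noncommutative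
  algebra. Multiplication by \<open>a\<close> and by \<open>b\<close> raises one of the divided
  powers with factors i and \<open>Suc n - i\<close>, which add up to \<open>Suc n\<close>.\<close>

lemma power_add_commute_sum:
  fixes a b :: "'a::rat_algebra"
  assumes "a * b = b * a"
  shows "(1 / fact n) *\<^sub>Q (a + b) ^ n =
    (\<Sum>i\<le>n. ((1 / fact i) *\<^sub>Q a ^ i) * ((1 / fact (n - i)) *\<^sub>Q b ^ (n - i)))"
proof (induction n)
  case 0 then show ?case by (simp add: scaleQ_one)
next
  case (Suc n)
  have comm: "b * a ^ i = a ^ i * b" for i
    by (induction i) (use assms in \<open>simp_all, metis mult.assoc\<close>)
  define A where "A i = (1 / fact i) *\<^sub>Q a ^ i" for i
  define B where "B i = (1 / fact i) *\<^sub>Q b ^ i" for i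
  have A: "a * A i = of_nat (Suc i) *\<^sub>Q A (Suc i)" for i
    by (simp add: A_def scaleQ_mult_right scaleQ_scaleQ)
  have B: "b * (A i * B j) = of_nat (Suc j) *\<^sub>Q (A i * B (Suc j))" for i j
    by (simp add: A_def B_def scaleQ_mult_right scaleQ_mult_left scaleQ_scaleQ mult.assoc[symmetric] comm)
  have IH: "(1 / fact n) *\<^sub>Q (a + b) ^ n = (\<Sum>i\<le>n. A i * B (n - i))"
    by (simp only: Suc.IH A_def B_def)
  have "(1 / fact (Suc n)) *\<^sub>Q (a + b) ^ Suc n = (1 / of_nat (Suc n)) *\<^sub>Q ((a + b) * ((1 / fact n) *\<^sub>Q (a + b) ^ n))"
    by (simp add: scaleQ_mult_right scaleQ_scaleQ)
  also have "(a + b) * ((1 / fact n) *\<^sub>Q (a + b) ^ n) = (\<Sum>i\<le>n. a * A i * B (n - i)) + (\<Sum>i\<le>n. b * (A i * B (n - i)))"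
    by (simp add: IH distrib_right sum_distrib_left mult.assoc sum.distrib)
  also have "(\<Sum>i\<le>n. a * A i * B (n - i)) = (\<Sum>i\<le>n. of_nat (Suc i) *\<^sub>Q (A (Suc i) * B (Suc n - Suc i)))"
    by (simp add: A scaleQ_mult_left del: of_nat_Suc)
  also have "\<dots> = (\<Sum>i\<le>Suc n. of_nat i *\<^sub>Q (A i * B (Suc n - i)))"
    using sum.atMost_Suc_shift[of "\<lambda>i. of_nat i *\<^sub>Q (A i * B (Suc n - i))" n] by simp
  also have "(\<Sum>i\<le>n. b * (A i * B (n - i))) = (\<Sum>i\<le>n. of_nat (Suc n - i) *\<^sub>Q (A i * B (Suc n - i)))"
    by (rule sum.cong) (simp_all add: B Suc_diff_le del: of_nat_Suc)
  also have "\<dots> = (\<Sum>i\<le>Suc n. of_nat (Suc n - i) *\<^sub>Q (A i * B (Suc n - i)))"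
    by simp
  also have "(\<Sum>i\<le>Suc n. of_nat i *\<^sub>Q (A i * B (Suc n - i))) + (\<Sum>i\<le>Suc n. of_nat (Suc n - i) *\<^sub>Q (A i * B (Suc n - i)))
      = (\<Sum>i\<le>Suc n. of_nat (Suc n) *\<^sub>Q (A i * B (Suc n - i)))"
    unfolding sum.distrib[symmetric] scaleQ_add_left[symmetric]
    by (rule sum.cong) (simp_all add: of_nat_add[symmetric] del: of_nat_Suc of_nat_add)
  finally show ?case
    by (simp add: scaleQ_sum[symmetric] scaleQ_scaleQ A_def B_def scaleQ_one del: of_nat_Suc)
qed

lemma exp_series_add:
  fixes a b :: "('m::graded_splits, 'a::rat_algebra) series"
  assumes "coeff a 0 = 0" "coeff b 0 = 0" "a * b = b * a"
  shows "exp_series (a + b) = exp_series a * exp_series b"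
  unfolding exp_series_def eval_series_def
  by (simp add: sum_series_cauchy_product[OF ascending_powers[OF assms(1)] ascending_powers[OF assms(2)]]
      power_add_commute_sum[OF assms(3)])

lemma eval_series_zero: "eval_series c (0::('m::graded_splits, 'a::rat_algebra) series) = c 0 *\<^sub>Q 1"
proof (rule series_eqI)
  fix m :: 'm
  have "(\<Sum>n\<le>mdeg m. c n *\<^sub>Q coeff (0 ^ n) m) = (\<Sum>n\<in>{0}. c n *\<^sub>Q coeff (0 ^ n :: ('m, 'a) series) m)"
  proof (rule sum.mono_neutral_right)
    show "\<forall>i\<in>{..mdeg m} - {0}. c i *\<^sub>Q coeff (0 ^ i :: ('m, 'a) series) m = 0"
    proof
      fix i assume "i \<in> {..mdeg m} - {0}"
      then show "c i *\<^sub>Q coeff (0 ^ i :: ('m, 'a) series) m = 0" by (cases i) auto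
    qed
  qed auto
  then show "coeff (eval_series c (0::('m, 'a) series)) m = coeff (c 0 *\<^sub>Q 1) m"
    by (simp add: coeff_eval_series[OF coeff_0 order_refl])
qed

lemma exp_series_zero [simp]: "exp_series (0::('m::graded_splits, 'a::rat_algebra) series) = 1"
  by (simp add: exp_series_def eval_series_zero scaleQ_one)

lemma log_series_one [simp]: "log_series (1::('m::graded_splits, 'a::rat_algebra) series) = 0"
  by (simp add: log_series_def eval_series_zero)

lemma inv_exp_series:
  fixes a :: "('m::graded_splits, 'a::rat_algebra) series"
  assumes "coeff a 0 = 0"
  shows "inv_series (exp_series a) = exp_series (- a)"
proof (rule inv_series_unique)
  show "exp_series a * exp_series (- a) = 1"
    using exp_series_add[of a "- a"] assms by simp
qed (simp add: coeff_exp_series_0 assms)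

section \<open>Coefficientwise linear maps\<close>

definition rat_linear :: "('a::rat_algebra \<Rightarrow> 'b::rat_algebra) \<Rightarrow> bool" where
  "rat_linear h \<longleftrightarrow> (\<forall>x y. h (x + y) = h x + h y) \<and> (\<forall>c x. h (c *\<^sub>Q x) = c *\<^sub>Q h x)"

definition alg_hom :: "('a::rat_algebra \<Rightarrow> 'b::rat_algebra) \<Rightarrow> bool" where
  "alg_hom h \<longleftrightarrow> rat_linear h \<and> h 1 = 1 \<and> (\<forall>x y. h (x * y) = h x * h y)"

text \<open>The maps \<open>T_map l\<close> respect commutators but not products; everything about
  \<open>theta\<close> has to go through this property.\<close>

definition lie_map :: "('a::rat_algebra \<Rightarrow> 'b::rat_algebra) \<Rightarrow> bool" where
  "lie_map h \<longleftrightarrow> rat_linear h \<and> (\<forall>x y. h (x * y - y * x) = h x * h y - h y * h x)"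

lemma rat_linear_add: "rat_linear h \<Longrightarrow> h (x + y) = h x + h y"
  and rat_linear_scaleQ: "rat_linear h \<Longrightarrow> h (c *\<^sub>Q x) = c *\<^sub>Q h x"
  by (auto simp: rat_linear_def)

lemma rat_linear_0: "rat_linear h \<Longrightarrow> h 0 = 0"
  using rat_linear_add[of h 0 0] by simp

lemma rat_linear_minus: "rat_linear h \<Longrightarrow> h (- x) = - h x"
  using rat_linear_scaleQ[of h "-1" x] by (simp add: scaleQ_minus_left scaleQ_one)

lemma rat_linear_diff: "rat_linear h \<Longrightarrow> h (x - y) = h x - h y"
  using rat_linear_add[of h x "- y"] by (simp add: rat_linear_minus)

lemma rat_linear_sum: "rat_linear h \<Longrightarrow> h (sum f A) = (\<Sum>x\<in>A. h (f x))"
  by (induction A rule: infinite_finite_induct) (auto simp: rat_linear_0 rat_linear_add)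

lemma alg_hom_linear: "alg_hom h \<Longrightarrow> rat_linear h"
  and alg_hom_1: "alg_hom h \<Longrightarrow> h 1 = 1"
  and alg_hom_mult: "alg_hom h \<Longrightarrow> h (x * y) = h x * h y"
  by (auto simp: alg_hom_def)

lemma alg_hom_lie_map: "alg_hom h \<Longrightarrow> lie_map h"
  by (auto simp: lie_map_def alg_hom_def rat_linear_diff)

lemma lie_map_linear: "lie_map h \<Longrightarrow> rat_linear h"
  by (auto simp: lie_map_def)

lemma lie_map_comp: "lie_map g \<Longrightarrow> lie_map h \<Longrightarrow> lie_map (\<lambda>x. g (h x))"
  by (auto simp: lie_map_def rat_linear_def)

lemma alg_hom_comp: "alg_hom g \<Longrightarrow> alg_hom h \<Longrightarrow> alg_hom (\<lambda>x. g (h x))"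
  by (auto simp: alg_hom_def rat_linear_def)

lemma map_series_linear:
  assumes "rat_linear h"
  shows "rat_linear (map_series h :: ('m::finite_splits, 'a::rat_algebra) series \<Rightarrow> ('m, 'b::rat_algebra) series)"
  using assms by (auto simp: rat_linear_def intro!: series_eqI)

lemma ord_ge_map_series: "h 0 = 0 \<Longrightarrow> ord_ge n x \<Longrightarrow> ord_ge n (map_series h x)"
  by (auto simp: ord_ge_def)

lemma map_series_sum_series:
  assumes h: "rat_linear h" and u: "ascending u"
  shows "map_series h (sum_series u) = sum_series (\<lambda>n. map_series h (u n))"
proof (rule series_eqI)
  fix m
  have "ascending (\<lambda>n. map_series h (u n))"
    using u rat_linear_0[OF h] by (auto simp: ascending_def intro: ord_ge_map_series)
  then show "coeff (map_series h (sum_series u)) m = coeff (sum_series (\<lambda>n. map_series h (u n))) m"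
    using u by (simp add: coeff_sum_series[OF _ order_refl] rat_linear_sum[OF h])
qed

lemma map_series_alg_hom:
  assumes "alg_hom h"
  shows "alg_hom (map_series h :: ('m::finite_splits, 'a::rat_algebra) series \<Rightarrow> ('m, 'b::rat_algebra) series)"
  unfolding alg_hom_def
proof (intro conjI allI)
  note lin = alg_hom_linear[OF assms]
  show "rat_linear (map_series h :: ('m, 'a) series \<Rightarrow> ('m, 'b) series)"
    by (rule map_series_linear[OF lin])
  show "map_series h (1 :: ('m, 'a) series) = 1"
    by (rule series_eqI) (simp add: coeff_1 alg_hom_1[OF assms] rat_linear_0[OF lin])
  show "map_series h (x * y) = map_series h x * map_series h y" for x y :: "('m, 'a) series"
    by (rule series_eqI)
      (simp add: coeff_mult rat_linear_sum[OF lin] alg_hom_mult[OF assms] case_prod_unfold)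
qed

lemma map_series_lie_map:
  assumes "lie_map h"
  shows "lie_map (map_series h :: ('m::finite_splits, 'a::rat_algebra) series \<Rightarrow> ('m, 'b::rat_algebra) series)"
  unfolding lie_map_def
proof (intro conjI allI)
  note lin = lie_map_linear[OF assms]
  show "rat_linear (map_series h :: ('m, 'a) series \<Rightarrow> ('m, 'b) series)"
    by (rule map_series_linear[OF lin])
  show "map_series h (x * y - y * x) = map_series h x * map_series h y - map_series h y * map_series h x"
    for x y :: "('m, 'a) series"
  proof (rule series_eqI)
    fix m :: 'm
    \<comment> \<open>The exponents commute, so the splittings of m are symmetric. Matching (a, b)
      in x * y with (b, a) in y * x turns the coefficient of a commutator of series into a sum of
      commutators of coefficients.\<close>
    have swap: "(\<Sum>(a, b)\<in>splits m. f a b) = (\<Sum>(a, b)\<in>splits m. f b a)" for f :: "'m \<Rightarrow> 'm \<Rightarrow> 'c::comm_monoid_add"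
      by (rule sum.reindex_bij_witness[of _ prod.swap prod.swap]) (auto simp: add.commute)
    have "coeff (x * y - y * x) m = (\<Sum>(a, b)\<in>splits m. coeff x a * coeff y b - coeff y b * coeff x a)"
      using swap[of "\<lambda>a b. coeff y a * coeff x b"]
      by (simp add: coeff_mult sum_subtractf case_prod_unfold)
    then have "coeff (map_series h (x * y - y * x)) m =
        (\<Sum>(a, b)\<in>splits m. h (coeff x a) * h (coeff y b) - h (coeff y b) * h (coeff x a))"
      using assms by (simp add: rat_linear_sum[OF lin] lie_map_def case_prod_unfold)
    also have "\<dots> = coeff (map_series h x * map_series h y - map_series h y * map_series h x) m"
      using swap[of "\<lambda>a b. h (coeff y a) * h (coeff x b)"]
      by (simp add: coeff_mult sum_subtractf case_prod_unfold)
    finally show "coeff (map_series h (x * y - y * x)) m =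
      coeff (map_series h x * map_series h y - map_series h y * map_series h x) m" .
  qed
qed

lemma alg_hom_power: "alg_hom h \<Longrightarrow> h (x ^ n) = h x ^ n"
  by (induction n) (simp_all add: alg_hom_1 alg_hom_mult)

lemma map_series_eval_series:
  assumes "alg_hom h" "coeff x (0::'m::graded_splits) = 0"
  shows "map_series h (eval_series c x) = eval_series c (map_series h x)"
  unfolding eval_series_def
  by (subst map_series_sum_series[OF alg_hom_linear[OF assms(1)] ascending_powers[OF assms(2)]])
    (simp add: rat_linear_scaleQ[OF map_series_linear[OF alg_hom_linear[OF assms(1)]]]
      alg_hom_power[OF map_series_alg_hom[OF assms(1)]])

section \<open>Multiplicativity of \<open>exp \<circ> T \<circ> log\<close> for Lie maps \<open>T\<close>\<close>

text \<open>The derivation multiplying a monomial by its degree. It detects every coefficient but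
  the constant one, whatever the number of variables, so it is the one derivative in which
  differential equations are posed.\<close>

definition euler :: "('m::graded_splits, 'a::rat_algebra) series \<Rightarrow> ('m, 'a) series" where
  "euler x = Series (\<lambda>m. of_nat (mdeg m) *\<^sub>Q coeff x m)"

lemma coeff_euler [simp]: "coeff (euler x) m = of_nat (mdeg m) *\<^sub>Q coeff x m"
  by (simp add: euler_def)

lemma euler_linear: "rat_linear (euler :: ('m::graded_splits, 'a::rat_algebra) series \<Rightarrow> _)"
  by (auto simp: rat_linear_def scaleQ_add_right scaleQ_scaleQ mult.commute intro!: series_eqI)

lemma euler_1 [simp]: "euler 1 = 0"
  by (rule series_eqI) (simp add: coeff_1)

lemma euler_mult: "euler (x * y) = euler x * y + x * euler y"
  by (rule series_eqI)
    (auto simp: coeff_mult scaleQ_sum sum.distrib[symmetric] mdeg_add scaleQ_add_left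
      scaleQ_mult_left scaleQ_mult_right intro!: sum.cong)

lemma ord_ge_euler: "ord_ge n x \<Longrightarrow> ord_ge n (euler x)"
  by (auto simp: ord_ge_def)

lemma euler_sum_series: "ascending u \<Longrightarrow> euler (sum_series u) = sum_series (\<lambda>n. euler (u n))"
proof (rule series_eqI)
  fix m
  assume u: "ascending u"
  then have "ascending (\<lambda>n. euler (u n))" by (auto simp: ascending_def intro: ord_ge_euler)
  then show "coeff (euler (sum_series u)) m = coeff (sum_series (\<lambda>n. euler (u n))) m"
    using u by (simp add: coeff_sum_series[OF _ order_refl] scaleQ_sum)
qed

text \<open>Since \<open>a\<close> has no constant term, the coefficient of \<open>a * x\<close> at
  m involves only coefficients of x of degree below that of m; the positive integer
  \<open>mdeg m\<close> on the left can be cancelled over \<rat>.\<close>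

lemma euler_ode_unique:
  assumes a: "coeff a 0 = 0" and x: "euler x = a * x" and y: "euler y = a * y"
    and eq0: "coeff x 0 = coeff y (0::'m::graded_splits)"
  shows "x = y"
proof (rule series_eqI)
  fix m
  show "coeff x m = coeff y m"
  proof (induction "mdeg m" arbitrary: m rule: less_induct)
    case less
    show ?case
    proof (cases "m = 0")
      case True then show ?thesis by (simp add: eq0)
    next
      case False
      have "coeff (a * x) m = coeff (a * y) m"
        unfolding coeff_mult
      proof (rule sum_splits_le)
        fix p q assume pq: "p + q = m"
        show "coeff a p * coeff x q = coeff a p * coeff y q"
        proof (cases "p = 0")
          case True then show ?thesis by (simp add: a)
        next
          case False
          then have "0 < mdeg p" using mdeg_eq_0_iff[of p] by (simp del: mdeg_eq_0_iff)
          then have "mdeg q < mdeg m" using pq mdeg_add[of p q] by auto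
          then show ?thesis by (simp add: less)
        qed
      qed
      then have "of_nat (mdeg m) *\<^sub>Q (coeff x m - coeff y m) = 0"
        using x y by (metis coeff_euler diff_self scaleQ_diff_right)
      then show ?thesis using False by (simp add: scaleQ_cancel)
    qed
  qed
qed

lemma sum_series_shift:
  assumes "ascending u" "u 0 = 0"
  shows "sum_series u = sum_series (\<lambda>n. u (Suc n) :: ('m::graded_splits, 'a::rat_algebra) series)"
proof (rule series_eqI)
  fix m :: 'm
  have "ascending (\<lambda>n. u (Suc n))"
    using assms by (auto simp: ascending_def intro: ord_ge_mono)
  then show "coeff (sum_series u) m = coeff (sum_series (\<lambda>n. u (Suc n))) m"
    by (simp add: coeff_sum_series[OF assms(1), of _ "Suc (mdeg m)"] sum.atMost_Suc_shift assms(2)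
        coeff_sum_series[OF _ order_refl] del: sum.atMost_Suc)
qed

definition ad :: "'a::ring \<Rightarrow> 'a \<Rightarrow> 'a" where "ad a b = a * b - b * a"

text \<open>Left multiplication by \<open>a\<close> is the sum of \<open>ad a\<close> and right
  multiplication by \<open>a\<close>, two commuting operators; this is their binomial
  expansion.\<close>

lemma power_mult_ad:
  fixes a b :: "'a::rat_algebra"
  shows "a ^ n * b = (\<Sum>j\<le>n. of_nat (n choose j) *\<^sub>Q ((ad a ^^ j) b * a ^ (n - j)))"
proof (induction n)
  case 0 then show ?case by (simp add: scaleQ_one)
next
  case (Suc n)
  let ?D = "\<lambda>j. (ad a ^^ j) b"
  let ?F = "\<lambda>j. ?D j * a ^ (Suc n - j)"
  have aD: "a * ?D j = ?D (Suc j) + ?D j * a" for j by (simp add: ad_def)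
  have "a ^ Suc n * b = a * (a ^ n * b)" by (simp add: mult.assoc)
  also have "\<dots> = (\<Sum>j\<le>n. of_nat (n choose j) *\<^sub>Q (a * ?D j * a ^ (n - j)))"
    by (simp add: Suc.IH sum_distrib_left scaleQ_mult_right mult.assoc)
  also have "\<dots> = (\<Sum>j\<le>n. of_nat (n choose j) *\<^sub>Q ?F (Suc j)) + (\<Sum>j\<le>n. of_nat (n choose j) *\<^sub>Q ?F j)"
    unfolding sum.distrib[symmetric]
    by (rule sum.cong) (auto simp del: funpow.simps simp: aD distrib_right scaleQ_add_right mult.assoc Suc_diff_le)
  also have "(\<Sum>j\<le>n. of_nat (n choose j) *\<^sub>Q ?F j) = (\<Sum>j\<le>Suc n. of_nat (n choose j) *\<^sub>Q ?F j)"
    by (simp add: binomial_eq_0)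
  also have "\<dots> = ?F 0 + (\<Sum>j\<le>n. of_nat (n choose Suc j) *\<^sub>Q ?F (Suc j))"
    by (subst sum.atMost_Suc_shift) (simp add: scaleQ_one del: funpow.simps)
  also have "(\<Sum>j\<le>n. of_nat (n choose j) *\<^sub>Q ?F (Suc j)) + (?F 0 + (\<Sum>j\<le>n. of_nat (n choose Suc j) *\<^sub>Q ?F (Suc j)))
      = ?F 0 + (\<Sum>j\<le>n. of_nat (Suc n choose Suc j) *\<^sub>Q ?F (Suc j))"
    by (simp add: scaleQ_add_left sum.distrib algebra_simps del: funpow.simps)
  also have "\<dots> = (\<Sum>j\<le>Suc n. of_nat (Suc n choose j) *\<^sub>Q ?F j)"
    by (subst sum.atMost_Suc_shift) (simp add: scaleQ_one del: funpow.simps)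
  finally show ?case .
qed

text \<open>The Leibniz rule, with every derivative moved to the left end by
  \<open>power_mult_ad\<close>. The coefficient (n+1 choose j+1) is the sum of the binomials (i
  choose j) for i up to n.\<close>

lemma euler_power_ad:
  "euler (a ^ Suc n) = (\<Sum>j\<le>n. of_nat (Suc n choose Suc j) *\<^sub>Q ((ad a ^^ j) (euler a) * a ^ (n - j)))"
proof (induction n)
  case 0 then show ?case by (simp add: scaleQ_one)
next
  case (Suc n)
  let ?D = "\<lambda>j. (ad a ^^ j) (euler a)"
  have "euler (a ^ Suc (Suc n)) = euler (a ^ Suc n) * a + a ^ Suc n * euler a"
    by (simp only: power_Suc2[of a "Suc n"] euler_mult)
  also have "euler (a ^ Suc n) * a = (\<Sum>j\<le>n. of_nat (Suc n choose Suc j) *\<^sub>Q (?D j * a ^ (Suc n - j)))"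
    unfolding Suc.IH sum_distrib_right
    by (rule sum.cong) (auto simp: scaleQ_mult_left mult.assoc Suc_diff_le power_commutes simp del: binomial_Suc_Suc)
  also have "\<dots> = (\<Sum>j\<le>Suc n. of_nat (Suc n choose Suc j) *\<^sub>Q (?D j * a ^ (Suc n - j)))"
    by (simp del: binomial_Suc_Suc add: binomial_eq_0)
  also have "\<dots> + a ^ Suc n * euler a =
      (\<Sum>j\<le>Suc n. of_nat (Suc (Suc n) choose Suc j) *\<^sub>Q (?D j * a ^ (Suc n - j)))"
    unfolding power_mult_ad sum.distrib[symmetric] scaleQ_add_left[symmetric]
    by (rule sum.cong) (simp_all add: add.commute)
  finally show ?case .
qed

text \<open>The operator given by a power series in \<open>ad a\<close>. With c n = 1/n! it is
  conjugation by exp a; with c n = 1/(n+1)! it is (exp(ad a) - 1) / ad a, which occurs in the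
  derivative of the exponential.\<close>

definition ad_series ::
    "(nat \<Rightarrow> rat) \<Rightarrow> ('m::graded_splits, 'a::rat_algebra) series \<Rightarrow> ('m, 'a) series \<Rightarrow> ('m, 'a) series" where
  "ad_series c a b = sum_series (\<lambda>n. c n *\<^sub>Q (ad a ^^ n) b)"

lemma ascending_ad:
  assumes "coeff (a::('m::graded_splits, 'a::rat_algebra) series) 0 = 0"
  shows "ascending (\<lambda>n. c n *\<^sub>Q (ad a ^^ n) b)"
proof -
  have "ord_ge n ((ad a ^^ n) b)" for n
  proof (induction n)
    case (Suc n)
    have "ord_ge (Suc n) (a * (ad a ^^ n) b)" by (rule mult_coeff_ord_ge_1[OF assms Suc])
    moreover have "ord_ge (Suc n) ((ad a ^^ n) b * a)"
      using ord_ge_mult[OF Suc, of "Suc 0" a] assms by (simp add: ord_ge_Suc_0)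
    ultimately show ?case by (simp add: ad_def[of a "(ad a ^^ n) b"] ord_ge_diff)
  qed simp
  then show ?thesis by (auto simp: ascending_def intro: ord_ge_scaleQ)
qed

text \<open>The reason for expressing everything through \<open>ad\<close>: iterated commutators
  survive a Lie map applied coefficientwise, whereas products do not.\<close>

lemma map_series_ad_series:
  fixes a b :: "('m::graded_splits, 'a::rat_algebra) series"
  assumes T: "lie_map T" and a: "coeff a 0 = 0"
  shows "map_series T (ad_series c a b) = ad_series c (map_series T a) (map_series T b)"
proof -
  note lin = lie_map_linear[OF T]
  have "map_series T (ad x y) = ad (map_series T x) (map_series T y)" for x y :: "('m, 'a) series"
    using map_series_lie_map[OF T] by (auto simp: ad_def lie_map_def)
  then have "map_series T ((ad a ^^ n) b) = (ad (map_series T a) ^^ n) (map_series T b)" for n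
    by (induction n) simp_all
  then show ?thesis
    unfolding ad_series_def
    by (simp add: map_series_sum_series[OF lin ascending_ad[OF a]] rat_linear_scaleQ[OF map_series_linear[OF lin]])
qed

lemma exp_series_mult_left:
  assumes a: "coeff a 0 = 0"
  shows "exp_series a * b = ad_series (\<lambda>n. 1 / fact n) a b * exp_series a"
proof -
  have "((1 / fact n) *\<^sub>Q a ^ n) * b =
      (\<Sum>j\<le>n. ((1 / fact j) *\<^sub>Q (ad a ^^ j) b) * ((1 / fact (n - j)) *\<^sub>Q a ^ (n - j)))" for n
    unfolding scaleQ_mult_left power_mult_ad scaleQ_sum
    by (rule sum.cong) (auto simp: scaleQ_scaleQ scaleQ_mult_right scaleQ_mult_left binomial_fact)
  then show ?thesis
    unfolding exp_series_def eval_series_def ad_series_def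
    by (simp add: sum_series_mult_right[OF ascending_powers[OF a]]
        sum_series_cauchy_product[OF ascending_ad[OF a] ascending_powers[OF a]])
qed

lemma euler_exp_series:
  assumes a: "coeff a 0 = 0"
  shows "euler (exp_series a) = ad_series (\<lambda>n. 1 / fact (Suc n)) a (euler a) * exp_series a"
proof -
  have step: "(1 / fact (Suc n)) *\<^sub>Q euler (a ^ Suc n) =
      (\<Sum>j\<le>n. ((1 / fact (Suc j)) *\<^sub>Q (ad a ^^ j) (euler a)) * ((1 / fact (n - j)) *\<^sub>Q a ^ (n - j)))" for n
    unfolding euler_power_ad scaleQ_sum
    by (rule sum.cong)
      (auto simp: scaleQ_scaleQ scaleQ_mult_right scaleQ_mult_left binomial_fact mult.commute simp del: binomial_Suc_Suc fact_Suc)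
  have asc: "ascending (\<lambda>n. (1 / fact n) *\<^sub>Q euler (a ^ n))"
    using ord_ge_power1[OF a] by (auto simp: ascending_def intro: ord_ge_scaleQ ord_ge_euler)
  have "euler (exp_series a) = sum_series (\<lambda>n. (1 / fact n) *\<^sub>Q euler (a ^ n))"
    unfolding exp_series_def eval_series_def
    by (simp add: euler_sum_series[OF ascending_powers[OF a]] rat_linear_scaleQ[OF euler_linear])
  also have "\<dots> = sum_series (\<lambda>n. (1 / fact (Suc n)) *\<^sub>Q euler (a ^ Suc n))"
    by (rule sum_series_shift[OF asc]) simp
  also have "\<dots> = ad_series (\<lambda>n. 1 / fact (Suc n)) a (euler a) * exp_series a"
    unfolding exp_series_def eval_series_def ad_series_def step
    by (simp add: sum_series_cauchy_product[OF ascending_ad[OF a] ascending_powers[OF a]])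
  finally show ?thesis .
qed

definition theta ::
    "('a::rat_algebra \<Rightarrow> 'b::rat_algebra) \<Rightarrow> ('m::graded_splits, 'a) series \<Rightarrow> ('m, 'b) series" where
  "theta T x = exp_series (map_series T (log_series x))"

context
  fixes T :: "'a::rat_algebra \<Rightarrow> 'b::rat_algebra"
  assumes T: "lie_map T"
begin

lemma lie_map_0 [simp]: "T 0 = 0"
  by (rule rat_linear_0[OF lie_map_linear[OF T]])

lemma coeff_map_log_0: "coeff x (0::'m::graded_splits) = 1 \<Longrightarrow> coeff (map_series T (log_series x)) 0 = 0"
  by (simp add: coeff_log_series_0 rat_linear_0[OF lie_map_linear[OF T]])

lemma coeff_theta_0: "coeff x (0::'m::graded_splits) = 1 \<Longrightarrow> coeff (theta T x) 0 = 1"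
  by (simp add: theta_def coeff_exp_series_0 coeff_log_series_0)

lemma theta_one [simp]: "theta T 1 = (1 :: ('m::graded_splits, 'b) series)"
proof -
  have "map_series T 0 = (0 :: ('m, 'b) series)" by (rule series_eqI) simp
  then show ?thesis by (simp add: theta_def)
qed

text \<open>The logarithmic derivative of x is a power series in \<open>ad (log_series x)\<close>
  applied to the derivative of the logarithm, so T carries it to the logarithmic derivative of
  \<open>theta T x\<close>.\<close>

lemma euler_theta:
  fixes x :: "('m::graded_splits, 'a) series"
  assumes "coeff x 0 = 1"
  shows "euler (theta T x) = map_series T (euler x * inv_series x) * theta T x"
proof -
  let ?y = "log_series x"
  have y0: "coeff ?y 0 = 0" and Ty0: "coeff (map_series T ?y) 0 = 0"
    using assms by (simp_all add: coeff_log_series_0 coeff_map_log_0)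
  have "euler x = ad_series (\<lambda>n. 1 / fact (Suc n)) ?y (euler ?y) * x"
    using euler_exp_series[OF y0] by (simp add: exp_log_series assms)
  then have "euler x * inv_series x = ad_series (\<lambda>n. 1 / fact (Suc n)) ?y (euler ?y)"
    by (simp add: mult.assoc inv_series_inverse assms)
  moreover have "euler (map_series T ?y) = map_series T (euler ?y)"
    by (rule series_eqI) (simp add: rat_linear_scaleQ[OF lie_map_linear[OF T]])
  ultimately show ?thesis
    by (simp add: theta_def euler_exp_series[OF Ty0] map_series_ad_series[OF T y0])
qed

text \<open>Conjugation by x is the exponential of \<open>ad (log_series x)\<close>, so T carries it
  to conjugation by \<open>theta T x\<close>.\<close>

lemma theta_conj:
  fixes x :: "('m::graded_splits, 'a) series"
  assumes "coeff x 0 = 1"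
  shows "theta T x * map_series T b = map_series T (x * b * inv_series x) * theta T x"
proof -
  let ?y = "log_series x"
  have y0: "coeff ?y 0 = 0" and Ty0: "coeff (map_series T ?y) 0 = 0"
    using assms by (simp_all add: coeff_log_series_0 coeff_map_log_0)
  have "x * b = ad_series (\<lambda>n. 1 / fact n) ?y b * x"
    using exp_series_mult_left[OF y0] by (simp add: exp_log_series assms)
  then have "x * b * inv_series x = ad_series (\<lambda>n. 1 / fact n) ?y b"
    by (simp add: mult.assoc inv_series_inverse assms)
  then show ?thesis
    by (simp add: theta_def exp_series_mult_left[OF Ty0] map_series_ad_series[OF T y0])
qed

text \<open>
  Both sides solve \<open>euler F = T (euler (x y) (x y)\<^sup>-\<^sup>1) F\<close>; this replaces the
  Baker--Campbell--Hausdorff formula.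
\<close>

lemma theta_mult:
  fixes x y :: "('m::graded_splits, 'a) series"
  assumes x: "coeff x 0 = 1" and y: "coeff y 0 = 1"
  shows "theta T (x * y) = theta T x * theta T y"
proof (rule euler_ode_unique)
  let ?a = "map_series T (euler (x * y) * inv_series (x * y))"
  note lin = lie_map_linear[OF T]
  have xy: "coeff (x * y) 0 = 1" by (simp add: x y)
  have "(x * y) * (inv_series y * inv_series x) = x * (y * inv_series y) * inv_series x"
    by (simp only: mult.assoc)
  then have inv: "inv_series (x * y) = inv_series y * inv_series x"
    by (intro inv_series_unique xy) (simp add: inv_series_inverse x y)
  have "euler (x * y) * inv_series (x * y) =
      euler x * (y * inv_series y) * inv_series x + x * (euler y * inv_series y) * inv_series x"
    by (simp only: euler_mult inv distrib_right mult.assoc)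
  then have a: "?a = map_series T (euler x * inv_series x) + map_series T (x * (euler y * inv_series y) * inv_series x)"
    by (simp add: inv_series_inverse y rat_linear_add[OF map_series_linear[OF lin]])
  show "coeff ?a 0 = 0" by (simp add: rat_linear_0[OF lin])
  show "euler (theta T (x * y)) = ?a * theta T (x * y)" by (rule euler_theta[OF xy])
  have "euler (theta T x * theta T y) = map_series T (euler x * inv_series x) * theta T x * theta T y
      + (theta T x * map_series T (euler y * inv_series y)) * theta T y"
    by (simp add: euler_mult euler_theta x y mult.assoc)
  then show "euler (theta T x * theta T y) = ?a * (theta T x * theta T y)"
    by (simp add: theta_conj[OF x] a distrib_right mult.assoc)
  show "coeff (theta T (x * y)) 0 = coeff (theta T x * theta T y) 0"
    by (simp add: coeff_theta_0 x y)
qed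

end

section \<open>Congruences and infinite products\<close>

lemma ord_ge_cong_mult:
  fixes x y :: "('m::graded_splits, 'a::rat_algebra) series"
  assumes "ord_ge n (x - x')" "ord_ge n (y - y')"
  shows "ord_ge n (x * y - x' * y')"
proof -
  have "ord_ge n ((x - x') * y + x' * (y - y'))"
    by (intro ord_ge_add ord_ge_mult1 ord_ge_mult2 assms)
  then show ?thesis by (simp add: algebra_simps)
qed

lemma ord_ge_cong_power:
  fixes x y :: "('m::graded_splits, 'a::rat_algebra) series"
  shows "ord_ge n (x - y) \<Longrightarrow> ord_ge n (x ^ k - y ^ k)"
  by (induction k) (auto simp: ord_ge_cong_mult, simp add: ord_ge_def)

lemma ord_ge_cong_eval_series:
  fixes x y :: "('m::graded_splits, 'a::rat_algebra) series"
  assumes "ord_ge n (x - y)" "coeff x 0 = 0" "coeff y 0 = 0"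
  shows "ord_ge n (eval_series c x - eval_series c y)"
  unfolding ord_ge_def
proof (intro allI impI)
  fix m :: 'm assume "mdeg m < n"
  then have "coeff (x ^ k) m = coeff (y ^ k) m" for k
    using ord_ge_cong_power[OF assms(1), of k] by (auto simp: ord_ge_def)
  then show "coeff (eval_series c x - eval_series c y) m = 0"
    by (simp add: coeff_eval_series[OF _ order_refl] assms)
qed

lemma ord_ge_eqI: "(\<And>n. n \<ge> 1 \<Longrightarrow> ord_ge n (x - y)) \<Longrightarrow> x = (y::('m::graded_splits, 'a::rat_algebra) series)"
proof (rule series_eqI)
  fix m assume *: "\<And>n. n \<ge> 1 \<Longrightarrow> ord_ge n (x - y)"
  show "coeff x m = coeff y m" using *[of "Suc (mdeg m)"] by (simp add: ord_ge_def)
qed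

lemma ord_ge_trans:
  "ord_ge n (x - y) \<Longrightarrow> ord_ge n (y - z) \<Longrightarrow> ord_ge n (x - (z::('m::graded_splits, 'a::rat_algebra) series))"
  using ord_ge_add[of n "x - y" "y - z"] by simp

lemma ord_ge_sym: "ord_ge n (x - y) \<Longrightarrow> ord_ge n (y - (x::('m::graded_splits, 'a::rat_algebra) series))"
  by (auto simp: ord_ge_def)

lemma ord_ge_exp_series:
  assumes "ord_ge n y" "n \<ge> 1"
  shows "ord_ge n (exp_series y - 1)"
proof -
  have "coeff y 0 = 0" using assms by (auto simp: ord_ge_def)
  then show ?thesis
    using ord_ge_cong_eval_series[of n y 0 "\<lambda>n. 1 / fact n"] assms(1)
    by (simp add: exp_series_def[symmetric])
qed

lemma ord_ge_log_series:
  assumes "ord_ge n (x - 1)" "n \<ge> 1"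
  shows "ord_ge n (log_series x)"
proof -
  have "coeff (x - 1) 0 = 0" using assms by (auto simp: ord_ge_def)
  then show ?thesis
    using ord_ge_cong_eval_series[of n "x - 1" 0 "\<lambda>n. if n = 0 then 0 else (-1) ^ (n + 1) / of_nat n"] assms(1)
    by (simp add: log_series_def eval_series_zero)
qed

lemma ord_ge_theta:
  assumes "rat_linear T" "ord_ge n (x - 1)" "n \<ge> 1"
  shows "ord_ge n (theta T x - 1)"
  unfolding theta_def using assms
  by (intro ord_ge_exp_series ord_ge_map_series ord_ge_log_series rat_linear_0)

text \<open>Convergence of the ordered product: the factor with index l differs from 1 only from
  degree l on. Indices start at 1 as in \<open>prod_series\<close>.\<close>

definition near_one :: "(nat \<Rightarrow> ('m::graded_splits, 'a::rat_algebra) series) \<Rightarrow> bool" where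
  "near_one f \<longleftrightarrow> (\<forall>l\<ge>1. ord_ge l (f l - 1))"

lemma near_one_coeff_0: "near_one f \<Longrightarrow> l \<ge> 1 \<Longrightarrow> coeff (f l) 0 = 1"
  by (force simp: near_one_def ord_ge_def coeff_1)

lemma near_one_mult:
  assumes "near_one f" "near_one g" shows "near_one (\<lambda>l. f l * g l)"
  using assms ord_ge_cong_mult[of _ _ 1 _ 1] by (fastforce simp: near_one_def)

abbreviation partial_prod :: "(nat \<Rightarrow> 'a::monoid_mult) \<Rightarrow> nat \<Rightarrow> 'a" where
  "partial_prod f N \<equiv> prod_list (map f [1..<N])"

lemma partial_prod_Suc: "N \<ge> 1 \<Longrightarrow> partial_prod f (Suc N) = partial_prod f N * f N"
  by simp

lemma partial_prod_stable:
  assumes "near_one f" "N \<ge> 1" "N \<le> N'"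
  shows "ord_ge N (partial_prod f N' - partial_prod f N)"
  using assms(3)
proof (induction N' rule: dec_induct)
  case base then show ?case by (simp add: ord_ge_def)
next
  case (step k)
  have "ord_ge N (f k - 1)" using assms step ord_ge_mono[of k "f k - 1" N] by (auto simp: near_one_def)
  from ord_ge_cong_mult[OF step.IH this] show ?case
    using partial_prod_Suc[of k f] step assms by simp
qed

text \<open>From N on, the partial products are constant below degree N, and this constant is what
  the definite description in \<open>prod_series\<close> picks.\<close>

lemma prod_series_approx:
  fixes f :: "nat \<Rightarrow> ('m::graded_splits, 'a::rat_algebra) series"
  assumes f: "near_one f" and N: "N \<ge> 1"
  shows "ord_ge N (prod_series f - partial_prod f N)"
  unfolding ord_ge_def
proof (intro allI impI)
  fix m :: 'm assume m: "mdeg m < N"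
  have ev: "\<forall>\<^sub>F K in sequentially. coeff (partial_prod f K) m = coeff (partial_prod f N) m"
    unfolding eventually_sequentially
  proof (intro exI allI impI)
    fix K assume "N \<le> K"
    from partial_prod_stable[OF f N this] m
    show "coeff (partial_prod f K) m = coeff (partial_prod f N) m" by (auto simp: ord_ge_def)
  qed
  have "(THE c. \<forall>\<^sub>F K in sequentially. coeff (partial_prod f K) m = c) = coeff (partial_prod f N) m"
  proof (rule the_equality)
    fix c assume "\<forall>\<^sub>F K in sequentially. coeff (partial_prod f K) m = c"
    with ev have "\<forall>\<^sub>F K in sequentially. c = coeff (partial_prod f N) m"
      by eventually_elim simp
    then show "c = coeff (partial_prod f N) m" by simp
  qed (rule ev)
  then show "coeff (prod_series f - partial_prod f N) m = 0"
    by (simp add: prod_series_def)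
qed

lemma prod_series_eqI:
  assumes "near_one f" "\<And>N. N \<ge> 1 \<Longrightarrow> ord_ge N (x - partial_prod f N)"
  shows "prod_series f = x"
  using prod_series_approx[OF assms(1)] assms(2) by (intro ord_ge_eqI) (blast intro: ord_ge_trans ord_ge_sym)

lemma prod_series_cong: "(\<And>l. l \<ge> 1 \<Longrightarrow> f l = g l) \<Longrightarrow> prod_series f = prod_series g"
proof -
  assume "\<And>l. l \<ge> 1 \<Longrightarrow> f l = g l"
  then have "map f [1..<N] = map g [1..<N]" for N by simp
  then show ?thesis by (simp only: prod_series_def)
qed

lemma coeff_prod_series_0: "near_one f \<Longrightarrow> coeff (prod_series f) (0::'m::graded_splits) = 1"
  using prod_series_approx[of f 1] by (force simp: ord_ge_def coeff_1)

lemma commute_prod_list: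
  "(\<And>y. y \<in> set ys \<Longrightarrow> x * y = y * x) \<Longrightarrow> x * prod_list ys = prod_list ys * (x::'a::monoid_mult)"
  by (induction ys) (auto, metis mult.assoc)

text \<open>Only factors with different labels commute, while \<open>f k\<close> and
  \<open>g k\<close> may not. Interleaving therefore moves each \<open>g x\<close> to the left past
  the later factors \<open>f k\<close>, never past its own partner.\<close>

lemma prod_list_mult_commute:
  fixes f g :: "'i \<Rightarrow> 'a::monoid_mult"
  assumes "distinct ls" "\<And>k l. k \<in> set ls \<Longrightarrow> l \<in> set ls \<Longrightarrow> k \<noteq> l \<Longrightarrow> f k * g l = g l * f k"
  shows "prod_list (map f ls) * prod_list (map g ls) = prod_list (map (\<lambda>l. f l * g l) ls)"
  using assms
proof (induction ls)
  case (Cons x ls)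
  have "g x * prod_list (map f ls) = prod_list (map f ls) * g x"
  proof (rule commute_prod_list)
    fix y assume "y \<in> set (map f ls)"
    then obtain k where k: "k \<in> set ls" "y = f k" by auto
    then have "k \<noteq> x" using Cons.prems(1) by auto
    then have "f k * g x = g x * f k" using k by (intro Cons.prems(2)) auto
    then show "g x * y = y * g x" using k by simp
  qed
  moreover have "prod_list (map f ls) * prod_list (map g ls) = prod_list (map (\<lambda>l. f l * g l) ls)"
    using Cons.prems by (intro Cons.IH) auto
  moreover have "f x * F * (g x * G) = f x * g x * (F * G)" if "g x * F = F * g x" for F G
  proof -
    have "f x * F * (g x * G) = f x * (F * g x) * G" by (simp only: mult.assoc)
    also have "\<dots> = f x * g x * (F * G)" by (simp only: that[symmetric] mult.assoc)
    finally show ?thesis .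
  qed
  ultimately show ?case by simp
qed simp

lemma prod_series_mult:
  assumes "near_one f" "near_one g"
    and "\<And>k l. 1 \<le> k \<Longrightarrow> 1 \<le> l \<Longrightarrow> k \<noteq> l \<Longrightarrow> f k * g l = g l * f k"
  shows "prod_series f * prod_series g = prod_series (\<lambda>l. f l * g l)"
proof (rule prod_series_eqI[symmetric])
  show "near_one (\<lambda>l. f l * g l)" by (rule near_one_mult[OF assms(1,2)])
  fix N :: nat assume "N \<ge> 1"
  then have "ord_ge N (prod_series f * prod_series g - partial_prod f N * partial_prod g N)"
    by (intro ord_ge_cong_mult prod_series_approx assms(1,2))
  moreover have "partial_prod f N * partial_prod g N = partial_prod (\<lambda>l. f l * g l) N"
    by (rule prod_list_mult_commute) (auto intro: assms(3))
  ultimately show "ord_ge N (prod_series f * prod_series g - partial_prod (\<lambda>l. f l * g l) N)"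
    by (simp only:)
qed

lemma commute_eval_series:
  assumes "z * a = a * z" "coeff a (0::'m::graded_splits) = 0"
  shows "z * eval_series c a = eval_series c a * z"
proof -
  have "z * a ^ n = a ^ n * z" for n
    by (induction n) (simp_all, metis assms(1) mult.assoc)
  then show ?thesis
    unfolding eval_series_def
    by (simp add: sum_series_mult_left sum_series_mult_right ascending_powers[OF assms(2)]
        scaleQ_mult_left scaleQ_mult_right)
qed

lemma series_commuteI:
  assumes "\<And>a b. coeff x a * coeff y b = coeff y b * coeff x a"
  shows "x * y = y * (x::('m::finite_splits, 'a::{ring,monoid_mult}) series)"
proof (rule series_eqI)
  fix m :: 'm
  have "coeff (x * y) m = (\<Sum>(a, b)\<in>splits m. coeff y b * coeff x a)"
    by (simp add: coeff_mult assms)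
  also have "\<dots> = coeff (y * x) m"
    unfolding coeff_mult
    by (rule sum.reindex_bij_witness[of _ prod.swap prod.swap]) (auto simp: add.commute)
  finally show "coeff (x * y) m = coeff (y * x) m" .
qed

lemma theta_commute:
  assumes "\<And>a b. S a * T b = T b * S a" "rat_linear S" "rat_linear T"
    and "coeff x (0::'m::graded_splits) = 1" "coeff y 0 = 1"
  shows "theta S x * theta T y = theta T y * theta S x"
proof -
  let ?a = "map_series S (log_series x)" and ?b = "map_series T (log_series y)"
  have "coeff ?a 0 = 0" "coeff ?b 0 = 0"
    using assms by (simp_all add: coeff_log_series_0 rat_linear_0)
  moreover have "?a * ?b = ?b * ?a" by (rule series_commuteI) (simp add: assms(1))
  ultimately show ?thesis
    unfolding theta_def exp_series_def by (metis commute_eval_series)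
qed

lemma partial_prod_exp_series:
  assumes y0: "\<And>l. l \<ge> 1 \<Longrightarrow> coeff (y l) (0::'m::graded_splits) = 0"
    and comm: "\<And>k l. 1 \<le> k \<Longrightarrow> 1 \<le> l \<Longrightarrow> y k * y l = y l * y k"
  shows "partial_prod (\<lambda>l. exp_series (y l)) N = exp_series (\<Sum>l\<in>{1..<N}. y l)"
proof (induction N)
  case (Suc N)
  show ?case
  proof (cases "N \<ge> 1")
    case True
    have "(\<Sum>l\<in>{1..<N}. y l) * y N = y N * (\<Sum>l\<in>{1..<N}. y l)"
      using True by (simp add: sum_distrib_left sum_distrib_right comm)
    then have "exp_series ((\<Sum>l\<in>{1..<N}. y l) + y N) = exp_series (\<Sum>l\<in>{1..<N}. y l) * exp_series (y N)"
      by (intro exp_series_add y0[OF True]) (simp_all add: y0)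
    then show ?thesis using Suc True by (simp only: partial_prod_Suc sum.atLeastLessThan_Suc)
  qed simp
qed simp

text \<open>The sum of the exponents enters through an element \<open>Y\<close> that it
  approximates: in the application the l-th exponent is spread over the multiples of l, and the sum
  is known in closed form as a sum over divisors.\<close>

lemma prod_series_exp:
  assumes y: "\<And>l. l \<ge> 1 \<Longrightarrow> ord_ge l (y l)"
    and comm: "\<And>k l. 1 \<le> k \<Longrightarrow> 1 \<le> l \<Longrightarrow> y k * y l = y l * y k"
    and Y: "\<And>N. N \<ge> 1 \<Longrightarrow> ord_ge N (Y - (\<Sum>l\<in>{1..<N}. y l))"
  shows "prod_series (\<lambda>l. exp_series (y l)) = exp_series Y"
proof (rule prod_series_eqI)
  show "near_one (\<lambda>l. exp_series (y l))"
    unfolding near_one_def by (intro allI impI ord_ge_exp_series y)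
  have y0: "coeff (y l) 0 = 0" if "l \<ge> 1" for l using y[OF that] that by (auto simp: ord_ge_def)
  have Y0: "coeff Y 0 = 0" using Y[of 1] by (auto simp: ord_ge_def)
  fix N :: nat assume "N \<ge> 1"
  from Y[OF this] have "ord_ge N (exp_series Y - exp_series (\<Sum>l\<in>{1..<N}. y l))"
    unfolding exp_series_def by (intro ord_ge_cong_eval_series) (auto simp: Y0 y0)
  moreover have "partial_prod (\<lambda>l. exp_series (y l)) N = exp_series (\<Sum>l\<in>{1..<N}. y l)"
    by (rule partial_prod_exp_series) (rule y0 comm; assumption)+
  ultimately show "ord_ge N (exp_series Y - partial_prod (\<lambda>l. exp_series (y l)) N)"
    by (simp only:)
qed

section \<open>Monomial substitutions\<close>

definition nmul :: "nat \<Rightarrow> 'm::comm_monoid_add \<Rightarrow> 'm" where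
  "nmul n k = (\<Sum>_<n. k)"

lemma nmul_0 [simp]: "nmul 0 k = 0" by (simp add: nmul_def)
lemma nmul_Suc: "nmul (Suc n) k = k + nmul n k" by (simp add: nmul_def add.commute)
lemma nmul_1 [simp]: "nmul (Suc 0) k = k" by (simp add: nmul_Suc)
lemma nmul_zero [simp]: "nmul n 0 = 0" by (simp add: nmul_def)
lemma nmul_add: "nmul (m + n) k = nmul m k + nmul n k"
  by (induction m) (auto simp: nmul_Suc add_ac)
lemma nmul_distrib: "nmul n (a + b) = nmul n a + nmul n b"
  by (simp add: nmul_def sum.distrib)
lemma nmul_nat [simp]: "nmul n (k::nat) = n * k" by (simp add: nmul_def)
lemma nmul_pair: "nmul n (a, b) = (nmul n a, nmul n b)"
  by (induction n) (auto simp: nmul_Suc zero_prod_def)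

lemma mdeg_nmul: "mdeg (nmul n (k::'m::graded_splits)) = n * mdeg k"
  by (induction n) (auto simp: nmul_Suc mdeg_add)

lemma nmul_eq_0: "nmul n (k::'m::graded_splits) = 0 \<longleftrightarrow> n = 0 \<or> k = 0"
  by (metis mdeg_eq_0_iff mdeg_nmul mult_is_0)

lemma nmul_inject: "(k::'m::graded_splits) \<noteq> 0 \<Longrightarrow> nmul m k = nmul n k \<longleftrightarrow> m = n"
  by (metis mdeg_eq_0_iff mdeg_nmul mult_right_cancel)

text \<open>Finite fibres make the coefficients of the image finite sums; non-decreasing degree
  makes the substitution continuous for \<open>ord_ge\<close>. The character \<chi> carries signs
  and scalars, or the value 0 for deleted variables.\<close>

definition monomial_map :: "('m::graded_splits \<Rightarrow> rat) \<Rightarrow> ('m \<Rightarrow> 'n::graded_splits) \<Rightarrow> bool" where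
  "monomial_map \<chi> f \<longleftrightarrow> \<chi> 0 = 1 \<and> (\<forall>a b. \<chi> (a + b) = \<chi> a * \<chi> b) \<and>
     f 0 = 0 \<and> (\<forall>a b. f (a + b) = f a + f b) \<and>
     (\<forall>n. finite {m. f m = n}) \<and> (\<forall>m. mdeg m \<le> mdeg (f m))"

text \<open>The continuous algebra homomorphism \<open>X\<^sup>m \<mapsto> \<chi> m X\<^sup>f\<^sup>m\<close>.\<close>

definition subst ::
    "('m::graded_splits \<Rightarrow> rat) \<Rightarrow> ('m \<Rightarrow> 'n::graded_splits) \<Rightarrow> ('m, 'a::rat_algebra) series \<Rightarrow> ('n, 'a) series" where
  "subst \<chi> f x = Series (\<lambda>n. \<Sum>m | f m = n. \<chi> m *\<^sub>Q coeff x m)"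

lemma coeff_subst: "coeff (subst \<chi> f x) n = (\<Sum>m | f m = n. \<chi> m *\<^sub>Q coeff x m)"
  by (simp add: subst_def)

lemma subst_linear: "rat_linear (subst \<chi> f)"
  unfolding rat_linear_def
  by (auto intro!: series_eqI simp: coeff_subst scaleQ_add_right sum.distrib scaleQ_sum scaleQ_scaleQ mult.commute)

lemma ord_ge_subst: "monomial_map \<chi> f \<Longrightarrow> ord_ge n x \<Longrightarrow> ord_ge n (subst \<chi> f x)"
  unfolding ord_ge_def coeff_subst monomial_map_def
  by (intro allI impI sum.neutral) (auto, metis le_less_trans scaleQ_zero_right)

lemma subst_monomial:
  assumes "monomial_map \<chi> f" shows "subst \<chi> f (monom k a) = monom (f k) (\<chi> k *\<^sub>Q a)"
proof (rule series_eqI)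
  fix n
  have "(\<Sum>m | f m = n. \<chi> m *\<^sub>Q coeff (monom k a) m) = (\<Sum>m | f m = n. if m = k then \<chi> k *\<^sub>Q a else 0)"
    by (rule sum.cong) (auto simp: coeff_monom)
  also have "\<dots> = (if f k = n then \<chi> k *\<^sub>Q a else 0)"
    using assms by (simp add: monomial_map_def)
  finally show "coeff (subst \<chi> f (monom k a)) n = coeff (monom (f k) (\<chi> k *\<^sub>Q a)) n"
    by (auto simp: coeff_subst coeff_monom)
qed

lemma one_monom: "1 = monom 0 1"
  by (rule series_eqI) (simp add: coeff_1 coeff_monom)

lemma subst_1: "monomial_map \<chi> f \<Longrightarrow> subst \<chi> f 1 = 1"
  by (simp add: one_monom subst_monomial scaleQ_one monomial_map_def)

lemma subst_mult:
  fixes x y :: "('m::graded_splits, 'a::rat_algebra) series" and f :: "'m \<Rightarrow> 'n::graded_splits"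
  assumes "monomial_map \<chi> f"
  shows "subst \<chi> f (x * y) = subst \<chi> f x * subst \<chi> f y"
proof (rule series_eqI)
  fix n :: 'n
  have fin: "finite {m. f m = k}" for k using assms by (simp add: monomial_map_def)
  have fs: "finite {p :: 'm \<times> 'm. fst p + snd p = k}" for k
    using finite_splits[of k] by (simp add: case_prod_unfold)
  have fsn: "finite {p :: 'n \<times> 'n. fst p + snd p = n}"
    using finite_splits[of n] by (simp add: case_prod_unfold)
  let ?t = "\<lambda>a b. (\<chi> a *\<^sub>Q coeff x a) * (\<chi> b *\<^sub>Q coeff y b)"
  have "coeff (subst \<chi> f (x * y)) n = (\<Sum>m | f m = n. \<Sum>(a, b)\<in>splits m. ?t a b)"
    unfolding coeff_subst coeff_mult scaleQ_sum case_prod_unfold using assms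
    by (intro sum.cong refl)
      (auto simp: monomial_map_def scaleQ_mult_left scaleQ_mult_right scaleQ_scaleQ mult.commute)
  also have "\<dots> = (\<Sum>(m, (a, b))\<in>(SIGMA m:{m. f m = n}. splits m). ?t a b)"
    by (subst sum.Sigma) (auto simp: fin fs case_prod_unfold)
  \<comment> \<open>Both sums run over the pairs (a, b) with f a + f b = n, grouped once by a + b
    and once by (f a, f b).\<close>
  also have "\<dots> = (\<Sum>((p, q), (a, b))\<in>(SIGMA pq:splits n. {a. f a = fst pq} \<times> {b. f b = snd pq}). ?t a b)"
    by (rule sum.reindex_bij_witness[of _ "\<lambda>((p, q), (a, b)). (a + b, (a, b))" "\<lambda>(m, (a, b)). ((f a, f b), (a, b))"])
      (use assms in \<open>auto simp: monomial_map_def\<close>)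
  also have "\<dots> = (\<Sum>(p, q)\<in>splits n. \<Sum>(a, b)\<in>{a. f a = p} \<times> {b. f b = q}. ?t a b)"
    by (subst sum.Sigma[symmetric]) (auto simp: fsn fin case_prod_unfold)
  also have "\<dots> = coeff (subst \<chi> f x * subst \<chi> f y) n"
    unfolding coeff_mult coeff_subst
    by (simp add: sum_product sum.cartesian_product)
  finally show "coeff (subst \<chi> f (x * y)) n = coeff (subst \<chi> f x * subst \<chi> f y) n" .
qed

lemma subst_alg_hom: "monomial_map \<chi> f \<Longrightarrow> alg_hom (subst \<chi> f)"
  by (simp add: alg_hom_def subst_linear subst_1 subst_mult)

lemma subst_sum_series:
  assumes \<chi>: "monomial_map \<chi> f" and u: "ascending u"
  shows "subst \<chi> f (sum_series u) = sum_series (\<lambda>k. subst \<chi> f (u k))"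
proof (rule series_eqI)
  fix n
  have asc: "ascending (\<lambda>k. subst \<chi> f (u k))"
    using u by (auto simp: ascending_def intro: ord_ge_subst[OF \<chi>])
  have "coeff (subst \<chi> f (sum_series u)) n = (\<Sum>m | f m = n. \<chi> m *\<^sub>Q (\<Sum>k\<le>mdeg n. coeff (u k) m))"
    unfolding coeff_subst
    using \<chi> by (auto simp: monomial_map_def
        intro!: sum.cong arg_cong[of _ _ "scaleQ _"] coeff_sum_series[OF u])
  also have "\<dots> = coeff (sum_series (\<lambda>k. subst \<chi> f (u k))) n"
    unfolding coeff_sum_series[OF asc order_refl] coeff_subst scaleQ_sum by (rule sum.swap)
  finally show "coeff (subst \<chi> f (sum_series u)) n = coeff (sum_series (\<lambda>k. subst \<chi> f (u k))) n" .
qed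

lemma subst_eval_series:
  assumes "monomial_map \<chi> f" "coeff x 0 = 0"
  shows "subst \<chi> f (eval_series c x) = eval_series c (subst \<chi> f x)"
  unfolding eval_series_def
  by (simp add: subst_sum_series[OF assms(1) ascending_powers[OF assms(2)]]
      rat_linear_scaleQ[OF subst_linear] alg_hom_power[OF subst_alg_hom[OF assms(1)]])

lemma subst_exp_series:
  "monomial_map \<chi> f \<Longrightarrow> coeff x 0 = 0 \<Longrightarrow> subst \<chi> f (exp_series x) = exp_series (subst \<chi> f x)"
  by (simp add: exp_series_def subst_eval_series)

lemma subst_log_series:
  "monomial_map \<chi> f \<Longrightarrow> coeff x 0 = 1 \<Longrightarrow> subst \<chi> f (log_series x) = log_series (subst \<chi> f x)"
  by (simp add: log_series_def subst_eval_series coeff_1 rat_linear_diff[OF subst_linear] subst_1)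

lemma subst_map_series:
  "rat_linear T \<Longrightarrow> subst \<chi> f (map_series T x) = map_series T (subst \<chi> f x)"
  by (rule series_eqI) (simp add: coeff_subst rat_linear_sum rat_linear_scaleQ)

lemma subst_theta:
  assumes "monomial_map \<chi> f" "rat_linear T" "coeff x 0 = 1"
  shows "subst \<chi> f (theta T x) = theta T (subst \<chi> f x)"
  using assms
  by (simp add: theta_def subst_exp_series subst_map_series subst_log_series coeff_log_series_0 rat_linear_0)

lemma subst_prod_series:
  assumes \<chi>: "monomial_map \<chi> f" and g: "near_one g"
  shows "subst \<chi> f (prod_series g) = prod_series (\<lambda>l. subst \<chi> f (g l))"
proof (rule prod_series_eqI[symmetric])
  note hom = subst_alg_hom[OF \<chi>]
  note diff = rat_linear_diff[OF subst_linear, of \<chi> f, symmetric]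
  show "near_one (\<lambda>l. subst \<chi> f (g l))"
    unfolding near_one_def
  proof (intro allI impI)
    fix l :: nat assume "1 \<le> l"
    then have "ord_ge l (subst \<chi> f (g l - 1))" using g by (auto simp: near_one_def intro: ord_ge_subst[OF \<chi>])
    then show "ord_ge l (subst \<chi> f (g l) - 1)" by (simp add: rat_linear_diff[OF subst_linear] subst_1[OF \<chi>])
  qed
  fix N :: nat assume N: "1 \<le> N"
  have "subst \<chi> f (prod_list xs) = prod_list (map (subst \<chi> f) xs)" for xs
    by (induction xs) (simp_all add: subst_1[OF \<chi>] subst_mult[OF \<chi>])
  from this[of "map g [1..<N]"] have "partial_prod (\<lambda>l. subst \<chi> f (g l)) N = subst \<chi> f (partial_prod g N)"
    by (simp only: map_map comp_def)
  then show "ord_ge N (subst \<chi> f (prod_series g) - partial_prod (\<lambda>l. subst \<chi> f (g l)) N)"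
    using ord_ge_subst[OF \<chi> prod_series_approx[OF g N]] by (simp add: rat_linear_diff[OF subst_linear])
qed

lemma subst_subst:
  assumes "monomial_map \<chi> f" "monomial_map \<psi> g"
  shows "subst \<psi> g (subst \<chi> f x) = subst (\<lambda>m. \<chi> m * \<psi> (f m)) (\<lambda>m. g (f m)) x"
proof (rule series_eqI)
  fix n
  have fin: "finite {m. f m = k}" "finite {k. g k = n}" for k using assms by (simp_all add: monomial_map_def)
  have "coeff (subst \<psi> g (subst \<chi> f x)) n = (\<Sum>k | g k = n. \<Sum>m | f m = k. (\<chi> m * \<psi> (f m)) *\<^sub>Q coeff x m)"
    by (auto simp: coeff_subst scaleQ_sum scaleQ_scaleQ mult.commute intro!: sum.cong)
  also have "\<dots> = (\<Sum>(k, m)\<in>(SIGMA k:{k. g k = n}. {m. f m = k}). (\<chi> m * \<psi> (f m)) *\<^sub>Q coeff x m)"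
    by (subst sum.Sigma) (auto simp: fin)
  also have "\<dots> = (\<Sum>m | g (f m) = n. (\<chi> m * \<psi> (f m)) *\<^sub>Q coeff x m)"
    by (rule sum.reindex_bij_witness[of _ "\<lambda>m. (f m, m)" snd]) auto
  finally show "coeff (subst \<psi> g (subst \<chi> f x)) n = coeff (subst (\<lambda>m. \<chi> m * \<psi> (f m)) (\<lambda>m. g (f m)) x) n"
    by (simp add: coeff_subst)
qed

lemma monomial_map_power:
  assumes "(k::'m::graded_splits) \<noteq> 0"
  shows "monomial_map (\<lambda>n. c ^ n) (\<lambda>n. nmul n k)"
proof -
  have "mdeg k \<ge> 1" using assms mdeg_eq_0_iff[of k] by (simp del: mdeg_eq_0_iff)
  then have le: "n \<le> n * mdeg k" for n by simp
  have "finite {n. nmul n k = m}" for m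
    by (rule finite_subset[of _ "{..mdeg m}"]) (use le in \<open>auto simp: mdeg_nmul\<close>)
  then show ?thesis using le by (auto simp: monomial_map_def power_add nmul_add mdeg_nmul mdeg_nat_def)
qed

lemma monomial_map_adams:
  assumes "l \<ge> 1"
  shows "monomial_map (\<lambda>_. 1) (nmul l :: 'm \<Rightarrow> 'm::graded_splits)"
proof -
  obtain k where l: "l = Suc k" using assms by (cases l) auto
  have "finite {m. nmul l m = n}" for n :: 'm
    by (rule finite_subset[of _ "fst ` splits n"]) (force simp: l nmul_Suc finite_splits image_iff)+
  then show ?thesis using assms by (auto simp: monomial_map_def nmul_distrib mdeg_nmul)
qed

lemma subst_monom_eq:
  assumes "(k::'m::graded_splits) \<noteq> 0"
  shows "subst_monom c k x = subst (\<lambda>n. c ^ n) (\<lambda>n. nmul n k) x"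
proof (rule series_eqI)
  fix m
  have fin: "finite {n. nmul n k = m}"
    using monomial_map_power[OF assms] by (simp add: monomial_map_def)
  have "coeff (subst_monom c k x) m = (\<Sum>n. if m = nmul n k then c ^ n *\<^sub>Q coeff x n else 0)"
    by (simp add: subst_monom_def sum_series_def coeff_monom nmul_def)
  also have "\<dots> = (\<Sum>n | nmul n k = m. if m = nmul n k then c ^ n *\<^sub>Q coeff x n else 0)"
    by (rule Sum_any.expand_superset) (auto simp: fin)
  finally show "coeff (subst_monom c k x) m = coeff (subst (\<lambda>n. c ^ n) (\<lambda>n. nmul n k) x) m"
    by (simp add: coeff_subst)
qed

lemma coeff_subst_monom:
  assumes "(k::'m::graded_splits) \<noteq> 0"
  shows "coeff (subst_monom c k x) (nmul n k) = c ^ n *\<^sub>Q coeff x n"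
    "\<nexists>n. m = nmul n k \<Longrightarrow> coeff (subst_monom c k x) m = 0"
  using assms by (auto simp: subst_monom_eq coeff_subst nmul_inject intro!: sum.neutral)

abbreviation adams :: "nat \<Rightarrow> ('m::graded_splits, 'a::rat_algebra) series \<Rightarrow> ('m, 'a) series" where
  "adams l \<equiv> subst (\<lambda>_. 1) (nmul l)"

text \<open>A nonconstant monomial lands in degree at least l, which makes the infinite product over
  l in \<open>Phi\<close> converge.\<close>

lemma ord_ge_adams:
  fixes x :: "('m::graded_splits, 'a::rat_algebra) series"
  assumes "l \<ge> 1" "coeff x 0 = 1"
  shows "ord_ge l (adams l x - 1)"
  unfolding ord_ge_def
proof (intro allI impI)
  fix n :: 'm assume n: "mdeg n < l"
  have "m = 0" if "nmul l m = n" for m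
    using that n mdeg_nmul[of l m] by (cases "mdeg m") auto
  then have "{m. nmul l m = n} = (if n = 0 then {0} else {})"
    by (auto simp: nmul_zero) (metis nmul_zero)
  then show "coeff (adams l x - 1) n = 0" by (simp add: coeff_subst coeff_1 assms scaleQ_one)
qed

lemma ord_ge_adams_cong:
  assumes "l \<ge> 1" "ord_ge p (x - 1)"
  shows "ord_ge p (adams l x - 1)"
  using ord_ge_subst[OF monomial_map_adams[OF assms(1)] assms(2)]
  by (simp add: rat_linear_diff[OF subst_linear] subst_1[OF monomial_map_adams[OF assms(1)]])

text \<open>The character is required to be idempotent since \<open>adams\<close> does not act on coefficients.\<close>

lemma subst_adams:
  assumes \<chi>: "monomial_map \<chi> f" and idem: "\<And>m. \<chi> m * \<chi> m = \<chi> m" and l: "l \<ge> 1"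
  shows "subst \<chi> f (adams l x) = adams l (subst \<chi> f x)"
proof -
  have "\<chi> (nmul l m) = \<chi> m" for m
    using l by (induction l rule: dec_induct)
      (use \<chi> idem in \<open>auto simp: monomial_map_def nmul_Suc[of "Suc _"] nmul_Suc\<close>)
  moreover have "f (nmul l m) = nmul l (f m)" for m
    by (induction l) (use \<chi> in \<open>auto simp: monomial_map_def nmul_Suc\<close>)
  ultimately show ?thesis
    by (simp add: subst_subst[OF monomial_map_adams[OF l] \<chi>] subst_subst[OF \<chi> monomial_map_adams[OF l]])
qed

section \<open>Universal properties\<close>

lemma same_mod_ideal:
  assumes "same_mod S x y" "S \<subseteq> K" "is_ideal UNIV K"
  shows "x - y \<in> K"
proof -
  have "is_ideal UNIV hull S \<subseteq> K" using assms(2,3) by (rule hull_minimal)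
  then show ?thesis using assms(1) by (auto simp: same_mod_def)
qed

lemma same_mod_alg_hom:
  assumes "same_mod S x y" "alg_hom h" "\<And>s. s \<in> S \<Longrightarrow> h s = 0"
  shows "h x = h y"
proof -
  note lin = alg_hom_linear[OF assms(2)]
  have "x - y \<in> {p. h p = 0}"
    by (rule same_mod_ideal[OF assms(1)])
      (auto simp: assms(3) is_ideal_def rat_linear_0[OF lin] rat_linear_diff[OF lin] alg_hom_mult[OF assms(2)])
  then show ?thesis by (simp add: rat_linear_diff[OF lin])
qed

lemma additive_of_int:
  fixes f :: "int \<Rightarrow> 'a::rat_algebra"
  assumes add: "\<And>v w. f (v + w) = f v + f w"
  shows "f v = of_int v *\<^sub>Q f 1"
proof (induction v rule: int_induct[of _ 0])
  case base show ?case using add[of 0 0] by simp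
next
  case (step1 i) then show ?case by (simp add: add scaleQ_add_left scaleQ_one)
next
  case (step2 i) then show ?case using add[of "i - 1" 1] by (simp add: scaleQ_diff_left scaleQ_one)
qed

section \<open>The universal property of monoid algebras\<close>

lemma poly_mapping_sum_single:
  "p = (\<Sum>k\<in>Poly_Mapping.keys p. Poly_Mapping.single k (Poly_Mapping.lookup p k))"
  by (rule poly_mapping_eqI) (simp add: lookup_sum lookup_single when_def in_keys_iff sum.delta)

lemma lookup_scaleQ [simp]: "Poly_Mapping.lookup (c *\<^sub>Q p) k = c *\<^sub>Q Poly_Mapping.lookup p k"
  by (simp add: scaleQ_poly_mapping_def Poly_Mapping.map.rep_eq when_def)

lemma scaleQ_single: "c *\<^sub>Q Poly_Mapping.single k v = Poly_Mapping.single k (c *\<^sub>Q v)"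
  by (rule poly_mapping_eqI) (simp add: lookup_single when_def)

text \<open>The scaling \<open>s\<close> is a parameter so that integral and rational monoid
  algebras are covered at once: \<open>\<rat> \<otimes> R\<close> is built over the integers, the
  other quotients over \<rat>.\<close>

definition lin_ext :: "('k::zero \<Rightarrow> 'a \<Rightarrow> 'a) \<Rightarrow> ('m \<Rightarrow> 'a) \<Rightarrow> ('m \<Rightarrow>\<^sub>0 'k) \<Rightarrow> 'a::rat_algebra" where
  "lin_ext s g p = (\<Sum>k\<in>Poly_Mapping.keys p. s (Poly_Mapping.lookup p k) (g k))"

lemma lin_ext_superset:
  assumes "\<And>x. s 0 x = 0" "finite A" "Poly_Mapping.keys p \<subseteq> A"
  shows "lin_ext s g p = (\<Sum>k\<in>A. s (Poly_Mapping.lookup p k) (g k))"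
  unfolding lin_ext_def using assms by (intro sum.mono_neutral_left) (auto simp: in_keys_iff)

lemma lin_ext_add:
  assumes s: "\<And>v w x. s (v + w) x = s v x + s w x"
  shows "lin_ext s g (p + q) = lin_ext s g p + lin_ext s g q"
proof -
  let ?A = "Poly_Mapping.keys p \<union> Poly_Mapping.keys q"
  have s0: "s 0 x = 0" for x using s[of 0 0 x] by simp
  have "Poly_Mapping.keys (p + q) \<subseteq> ?A" by (rule keys_add)
  then show ?thesis
    by (simp add: lin_ext_superset[where s=s, OF s0, of ?A] lookup_add s sum.distrib)
qed

lemma lin_ext_zero [simp]: "lin_ext s g 0 = 0"
  by (simp add: lin_ext_def)

lemma lin_ext_sum:
  assumes s: "\<And>v w x. s (v + w) x = s v x + s w x"
  shows "lin_ext s g (sum f A) = (\<Sum>i\<in>A. lin_ext s g (f i))"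
  by (induction A rule: infinite_finite_induct) (auto simp: lin_ext_add[of s, OF s])

lemma lin_ext_diff:
  fixes p :: "'m \<Rightarrow>\<^sub>0 'k::ab_group_add"
  assumes s: "\<And>v w x. s (v + w) x = s v x + s w x"
  shows "lin_ext s g (p - q) = lin_ext s g p - lin_ext s g q"
  using lin_ext_add[of s, OF s, of g "p - q" q] by simp

lemma lin_ext_single:
  assumes "\<And>x. s 0 x = 0"
  shows "lin_ext s g (Poly_Mapping.single k v) = s v (g k)"
  using assms by (simp add: lin_ext_def)

abbreviation rat_ext :: "('m \<Rightarrow> 'a::rat_algebra) \<Rightarrow> ('m \<Rightarrow>\<^sub>0 rat) \<Rightarrow> 'a" where
  "rat_ext \<equiv> lin_ext scaleQ"

lemma rat_ext_linear: "rat_linear (rat_ext g :: ('m::monoid_add \<Rightarrow>\<^sub>0 rat) \<Rightarrow> _)"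
  unfolding rat_linear_def
proof (intro conjI allI)
  show "rat_ext g (x + y) = rat_ext g x + rat_ext g y" for x y
    by (rule lin_ext_add) (simp add: scaleQ_add_left)
  fix c :: rat and x :: "'m \<Rightarrow>\<^sub>0 rat"
  have "Poly_Mapping.keys (c *\<^sub>Q x) \<subseteq> Poly_Mapping.keys x" by (auto simp: in_keys_iff)
  then show "rat_ext g (c *\<^sub>Q x) = c *\<^sub>Q rat_ext g x"
    by (simp add: lin_ext_superset[of scaleQ "Poly_Mapping.keys x"] scaleQ_sum scaleQ_scaleQ scaleQ_rat_def)
qed

lemma rat_ext_single: "rat_ext g (Poly_Mapping.single k v) = v *\<^sub>Q g k"
  by (simp add: lin_ext_single)

lemma rat_ext_alg_hom:
  assumes "g 0 = 1" "\<And>a b. g (a + b) = g a * g (b::'m::monoid_add)"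
  shows "alg_hom (rat_ext g)"
  unfolding alg_hom_def
proof (intro conjI allI rat_ext_linear)
  show "rat_ext g 1 = 1" using rat_ext_single[of g 0 1] by (simp add: assms scaleQ_one)
  fix p q :: "'m \<Rightarrow>\<^sub>0 rat"
  note lin = rat_ext_linear[of g]
  have "rat_ext g (p * q) =
      (\<Sum>a\<in>Poly_Mapping.keys p. \<Sum>b\<in>Poly_Mapping.keys q. (Poly_Mapping.lookup p a * Poly_Mapping.lookup q b) *\<^sub>Q g (a + b))"
    by (subst (1) poly_mapping_sum_single[of p], subst (1) poly_mapping_sum_single[of q])
      (simp add: sum_product mult_single rat_linear_sum[OF lin] rat_ext_single)
  also have "\<dots> = rat_ext g p * rat_ext g q"
    by (simp add: lin_ext_def sum_product assms scaleQ_mult_left scaleQ_mult_right scaleQ_scaleQ mult.commute)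
  finally show "rat_ext g (p * q) = rat_ext g p * rat_ext g q" .
qed

section \<open>Words and the free algebra\<close>

lemma letters_0 [simp]: "letters 0 = []" by (simp add: zero_word_def)
lemma letters_add [simp]: "letters (v + w) = letters v @ letters w" by (simp add: plus_word_def)

lemma free_eval_rat_ext: "free_eval f = rat_ext (\<lambda>w. prod_list (map f (letters w)))"
  by (simp add: free_eval_def[abs_def] lin_ext_def[abs_def])

lemma free_eval_alg_hom: "alg_hom (free_eval f)"
  unfolding free_eval_rat_ext by (rule rat_ext_alg_hom) simp_all

lemma free_eval_gen [simp]: "free_eval f (free_gen x) = f x"
  by (simp add: free_eval_rat_ext free_gen_def rat_ext_single scaleQ_one)

lemma free_gen_mult: "free_gen x * mon (Word w) = mon (Word (x # w))"
  by (simp add: free_gen_def mult_single plus_word_def)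

lemma free_on_induct [consumes 1, case_names one gen add scale]:
  assumes "p \<in> free_on X"
    and one: "P 1" and gen: "\<And>x p. x \<in> X \<Longrightarrow> P p \<Longrightarrow> P (free_gen x * p)"
    and add: "\<And>p q. P p \<Longrightarrow> P q \<Longrightarrow> P (p + q)" and scale: "\<And>c p. P p \<Longrightarrow> P (c *\<^sub>Q p)"
  shows "P p"
proof -
  have word: "P (mon (Word w))" if "set w \<subseteq> X" for w
    using that
  proof (induction w)
    case Nil
    have "mon (Word []) = (1 :: 'a free_alg)" by (metis single_one zero_word_def)
    then show ?case using one by simp
  next
    case (Cons x w) then show ?case using gen by (simp add: free_gen_mult[symmetric])
  qed
  have "P (\<Sum>k\<in>A. Poly_Mapping.single k (Poly_Mapping.lookup p k))"
    if "finite A" "A \<subseteq> Poly_Mapping.keys p" for A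
    using that
  proof (induction A)
    case empty show ?case using scale[OF one, of 0] by simp
  next
    case (insert k A)
    have "set (letters k) \<subseteq> X" using insert assms(1) by (auto simp: free_on_def)
    then have "P (Poly_Mapping.single k (Poly_Mapping.lookup p k))"
      using scale[OF word[of "letters k"], of "Poly_Mapping.lookup p k"]
      by (simp add: scaleQ_single scaleQ_rat_def)
    then show ?case using insert add by simp
  qed
  from this[of "Poly_Mapping.keys p"] show ?thesis
    by (simp add: poly_mapping_sum_single[symmetric])
qed

lemma free_on_UNIV [simp]: "free_on UNIV = UNIV"
  by (simp add: free_on_def)

lemma alg_hom_free_eqI:
  assumes "alg_hom h" "alg_hom h'" "\<And>x. x \<in> X \<Longrightarrow> h (free_gen x) = h' (free_gen x)" "p \<in> free_on X"
  shows "h p = h' p"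
  using assms(4)
  by (induction p rule: free_on_induct)
    (simp_all add: alg_hom_1 alg_hom_mult assms alg_hom_linear rat_linear_add rat_linear_scaleQ)

subsection \<open>\<open>\<rat> \<otimes> R\<close>\<close>

lemma tensor_one_add: "tensor_one (x + y) = tensor_one x + tensor_one y"
  by transfer (rule same_mod_gen, unfold biadditive_rels_def, blast)

lemma tensor_one_mult: "tensor_one (x * y) = tensor_one x * tensor_one y"
  by transfer (rule same_mod_eq, simp add: mult_single)

lemma tensor_one_1: "tensor_one 1 = 1"
  by transfer (rule same_mod_eq, metis single_one zero_qpair_def)

lemma tensor_one_0 [simp]: "tensor_one 0 = 0"
  using tensor_one_add[of 0 0] by simp

lemma tensor_one_minus: "tensor_one (- x) = - tensor_one x"
  using tensor_one_add[of x "- x"] by (simp add: eq_neg_iff_add_eq_0 add.commute)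

lemma tensor_one_power: "tensor_one (x ^ n) = tensor_one x ^ n"
  by (induction n) (simp_all add: tensor_one_1 tensor_one_mult)

definition qpair_eval :: "('r \<Rightarrow> 'a::rat_algebra) \<Rightarrow> 'r qpair \<Rightarrow> 'a" where
  "qpair_eval f k = (case k of QPair c x \<Rightarrow> c *\<^sub>Q f x)"

abbreviation int_ext :: "('m \<Rightarrow> 'a::rat_algebra) \<Rightarrow> ('m \<Rightarrow>\<^sub>0 int) \<Rightarrow> 'a" where
  "int_ext \<equiv> lin_ext (\<lambda>v. scaleQ (of_int v))"

lemma int_ext_add: "int_ext g (p + q) = int_ext g p + int_ext g q"
  and int_ext_diff: "int_ext g (p - q) = int_ext g p - int_ext g q"
  and int_ext_sum: "int_ext g (sum F A) = (\<Sum>i\<in>A. int_ext g (F i))"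
  and int_ext_single: "int_ext g (Poly_Mapping.single k v) = of_int v *\<^sub>Q g k"
  by (intro lin_ext_add lin_ext_diff lin_ext_sum lin_ext_single; simp add: scaleQ_add_left)+

lemma int_ext_biadditive_rels:
  fixes f :: "'r::{ring,monoid_mult} \<Rightarrow> 'a::rat_algebra"
  assumes f: "\<And>x y. f (x + y) = f x + f y" and pq: "same_mod biadditive_rels p q"
  shows "int_ext (qpair_eval f) p = int_ext (qpair_eval f) q"
proof -
  let ?h = "int_ext (qpair_eval f)"
  \<comment> \<open>\<open>?h\<close> is additive but not multiplicative, so its kernel need not be
    an ideal. \<open>?K\<close> is the largest two-sided ideal inside the kernel, and it is enough
    to find the relators in it.\<close>
  let ?K = "{p. \<forall>a b. ?h (a * p * b) = 0}"
  have single: "?h (a * p * b) = 0"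
    if "\<And>k v l w. ?h (Poly_Mapping.single k v * p * Poly_Mapping.single l w) = 0" for a b p
    by (subst (1) poly_mapping_sum_single[of a], subst (1) poly_mapping_sum_single[of b])
      (simp add: sum_distrib_left sum_distrib_right int_ext_sum that)
  have "biadditive_rels \<subseteq> ?K"
  proof (clarify)
    fix p a b :: "'r qpair \<Rightarrow>\<^sub>0 int" assume p: "p \<in> biadditive_rels"
    show "?h (a * p * b) = 0"
    proof (rule single)
      fix k l :: "'r qpair" and v w
      obtain c x where k: "k = QPair c x" by (cases k)
      obtain d y where l: "l = QPair d y" by (cases l)
      show "?h (Poly_Mapping.single k v * p * Poly_Mapping.single l w) = 0"
        using p unfolding biadditive_rels_def
      proof (elim UnE CollectE exE conjE)
        fix a b z assume p: "p = mon (QPair (a + b) z) - (mon (QPair a z) + mon (QPair b z))"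
        show ?thesis
          by (simp add: p k l ring_distribs mult_single int_ext_diff int_ext_add int_ext_single qpair_eval_def
              scaleQ_add_left scaleQ_add_right)
      next
        fix a z z' assume p: "p = mon (QPair a (z + z')) - (mon (QPair a z) + mon (QPair a z'))"
        show ?thesis
          by (simp add: p k l ring_distribs mult_single int_ext_diff int_ext_add int_ext_single qpair_eval_def f
              scaleQ_add_left scaleQ_add_right)
      qed
    qed
  qed
  moreover have "is_ideal UNIV ?K"
    unfolding is_ideal_def
  proof (intro conjI ballI)
    show "0 \<in> ?K" by simp
    show "x - y \<in> ?K" if "x \<in> ?K" "y \<in> ?K" for x y
      using that by (simp add: right_diff_distrib left_diff_distrib int_ext_diff)
    show "c * x \<in> ?K" if "x \<in> ?K" for c x
      using that by (auto simp: mult.assoc[symmetric])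
    show "x * c \<in> ?K" if "x \<in> ?K" for c x
      using that by (auto simp: mult.assoc)
  qed simp
  ultimately have "p - q \<in> ?K" by (rule same_mod_ideal[OF pq])
  then have "?h (1 * (p - q) * 1) = 0" by blast
  then show ?thesis by (simp add: int_ext_diff)
qed

text \<open>The case distinction yields a total function on the quotient: for a map that is not
  additive, the default 0 respects the relation trivially. The later lifts use the same
  device.\<close>

lift_definition rat_tensor_lift :: "('r::{ring,monoid_mult} \<Rightarrow> 'a::rat_algebra) \<Rightarrow> 'r rat_tensor \<Rightarrow> 'a"
  is "\<lambda>f p. if \<forall>x y. f (x + y) = f x + f y then int_ext (qpair_eval f) p else 0"
  by (auto intro: int_ext_biadditive_rels)

lemma rat_tensor_lift_linear:
  assumes "\<And>x y. f (x + y) = f x + f y"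
  shows "rat_linear (rat_tensor_lift f)"
  unfolding rat_linear_def
proof (intro conjI allI)
  show "rat_tensor_lift f (x + y) = rat_tensor_lift f x + rat_tensor_lift f y" for x y
    using assms by transfer (simp add: int_ext_add)
  show "rat_tensor_lift f (c *\<^sub>Q x) = c *\<^sub>Q rat_tensor_lift f x" for c x
    using assms
  proof transfer
    fix f :: "'a \<Rightarrow> 'b" and c and p :: "'a qpair \<Rightarrow>\<^sub>0 int" assume f: "\<And>x y. f (x + y) = f x + f y"
    have e: "qpair_eval f (QPair c 1 + k) = c *\<^sub>Q qpair_eval f k" for k
      by (cases k) (simp add: qpair_eval_def scaleQ_scaleQ)
    have "int_ext (qpair_eval f) (mon (QPair c 1) * p) = c *\<^sub>Q int_ext (qpair_eval f) p"
      by (subst (1) poly_mapping_sum_single[of p])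
        (simp add: sum_distrib_left mult_single int_ext_sum int_ext_single e lin_ext_def[of _ _ p]
          scaleQ_sum scaleQ_scaleQ mult.commute)
    then show "(if \<forall>x y. f (x + y) = f x + f y then int_ext (qpair_eval f) (mon (QPair c 1) * p) else 0) =
       c *\<^sub>Q (if \<forall>x y. f (x + y) = f x + f y then int_ext (qpair_eval f) p else 0)" by simp
  qed
qed

lemma rat_tensor_lift_one:
  assumes "\<And>x y. f (x + y) = f x + f y"
  shows "rat_tensor_lift f (tensor_one x) = f x"
  using assms by transfer (simp add: int_ext_single qpair_eval_def scaleQ_one)

lemma rat_tensor_induct [case_names add scale]:
  fixes r :: "'r::{ring,monoid_mult} rat_tensor"
  assumes add: "\<And>r s. P r \<Longrightarrow> P s \<Longrightarrow> P (r + s)" and scale: "\<And>c x. P (c *\<^sub>Q tensor_one x)"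
  shows "P r"
proof -
  have "P (abs_rat_tensor p)" for p :: "'r qpair \<Rightarrow>\<^sub>0 int"
  proof -
    have abs_add: "abs_rat_tensor (p + q) = abs_rat_tensor p + abs_rat_tensor q" for p q :: "'r qpair \<Rightarrow>\<^sub>0 int"
      by (simp add: plus_rat_tensor.abs_eq)
    have abs_mon: "abs_rat_tensor (mon (QPair c x)) = c *\<^sub>Q tensor_one x" for c and x :: 'r
      by (simp add: tensor_one.abs_eq scaleQ_rat_tensor.abs_eq mult_single)
    have single: "P (abs_rat_tensor (Poly_Mapping.single k v))" for k v
    proof -
      obtain c x where k: "k = QPair c x" by (cases k)
      have "abs_rat_tensor (Poly_Mapping.single k v) = of_int v *\<^sub>Q abs_rat_tensor (mon k)"
        by (rule additive_of_int) (simp add: single_add abs_add)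
      then show ?thesis by (simp add: k abs_mon scaleQ_scaleQ scale)
    qed
    have "P (abs_rat_tensor (\<Sum>k\<in>A. Poly_Mapping.single k (Poly_Mapping.lookup p k)))" if "finite A" for A
      using that
    proof (induction A)
      case empty
      show ?case using scale[of 0 0] by (simp add: zero_rat_tensor.abs_eq[symmetric])
    next
      case (insert k A) then show ?case by (simp add: abs_add add single)
    qed
    from this[of "Poly_Mapping.keys p"] show ?thesis by (simp add: poly_mapping_sum_single[symmetric])
  qed
  then show ?thesis by (metis Quotient3_abs_rep[OF Quotient3_rat_tensor])
qed

subsection \<open>Enveloping algebras\<close>

lift_definition uea_lift :: "('l::rat_algebra \<Rightarrow> 'a::rat_algebra) \<Rightarrow> 'l uea \<Rightarrow> 'a"
  is "\<lambda>f p. if lie_map f then free_eval f p else 0"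
proof -
  fix f :: "'l \<Rightarrow> 'a" and p q :: "'l free_alg"
  assume pq: "same_mod uea_rels p q"
  note hom = free_eval_alg_hom[of f]
  note lin = alg_hom_linear[OF hom]
  have "free_eval f p = free_eval f q" if f: "lie_map f"
    by (rule same_mod_alg_hom[OF pq hom])
      (use f in \<open>auto simp: uea_rels_def lie_map_def rat_linear_def rat_linear_diff[OF lin]
        rat_linear_add[OF lin] rat_linear_scaleQ[OF lin] alg_hom_mult[OF hom]\<close>)
  then show "(if lie_map f then free_eval f p else 0) = (if lie_map f then free_eval f q else 0)" by simp
qed

lemma uea_lift_alg_hom:
  assumes "lie_map f" shows "alg_hom (uea_lift f)"
  unfolding alg_hom_def rat_linear_def
proof (intro conjI allI)
  note hom = free_eval_alg_hom
  note lin = alg_hom_linear[OF hom]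
  show "uea_lift f (x + y) = uea_lift f x + uea_lift f y" for x y
    by transfer (simp add: rat_linear_add[OF lin])
  show "uea_lift f (c *\<^sub>Q x) = c *\<^sub>Q uea_lift f x" for c x
    by transfer (simp add: rat_linear_scaleQ[OF lin])
  show "uea_lift f 1 = 1" using assms by transfer (simp add: alg_hom_1[OF hom])
  show "uea_lift f (x * y) = uea_lift f x * uea_lift f y" for x y
    by transfer (simp add: alg_hom_mult[OF hom])
qed

lemma uea_lift_gen: "lie_map f \<Longrightarrow> uea_lift f (uea_gen x) = f x"
  by transfer simp

lemma uea_gen_lie_map: "lie_map uea_gen"
  unfolding lie_map_def rat_linear_def
  by (intro conjI allI; transfer; rule same_mod_gen same_mod_gen[THEN equivp_symp[OF equivp_same_mod]];
    auto simp: uea_rels_def)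

lemma uea_induct [case_names one gen add scale]:
  fixes u :: "'l::rat_algebra uea"
  assumes one: "P 1" and gen: "\<And>x u. P u \<Longrightarrow> P (uea_gen x * u)"
    and add: "\<And>u v. P u \<Longrightarrow> P v \<Longrightarrow> P (u + v)" and scale: "\<And>c u. P u \<Longrightarrow> P (c *\<^sub>Q u)"
  shows "P u"
proof -
  have "P (abs_uea p)" for p
  proof -
    have "p \<in> free_on UNIV" by simp
    then show ?thesis
    proof (induction p rule: free_on_induct)
      case one show ?case using assms(1) by (simp add: one_uea.abs_eq)
    next
      case (gen x p)
      from assms(2)[OF gen(2), of x] show ?case by (simp add: times_uea.abs_eq uea_gen.abs_eq)
    next
      case (add p q)
      from assms(3)[OF this] show ?case by (simp add: plus_uea.abs_eq)
    next
      case (scale c p)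
      from assms(4)[OF this, of c] show ?case by (simp add: scaleQ_uea.abs_eq)
    qed
  qed
  then show ?thesis by (metis Quotient3_abs_rep[OF Quotient3_uea])
qed

subsection \<open>Tensor powers\<close>

lemma prod_list_eq_1: "(\<And>x. x \<in> set xs \<Longrightarrow> x = 1) \<Longrightarrow> prod_list xs = (1::'a::monoid_mult)"
  by (induction xs) auto

lemma factor_simps [simp]:
  "factor 0 i = 1" "factor (f + g) i = factor f i * factor g i"
  "factor (family_upd f i x) j = (if j = i then x else factor f j)"
  by (simp_all add: zero_family.rep_eq plus_family.rep_eq family_upd.rep_eq)

lemma family_eqI: "(\<And>i. factor f i = factor g i) \<Longrightarrow> f = g"
  by (metis ext factor_inject)

definition fam_bound :: "(nat, 'a::monoid_mult) family \<Rightarrow> nat" where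
  "fam_bound f = (LEAST N. \<forall>i\<ge>N. factor f i = 1)"

lemma ex_fam_bound: "\<exists>N. \<forall>i\<ge>N. factor (f :: (nat, 'a::monoid_mult) family) i = 1"
proof -
  have "finite {i. factor f i \<noteq> 1}" using factor[of f] by simp
  then obtain N where "\<forall>i\<in>{i. factor f i \<noteq> 1}. i < N" using finite_nat_set_iff_bounded by metis
  then show ?thesis by (meson linorder_not_le mem_Collect_eq)
qed

lemma fam_bound: "fam_bound f \<le> i \<Longrightarrow> factor f i = 1"
proof -
  have "\<forall>i\<ge>fam_bound f. factor f i = 1"
    unfolding fam_bound_def by (rule LeastI_ex) (rule ex_fam_bound)
  then show "fam_bound f \<le> i \<Longrightarrow> factor f i = 1" by blast
qed

definition fam_prod :: "(nat \<Rightarrow> 'a::monoid_mult \<Rightarrow> 'b::monoid_mult) \<Rightarrow> (nat, 'a) family \<Rightarrow> 'b" where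
  "fam_prod g f = prod_list (map (\<lambda>i. g i (factor f i)) [0..<fam_bound f])"

lemma fam_prod_eq:
  assumes "\<And>i. g i 1 = 1" "\<And>i. i \<ge> N \<Longrightarrow> factor f i = 1"
  shows "fam_prod g f = prod_list (map (\<lambda>i. g i (factor f i)) [0..<N])"
proof -
  have "fam_bound f \<le> N" unfolding fam_bound_def using assms(2) by (intro Least_le) auto
  then have "[0..<N] = [0..<fam_bound f] @ [fam_bound f..<N]"
    using upt_add_eq_append[of 0 "fam_bound f" "N - fam_bound f"] by simp
  moreover have "prod_list (map (\<lambda>i. g i (factor f i)) [fam_bound f..<N]) = 1"
    by (rule prod_list_eq_1) (auto simp: fam_bound assms(1))
  ultimately show ?thesis by (simp add: fam_prod_def)
qed

definition commuting_homs :: "(nat \<Rightarrow> 'a::rat_algebra \<Rightarrow> 'b::rat_algebra) \<Rightarrow> bool" where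
  "commuting_homs g \<longleftrightarrow> (\<forall>i. alg_hom (g i)) \<and> (\<forall>i j x y. i \<noteq> j \<longrightarrow> g i x * g j y = g j y * g i x)"

lemma fam_prod_alg_hom:
  assumes g: "commuting_homs g" shows "alg_hom (rat_ext (fam_prod g))"
proof (rule rat_ext_alg_hom)
  have hom: "alg_hom (g i)" for i using g by (simp add: commuting_homs_def)
  show "fam_prod g 0 = 1" by (subst fam_prod_eq[of _ 0]) (simp_all add: alg_hom_1[OF hom])
  fix a b :: "(nat, 'a) family"
  let ?N = "max (fam_bound a) (fam_bound b)"
  show "fam_prod g (a + b) = fam_prod g a * fam_prod g b"
    by (subst (1 2 3) fam_prod_eq[of _ ?N])
      (use g in \<open>simp_all add: alg_hom_1[OF hom] alg_hom_mult[OF hom] fam_bound prod_list_mult_commute commuting_homs_def\<close>)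
qed

text \<open>Isolating the factor at i exhibits \<open>fam_prod g\<close> as multilinear, since a and
  b do not depend on x. The cut is at least \<open>Suc i\<close>, so that slot i exists even beyond
  the support of f.\<close>

lemma fam_prod_upd:
  assumes g: "commuting_homs g"
  shows "\<exists>a b. \<forall>x. fam_prod g (family_upd f i x) = a * g i x * b"
proof -
  have hom: "alg_hom (g i)" for i using g by (simp add: commuting_homs_def)
  let ?N = "max (Suc i) (fam_bound f)"
  have "[0..<?N] = [0..<i] @ [i..<?N]"
    using upt_add_eq_append[of 0 i "?N - i"] by simp
  then have N: "[0..<?N] = [0..<i] @ i # [Suc i..<?N]"
    by (simp add: upt_conv_Cons)
  let ?p = "\<lambda>xs. prod_list (map (\<lambda>j. g j (factor f j)) xs)"
  have "fam_prod g (family_upd f i x) = ?p [0..<i] * g i x * ?p [Suc i..<?N]" for x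
  proof -
    have "map (\<lambda>j. g j (factor (family_upd f i x) j)) [0..<i] = map (\<lambda>j. g j (factor f j)) [0..<i]"
      "map (\<lambda>j. g j (factor (family_upd f i x) j)) [Suc i..<?N] = map (\<lambda>j. g j (factor f j)) [Suc i..<?N]"
      by auto
    moreover have "fam_prod g (family_upd f i x) = prod_list (map (\<lambda>j. g j (factor (family_upd f i x) j)) [0..<?N])"
      by (rule fam_prod_eq) (auto simp: alg_hom_1[OF hom] fam_bound)
    ultimately show ?thesis
      by (simp only: N map_append list.map prod_list.append prod_list.Cons mult.assoc factor_simps simp_thms if_True)
  qed
  then show ?thesis by blast
qed

lift_definition tensor_power_lift ::
    "(nat \<Rightarrow> 'a::rat_algebra \<Rightarrow> 'b::rat_algebra) \<Rightarrow> (nat, 'a) tensor_power \<Rightarrow> 'b"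
  is "\<lambda>g p. if commuting_homs g then rat_ext (fam_prod g) p else 0"
proof -
  fix g :: "nat \<Rightarrow> 'a \<Rightarrow> 'b" and p q :: "(nat, 'a) family \<Rightarrow>\<^sub>0 rat"
  assume pq: "same_mod multilinear_rels p q"
  have "rat_ext (fam_prod g) p = rat_ext (fam_prod g) q" if g: "commuting_homs g"
  proof (rule same_mod_alg_hom[OF pq fam_prod_alg_hom[OF g]])
    note lin = rat_ext_linear[of "fam_prod g"]
    have gl: "rat_linear (g i)" for i using g by (simp add: commuting_homs_def alg_hom_linear)
    fix s :: "(nat, 'a) family \<Rightarrow>\<^sub>0 rat" assume "s \<in> multilinear_rels"
    then show "rat_ext (fam_prod g) s = 0"
      unfolding multilinear_rels_def
    proof (elim UnE CollectE exE conjE)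
      fix f i x y assume s: "s = mon (family_upd f i (x + y)) - (mon (family_upd f i x) + mon (family_upd f i y))"
      obtain a b where "\<And>x. fam_prod g (family_upd f i x) = a * g i x * b" using fam_prod_upd[OF g] by blast
      then show ?thesis
        by (simp add: s rat_linear_diff[OF lin] rat_linear_add[OF lin] rat_ext_single scaleQ_one
            rat_linear_add[OF gl] distrib_left distrib_right)
    next
      fix f i c x assume s: "s = mon (family_upd f i (c *\<^sub>Q x)) - c *\<^sub>Q mon (family_upd f i x)"
      obtain a b where "\<And>x. fam_prod g (family_upd f i x) = a * g i x * b" using fam_prod_upd[OF g] by blast
      then show ?thesis
        by (simp add: s rat_linear_diff[OF lin] rat_linear_scaleQ[OF lin] rat_ext_single scaleQ_one
            rat_linear_scaleQ[OF gl] scaleQ_mult_left scaleQ_mult_right)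
    qed
  qed
  then show "(if commuting_homs g then rat_ext (fam_prod g) p else 0) =
      (if commuting_homs g then rat_ext (fam_prod g) q else 0)" by simp
qed

lemma tensor_power_lift_alg_hom:
  assumes "commuting_homs g" shows "alg_hom (tensor_power_lift g)"
  unfolding alg_hom_def rat_linear_def
proof (intro conjI allI)
  note hom = fam_prod_alg_hom
  note lin = alg_hom_linear[OF hom]
  show "tensor_power_lift g (x + y) = tensor_power_lift g x + tensor_power_lift g y" for x y
    by transfer (simp add: rat_linear_add[OF lin])
  show "tensor_power_lift g (c *\<^sub>Q x) = c *\<^sub>Q tensor_power_lift g x" for c x
    by transfer (simp add: rat_linear_scaleQ[OF lin])
  show "tensor_power_lift g 1 = 1" using assms by transfer (simp add: alg_hom_1[OF hom])
  show "tensor_power_lift g (x * y) = tensor_power_lift g x * tensor_power_lift g y" for x y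
    by transfer (simp add: alg_hom_mult[OF hom])
qed

lemma tensor_power_lift_at:
  assumes "commuting_homs g" shows "tensor_power_lift g (tensor_at i x) = g i x"
  using assms
proof transfer
  fix g :: "nat \<Rightarrow> 'a \<Rightarrow> 'b" and i x assume g: "commuting_homs g"
  have hom: "alg_hom (g i)" for i using g by (simp add: commuting_homs_def)
  have "fam_prod g (family_upd 0 i x) = prod_list (map (\<lambda>j. g j (factor (family_upd 0 i x) j)) [0..<Suc i])"
    by (rule fam_prod_eq) (auto simp: alg_hom_1[OF hom])
  also have "prod_list (map (\<lambda>j. g j (factor (family_upd 0 i x) j)) [0..<i]) = 1"
    by (rule prod_list_eq_1) (auto simp: alg_hom_1[OF hom])
  then have "prod_list (map (\<lambda>j. g j (factor (family_upd 0 i x) j)) [0..<Suc i]) = g i x"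
    by simp
  finally show "(if commuting_homs g then rat_ext (fam_prod g) (mon (family_upd 0 i x)) else 0) = g i x"
    using g by (simp add: rat_ext_single scaleQ_one)
qed

lemma tensor_at_alg_hom: "alg_hom (tensor_at i :: 'b::rat_algebra \<Rightarrow> ('i, 'b) tensor_power)"
  unfolding alg_hom_def rat_linear_def
proof (intro conjI allI)
  show "tensor_at i (x + y) = tensor_at i x + tensor_at i y" for x y :: 'b
    by transfer (rule same_mod_gen, unfold multilinear_rels_def, blast)
  show "tensor_at i (c *\<^sub>Q x) = c *\<^sub>Q tensor_at i x" for c and x :: 'b
    by transfer (rule same_mod_gen, unfold multilinear_rels_def, blast)
  have "family_upd 0 i (1::'b) = 0" by (rule family_eqI) simp
  then show "tensor_at i (1::'b) = 1" by (simp add: tensor_at.abs_eq one_tensor_power.abs_eq)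
  have "family_upd 0 i (x * y) = family_upd 0 i x + family_upd 0 i y" for x y :: 'b by (rule family_eqI) simp
  then show "tensor_at i (x * y) = tensor_at i x * tensor_at i y" for x y :: 'b
    by (simp add: tensor_at.abs_eq times_tensor_power.abs_eq mult_single)
qed

lemma tensor_at_commute:
  fixes x y :: "'b::rat_algebra"
  assumes "i \<noteq> j" shows "tensor_at i x * tensor_at j y = tensor_at j y * tensor_at i x"
proof -
  have "family_upd 0 i x + family_upd 0 j y = family_upd 0 j y + family_upd 0 i x"
    by (rule family_eqI) (use assms in auto)
  then show ?thesis by (simp add: tensor_at.abs_eq times_tensor_power.abs_eq mult_single)
qed

lemma tensor_power_induct [case_names one at add scale]:
  fixes t :: "('i, 'b::rat_algebra) tensor_power"
  assumes one: "P 1" and at: "\<And>i x t. P t \<Longrightarrow> P (tensor_at i x * t)"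
    and add: "\<And>s t. P s \<Longrightarrow> P t \<Longrightarrow> P (s + t)" and scale: "\<And>c t. P t \<Longrightarrow> P (c *\<^sub>Q t)"
  shows "P t"
proof -
  \<comment> \<open>Peeling off one nontrivial factor shrinks the support of the family, so a pure
    tensor is a finite product of elements \<open>tensor_at i x\<close>.\<close>
  have fam: "P (abs_tensor_power (mon f))" for f
  proof (induction "card {i. factor f i \<noteq> 1}" arbitrary: f rule: less_induct)
    case less
    show ?case
    proof (cases "f = 0")
      case True then show ?thesis using one by (simp add: one_tensor_power.abs_eq)
    next
      case False
      then obtain i where i: "factor f i \<noteq> 1" by (metis factor_simps(1) family_eqI)
      have f: "f = family_upd 0 i (factor f i) + family_upd f i 1" by (rule family_eqI) simp
      have "{j. factor (family_upd f i 1) j \<noteq> 1} \<subset> {j. factor f j \<noteq> 1}" using i by auto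
      then have "card {j. factor (family_upd f i 1) j \<noteq> 1} < card {j. factor f j \<noteq> 1}"
        using factor[of f] by (intro psubset_card_mono) auto
      from less[OF this] have "P (tensor_at i (factor f i) * abs_tensor_power (mon (family_upd f i 1)))" by (rule at)
      also have "tensor_at i (factor f i) * abs_tensor_power (mon (family_upd f i 1)) = abs_tensor_power (mon f)"
        unfolding tensor_at.abs_eq times_tensor_power.abs_eq mult_single f[symmetric] by simp
      finally show ?thesis .
    qed
  qed
  have "P (abs_tensor_power p)" for p
  proof -
    have "P (abs_tensor_power (\<Sum>k\<in>A. Poly_Mapping.single k (Poly_Mapping.lookup p k)))" if "finite A" for A
      using that
    proof (induction A)
      case empty
      show ?case using scale[OF one, of 0] by (simp add: zero_tensor_power.abs_eq[symmetric])
    next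
      case (insert k A)
      have sc: "abs_tensor_power (Poly_Mapping.single k v) = v *\<^sub>Q abs_tensor_power (mon k)" for v
        by (simp add: scaleQ_tensor_power.abs_eq scaleQ_single scaleQ_rat_def)
      then have "P (abs_tensor_power (Poly_Mapping.single k (Poly_Mapping.lookup p k)))"
        by (subst sc) (rule scale[OF fam])
      from add[OF this insert(3)] show ?case
        unfolding sum.insert[OF insert(1,2)] plus_tensor_power.abs_eq .
    qed
    from this[of "Poly_Mapping.keys p"] show ?thesis by (simp add: poly_mapping_sum_single[symmetric])
  qed
  then show ?thesis by (metis Quotient3_abs_rep[OF Quotient3_tensor_power])
qed

subsection \<open>The algebra \<open>\<G>\<^sub>\<infinity>\<^sup>\<rat>(R)\<close>\<close>

lemma T_map_lie_map: "lie_map (T_map l)"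
  unfolding T_map_def by (rule lie_map_comp[OF alg_hom_lie_map[OF tensor_at_alg_hom] uea_gen_lie_map])

lemmas T_map_linear = lie_map_linear[OF T_map_lie_map]

lemma T_map_commute: "1 \<le> k \<Longrightarrow> 1 \<le> l \<Longrightarrow> k \<noteq> l \<Longrightarrow> T_map k x * T_map l y = T_map l y * T_map k x"
  unfolding T_map_def by (rule tensor_at_commute) auto

abbreviation T_one :: "nat \<Rightarrow> 'r::{ring,monoid_mult} \<Rightarrow> 'r ginf" where
  "T_one l U \<equiv> T_map l (tensor_one U)"

text \<open>The universal properties of the three constructions combined. For k = l the bracket
  condition says that \<open>\<tau> k\<close> is a Lie map, for different k and l that the images
  commute. Indices are shifted since copy l sits in slot l - 1.\<close>

lemma ginf_lift:
  fixes \<tau> :: "nat \<Rightarrow> 'r::{ring,monoid_mult} \<Rightarrow> 'a::rat_algebra"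
  assumes add: "\<And>l x y. l \<ge> 1 \<Longrightarrow> \<tau> l (x + y) = \<tau> l x + \<tau> l y"
    and comm: "\<And>k l x y. k \<ge> 1 \<Longrightarrow> l \<ge> 1 \<Longrightarrow>
      \<tau> k x * \<tau> l y - \<tau> l y * \<tau> k x = (if k = l then \<tau> k (x * y) - \<tau> k (y * x) else 0)"
  obtains h :: "'r ginf \<Rightarrow> 'a" where "alg_hom h" "\<And>l x. l \<ge> 1 \<Longrightarrow> h (T_one l x) = \<tau> l x"
proof -
  define f where "f i = rat_tensor_lift (\<tau> (Suc i))" for i
  have add': "\<tau> (Suc i) (x + y) = \<tau> (Suc i) x + \<tau> (Suc i) y" for i x y by (rule add) simp
  have lin: "rat_linear (f i)" for i unfolding f_def by (rule rat_tensor_lift_linear[OF add'])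
  have one: "f i (tensor_one x) = \<tau> (Suc i) x" for i x unfolding f_def by (rule rat_tensor_lift_one[OF add'])
  \<comment> \<open>The bracket is given on R only; both sides are bilinear in r and s, hence it
    extends to \<open>\<rat> \<otimes> R\<close>.\<close>
  have br: "f i r * f j s - f j s * f i r = (if i = j then f i (r * s - s * r) else 0)" for i j r s
  proof (induction r rule: rat_tensor_induct)
    case (add r r')
    then show ?case by (auto simp: rat_linear_add[OF lin] rat_linear_diff[OF lin] algebra_simps split: if_splits)
  next
    case (scale c x)
    show ?case
    proof (induction s rule: rat_tensor_induct)
      case (add s s')
      then show ?case by (auto simp: rat_linear_add[OF lin] rat_linear_diff[OF lin] algebra_simps split: if_splits)
    next
      case (scale d y)
      have "f i (c *\<^sub>Q tensor_one x) * f j (d *\<^sub>Q tensor_one y) - f j (d *\<^sub>Q tensor_one y) * f i (c *\<^sub>Q tensor_one x)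
        = (c * d) *\<^sub>Q (\<tau> (Suc i) x * \<tau> (Suc j) y - \<tau> (Suc j) y * \<tau> (Suc i) x)"
        by (simp add: rat_linear_scaleQ[OF lin] one scaleQ_mult_left scaleQ_mult_right scaleQ_scaleQ
            scaleQ_diff_right mult.commute)
      also have "\<tau> (Suc i) x * \<tau> (Suc j) y - \<tau> (Suc j) y * \<tau> (Suc i) x =
          (if i = j then \<tau> (Suc i) (x * y) - \<tau> (Suc i) (y * x) else 0)"
        by (subst comm) auto
      finally show ?case
        by (simp add: rat_linear_scaleQ[OF lin] rat_linear_diff[OF lin] one scaleQ_mult_left scaleQ_mult_right
            scaleQ_scaleQ scaleQ_diff_right mult.commute tensor_one_mult[symmetric])
    qed
  qed
  have lie: "lie_map (f i)" for i
    using br[of i _ i] lin by (auto simp: lie_map_def)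
  define g where "g i = uea_lift (f i)" for i
  have hom: "alg_hom (g i)" for i unfolding g_def by (rule uea_lift_alg_hom[OF lie])
  have gen: "g i (uea_gen r) = f i r" for i r unfolding g_def by (rule uea_lift_gen[OF lie])
  \<comment> \<open>Commutation passes from generators to the enveloping algebras one side at a
    time: first a generator against a whole algebra, then two whole algebras.\<close>
  have comm1: "f i r * g j u = g j u * f i r" if "i \<noteq> j" for i j r u
  proof (induction u rule: uea_induct)
    case (gen s u)
    have rs: "f i r * f j s = f j s * f i r" using br[of i r j s] that by simp
    have "f i r * (f j s * g j u) = f j s * (f i r * g j u)" by (simp only: rs mult.assoc[symmetric])
    then show ?case by (simp add: alg_hom_mult[OF hom] \<open>\<And>i r. g i (uea_gen r) = f i r\<close> gen mult.assoc)
  qed (simp_all add: alg_hom_1[OF hom] rat_linear_add[OF alg_hom_linear[OF hom]] distrib_left distrib_right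
      rat_linear_scaleQ[OF alg_hom_linear[OF hom]] scaleQ_mult_left scaleQ_mult_right)
  have "g i t * g j u = g j u * g i t" if "i \<noteq> j" for i j t u
  proof (induction t rule: uea_induct)
    case (gen s t)
    have rs: "f i s * g j u = g j u * f i s" using comm1[OF that] .
    have "f i s * g i t * g j u = g j u * (f i s * g i t)" by (metis gen mult.assoc rs)
    then show ?case by (simp add: alg_hom_mult[OF hom] \<open>\<And>i r. g i (uea_gen r) = f i r\<close>)
  qed (simp_all add: alg_hom_1[OF hom] rat_linear_add[OF alg_hom_linear[OF hom]] distrib_left distrib_right
      rat_linear_scaleQ[OF alg_hom_linear[OF hom]] scaleQ_mult_left scaleQ_mult_right)
  then have ch: "commuting_homs g" by (simp add: commuting_homs_def hom)
  show ?thesis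
  proof
    show "alg_hom (tensor_power_lift g)" by (rule tensor_power_lift_alg_hom[OF ch])
    show "tensor_power_lift g (T_one l x) = \<tau> l x" if "l \<ge> 1" for l x
      using that by (simp add: T_map_def tensor_power_lift_at[OF ch] gen one)
  qed
qed

lemma ginf_generated:
  fixes A :: "'r::{ring,monoid_mult} ginf set"
  assumes one: "1 \<in> A" and T: "\<And>l U. l \<ge> 1 \<Longrightarrow> T_one l U \<in> A"
    and add: "\<And>x y. x \<in> A \<Longrightarrow> y \<in> A \<Longrightarrow> x + y \<in> A" and scale: "\<And>c x. x \<in> A \<Longrightarrow> c *\<^sub>Q x \<in> A"
    and mult: "\<And>x y. x \<in> A \<Longrightarrow> y \<in> A \<Longrightarrow> x * y \<in> A"
  shows "A = UNIV"
proof -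
  have Tr: "T_map l r \<in> A" if "l \<ge> 1" for l r
  proof (induction r rule: rat_tensor_induct)
    case (add r s) then show ?case using assms(3) by (simp add: rat_linear_add[OF T_map_linear])
  next
    case (scale c x) then show ?case using assms(4) T[OF that] by (simp add: rat_linear_scaleQ[OF T_map_linear])
  qed
  have at: "tensor_at i u \<in> A" for i u
  proof (induction u rule: uea_induct)
    case (gen r u)
    have "tensor_at i (uea_gen r) \<in> A" using Tr[of "Suc i" r] by (simp add: T_map_def)
    then show ?case using gen mult by (simp add: alg_hom_mult[OF tensor_at_alg_hom])
  qed (use one assms(3,4) in \<open>simp_all add: alg_hom_1[OF tensor_at_alg_hom]
      rat_linear_add[OF alg_hom_linear[OF tensor_at_alg_hom]] rat_linear_scaleQ[OF alg_hom_linear[OF tensor_at_alg_hom]]\<close>)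
  have "t \<in> A" for t
    by (induction t rule: tensor_power_induct) (simp_all add: one mult at add scale)
  then show ?thesis by auto
qed

section \<open>Moebius inversion and the series \<open>E\<^sub>W\<close>\<close>

text \<open>The substitution d = k * r, in the form used by both directions of Moebius
  inversion.\<close>

lemma sum_divisors_reindex:
  fixes F :: "nat \<Rightarrow> nat \<Rightarrow> 'a::comm_monoid_add"
  assumes "n \<ge> 1"
  shows "(\<Sum>k | k dvd n. \<Sum>r | r dvd n div k. F k r) = (\<Sum>d | d dvd n. \<Sum>r | r dvd d. F (d div r) r)"
proof -
  have fin: "finite {k. k dvd d}" if "d \<ge> 1" for d :: nat using that by simp
  have pos: "d \<ge> 1" if "d dvd n" for d using assms that dvd_pos_nat by fastforce
  have f1: "finite {d. d dvd n}" and f2: "\<forall>d\<in>{d. d dvd n}. finite {r. r dvd d}"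
    using fin[OF assms] fin pos by blast+
  have q: "n div k \<ge> 1" if "k dvd n" for k using assms that by (auto simp: Suc_le_eq elim!: dvdE)
  have "(\<Sum>k | k dvd n. \<Sum>r | r dvd n div k. F k r) =
      (\<Sum>(k, r)\<in>(SIGMA k:{k. k dvd n}. {r. r dvd n div k}). F k r)"
    using fin q assms by (intro sum.Sigma) auto
  also have "\<dots> = (\<Sum>(d, r)\<in>(SIGMA d:{d. d dvd n}. {r. r dvd d}). F (d div r) r)"
    by (rule sum.reindex_bij_witness[of _ "\<lambda>(d, r). (d div r, r)" "\<lambda>(k, r). (k * r, r)"])
      (use assms in \<open>auto simp: dvd_div_iff_mult mult.commute elim!: dvdE\<close>)
  also have "\<dots> = (\<Sum>d | d dvd n. \<Sum>r | r dvd d. F (d div r) r)"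
    by (rule sum.Sigma[symmetric, OF f1 f2])
  finally show ?thesis .
qed

lemma sum_divisors_flip:
  fixes F :: "nat \<Rightarrow> 'a::comm_monoid_add"
  assumes "n \<ge> 1"
  shows "(\<Sum>k | k dvd n. F k) = (\<Sum>k | k dvd n. F (n div k))"
  by (rule sum.reindex_bij_witness[of _ "\<lambda>k. n div k" "\<lambda>k. n div k"])
    (use assms in \<open>auto elim!: dvdE\<close>)

lemma moebius_mu_1 [simp]: "moebius_mu (Suc 0) = 1"
  by (simp add: moebius_mu_def)

lemma moebius_mu_prime_mult:
  assumes p: "prime p" and d: "\<not> p dvd d" "d \<noteq> 0"
  shows "moebius_mu (p * d) = - moebius_mu d"
proof -
  have cop: "coprime p d" using p d by (simp add: prime_imp_coprime)
  have "squarefree (p * d) \<longleftrightarrow> squarefree d"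
    using squarefree_mult_coprime[OF cop squarefree_prime[OF p]] squarefree_multD by blast
  moreover have "prime_factors (p * d) = insert p (prime_factors d)"
    using p d by (simp add: prime_factors_product prime_prime_factors)
  moreover have "p \<notin> prime_factors d" using d by auto
  ultimately show ?thesis by (simp add: moebius_mu_def)
qed

text \<open>For a prime p dividing n, divisors divisible by p^2 contribute 0, and those divisible by
  p exactly once are p times the divisors prime to p, with opposite sign.\<close>

lemma sum_moebius_mu:
  assumes "n \<ge> 1"
  shows "(\<Sum>d | d dvd n. moebius_mu d) = (if n = 1 then 1 else 0)"
proof (cases "n = 1")
  case False
  then obtain p where p: "prime p" "p dvd n" using prime_factor_nat by blast
  let ?A = "{d. d dvd n \<and> \<not> p dvd d}" and ?B = "{d. d dvd n \<and> p dvd d}" and ?C = "{d. d dvd n \<and> p dvd d \<and> \<not> p\<^sup>2 dvd d}"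
  have fin: "finite {d. d dvd n}" using assms by simp
  have finA: "finite ?A" and finB: "finite ?B" by (rule finite_subset[OF _ fin]; auto)+
  have AB: "?A \<union> ?B = {d. d dvd n}" "?A \<inter> ?B = {}" by auto
  have "(\<Sum>d | d dvd n. moebius_mu d) = (\<Sum>d\<in>?A. moebius_mu d) + (\<Sum>d\<in>?B. moebius_mu d)"
    using sum.union_disjoint[OF finA finB, of moebius_mu] by (simp add: AB)
  also have "(\<Sum>d\<in>?B. moebius_mu d) = (\<Sum>d\<in>?C. moebius_mu d)"
  proof (rule sum.mono_neutral_right)
    show "\<forall>i\<in>?B - ?C. moebius_mu i = 0"
    proof
      fix i assume "i \<in> ?B - ?C"
      then have "p\<^sup>2 dvd i" by blast
      then have "\<not> squarefree i" using squarefreeD[of i p] p(1) not_prime_unit by blast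
      then show "moebius_mu i = 0" by (simp add: moebius_mu_def)
    qed
  qed (use finB in auto)
  also have "\<dots> = (\<Sum>d\<in>?A. moebius_mu (p * d))"
  proof (rule sum.reindex_bij_witness[of _ "\<lambda>d. p * d" "\<lambda>d. d div p"])
    have p0: "p \<noteq> 0" using p(1) by auto
    fix d assume d: "d \<in> ?A"
    then have "p * d dvd n" using p by (intro divides_mult) (auto simp: prime_imp_coprime)
    then show "p * d \<in> ?C" using d p0 by (simp add: power2_eq_square)
    show "p * d div p = d" using p0 by simp
  next
    have p0: "p \<noteq> 0" using p(1) by auto
    fix d assume d: "d \<in> ?C"
    then obtain e where e: "d = p * e" by blast
    then show "p * (d div p) = d" "moebius_mu (p * (d div p)) = moebius_mu d" using p0 by simp_all
    show "d div p \<in> ?A" using d p0 dvd_mult_right[of p e n] by (simp add: e power2_eq_square)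
  qed
  also have "\<dots> = (\<Sum>d\<in>?A. - moebius_mu d)"
    using assms by (intro sum.cong refl moebius_mu_prime_mult p(1)) auto
  finally show ?thesis using False by (simp add: sum_negf)
qed simp

text \<open>This is the logarithm of E_W(-t), not of E_W(t): after the sign change the arguments 1 -
  (-t)^l W in the product defining e_r become 1 - t^l W and carry no signs.\<close>

definition log_E :: "(nat \<Rightarrow> 'r::monoid_mult \<Rightarrow> 'a::rat_algebra) \<Rightarrow> 'r \<Rightarrow> (nat, 'a) series" where
  "log_E \<tau> W = Series (\<lambda>n. if n = 0 then 0 else - (\<Sum>k | k dvd n. (1 / of_nat k) *\<^sub>Q \<tau> (n div k) (W ^ k)))"

definition flip_sign :: "(nat, 'a::rat_algebra) series \<Rightarrow> (nat, 'a) series" where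
  "flip_sign = subst_monom (-1) 1"

text \<open>The family with \<open>E\<^sub>W(-t) = exp (- \<Sum>\<^sub>l\<^sub>,\<^sub>k t\<^sup>l\<^sup>k \<tau>\<^sub>l(W\<^sup>k) / k)\<close>.\<close>

definition E_of :: "(nat \<Rightarrow> 'r::monoid_mult \<Rightarrow> 'a::rat_algebra) \<Rightarrow> 'r \<Rightarrow> (nat, 'a) series" where
  "E_of \<tau> W = flip_sign (exp_series (log_E \<tau> W))"

lemma coeff_flip_sign [simp]: "coeff (flip_sign x) n = (-1) ^ n *\<^sub>Q coeff x n"
  using coeff_subst_monom(1)[of "1::nat" "-1" x n] by (simp add: flip_sign_def)

lemma flip_sign_flip_sign [simp]: "flip_sign (flip_sign x) = x"
  by (rule series_eqI) (simp add: scaleQ_scaleQ power_mult_distrib[symmetric] scaleQ_one)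

lemma coeff_log_E_0 [simp]: "coeff (log_E \<tau> W) 0 = 0"
  by (simp add: log_E_def)

lemma coeff_E_of_0 [simp]: "coeff (E_of \<tau> W) 0 = 1"
  by (simp add: E_of_def coeff_exp_series_0 scaleQ_one)

lemma log_flip_E_of: "log_series (flip_sign (E_of \<tau> W)) = log_E \<tau> W"
  by (simp add: E_of_def log_exp_series)

lemma subst_monom_flip_sign:
  assumes "(k::'m::graded_splits) \<noteq> 0"
  shows "subst_monom (-1) k x = subst_monom 1 k (flip_sign x)"
proof (rule series_eqI)
  fix m
  show "coeff (subst_monom (-1) k x) m = coeff (subst_monom 1 k (flip_sign x)) m"
    using assms by (cases "\<exists>n. m = nmul n k") (auto simp: coeff_subst_monom scaleQ_one)
qed

lemma subst_monom_log_series: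
  assumes "(k::'m::graded_splits) \<noteq> 0" "coeff x 0 = 1"
  shows "log_series (subst_monom c k x) = subst_monom c k (log_series x)"
  using assms by (simp add: subst_monom_eq subst_log_series[OF monomial_map_power[OF assms(1)]])

text \<open>Since E(-t^r) is the series E(-t) with t replaced by t^r, only r dividing n contribute,
  each through the coefficient at n div r of the flipped logarithm.\<close>

lemma coeff_moebius_log:
  assumes E0: "\<And>W. coeff (E W) 0 = 1"
  shows "coeff (moebius_log E W) n = (if n = 0 then 0 else
    (\<Sum>r | r dvd n. (of_int (moebius_mu r) / of_nat r) *\<^sub>Q coeff (log_series (flip_sign (E (W ^ r)))) (n div r)))"
proof -
  let ?l = "\<lambda>r. log_series (flip_sign (E (W ^ r)))"
  let ?f = "\<lambda>r. if r \<ge> 1 then (of_int (moebius_mu r) / of_nat r) *\<^sub>Q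
      log_series (subst_monom (-1) r (E (W ^ r))) else 0"
  have flip0: "coeff (flip_sign (E V)) 0 = 1" for V by (simp add: E0 scaleQ_one)
  have l0: "coeff (?l r) 0 = 0" for r by (rule coeff_log_series_0[OF flip0])
  have f: "coeff (?f r) n = (if r \<ge> 1 \<and> r dvd n then
      (of_int (moebius_mu r) / of_nat r) *\<^sub>Q coeff (?l r) (n div r) else 0)" for r
  proof (cases "r \<ge> 1")
    case True
    then have r: "r \<noteq> 0" by simp
    have e: "log_series (subst_monom (-1) r (E (W ^ r))) = subst_monom 1 r (?l r)"
      using r by (simp add: subst_monom_flip_sign subst_monom_log_series E0 scaleQ_one)
    show ?thesis
    proof (cases "r dvd n")
      case True
      then obtain k where "n = k * r" by (metis dvdE mult.commute)
      then show ?thesis using r coeff_subst_monom(1)[of r 1 "?l r" k] by (simp add: e scaleQ_one)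
    next
      case False
      then have "\<nexists>k. n = nmul k r" by auto
      then show ?thesis using r False coeff_subst_monom(2)[of r n 1 "?l r"] by (simp add: e)
    qed
  qed simp
  have c: "coeff (moebius_log E W) n = (\<Sum>r. coeff (?f r) n)"
    by (simp add: moebius_log_def sum_series_def)
  show ?thesis
  proof (cases "n = 0")
    case True
    then have "coeff (?f r) n = 0" for r using l0[of r] unfolding f by simp
    then show ?thesis using True unfolding c by simp
  next
    case False
    then have fin: "finite {r. r dvd n}" by simp
    have "(\<Sum>r. coeff (?f r) n) = (\<Sum>r | r dvd n. coeff (?f r) n)"
      by (rule Sum_any.expand_superset[OF fin]) (unfold f, auto split: if_splits)
    also have "\<dots> = (\<Sum>r | r dvd n. (of_int (moebius_mu r) / of_nat r) *\<^sub>Q coeff (?l r) (n div r))"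
      using False by (intro sum.cong refl) (unfold f, auto simp: Suc_le_eq intro: dvd_pos_nat)
    finally show ?thesis using False c by simp
  qed
qed

lemma sum_moebius_scaleQ:
  assumes "d \<ge> 1"
  shows "(\<Sum>r | r dvd d. (of_int (moebius_mu r) / of_nat d) *\<^sub>Q x) = (if d = 1 then (x::'a::rat_algebra) else 0)"
proof -
  have "(\<Sum>r | r dvd d. (of_int (moebius_mu r) / of_nat d) *\<^sub>Q x) =
      (of_int (\<Sum>r | r dvd d. moebius_mu r) / of_nat d) *\<^sub>Q x"
    by (simp add: scaleQ_sum_left[symmetric] sum_divide_distrib)
  then show ?thesis using assms by (simp add: sum_moebius_mu scaleQ_one)
qed

lemma sum_divisors_single:
  assumes "n \<ge> 1"
  shows "(\<Sum>d | d dvd n. if d = 1 then f d else 0) = (f (1::nat)::'a::comm_monoid_add)"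
  using assms by (subst sum.delta) auto

text \<open>The two sums over divisors combine into one over d = r * k, in which the term at d
  carries the sum of \<mu> over the divisors of d; only d = 1 survives. In these coordinates (2) is
  the additivity of every \<open>\<tau> n\<close>.\<close>

lemma moebius_log_E_of:
  "coeff (moebius_log (E_of \<tau>) W) n = (if n = 0 then 0 else - \<tau> n W)"
proof (cases "n = 0")
  case True then show ?thesis by (simp add: coeff_moebius_log)
next
  case False
  then have n: "n \<ge> 1" by simp
  have pos: "d \<ge> 1" if "d \<in> {d. d dvd n}" for d using that n dvd_pos_nat by fastforce
  have "coeff (moebius_log (E_of \<tau>) W) n =
    (\<Sum>r | r dvd n. (of_int (moebius_mu r) / of_nat r) *\<^sub>Q
      - (\<Sum>k | k dvd n div r. (1 / of_nat k) *\<^sub>Q \<tau> (n div r div k) ((W ^ r) ^ k)))"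
    using False by (subst coeff_moebius_log)
      (auto simp: log_flip_E_of log_E_def intro!: sum.cong elim!: dvdE)
  also have "\<dots> = - (\<Sum>r | r dvd n. \<Sum>k | k dvd n div r.
      (of_int (moebius_mu r) / of_nat (r * k)) *\<^sub>Q \<tau> (n div (r * k)) (W ^ (r * k)))"
    by (simp add: scaleQ_minus_right scaleQ_sum scaleQ_scaleQ sum_negf div_mult2_eq power_mult)
  also have "(\<Sum>r | r dvd n. \<Sum>k | k dvd n div r.
      (of_int (moebius_mu r) / of_nat (r * k)) *\<^sub>Q \<tau> (n div (r * k)) (W ^ (r * k))) =
    (\<Sum>d | d dvd n. \<Sum>k | k dvd d.
      (of_int (moebius_mu (d div k)) / of_nat d) *\<^sub>Q \<tau> (n div d) (W ^ d))"
    unfolding sum_divisors_reindex[OF n] by (intro sum.cong refl) auto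
  also have "\<dots> = (\<Sum>d | d dvd n. \<Sum>k | k dvd d. (of_int (moebius_mu k) / of_nat d) *\<^sub>Q \<tau> (n div d) (W ^ d))"
  proof (rule sum.cong[OF refl])
    fix d assume "d \<in> {d. d dvd n}"
    then have "d \<ge> 1" using n dvd_pos_nat by fastforce
    then show "(\<Sum>k | k dvd d. (of_int (moebius_mu (d div k)) / of_nat d) *\<^sub>Q \<tau> (n div d) (W ^ d)) =
        (\<Sum>k | k dvd d. (of_int (moebius_mu k) / of_nat d) *\<^sub>Q \<tau> (n div d) (W ^ d))"
      by (rule sum_divisors_flip[symmetric])
  qed
  also have "\<dots> = (\<Sum>d | d dvd n. if d = 1 then \<tau> (n div d) (W ^ d) else 0)"
    by (intro sum.cong refl sum_moebius_scaleQ pos)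
  also have "\<dots> = \<tau> n W" by (subst sum_divisors_single[OF n]) simp
  finally show ?thesis using False by simp
qed

text \<open>The inverse of the preceding step: every family with constant terms 1 arises from
  exactly one \<tau> on positive indices, before any relation is imposed.\<close>

lemma E_of_moebius_log:
  assumes E0: "\<And>W. coeff (E W) 0 = 1"
  shows "E_of (\<lambda>n W. - coeff (moebius_log E W) n) W = E W"
proof -
  let ?l = "\<lambda>W. log_series (flip_sign (E W))"
  have flip0: "coeff (flip_sign (E V)) 0 = 1" for V by (simp add: E0 scaleQ_one)
  have "log_E (\<lambda>n W. - coeff (moebius_log E W) n) W = ?l W"
  proof (rule series_eqI)
    fix n
    show "coeff (log_E (\<lambda>n W. - coeff (moebius_log E W) n) W) n = coeff (?l W) n"
    proof (cases "n = 0")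
      case True then show ?thesis by (simp only: coeff_log_E_0 coeff_log_series_0[OF flip0])
    next
      case False
      then have n: "n \<ge> 1" by simp
      have pos: "d \<ge> 1" if "d \<in> {d. d dvd n}" for d using that n dvd_pos_nat by fastforce
      have "coeff (log_E (\<lambda>n W. - coeff (moebius_log E W) n) W) n =
        (\<Sum>k | k dvd n. (1 / of_nat k) *\<^sub>Q coeff (moebius_log E (W ^ k)) (n div k))"
        using False by (simp add: log_E_def scaleQ_minus_right sum_negf)
      also have "\<dots> = (\<Sum>k | k dvd n. \<Sum>r | r dvd n div k.
          (of_int (moebius_mu r) / of_nat (k * r)) *\<^sub>Q coeff (?l (W ^ (k * r))) (n div (k * r)))"
        using False by (intro sum.cong refl)
          (auto simp: coeff_moebius_log[of E, OF E0] scaleQ_sum scaleQ_scaleQ div_mult2_eq power_mult elim!: dvdE)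
      also have "\<dots> = (\<Sum>d | d dvd n. \<Sum>r | r dvd d.
          (of_int (moebius_mu r) / of_nat d) *\<^sub>Q coeff (?l (W ^ d)) (n div d))"
        unfolding sum_divisors_reindex[OF n] by (intro sum.cong refl) auto
      also have "\<dots> = (\<Sum>d | d dvd n. if d = 1 then coeff (?l (W ^ d)) (n div d) else 0)"
        by (intro sum.cong refl sum_moebius_scaleQ pos)
      also have "\<dots> = coeff (?l W) n" by (subst sum_divisors_single[OF n]) simp
      finally show ?thesis .
    qed
  qed
  then show ?thesis by (simp add: E_of_def exp_log_series[OF flip0])
qed

section \<open>Existence and uniqueness of \<open>E_free\<close>\<close>

text \<open>From the second power on there is an additional factor without constant term, which
  pushes a discrepancy between x and y above the degree of m; only the linear term can see
  it.\<close>

lemma exp_series_cong_coeff: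
  fixes x y :: "('m::graded_splits, 'a::rat_algebra) series"
  assumes "coeff x 0 = 0" "coeff y 0 = 0" "ord_ge (mdeg m) (x - y)"
  shows "coeff (exp_series x) m - coeff x m = coeff (exp_series y) m - coeff y m"
proof -
  have "ord_ge (Suc (mdeg m)) (x ^ Suc (Suc k) - y ^ Suc (Suc k))" for k
  proof -
    have "ord_ge (mdeg m + 1) ((x - y) * x ^ Suc k + y * (x ^ Suc k - y ^ Suc k))"
      using ord_ge_mult[OF assms(3), of 1 "x ^ Suc k"] ord_ge_cong_power[OF assms(3), of "Suc k"] assms
      by (intro ord_ge_add) (auto simp: ord_ge_Suc_0 intro!: mult_coeff_ord_ge_1)
    moreover have "(x - y) * x ^ Suc k + y * (x ^ Suc k - y ^ Suc k) = x ^ Suc (Suc k) - y ^ Suc (Suc k)"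
      by (simp add: algebra_simps)
    ultimately show ?thesis by simp
  qed
  then have hi: "coeff (x ^ Suc (Suc k)) m = coeff (y ^ Suc (Suc k)) m" for k
    by (metis coeff_diff eq_iff_diff_eq_0 lessI ord_ge_def)
  have e: "coeff (exp_series z) m - coeff z m = coeff (1::('m, 'a) series) m +
      (\<Sum>n\<le>mdeg m. (1 / fact (Suc (Suc n))) *\<^sub>Q coeff (z ^ Suc (Suc n)) m)"
    if "coeff z 0 = 0" for z :: "('m, 'a) series"
  proof -
    have "coeff (exp_series z) m = (\<Sum>n\<le>Suc (Suc (mdeg m)). (1 / fact n) *\<^sub>Q coeff (z ^ n) m)"
      unfolding exp_series_def by (rule coeff_eval_series[OF that]) simp
    then show ?thesis
      by (simp add: sum.atMost_Suc_shift scaleQ_one del: sum.atMost_Suc power_Suc fact_Suc)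
  qed
  show ?thesis unfolding e[OF assms(1)] e[OF assms(2)] hi ..
qed

text \<open>The coefficients of \<open>E\<^sub>W\<close> are unitriangular in the \<open>\<tau>\<^sub>n\<close>, up to sign.\<close>

lemma coeff_E_of_triangular:
  assumes n: "n \<ge> 1" and eq: "\<And>l W. 1 \<le> l \<Longrightarrow> l < n \<Longrightarrow> \<tau> l W = \<tau>' l W"
  shows "coeff (E_of \<tau> W) n + (-1) ^ n *\<^sub>Q \<tau> n W = coeff (E_of \<tau>' W) n + (-1) ^ n *\<^sub>Q \<tau>' n W"
proof -
  let ?x = "log_E \<tau> W" and ?y = "log_E \<tau>' W"
  \<comment> \<open>The term for k uses \<tau> at the index m div k, which is below n unless m = n
    and k = 1.\<close>
  have tail: "(1 / of_nat k) *\<^sub>Q \<tau> (m div k) (W ^ k) = (1 / of_nat k) *\<^sub>Q \<tau>' (m div k) (W ^ k)"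
    if kl: "k dvd m" "m \<noteq> 0" "m < n \<or> m = n \<and> k \<noteq> 1" for k m
  proof -
    obtain l where l: "m = k * l" using kl(1) by blast
    then have "l \<ge> 1" "k \<ge> 1" using kl(2) by (simp_all add: Suc_le_eq)
    moreover have "l < n"
    proof (cases "m < n")
      case True
      then show ?thesis using l \<open>k \<ge> 1\<close> by (metis le_less_trans mult_le_mono1 nat_mult_1)
    next
      case False
      then have "k \<ge> 2" "m = n" using kl \<open>k \<ge> 1\<close> by auto
      then have "2 * l \<le> n" using l mult_le_mono1[of 2 k l] by simp
      then show ?thesis using \<open>l \<ge> 1\<close> by linarith
    qed
    ultimately show ?thesis using l eq[of l "W ^ k"] by simp
  qed
  have "ord_ge n (?x - ?y)"
    unfolding ord_ge_def mdeg_nat_def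
    using tail by (auto simp: log_E_def intro!: sum.cong)
  then have c: "coeff (exp_series ?x) n - coeff ?x n = coeff (exp_series ?y) n - coeff ?y n"
    by (intro exp_series_cong_coeff) (simp_all add: mdeg_nat_def)
  have split: "coeff (log_E \<sigma> W) n = - \<sigma> n W - (\<Sum>k\<in>{k. k dvd n} - {1}. (1 / of_nat k) *\<^sub>Q \<sigma> (n div k) (W ^ k))"
    for \<sigma> :: "nat \<Rightarrow> 'a \<Rightarrow> 'b"
    using n by (simp add: log_E_def sum.remove[of "{k. k dvd n}" 1] scaleQ_one)
  have "(\<Sum>k\<in>{k. k dvd n} - {1}. (1 / of_nat k) *\<^sub>Q \<tau> (n div k) (W ^ k)) =
      (\<Sum>k\<in>{k. k dvd n} - {1}. (1 / of_nat k) *\<^sub>Q \<tau>' (n div k) (W ^ k))"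
    using n tail by (intro sum.cong refl) auto
  then have "coeff (exp_series ?x) n + \<tau> n W = coeff (exp_series ?y) n + \<tau>' n W"
    using c unfolding split by (simp add: algebra_simps)
  then have "(-1) ^ n *\<^sub>Q (coeff (exp_series ?x) n + \<tau> n W) = (-1) ^ n *\<^sub>Q (coeff (exp_series ?y) n + \<tau>' n W)"
    by simp
  then show ?thesis by (simp add: E_of_def scaleQ_add_right)
qed

lemma additive_zscale:
  fixes f :: "'r::ab_group_add \<Rightarrow> 'a::rat_algebra"
  assumes "\<And>x y. f (x + y) = f x + f y"
  shows "f (zscale v x) = of_int v *\<^sub>Q f x"
  using additive_of_int[of "\<lambda>v. f (zscale v x)" v]
  by (simp add: int_module.scale_left_distrib assms)

lemma additive_sum:
  fixes f :: "'r::ab_group_add \<Rightarrow> 'a::rat_algebra"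
  assumes "\<And>x y. f (x + y) = f x + f y"
  shows "f (sum g A) = (\<Sum>i\<in>A. f (g i))"
proof -
  have "f 0 = 0" using assms[of 0 0] by simp
  then show ?thesis by (induction A rule: infinite_finite_induct) (auto simp: assms)
qed

lemma additive_eqI:
  fixes f g :: "'r::ab_group_add \<Rightarrow> 'a::rat_algebra"
  assumes I: "is_int_basis I" and f: "\<And>x y. f (x + y) = f x + f y" and g: "\<And>x y. g (x + y) = g x + g y"
    and eq: "\<And>U. U \<in> I \<Longrightarrow> f U = g U"
  shows "f W = g W"
proof -
  have "W \<in> int_module.span I" using I by (simp add: is_int_basis_def)
  then show ?thesis
  proof (induction W rule: int_module.span_induct_alt)
    case base show ?case using f[of 0 0] g[of 0 0] by simp
  next
    case (step c x y)
    then show ?case by (simp add: f g additive_zscale[OF f] additive_zscale[OF g] eq)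
  qed
qed

text \<open>Relation (2) without reference to a basis; \<open>moebius_additiveI\<close> and
  \<open>moebius_additive_relator\<close> translate between the two forms.\<close>

definition moebius_additive :: "('r::{ring,monoid_mult} \<Rightarrow> (nat, 'a::rat_algebra) series) \<Rightarrow> bool" where
  "moebius_additive E \<longleftrightarrow> (\<forall>U V. moebius_log E (U + V) = moebius_log E U + moebius_log E V)"

lemma moebius_additive_relator:
  assumes E: "moebius_additive E"
  shows "additivity_relator E a = 0"
proof -
  have add: "moebius_log E (U + V) = moebius_log E U + moebius_log E V" for U V
    using E by (simp add: moebius_additive_def)
  show ?thesis
    by (simp add: additivity_relator_def additive_sum[of "moebius_log E", OF add]
        additive_zscale[of "moebius_log E", OF add])
qed

lemma moebius_additiveI:
  fixes I :: "'r::{ring,monoid_mult} set" and E :: "'r \<Rightarrow> (nat, 'a::rat_algebra) series"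
  assumes I: "is_int_basis I" and rel: "\<And>a. a \<in> int_combinations I \<Longrightarrow> additivity_relator E a = 0"
  shows "moebius_additive E"
  unfolding moebius_additive_def
proof (intro allI)
  fix U V :: 'r
  have ind: "\<not> int_module.dependent I" and span: "W \<in> int_module.span I" for W
    using I by (auto simp: is_int_basis_def)
  let ?rep = "int_module.representation I"
  have comb: "?rep W \<in> int_combinations I" for W
    unfolding int_combinations_def
    using int_module.finite_representation[of I W] int_module.representation_ne_zero[of I W] by auto
  have sum: "(\<Sum>U | ?rep W U \<noteq> 0. zscale (?rep W U) U) = W" for W
    by (rule int_module.sum_nonzero_representation_eq[OF ind span])
  have expand: "moebius_log E W = (\<Sum>x\<in>A. of_int (?rep W x) *\<^sub>Q moebius_log E x)"
    if "finite A" "{x. ?rep W x \<noteq> 0} \<subseteq> A" for W A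
  proof -
    have "moebius_log E W = (\<Sum>x | ?rep W x \<noteq> 0. of_int (?rep W x) *\<^sub>Q moebius_log E x)"
      using rel[OF comb[of W]] by (simp add: additivity_relator_def sum)
    also have "\<dots> = (\<Sum>x\<in>A. of_int (?rep W x) *\<^sub>Q moebius_log E x)"
      using that by (intro sum.mono_neutral_left) auto
    finally show ?thesis .
  qed
  let ?A = "{x. ?rep U x \<noteq> 0} \<union> {x. ?rep V x \<noteq> 0}"
  have fin: "finite ?A" by (simp add: int_module.finite_representation)
  have add: "?rep (U + V) x = ?rep U x + ?rep V x" for x
    by (simp add: int_module.representation_add[OF ind span span])
  show "moebius_log E (U + V) = moebius_log E U + moebius_log E V"
    by (subst (1 2 3) expand[OF fin]) (auto simp: add sum.distrib scaleQ_add_left)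
qed

lemma moebius_additive_E_of:
  assumes "\<And>n V W. n \<ge> 1 \<Longrightarrow> \<tau> n (V + W) = \<tau> n V + \<tau> n W"
  shows "moebius_additive (E_of \<tau>)"
  unfolding moebius_additive_def
  by (intro allI series_eqI) (simp add: moebius_log_E_of assms)

text \<open>By induction on n: triangularity reads \<open>\<tau> n\<close> on the basis off the n-th
  coefficients, and additivity extends it to all of R. All later comparisons of families rest on
  this.\<close>

lemma E_family_unique:
  fixes I :: "'r::{ring,monoid_mult} set" and E E' :: "'r \<Rightarrow> (nat, 'a::rat_algebra) series"
  assumes I: "is_int_basis I" and E0: "\<And>W. coeff (E W) 0 = 1" and E0': "\<And>W. coeff (E' W) 0 = 1"
    and eq: "\<And>U r. U \<in> I \<Longrightarrow> r \<ge> 1 \<Longrightarrow> coeff (E U) r = coeff (E' U) r"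
    and add: "moebius_additive E" and add': "moebius_additive E'"
  shows "E = E'"
proof -
  define \<tau> where "\<tau> n W = - coeff (moebius_log E W) n" for n W
  define \<tau>' where "\<tau>' n W = - coeff (moebius_log E' W) n" for n W
  have E: "E_of \<tau> W = E W" and E': "E_of \<tau>' W = E' W" for W
    unfolding \<tau>_def[abs_def] \<tau>'_def[abs_def] by (rule E_of_moebius_log; fact)+
  have "\<tau> n W = \<tau>' n W" if "n \<ge> 1" for n W
    using that
  proof (induction n arbitrary: W rule: less_induct)
    case (less n)
    show ?case
    proof (rule additive_eqI[OF I])
      show "\<tau> n (x + y) = \<tau> n x + \<tau> n y" "\<tau>' n (x + y) = \<tau>' n x + \<tau>' n y" for x y
        using add add' by (simp_all add: \<tau>_def \<tau>'_def moebius_additive_def)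
      fix U assume "U \<in> I"
      have "coeff (E_of \<tau> U) n + (-1) ^ n *\<^sub>Q \<tau> n U = coeff (E_of \<tau>' U) n + (-1) ^ n *\<^sub>Q \<tau>' n U"
        using less by (intro coeff_E_of_triangular) auto
      then have "(-1) ^ n *\<^sub>Q (\<tau> n U - \<tau>' n U) = 0"
        using eq[OF \<open>U \<in> I\<close> less.prems] by (simp add: E E' scaleQ_diff_right)
      then show "\<tau> n U = \<tau>' n U" by (simp add: scaleQ_cancel)
    qed
  qed
  then have "log_E \<tau> W = log_E \<tau>' W" for W
    by (intro series_eqI) (auto simp: log_E_def intro!: sum.cong arg_cong[of _ _ "scaleQ _"] elim!: dvdE)
  then show ?thesis using E E' by (auto simp: E_of_def fun_eq_iff)
qed

text \<open>Solves the triangular relation for \<open>\<tau> n U\<close> so that the n-th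
  coefficient of a basis series becomes the generator, then extends additively; the sign is minus
  (-1)^n. The inner family is cut off to 0 from n on, which makes the recursion terminate and leaves
  no \<tau> term at n in the relation.\<close>

function tau_free :: "'r::{ring,monoid_mult} set \<Rightarrow> nat \<Rightarrow> 'r \<Rightarrow> ('r \<times> nat) free_alg" where
  "tau_free I n W = (\<Sum>U | int_module.representation I W U \<noteq> 0.
     of_int (int_module.representation I W U) *\<^sub>Q (-1) ^ Suc n *\<^sub>Q
       (free_gen (U, n) - coeff (E_of (\<lambda>l V. if l < n then tau_free I l V else 0) U) n))"
  by pat_completeness auto
termination by (relation "measure (\<lambda>(I, n, W). n)") auto

declare tau_free.simps [simp del]

context
  fixes I :: "'r::{ring,monoid_mult} set"
  assumes I: "is_int_basis I"
begin

lemma independent_basis: "\<not> int_module.dependent I" and span_basis: "W \<in> int_module.span I"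
  using I by (auto simp: is_int_basis_def)

lemma tau_free_add: "tau_free I n (V + W) = tau_free I n V + tau_free I n W"
proof -
  let ?rep = "int_module.representation I"
  let ?t = "\<lambda>U. (-1) ^ Suc n *\<^sub>Q
       (free_gen (U, n) - coeff (E_of (\<lambda>l V. if l < n then tau_free I l V else 0) U) n)"
  let ?A = "{x. ?rep V x \<noteq> 0} \<union> {x. ?rep W x \<noteq> 0}"
  have fin: "finite ?A" by (simp add: int_module.finite_representation)
  have expand: "tau_free I n X = (\<Sum>U\<in>?A. of_int (?rep X U) *\<^sub>Q ?t U)"
    if "{x. ?rep X x \<noteq> 0} \<subseteq> ?A" for X
    unfolding tau_free.simps[of I n X] using that fin by (intro sum.mono_neutral_left) auto
  have add: "?rep (V + W) x = ?rep V x + ?rep W x" for x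
    by (simp add: int_module.representation_add[OF independent_basis span_basis span_basis])
  show ?thesis
    by (subst (1 2 3) expand) (auto simp: add sum.distrib scaleQ_add_left)
qed

lemma coeff_E_of_tau_free:
  assumes U: "U \<in> I" and n: "n \<ge> 1"
  shows "coeff (E_of (tau_free I) U) n = free_gen (U, n)"
proof -
  let ?\<tau> = "\<lambda>l V. if l < n then tau_free I l V else 0"
  have "tau_free I n U = (-1) ^ Suc n *\<^sub>Q (free_gen (U, n) - coeff (E_of ?\<tau> U) n)"
    unfolding tau_free.simps[of I n U]
    by (simp add: int_module.representation_basis[OF independent_basis U] scaleQ_one)
  moreover have "coeff (E_of (tau_free I) U) n + (-1) ^ n *\<^sub>Q tau_free I n U = coeff (E_of ?\<tau> U) n + (-1) ^ n *\<^sub>Q ?\<tau> n U"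
    using n by (intro coeff_E_of_triangular) auto
  ultimately show ?thesis
    by (simp add: scaleQ_scaleQ power_mult_distrib[symmetric] scaleQ_minus_left scaleQ_minus_right scaleQ_one)
qed

lemma E_free_eq: "E_free I = E_of (tau_free I)"
  unfolding E_free_def
proof (rule the_equality)
  have add: "moebius_additive (E_of (tau_free I))"
    by (rule moebius_additive_E_of) (rule tau_free_add)
  show "(\<forall>W. coeff (E_of (tau_free I) W) 0 = 1) \<and>
     (\<forall>U\<in>I. \<forall>r\<ge>1. coeff (E_of (tau_free I) U) r = free_gen (U, r)) \<and>
     (\<forall>a\<in>int_combinations I. additivity_relator (E_of (tau_free I)) a = 0)"
    by (auto simp: coeff_E_of_tau_free moebius_additive_relator[OF add])
  fix E :: "'r \<Rightarrow> (nat, ('r \<times> nat) free_alg) series"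
  assume E: "(\<forall>W. coeff (E W) 0 = 1) \<and> (\<forall>U\<in>I. \<forall>r\<ge>1. coeff (E U) r = free_gen (U, r)) \<and>
     (\<forall>a\<in>int_combinations I. additivity_relator E a = 0)"
  show "E = E_of (tau_free I)"
  proof (rule E_family_unique[OF I _ _ _ _ add])
    show "moebius_additive E" by (rule moebius_additiveI[OF I]) (use E in auto)
  qed (use E in \<open>auto simp: coeff_E_of_tau_free\<close>)
qed

lemma coeff_E_free_0: "coeff (E_free I W) 0 = 1"
  and coeff_E_free_gen: "U \<in> I \<Longrightarrow> r \<ge> 1 \<Longrightarrow> coeff (E_free I U) r = free_gen (U, r)"
  and moebius_additive_E_free: "moebius_additive (E_free I)"
  unfolding E_free_eq by (auto simp: coeff_E_of_tau_free intro!: moebius_additive_E_of tau_free_add)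

end

section \<open>Images of families under algebra homomorphisms\<close>

lemma map_series_flip_sign: "rat_linear h \<Longrightarrow> map_series h (flip_sign x) = flip_sign (map_series h x)"
  by (rule series_eqI) (simp add: rat_linear_scaleQ)

lemma map_series_log_series:
  "alg_hom h \<Longrightarrow> coeff x (0::'m::graded_splits) = 1 \<Longrightarrow> map_series h (log_series x) = log_series (map_series h x)"
  unfolding log_series_def
  by (subst map_series_eval_series)
    (simp_all add: coeff_1 rat_linear_diff[OF map_series_linear[OF alg_hom_linear]] alg_hom_1[OF map_series_alg_hom])

lemma map_series_inv_series:
  "alg_hom h \<Longrightarrow> coeff x (0::'m::graded_splits) = 1 \<Longrightarrow> map_series h (inv_series x) = inv_series (map_series h x)"
  unfolding inv_series_def
  by (subst map_series_eval_series)
    (simp_all add: coeff_1 rat_linear_diff[OF map_series_linear[OF alg_hom_linear]] alg_hom_1[OF map_series_alg_hom])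

lemma map_series_subst_monom:
  "rat_linear h \<Longrightarrow> (k::'m::graded_splits) \<noteq> 0 \<Longrightarrow> map_series h (subst_monom c k x) = subst_monom c k (map_series h x)"
  by (simp add: subst_monom_eq subst_map_series)

lemma coeff_subst_monom_0:
  assumes "(k::'m::graded_splits) \<noteq> 0" shows "coeff (subst_monom c k x) 0 = coeff x 0"
  using coeff_subst_monom(1)[OF assms, of c x 0] by (simp add: scaleQ_one)

context
  fixes h :: "'a::rat_algebra \<Rightarrow> 'b::rat_algebra" and E :: "'r::{ring,monoid_mult} \<Rightarrow> (nat, 'a) series"
  assumes h: "alg_hom h" and E0: "\<And>W. coeff (E W) 0 = 1"
begin

lemma map_series_E0: "coeff (map_series h (E W)) 0 = 1"
  by (simp add: E0 alg_hom_1[OF h])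

lemma map_series_moebius_log:
  "map_series h (moebius_log E W) = moebius_log (\<lambda>W. map_series h (E W)) W"
proof (rule series_eqI)
  fix n
  note lin = alg_hom_linear[OF h]
  have "coeff (log_series (flip_sign (map_series h (E V)))) k = h (coeff (log_series (flip_sign (E V))) k)" for V k
  proof -
    have "log_series (flip_sign (map_series h (E V))) = map_series h (log_series (flip_sign (E V)))"
      by (simp add: map_series_log_series[OF h] map_series_flip_sign[OF lin] E0 scaleQ_one)
    then show ?thesis by simp
  qed
  then show "coeff (map_series h (moebius_log E W)) n = coeff (moebius_log (\<lambda>W. map_series h (E W)) W) n"
    by (simp add: coeff_moebius_log[of E, OF E0] coeff_moebius_log[of "\<lambda>W. map_series h (E W)", OF map_series_E0]
        rat_linear_0[OF lin] rat_linear_sum[OF lin] rat_linear_scaleQ[OF lin])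
qed

lemma moebius_additive_map: "moebius_additive E \<Longrightarrow> moebius_additive (\<lambda>W. map_series h (E W))"
  unfolding moebius_additive_def map_series_moebius_log[symmetric]
  by (simp add: rat_linear_add[OF map_series_linear[OF alg_hom_linear[OF h]]])

lemma map_series_commutation_relator:
  "map_series h (commutation_relator E U V) = commutation_relator (\<lambda>W. map_series h (E W)) U V"
proof -
  note H = map_series_alg_hom[OF h] and lin = alg_hom_linear[OF h]
  have nz: "(1::nat, 0::nat) \<noteq> 0" "(0::nat, 1::nat) \<noteq> 0" "(1::nat, 1::nat) \<noteq> 0" by (auto simp: zero_prod_def)
  show ?thesis
    unfolding commutation_relator_def Let_def
    by (simp only: rat_linear_diff[OF alg_hom_linear[OF H]] alg_hom_mult[OF H] map_series_subst_monom[OF lin nz(1)]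
        map_series_subst_monom[OF lin nz(2)] map_series_subst_monom[OF lin nz(3)]
        map_series_inv_series[OF h] coeff_subst_monom_0[OF nz(3)] E0)
qed

end

section \<open>The relations hold in \<open>\<G>\<^sub>\<infinity>\<^sup>\<rat>(R)\<close>\<close>

lemma monom_mult: "monom k a * monom l b = monom (k + l) (a * b)"
proof (rule series_eqI)
  fix m
  have "coeff (monom k a * monom l b) m = (\<Sum>p\<in>splits m. if p = (k, l) then a * b else 0)"
    unfolding coeff_mult
  proof (rule sum.cong[OF refl])
    fix p
    show "(case p of (p, q) \<Rightarrow> coeff (monom k a) p * coeff (monom l b) q) = (if p = (k, l) then a * b else 0)"
      by (cases p) (simp add: coeff_monom)
  qed
  also have "\<dots> = coeff (monom (k + l) (a * b)) m"
    by (simp add: finite_splits coeff_monom)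
  finally show "coeff (monom k a * monom l b) m = coeff (monom (k + l) (a * b)) m" .
qed

lemma monom_minus: "- monom k a = monom k (- a :: 'a::{ring,monoid_mult})"
  by (rule series_eqI) (simp add: coeff_monom)

lemma inv_series_mult:
  assumes "coeff x (0::'m::graded_splits) = 1" "coeff y 0 = 1"
  shows "inv_series (x * y) = inv_series y * inv_series x"
proof (rule inv_series_unique)
  have "x * y * (inv_series y * inv_series x) = x * (y * inv_series y) * inv_series x"
    by (simp only: mult.assoc)
  then show "x * y * (inv_series y * inv_series x) = 1"
    by (simp add: inv_series_inverse assms)
qed (simp add: assms)

text \<open>Both sides equal \<open>(1 / (1 - a) + 1 / (1 - b) - 1)\<inverse>\<close>.\<close>

lemma inv_series_swap:
  fixes a b :: "('m::graded_splits, 'a::rat_algebra) series"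
  assumes a: "coeff a 0 = 0" and b: "coeff b 0 = 0"
  shows "(1 - a) * inv_series (1 - b * a) * (1 - b) = (1 - b) * inv_series (1 - a * b) * (1 - a)"
proof -
  have main: "(1 - a) * inv_series (1 - b * a) * (1 - b) = inv_series (inv_series (1 - a) + inv_series (1 - b) - 1)"
    if a: "coeff a 0 = 0" and b: "coeff b 0 = 0" for a b :: "('m, 'a) series"
  proof -
    let ?x = "inv_series (1 - a)" and ?y = "inv_series (1 - b)"
    let ?s = "?x + ?y - 1"
    have a1: "coeff (1 - a) 0 = 1" and b1: "coeff (1 - b) 0 = 1" by (simp_all add: coeff_1 a b)
    have s1: "coeff ?s 0 = 1" by (simp add: coeff_inv_series_0 a1[simplified] b1[simplified] coeff_1 a b)
    have "p * (x + y - 1) * q = p * (x * q) + (p * y) * q - p * q" for p q x y :: "('m, 'a) series"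
      by (simp add: algebra_simps)
    then have "(1 - b) * ?s * (1 - a) = (1 - b) * (?x * (1 - a)) + ((1 - b) * ?y) * (1 - a) - (1 - b) * (1 - a)"
      by blast
    also have "\<dots> = 1 - b * a"
      by (simp only: inv_series_inverse[OF a1] inv_series_inverse[OF b1] mult_1_left mult_1_right)
        (simp add: algebra_simps)
    finally have "inv_series (1 - b * a) = inv_series ((1 - b) * ?s * (1 - a))" by simp
    also have "\<dots> = ?x * (inv_series ?s * ?y)"
    proof -
      have "coeff ((1 - b) * ?s) 0 = 1" using b1 s1 by simp
      then show ?thesis by (simp only: inv_series_mult a1 b1 s1)
    qed
    finally have "(1 - a) * inv_series (1 - b * a) * (1 - b) = ((1 - a) * ?x) * inv_series ?s * (?y * (1 - b))"
      by (simp only: mult.assoc)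
    then show ?thesis by (simp add: inv_series_inverse[OF a1] inv_series_inverse[OF b1])
  qed
  show ?thesis unfolding main[OF a b] main[OF b a] by (simp add: add.commute)
qed

lemma Theta_eq_theta: "Theta l = theta (T_map l)"
  by (simp add: fun_eq_iff Theta_def theta_def)

text \<open>The arguments x l vary freely with l: the series 1 - (-t)^l U in e_r are not the Adams
  images of one series, because Adams operations do not act on the sign in the coefficient.\<close>

definition theta_prod ::
    "(nat \<Rightarrow> ('m::graded_splits, 'r::{ring,monoid_mult} rat_tensor) series) \<Rightarrow> ('m, 'r ginf) series" where
  "theta_prod x = prod_series (\<lambda>l. theta (T_map l) (x l))"

lemma near_one_theta: "near_one x \<Longrightarrow> near_one (\<lambda>l. theta (T_map l) (x l))"
  by (simp add: near_one_def ord_ge_theta[OF T_map_linear])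

lemma coeff_theta_prod_0: "near_one x \<Longrightarrow> coeff (theta_prod x) 0 = 1"
  unfolding theta_prod_def by (rule coeff_prod_series_0[OF near_one_theta])

lemma theta_prod_cong: "(\<And>l. l \<ge> 1 \<Longrightarrow> x l = y l) \<Longrightarrow> theta_prod x = theta_prod y"
  unfolding theta_prod_def by (rule prod_series_cong) simp

lemma theta_prod_one [simp]: "theta_prod (\<lambda>_. 1) = 1"
  unfolding theta_prod_def
proof (rule prod_series_eqI)
  show "near_one (\<lambda>l. theta (T_map l) 1)" by (simp add: near_one_def theta_one[OF T_map_lie_map] ord_ge_def)
  show "ord_ge N (1 - partial_prod (\<lambda>l. theta (T_map l) 1) N)" for N
    by (simp add: theta_one[OF T_map_lie_map] map_replicate_const ord_ge_def prod_list_eq_1)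
qed

text \<open>Factors with different l commute because the images of the T maps do, which lets the two
  products interleave; within one l, \<open>theta\<close> is multiplicative.\<close>

lemma theta_prod_mult:
  assumes x: "near_one x" and y: "near_one y"
  shows "theta_prod x * theta_prod y = theta_prod (\<lambda>l. x l * y l)"
proof -
  have "theta_prod x * theta_prod y = prod_series (\<lambda>l. theta (T_map l) (x l) * theta (T_map l) (y l))"
    unfolding theta_prod_def
    by (intro prod_series_mult near_one_theta x y)
      (rule theta_commute[OF T_map_commute T_map_linear T_map_linear near_one_coeff_0[OF x] near_one_coeff_0[OF y]])
  also have "\<dots> = theta_prod (\<lambda>l. x l * y l)"
    unfolding theta_prod_def
    by (rule prod_series_cong) (simp add: theta_mult[OF T_map_lie_map] near_one_coeff_0[OF x] near_one_coeff_0[OF y])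
  finally show ?thesis .
qed

lemma near_one_inv:
  assumes x: "near_one x" shows "near_one (\<lambda>l. inv_series (x l))"
  unfolding near_one_def
proof (intro allI impI)
  fix l :: nat assume l: "1 \<le> l"
  note x0 = near_one_coeff_0[OF x l]
  have "ord_ge l (x l - 1)" using x l by (simp add: near_one_def)
  then have "ord_ge l ((x l - 1) * inv_series (x l))" by (rule ord_ge_mult1)
  then have "ord_ge l (1 - inv_series (x l))"
    by (simp add: left_diff_distrib inv_series_inverse[OF x0])
  then show "ord_ge l (inv_series (x l) - 1)" by (rule ord_ge_sym)
qed

lemma inv_theta_prod:
  assumes x: "near_one x"
  shows "inv_series (theta_prod x) = theta_prod (\<lambda>l. inv_series (x l))"
proof (rule inv_series_unique)
  show "coeff (theta_prod x) 0 = 1" by (rule coeff_theta_prod_0[OF x])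
  have "theta_prod x * theta_prod (\<lambda>l. inv_series (x l)) = theta_prod (\<lambda>_. 1)"
    unfolding theta_prod_mult[OF x near_one_inv[OF x]]
    by (rule theta_prod_cong) (simp add: inv_series_inverse near_one_coeff_0[OF x])
  then show "theta_prod x * theta_prod (\<lambda>l. inv_series (x l)) = 1" by simp
qed

lemma subst_theta_prod:
  assumes "monomial_map \<chi> f" "near_one x"
  shows "subst \<chi> f (theta_prod x) = theta_prod (\<lambda>l. subst \<chi> f (x l))"
  unfolding theta_prod_def subst_prod_series[OF assms(1) near_one_theta[OF assms(2)]]
  by (rule prod_series_cong) (simp add: subst_theta[OF assms(1) T_map_linear] near_one_coeff_0[OF assms(2)])

lemma near_one_minus_monom:
  assumes "(k::'m::graded_splits) \<noteq> 0"
  shows "near_one (\<lambda>l. 1 - monom (nmul l k) (c l))"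
  unfolding near_one_def
proof (intro allI impI)
  fix l :: nat
  have "mdeg k \<ge> 1" using assms mdeg_eq_0_iff[of k] by (simp del: mdeg_eq_0_iff)
  then have "l \<le> l * mdeg k" by simp
  then show "ord_ge l (1 - monom (nmul l k) (c l) - 1)"
    by (auto simp: ord_ge_def coeff_monom mdeg_nmul)
qed

definition E_ginf :: "'r::{ring,monoid_mult} \<Rightarrow> (nat, 'r ginf) series" where
  "E_ginf W = Series (\<lambda>r. e_ginf r W)"

lemma coeff_E_ginf [simp]: "coeff (E_ginf W) r = e_ginf r W"
  by (simp add: E_ginf_def)

lemma E_ginf_theta_prod:
  "E_ginf W = theta_prod (\<lambda>l. 1 - monom (nmul l 1) ((-1) ^ l *\<^sub>Q tensor_one W))"
  by (rule series_eqI) (simp add: e_ginf_def theta_prod_def Theta_eq_theta)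

lemma subst_monom_E_ginf:
  assumes k: "(k::'m::graded_splits) \<noteq> 0"
  shows "subst_monom c k (E_ginf W) = theta_prod (\<lambda>l. 1 - monom (nmul l k) ((c ^ l * (-1) ^ l) *\<^sub>Q tensor_one W))"
proof -
  note \<chi> = monomial_map_power[OF k, of c]
  have one: "(1::nat) \<noteq> 0" by simp
  show ?thesis
    unfolding subst_monom_eq[OF k] E_ginf_theta_prod subst_theta_prod[OF \<chi> near_one_minus_monom[OF one]]
    by (simp add: rat_linear_diff[OF subst_linear] subst_1[OF \<chi>] subst_monomial[OF \<chi>] scaleQ_scaleQ)
qed

lemma commutation_relator_E_ginf: "commutation_relator E_ginf U V = 0"
proof -
  let ?u = "(1, 0) :: nat \<times> nat" and ?v = "(0, 1) :: nat \<times> nat" and ?w = "(1, 1) :: nat \<times> nat"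
  have nz: "?u \<noteq> 0" "?v \<noteq> 0" "?w \<noteq> 0" by (auto simp: zero_prod_def)
  note One_nat_def [simp del]
  define a where "a l = monom (nmul l ?u) ((-1) ^ l *\<^sub>Q tensor_one U)" for l
  define b where "b l = monom (nmul l ?v) ((-1) ^ l *\<^sub>Q tensor_one V)" for l
  \<comment> \<open>The signs of \<open>a l\<close> and \<open>b l\<close> cancel in their products,
    so \<open>b l * a l\<close> is (uv)^l VU. This is why the middle series in (1) is evaluated at
    -uv.\<close>
  have sq: "(-1) ^ l * (-1) ^ l = (1::rat)" for l :: nat by (simp add: power_mult_distrib[symmetric])
  have w: "nmul l ?v + nmul l ?u = nmul l ?w" "nmul l ?u + nmul l ?v = nmul l ?w" for l
    by (simp_all add: nmul_distrib[symmetric])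
  have ba: "b l * a l = monom (nmul l ?w) (tensor_one (V * U))" and ab: "a l * b l = monom (nmul l ?w) (tensor_one (U * V))" for l
    by (simp_all add: a_def b_def monom_mult w scaleQ_mult_left scaleQ_mult_right scaleQ_scaleQ sq scaleQ_one tensor_one_mult)
  have EU: "subst_monom 1 ?u (E_ginf U) = theta_prod (\<lambda>l. 1 - a l)" and
    EV: "subst_monom 1 ?v (E_ginf V) = theta_prod (\<lambda>l. 1 - b l)" and
    EVU: "subst_monom (-1) ?w (E_ginf (V * U)) = theta_prod (\<lambda>l. 1 - b l * a l)" and
    EUV: "subst_monom (-1) ?w (E_ginf (U * V)) = theta_prod (\<lambda>l. 1 - a l * b l)"
    unfolding subst_monom_E_ginf[OF nz(1)] subst_monom_E_ginf[OF nz(2)] subst_monom_E_ginf[OF nz(3)] ab ba sq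
    by (simp_all add: a_def b_def scaleQ_one)
  have n: "near_one (\<lambda>l. 1 - a l)" "near_one (\<lambda>l. 1 - b l)" "near_one (\<lambda>l. 1 - b l * a l)" "near_one (\<lambda>l. 1 - a l * b l)"
    unfolding ab ba unfolding a_def b_def by (rule near_one_minus_monom nz)+
  have a0: "coeff (a l) 0 = 0" and b0: "coeff (b l) 0 = 0" if "l \<ge> 1" for l
    using that nz nmul_eq_0[of l ?u] nmul_eq_0[of l ?v] by (auto simp: a_def b_def coeff_monom)
  have "subst_monom 1 ?u (E_ginf U) * inv_series (subst_monom (-1) ?w (E_ginf (V * U))) * subst_monom 1 ?v (E_ginf V)
      = theta_prod (\<lambda>l. (1 - a l) * inv_series (1 - b l * a l) * (1 - b l))"
    by (simp only: EU EV EVU inv_theta_prod n theta_prod_mult near_one_inv near_one_mult)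
  also have "\<dots> = theta_prod (\<lambda>l. (1 - b l) * inv_series (1 - a l * b l) * (1 - a l))"
    by (rule theta_prod_cong) (rule inv_series_swap[OF a0 b0])
  also have "\<dots> = subst_monom 1 ?v (E_ginf V) * inv_series (subst_monom (-1) ?w (E_ginf (U * V))) * subst_monom 1 ?u (E_ginf U)"
    by (simp only: EU EV EUV inv_theta_prod n theta_prod_mult near_one_inv near_one_mult)
  finally show ?thesis by (simp add: commutation_relator_def)
qed

lemma coeff_log_one_minus_monom:
  assumes "k \<ge> 1"
  shows "coeff (log_series (1 - monom k a)) n =
    (if n \<noteq> 0 \<and> k dvd n then - ((1 / of_nat (n div k)) *\<^sub>Q a ^ (n div k)) else 0)"
proof -
  let ?c = "\<lambda>j. if j = 0 then 0 else (-1) ^ (j + 1) / of_nat j :: rat"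
  have p: "(- monom k a) ^ j = (-1) ^ j *\<^sub>Q monom (j * k) (a ^ j)" for j
    by (induction j) (auto simp: one_monom monom_mult monom_minus scaleQ_mult_right scaleQ_one intro!: series_eqI,
      simp add: coeff_monom scaleQ_minus_left scaleQ_minus_right)
  have "coeff (log_series (1 - monom k a)) n = (\<Sum>j\<le>n. ?c j *\<^sub>Q coeff ((- monom k a) ^ j) n)"
    using assms by (simp add: log_series_def coeff_eval_series[where K = n] mdeg_nat_def coeff_monom)
  also have "\<dots> = (\<Sum>j\<le>n. if k dvd n \<and> j = n div k then (if j = 0 then 0 else - ((1 / of_nat j) *\<^sub>Q a ^ j)) else 0)"
    using assms
    by (intro sum.cong refl)
      (auto simp: p coeff_monom scaleQ_scaleQ power_mult_distrib[symmetric] scaleQ_minus_left[symmetric] elim!: dvdE)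
  also have "\<dots> = (if n \<noteq> 0 \<and> k dvd n then - ((1 / of_nat (n div k)) *\<^sub>Q a ^ (n div k)) else 0)"
    using assms by (cases "k dvd n") (auto simp: dvd_div_eq_0_iff)
  finally show ?thesis .
qed

text \<open>After t -> -t, the logarithm of the l-th factor is minus the sum of t^(lk) T_l(W^k) / k.
  The logarithms for different l commute, so the product is a single exponential, and collecting the
  power t^n over all l dividing n gives \<open>log_E\<close> with \<tau> =
  \<open>T_one\<close>.\<close>

lemma E_ginf_E_of: "E_ginf W = E_of T_one W"
proof -
  define y where "y l = map_series (T_map l) (log_series (1 - monom l (tensor_one W)))" for l :: nat
  have y: "coeff (y l) n = (if n \<noteq> 0 \<and> l dvd n then - ((1 / of_nat (n div l)) *\<^sub>Q T_one l (W ^ (n div l))) else 0)"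
    if "l \<ge> 1" for l n
    using that by (simp add: y_def coeff_log_one_minus_monom rat_linear_minus[OF T_map_linear]
        rat_linear_scaleQ[OF T_map_linear] rat_linear_0[OF T_map_linear] tensor_one_power)
  have "flip_sign (E_ginf W) = theta_prod (\<lambda>l. 1 - monom (nmul l 1) (((-1) ^ l * (-1) ^ l) *\<^sub>Q tensor_one W))"
    unfolding flip_sign_def by (rule subst_monom_E_ginf) simp
  also have "\<dots> = prod_series (\<lambda>l. exp_series (y l))"
    by (simp add: power_mult_distrib[symmetric] scaleQ_one theta_prod_def theta_def y_def)
  also have "\<dots> = exp_series (log_E T_one W)"
  proof (rule prod_series_exp)
    show "ord_ge l (y l)" if "1 \<le> l" for l
      using that dvd_imp_le by (fastforce simp: ord_ge_def y mdeg_nat_def)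
    show "y k * y l = y l * y k" if "1 \<le> k" "1 \<le> l" for k l
    proof (cases "k = l")
      case False
      then show ?thesis unfolding y_def 
        by (intro series_commuteI) (simp only: coeff_map_series T_map_commute[OF that False])
    qed simp
    fix N :: nat assume "1 \<le> N"
    show "ord_ge N (log_E T_one W - sum y {1..<N})"
      unfolding ord_ge_def mdeg_nat_def
    proof (intro allI impI)
      fix n assume n: "n < N"
      show "coeff (log_E T_one W - sum y {1..<N}) n = 0"
      proof (cases "n = 0")
        case True then show ?thesis by (simp add: y)
      next
        case False
        have "coeff (sum y {1..<N}) n = (\<Sum>l | l dvd n. coeff (y l) n)"
          unfolding coeff_sum
        proof (rule sum.mono_neutral_right)
          show "{l. l dvd n} \<subseteq> {1..<N}"
          proof
            fix l assume "l \<in> {l. l dvd n}"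
            then have "l \<le> n" "l \<noteq> 0" using False by (auto dest: dvd_imp_le)
            then show "l \<in> {1..<N}" using n by simp
          qed
        qed (use False in \<open>auto simp: y\<close>)
        also have "\<dots> = (\<Sum>l | l dvd n. - ((1 / of_nat (n div l)) *\<^sub>Q T_one l (W ^ (n div l))))"
          using False by (intro sum.cong refl) (auto simp: y Suc_le_eq intro: Nat.gr0I)
        also have "\<dots> = (\<Sum>k | k dvd n. - ((1 / of_nat k) *\<^sub>Q T_one (n div k) (W ^ k)))"
          using False by (subst sum_divisors_flip) (auto intro!: sum.cong elim!: dvdE)
        finally show ?thesis using False by (simp add: log_E_def sum_negf)
      qed
    qed
  qed
  finally have "flip_sign (flip_sign (E_ginf W)) = E_of T_one W" by (simp add: E_of_def)
  then show ?thesis by simp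
qed

lemma T_one_add: "T_one l (U + V) = T_one l U + T_one l V"
  by (simp add: tensor_one_add rat_linear_add[OF T_map_linear])

lemma moebius_additive_E_ginf: "moebius_additive E_ginf"
  unfolding E_ginf_E_of[abs_def] by (rule moebius_additive_E_of) (rule T_one_add)

lemma e_ginf_0: "e_ginf 0 W = 1"
  using coeff_E_of_0[of T_one W] by (simp add: E_ginf_E_of[symmetric])

lemma T_one_moebius_log: "l \<ge> 1 \<Longrightarrow> T_one l W = - coeff (moebius_log E_ginf W) l"
  by (simp add: E_ginf_E_of[abs_def] moebius_log_E_of)

section \<open>Polynomial functions and their linear parts\<close>

text \<open>Polynomial functions of n together with their constant and linear coefficients. These
  two are enough to follow linear parts through sums, products and exponentials.\<close>

inductive poly_fn :: "(nat \<Rightarrow> 'a::rat_algebra) \<Rightarrow> 'a \<Rightarrow> 'a \<Rightarrow> bool" where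
  const: "poly_fn (\<lambda>_. a) a 0"
| shift: "poly_fn f a b \<Longrightarrow> poly_fn (\<lambda>n. of_nat n *\<^sub>Q f n) 0 a"
| add: "poly_fn f a b \<Longrightarrow> poly_fn g a' b' \<Longrightarrow> poly_fn (\<lambda>n. f n + g n) (a + a') (b + b')"

lemma poly_fn_mult_left: "poly_fn f a b \<Longrightarrow> poly_fn (\<lambda>n. c * f n) (c * a) (c * b)"
proof (induction rule: poly_fn.induct)
  case (const a) show ?case using poly_fn.const[of "c * a"] by simp
next
  case (shift f a b)
  from poly_fn.shift[OF shift.IH] show ?case by (simp add: scaleQ_mult_right)
next
  case (add f a b g a' b')
  from poly_fn.add[OF add.IH] show ?case by (simp add: distrib_left)
qed

lemma poly_fn_mult:
  "poly_fn f a b \<Longrightarrow> poly_fn g a' b' \<Longrightarrow> poly_fn (\<lambda>n. f n * g n) (a * a') (a * b' + b * a')"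
proof (induction rule: poly_fn.induct)
  case (const a) then show ?case using poly_fn_mult_left[of g a' b' a] by simp
next
  case (shift f a b)
  from poly_fn.shift[OF shift.IH[OF shift.prems]] show ?case by (simp add: scaleQ_mult_left)
next
  case (add f a b h c d)
  from poly_fn.add[OF add.IH(1)[OF add.prems] add.IH(2)[OF add.prems]] show ?case by (simp add: algebra_simps)
qed

lemma poly_fn_scaleQ: "poly_fn f a b \<Longrightarrow> poly_fn (\<lambda>n. c *\<^sub>Q f n) (c *\<^sub>Q a) (c *\<^sub>Q b)"
  using poly_fn_mult_left[of f a b "c *\<^sub>Q 1"] by (simp add: scaleQ_conv_mult[symmetric])

lemma poly_fn_minus: "poly_fn f a b \<Longrightarrow> poly_fn (\<lambda>n. - f n) (- a) (- b)"
  using poly_fn_scaleQ[of f a b "-1"] by (simp add: scaleQ_minus_left scaleQ_one)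

lemma poly_fn_sum:
  "(\<And>i. i \<in> A \<Longrightarrow> poly_fn (f i) (a i) (b i)) \<Longrightarrow> poly_fn (\<lambda>n. \<Sum>i\<in>A. f i n) (\<Sum>i\<in>A. a i) (\<Sum>i\<in>A. b i)"
  by (induction A rule: infinite_finite_induct) (auto intro: poly_fn.const[of 0, simplified] poly_fn.add)

lemma poly_fn_power: "k \<ge> 1 \<Longrightarrow> poly_fn (\<lambda>n. of_nat n ^ k *\<^sub>Q a) 0 (if k = 1 then a else 0)"
proof (induction k rule: dec_induct)
  case base show ?case using poly_fn.shift[OF poly_fn.const, of a] by simp
next
  case (step k)
  from poly_fn.shift[OF step.IH] step.hyps show ?case by (simp add: scaleQ_scaleQ)
qed

text \<open>The bound \<open>d\<close> may be exceeded freely, so that expansions of different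
  degrees can be added over one range.\<close>

lemma poly_fn_coeffs:
  "poly_fn f a b \<Longrightarrow> \<exists>d c. c 0 = a \<and> c (Suc 0) = b \<and> (\<forall>D\<ge>d. \<forall>n. f n = (\<Sum>i\<le>D. of_nat n ^ i *\<^sub>Q c i))"
proof (induction rule: poly_fn.induct)
  case (const a)
  have "(\<Sum>i\<le>D. of_nat n ^ i *\<^sub>Q (if i = 0 then a else 0)) = (\<Sum>i\<le>D. if i = 0 then a else 0)" for D n
    by (intro sum.cong refl) (simp add: scaleQ_one)
  then show ?case by (intro exI[of _ 0] exI[of _ "\<lambda>i. if i = 0 then a else 0"]) simp
next
  case (shift f a b)
  then obtain d c where c: "c 0 = a" "c (Suc 0) = b" "\<And>D n. D \<ge> d \<Longrightarrow> f n = (\<Sum>i\<le>D. of_nat n ^ i *\<^sub>Q c i)" by blast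
  have "of_nat n *\<^sub>Q f n = (\<Sum>i\<le>D. of_nat n ^ i *\<^sub>Q (case i of 0 \<Rightarrow> 0 | Suc j \<Rightarrow> c j))" if "Suc d \<le> D" for D n
  proof -
    obtain D' where "D = Suc D'" "d \<le> D'" using \<open>Suc d \<le> D\<close> Suc_le_D by auto
    then show ?thesis
      by (simp add: c(3)[of D'] sum.atMost_Suc_shift scaleQ_sum scaleQ_scaleQ del: sum.atMost_Suc)
  qed
  then show ?case using c(1)
    by (intro exI[of _ "Suc d"] exI[of _ "\<lambda>i. case i of 0 \<Rightarrow> 0 | Suc j \<Rightarrow> c j"]) simp
next
  case (add f a b g a' b')
  then obtain d c d' c' where c: "c 0 = a" "c (Suc 0) = b" "\<And>D n. D \<ge> d \<Longrightarrow> f n = (\<Sum>i\<le>D. of_nat n ^ i *\<^sub>Q c i)"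
    "c' 0 = a'" "c' (Suc 0) = b'" "\<And>D n. D \<ge> d' \<Longrightarrow> g n = (\<Sum>i\<le>D. of_nat n ^ i *\<^sub>Q c' i)" by blast
  have "f n + g n = (\<Sum>i\<le>D. of_nat n ^ i *\<^sub>Q (c i + c' i))" if "max d d' \<le> D" for D n
    using that c(3)[of D n] c(6)[of D n] by (simp add: scaleQ_add_right sum.distrib)
  then show ?case using c
    by (intro exI[of _ "max d d'"] exI[of _ "\<lambda>i. c i + c' i"]) simp
qed

lemma poly_coeffs_zero:
  fixes c :: "nat \<Rightarrow> 'a::rat_algebra"
  assumes "\<And>n::nat. (\<Sum>i\<le>D. of_nat n ^ i *\<^sub>Q c i) = 0" "i \<le> D"
  shows "c i = 0"
  using assms
proof (induction D arbitrary: c i)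
  case 0
  from "0.prems"(1)[of 0] "0.prems"(2) show ?case by (simp add: scaleQ_one)
next
  case (Suc D)
  \<comment> \<open>Subtracting 2^(D+1) times the value at n from the value at 2n cancels the top
    coefficient; the others are only multiplied by nonzero numbers.\<close>
  let ?e = "\<lambda>i. (2 ^ i - 2 ^ Suc D :: rat) *\<^sub>Q c i"
  have low: "c j = 0" if "j \<le> D" for j
  proof -
    have "(\<Sum>i\<le>D. of_nat n ^ i *\<^sub>Q ?e i) = 0" for n
    proof -
      have "(\<Sum>i\<le>Suc D. of_nat n ^ i *\<^sub>Q ?e i) =
          (\<Sum>i\<le>Suc D. of_nat (2 * n) ^ i *\<^sub>Q c i) - 2 ^ Suc D *\<^sub>Q (\<Sum>i\<le>Suc D. of_nat n ^ i *\<^sub>Q c i)"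
        unfolding scaleQ_sum sum_subtractf[symmetric]
        by (intro sum.cong refl)
          (simp only: scaleQ_scaleQ scaleQ_diff_left[symmetric] of_nat_mult power_mult_distrib, simp add: algebra_simps)
      also have "\<dots> = 0" by (simp only: Suc.prems(1)) simp
      finally show ?thesis by simp
    qed
    from Suc.IH[of ?e, OF this that] have "(2 ^ j - 2 ^ Suc D :: rat) *\<^sub>Q c j = 0" .
    moreover have "(2 ^ j :: rat) < 2 ^ Suc D" using that by (intro power_strict_increasing) auto
    ultimately show ?thesis by (simp add: scaleQ_cancel)
  qed
  have "c (Suc D) = 0" using Suc.prems(1)[of 1] low by (simp add: scaleQ_one)
  then show ?case using low Suc.prems(2) le_Suc_eq by metis
qed

lemma poly_fn_unique:
  assumes "poly_fn f a b" "poly_fn f a' b'" shows "b = b'"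
proof -
  have "poly_fn (\<lambda>n. f n + - f n) (a + - a') (b + - b')"
    by (intro poly_fn.add poly_fn_minus assms)
  then obtain d c where c: "c (Suc 0) = b - b'" "\<And>D n. D \<ge> d \<Longrightarrow> 0 = (\<Sum>i\<le>D. of_nat n ^ i *\<^sub>Q c i)"
    using poly_fn_coeffs by fastforce
  have "c (Suc 0) = 0" by (rule poly_coeffs_zero[where D = "Suc d"]) (use c(2)[of "Suc d"] in auto)
  then show ?thesis using c(1) by simp
qed

definition poly_series ::
    "(nat \<Rightarrow> ('m::graded_splits, 'a::rat_algebra) series) \<Rightarrow> ('m, 'a) series \<Rightarrow> ('m, 'a) series \<Rightarrow> bool" where
  "poly_series X a b \<longleftrightarrow> (\<forall>m. poly_fn (\<lambda>n. coeff (X n) m) (coeff a m) (coeff b m))"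

lemma poly_series_const: "poly_series (\<lambda>_. a) a 0"
  by (simp add: poly_series_def poly_fn.const)

lemma poly_series_mult:
  "poly_series X a b \<Longrightarrow> poly_series Y a' b' \<Longrightarrow> poly_series (\<lambda>n. X n * Y n) (a * a') (a * b' + b * a')"
  unfolding poly_series_def coeff_mult coeff_add sum.distrib[symmetric] case_prod_unfold
  by (intro allI poly_fn_sum poly_fn_mult) auto

lemma poly_series_add:
  "poly_series X a b \<Longrightarrow> poly_series Y a' b' \<Longrightarrow> poly_series (\<lambda>n. X n + Y n) (a + a') (b + b')"
  by (simp add: poly_series_def poly_fn.add)

lemma poly_series_minus: "poly_series X a b \<Longrightarrow> poly_series (\<lambda>n. - X n) (- a) (- b)"
  by (simp add: poly_series_def poly_fn_minus)

lemma poly_series_linear: "poly_series (\<lambda>n. of_nat n *\<^sub>Q a) 0 a"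
  unfolding poly_series_def coeff_scaleQ coeff_0 
  by (intro allI) (rule poly_fn.shift, rule poly_fn.const)

lemma poly_series_subst:
  "poly_series X a b \<Longrightarrow> poly_series (\<lambda>n. subst \<chi> f (X n)) (subst \<chi> f a) (subst \<chi> f b)"
  unfolding poly_series_def coeff_subst by (intro allI poly_fn_sum poly_fn_scaleQ) auto

lemma poly_series_unique: "poly_series X a b \<Longrightarrow> poly_series X a' b' \<Longrightarrow> b = b'"
  unfolding poly_series_def by (intro series_eqI) (blast intro: poly_fn_unique)

text \<open>The constant part of X is 0, so its powers from the second on have no linear
  part.\<close>

lemma poly_series_exp:
  assumes X: "poly_series X 0 b" and X0: "\<And>n. coeff (X n) 0 = 0"
  shows "poly_series (\<lambda>n. exp_series (X n)) 1 b"
proof -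
  have pow: "poly_series (\<lambda>n. X n ^ k) (if k = 0 then 1 else 0) (if k = 1 then b else 0)" for k
  proof (induction k)
    case 0 show ?case by (simp add: poly_series_const)
  next
    case (Suc k)
    from poly_series_mult[OF X Suc] show ?case by (cases k) simp_all
  qed
  show ?thesis
    unfolding poly_series_def
  proof
    fix m :: 'a
    \<comment> \<open>One more than the degree, so that the index 1, which carries the linear part,
      is in range even for m = 0.\<close>
    let ?K = "Suc (mdeg m)"
    have "poly_fn (\<lambda>n. \<Sum>k\<le>?K. (1 / fact k) *\<^sub>Q coeff (X n ^ k) m)
        (\<Sum>k\<le>?K. (1 / fact k) *\<^sub>Q coeff (if k = 0 then 1 else 0) m)
        (\<Sum>k\<le>?K. (1 / fact k) *\<^sub>Q coeff (if k = 1 then b else 0) m)"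
      using pow unfolding poly_series_def by (intro poly_fn_sum poly_fn_scaleQ) auto
    moreover have "(\<Sum>k\<le>?K. (1 / fact k) *\<^sub>Q coeff (if k = 0 then 1 else 0 :: ('a, 'b) series) m) = coeff 1 m"
      by (subst sum.atMost_Suc_shift) (simp add: scaleQ_one)
    moreover have "(\<Sum>k\<le>?K. (1 / fact k) *\<^sub>Q coeff (if k = 1 then b else 0) m) = coeff b m"
      by (subst sum.mono_neutral_right[of _ "{1}"]) (auto simp: scaleQ_one)
    ultimately show "poly_fn (\<lambda>n. coeff (exp_series (X n)) m) (coeff 1 m) (coeff b m)"
      unfolding exp_series_def by (simp only: coeff_eval_series[OF X0, of m ?K] le_SucI order_refl)
  qed
qed

section \<open>The commutation relation determines the brackets\<close>

lemma zscale_mult_left: "zscale v U * V = zscale v (U * (V::'r::{ring,monoid_mult}))"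
  by (simp add: zscale_def left_diff_distrib sum_distrib_right)

lemma zscale_mult_right: "V * zscale v U = zscale v (V * (U::'r::{ring,monoid_mult}))"
  by (simp add: zscale_def right_diff_distrib sum_distrib_left)

lemma zscale_power: "zscale v U ^ k = zscale (v ^ k) (U ^ k :: 'r::{ring,monoid_mult})"
  by (induction k) (simp_all add: zscale_mult_left zscale_mult_right mult.commute[of v])

text \<open>
  Replace \<open>U\<close> and \<open>V\<close> by \<open>n U\<close> and \<open>m V\<close>: every coefficient becomes polynomial in \<open>n\<close> and \<open>m\<close>, and
  the bracket relation is the part that is linear in both.
\<close>

lemma commutation_relator_imp_bracket:
  fixes \<tau> :: "nat \<Rightarrow> 'r::{ring,monoid_mult} \<Rightarrow> 'a::rat_algebra"
  assumes add: "\<And>l x y. l \<ge> 1 \<Longrightarrow> \<tau> l (x + y) = \<tau> l x + \<tau> l y"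
    and rel: "\<And>U V. commutation_relator (E_of \<tau>) U V = 0"
    and k: "k \<ge> 1" and l: "l \<ge> 1"
  shows "\<tau> k U * \<tau> l V - \<tau> l V * \<tau> k U = (if k = l then \<tau> k (U * V) - \<tau> k (V * U) else 0)"
proof -
  let ?u = "(1, 0) :: nat \<times> nat" and ?v = "(0, 1) :: nat \<times> nat" and ?w = "(1, 1) :: nat \<times> nat"
  have nz: "?u \<noteq> 0" "?v \<noteq> 0" "?w \<noteq> 0" by (auto simp: zero_prod_def)
  note One_nat_def [simp del]
  define A where "A U = subst_monom (-1) ?u (log_E \<tau> U)" for U
  define B where "B V = subst_monom (-1) ?v (log_E \<tau> V)" for V
  define C where "C W = subst_monom 1 ?w (log_E \<tau> W)" for W
  \<comment> \<open>The term k = 1 of \<open>log_E\<close>, which is its part linear in W.\<close>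
  define lin where "lin W = Series (\<lambda>n. if n = 0 then 0 else - \<tau> n W)" for W
  have zs: "\<tau> j (zscale v W) = of_int v *\<^sub>Q \<tau> j W" if "j \<ge> 1" for j v W
    by (rule additive_zscale) (rule add[OF that])
  have A0: "coeff (A W) 0 = 0" and B0: "coeff (B W) 0 = 0" and C0: "coeff (C W) 0 = 0" for W
    by (simp_all add: A_def B_def C_def coeff_subst_monom_0 nz)
  have sub: "subst_monom c p (exp_series x) = exp_series (subst_monom c p x)"
    if "p \<noteq> 0" "coeff x 0 = 0" for c and p :: "nat \<times> nat" and x :: "(nat, 'a) series"
    using that by (simp add: subst_monom_eq subst_exp_series[OF monomial_map_power])
  have eA: "subst_monom 1 ?u (E_of \<tau> W) = exp_series (A W)" and eB: "subst_monom 1 ?v (E_of \<tau> W) = exp_series (B W)"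
    and eC: "inv_series (subst_monom (-1) ?w (E_of \<tau> W)) = exp_series (- C W)" for W
    unfolding E_of_def A_def B_def subst_monom_flip_sign[OF nz(1), symmetric] subst_monom_flip_sign[OF nz(2), symmetric]
      subst_monom_flip_sign[OF nz(3)] flip_sign_flip_sign
    by (simp_all add: sub nz C_def[symmetric] inv_exp_series C0)
  have rel': "exp_series (A U) * exp_series (- C (V * U)) * exp_series (B V) =
      exp_series (B V) * exp_series (- C (U * V)) * exp_series (A U)" for U V
    using rel[of U V] by (simp add: commutation_relator_def eA eB eC del: One_nat_def)
  \<comment> \<open>Replacing W by n W multiplies the value of \<tau> at W^i by n^i, so only i = 1
    contributes to the linear part.\<close>
  have poly_log: "poly_series (\<lambda>n. log_E \<tau> (zscale (int n) W)) 0 (lin W)" for W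
    unfolding poly_series_def
  proof
    fix m :: nat
    show "poly_fn (\<lambda>n. coeff (log_E \<tau> (zscale (int n) W)) m) (coeff 0 m) (coeff (lin W) m)"
    proof (cases "m = 0")
      case True then show ?thesis by (simp add: lin_def poly_fn.const)
    next
      case False
      have e: "coeff (log_E \<tau> (zscale (int n) W)) m = - (\<Sum>i | i dvd m. of_nat n ^ i *\<^sub>Q (1 / of_nat i) *\<^sub>Q \<tau> (m div i) (W ^ i))" for n
        unfolding log_E_def using False
        by (auto intro!: sum.cong simp: zscale_power zs Suc_le_eq scaleQ_scaleQ mult.commute elim!: dvdE)
      have "poly_fn (\<lambda>n. - (\<Sum>i | i dvd m. of_nat n ^ i *\<^sub>Q (1 / of_nat i) *\<^sub>Q \<tau> (m div i) (W ^ i)))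
          (- (\<Sum>i | i dvd m. 0)) (- (\<Sum>i | i dvd m. if i = 1 then (1 / of_nat i) *\<^sub>Q \<tau> (m div i) (W ^ i) else 0))"
        using False by (intro poly_fn_minus poly_fn_sum poly_fn_power) (auto simp: Suc_le_eq intro: Nat.gr0I)
      moreover have "(\<Sum>i | i dvd m. if i = 1 then (1 / of_nat i) *\<^sub>Q \<tau> (m div i) (W ^ i) else 0) = \<tau> m W"
        using False by (subst sum_divisors_single) (auto simp: scaleQ_one)
      ultimately show ?thesis using False by (simp add: e lin_def)
    qed
  qed
  have sub0: "subst \<chi> f 0 = (0::(nat \<times> nat, 'a) series)" for \<chi> :: "nat \<Rightarrow> rat" and f
    by (rule rat_linear_0[OF subst_linear])
  have ps: "poly_series (\<lambda>n. subst \<chi> f (log_E \<tau> (zscale (int n) W))) 0 (subst \<chi> f (lin W))"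
    for \<chi> and f :: "nat \<Rightarrow> nat \<times> nat" and W
    using poly_series_subst[OF poly_log, of \<chi> f W] by (simp add: sub0)
  define A1 where "A1 U = subst_monom (-1) ?u (lin U)" for U
  define B1 where "B1 V = subst_monom (-1) ?v (lin V)" for V
  define C1 where "C1 W = subst_monom 1 ?w (lin W)" for W
  have pA: "poly_series (\<lambda>n. A (zscale (int n) W)) 0 (A1 W)"
    and pB: "poly_series (\<lambda>n. B (zscale (int n) W)) 0 (B1 W)"
    and pC: "poly_series (\<lambda>n. C (zscale (int n) W)) 0 (C1 W)" for W
    unfolding A_def B_def C_def A1_def B1_def C1_def subst_monom_eq[OF nz(1)] subst_monom_eq[OF nz(2)] subst_monom_eq[OF nz(3)]
    by (rule ps)+
  have eA1: "poly_series (\<lambda>n. exp_series (A (zscale (int n) W))) 1 (A1 W)"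
    and eB1: "poly_series (\<lambda>n. exp_series (B (zscale (int n) W))) 1 (B1 W)" for W
    by (rule poly_series_exp[OF pA A0] poly_series_exp[OF pB B0])+
  have eC1: "poly_series (\<lambda>n. exp_series (- C (zscale (int n) W))) 1 (- C1 W)" for W
    by (rule poly_series_exp) (use poly_series_minus[OF pC] C0 in simp_all)
  \<comment> \<open>The part linear in n of (1) with U replaced by n U. Only the exponentials
    involving U vary, and each has constant part 1.\<close>
  have first: "(A1 U - C1 (V * U)) * exp_series (B V) = exp_series (B V) * (A1 U - C1 (U * V))" for V
  proof -
    let ?b = "exp_series (B V)"
    have "poly_series (\<lambda>n. exp_series (A (zscale (int n) U)) * exp_series (- C (zscale (int n) (V * U))) * ?b)
        (1 * 1 * ?b) (1 * 1 * 0 + (1 * - C1 (V * U) + A1 U * 1) * ?b)"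
      by (intro poly_series_mult eA1 eC1 poly_series_const)
    moreover have "poly_series (\<lambda>n. ?b * exp_series (- C (zscale (int n) (U * V))) * exp_series (A (zscale (int n) U)))
        (?b * 1 * 1) (?b * 1 * A1 U + (?b * - C1 (U * V) + 0 * 1) * 1)"
      by (intro poly_series_mult eA1 eC1 poly_series_const)
    moreover have "exp_series (A (zscale (int n) U)) * exp_series (- C (zscale (int n) (V * U))) * ?b =
       ?b * exp_series (- C (zscale (int n) (U * V))) * exp_series (A (zscale (int n) U))" for n
      using rel'[of "zscale (int n) U" V] by (simp add: zscale_mult_left zscale_mult_right)
    ultimately have "1 * 1 * 0 + (1 * - C1 (V * U) + A1 U * 1) * ?b = ?b * 1 * A1 U + (?b * - C1 (U * V) + 0 * 1) * 1"
      by (simp only: poly_series_unique)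
    then show ?thesis by (simp add: algebra_simps)
  qed
  have lin_zs: "lin (zscale (int n) W) = of_nat n *\<^sub>Q lin W" for n W
    by (rule series_eqI) (simp add: lin_def zs scaleQ_minus_right)
  have C1_zs: "C1 (zscale (int n) W) = of_nat n *\<^sub>Q C1 W" for n W
    unfolding C1_def lin_zs subst_monom_eq[OF nz(3)] by (rule rat_linear_scaleQ[OF subst_linear])
  \<comment> \<open>The part linear in n of \<open>first\<close> with V replaced by n V; the terms
    \<open>C1\<close> are already linear in V.\<close>
  have second: "A1 U * B1 V - C1 (V * U) = B1 V * A1 U - C1 (U * V)"
  proof -
    have "poly_series (\<lambda>n. (A1 U + - (of_nat n *\<^sub>Q C1 (V * U))) * exp_series (B (zscale (int n) V)))
        ((A1 U + - 0) * 1) ((A1 U + - 0) * B1 V + (0 + - C1 (V * U)) * 1)"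
      by (intro poly_series_mult poly_series_add poly_series_minus poly_series_const poly_series_linear eB1)
    moreover have "poly_series (\<lambda>n. exp_series (B (zscale (int n) V)) * (A1 U + - (of_nat n *\<^sub>Q C1 (U * V))))
        (1 * (A1 U + - 0)) (1 * (0 + - C1 (U * V)) + B1 V * (A1 U + - 0))"
      by (intro poly_series_mult poly_series_add poly_series_minus poly_series_const poly_series_linear eB1)
    moreover have "(A1 U + - (of_nat n *\<^sub>Q C1 (V * U))) * exp_series (B (zscale (int n) V)) =
      exp_series (B (zscale (int n) V)) * (A1 U + - (of_nat n *\<^sub>Q C1 (U * V)))" for n
      using first[of "zscale (int n) V"] by (simp add: zscale_mult_left zscale_mult_right C1_zs)
    ultimately have "(A1 U + - 0) * B1 V + (0 + - C1 (V * U)) * 1 = 1 * (0 + - C1 (U * V)) + B1 V * (A1 U + - 0)"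
      by (simp only: poly_series_unique)
    then show ?thesis by (simp add: algebra_simps)
  qed
  have nm: "nmul n ?u = (n, 0)" "nmul n ?v = (0, n)" "nmul n ?w = (n, n)" for n by (simp_all add: nmul_pair)
  have cA: "coeff (A1 U) p = (if snd p = 0 then (-1) ^ fst p *\<^sub>Q coeff (lin U) (fst p) else 0)" for p
    using coeff_subst_monom(1)[OF nz(1), of "-1" "lin U" "fst p"] coeff_subst_monom(2)[OF nz(1), of p "-1" "lin U"]
    unfolding A1_def nm by (cases p) auto
  have cB: "coeff (B1 V) p = (if fst p = 0 then (-1) ^ snd p *\<^sub>Q coeff (lin V) (snd p) else 0)" for p
    using coeff_subst_monom(1)[OF nz(2), of "-1" "lin V" "snd p"] coeff_subst_monom(2)[OF nz(2), of p "-1" "lin V"]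
    unfolding B1_def nm by (cases p) auto
  have cC: "coeff (C1 W) (k, l) = (if k = l then - \<tau> k W else 0)" for W
    using coeff_subst_monom(1)[OF nz(3), of 1 "lin W" k] coeff_subst_monom(2)[OF nz(3), of "(k, l)" 1 "lin W"] k
    unfolding C1_def nm by (auto simp: lin_def scaleQ_one)
  have fs: "finite (splits (k, l))" by (rule finite_splits)
  \<comment> \<open>\<open>A1\<close> lives on powers of u and \<open>B1\<close> on powers of v, so
    the exponent (k, l) splits in one way. \<open>C1\<close> lives on the diagonal and contributes
    for k = l only.\<close>
  have "coeff (A1 U * B1 V) (k, l) = (\<Sum>(p, q)\<in>{((k, 0), (0, l))}. coeff (A1 U) p * coeff (B1 V) q)"
    unfolding coeff_mult by (rule sum.mono_neutral_right[OF fs]) (auto simp: cA cB split: if_splits)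
  then have AB: "coeff (A1 U * B1 V) (k, l) = ((-1) ^ k * (-1) ^ l) *\<^sub>Q (\<tau> k U * \<tau> l V)"
    using k l by (simp add: cA cB lin_def scaleQ_mult_left scaleQ_mult_right scaleQ_scaleQ scaleQ_minus_right mult.commute)
  have "coeff (B1 V * A1 U) (k, l) = (\<Sum>(p, q)\<in>{((0, l), (k, 0))}. coeff (B1 V) p * coeff (A1 U) q)"
    unfolding coeff_mult by (rule sum.mono_neutral_right[OF fs]) (auto simp: cA cB split: if_splits)
  then have BA: "coeff (B1 V * A1 U) (k, l) = ((-1) ^ k * (-1) ^ l) *\<^sub>Q (\<tau> l V * \<tau> k U)"
    using k l by (simp add: cA cB lin_def scaleQ_mult_left scaleQ_mult_right scaleQ_scaleQ scaleQ_minus_right mult.commute)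
  have "coeff (A1 U * B1 V - C1 (V * U)) (k, l) = coeff (B1 V * A1 U - C1 (U * V)) (k, l)"
    by (simp only: second)
  then have main: "((-1) ^ k * (-1) ^ l) *\<^sub>Q (\<tau> k U * \<tau> l V - \<tau> l V * \<tau> k U) =
      (if k = l then \<tau> k (U * V) - \<tau> k (V * U) else 0)"
    by (auto simp: AB BA cC scaleQ_diff_right algebra_simps split: if_splits)
  show ?thesis
  proof (cases "k = l")
    case True
    then show ?thesis using main by (simp add: power_mult_distrib[symmetric] scaleQ_one)
  next
    case False
    then show ?thesis using main by (simp add: scaleQ_cancel)
  qed
qed

section \<open>The presentation\<close>

text \<open>
  The same presentation with a generator for every \<open>W\<close> in \<open>R\<close> does not mention the basis, so that its
  algebra is a type; it receives the inverse of the evaluation map.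
\<close>

definition gen_series :: "'r \<Rightarrow> (nat, ('r \<times> nat) free_alg) series" where
  "gen_series W = Series (\<lambda>r. if r = 0 then 1 else free_gen (W, r))"

definition universal_relators :: "('r::{ring,monoid_mult} \<times> nat) free_alg set" where
  "universal_relators =
     {coeff (commutation_relator gen_series U V) k | U V k. True} \<union>
     {coeff (moebius_log gen_series (U + V) - (moebius_log gen_series U + moebius_log gen_series V)) n | U V n. True}"

quotient_type (overloaded) 'r pres =
    "('r::{ring,monoid_mult} \<times> nat) free_alg" / "same_mod universal_relators"
  by (rule equivp_same_mod)

instantiation pres :: ("{ring,monoid_mult}") rat_algebra
begin

lift_definition zero_pres :: "'a pres" is 0 .
lift_definition one_pres :: "'a pres" is 1 .
lift_definition plus_pres :: "'a pres \<Rightarrow> 'a pres \<Rightarrow> 'a pres" is "(+)" by (rule same_mod_add)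
lift_definition minus_pres :: "'a pres \<Rightarrow> 'a pres \<Rightarrow> 'a pres" is "(-)" by (rule same_mod_diff)
lift_definition uminus_pres :: "'a pres \<Rightarrow> 'a pres" is "uminus" by (rule same_mod_minus)
lift_definition times_pres :: "'a pres \<Rightarrow> 'a pres \<Rightarrow> 'a pres" is "(*)" by (rule same_mod_mult)
lift_definition scaleQ_pres :: "rat \<Rightarrow> 'a pres \<Rightarrow> 'a pres" is scaleQ by (rule same_mod_scaleQ)

instance
  by standard
    (transfer, rule same_mod_eq, simp add: algebra_simps scaleQ_add_right scaleQ_add_left
      scaleQ_scaleQ scaleQ_one scaleQ_mult_left scaleQ_mult_right)+

end

lemma abs_pres_alg_hom: "alg_hom abs_pres"
  by (simp add: alg_hom_def rat_linear_def plus_pres.abs_eq times_pres.abs_eq scaleQ_pres.abs_eq one_pres.abs_eq)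

lemma abs_pres_eq_0: "abs_pres p = 0 \<longleftrightarrow> p \<in> is_ideal UNIV hull universal_relators"
  by (simp add: zero_pres.abs_eq pres.abs_eq_iff same_mod_def)

lemma abs_pres_relator: "p \<in> universal_relators \<Longrightarrow> abs_pres p = 0"
  by (simp add: abs_pres_eq_0 hull_inc)

lemma coeff_gen_series_0 [simp]: "coeff (gen_series W) 0 = 1"
  by (simp add: gen_series_def)

lemma commutation_relator_pres: "commutation_relator (\<lambda>W. map_series abs_pres (gen_series W)) U V = 0"
proof -
  have "map_series abs_pres (commutation_relator gen_series U V) = 0"
    by (rule series_eqI, unfold coeff_map_series coeff_0, rule abs_pres_relator, unfold universal_relators_def, blast)
  then show ?thesis by (simp add: map_series_commutation_relator[OF abs_pres_alg_hom])
qed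

lemma moebius_additive_pres: "moebius_additive (\<lambda>W :: 'r::{ring,monoid_mult}. map_series abs_pres (gen_series W))"
proof -
  note lin = map_series_linear[OF alg_hom_linear[OF abs_pres_alg_hom]]
  have "map_series abs_pres (moebius_log gen_series (U + V) - (moebius_log gen_series U + moebius_log gen_series V)) = 0" for U V :: 'r
    by (rule series_eqI, unfold coeff_map_series coeff_0, rule abs_pres_relator, unfold universal_relators_def, blast)
  then have "map_series abs_pres (moebius_log gen_series (U + V)) =
      map_series abs_pres (moebius_log gen_series U) + map_series abs_pres (moebius_log gen_series V)" for U V :: 'r
    by (simp add: rat_linear_diff[OF lin] rat_linear_add[OF lin])
  then show ?thesis
    by (simp add: moebius_additive_def map_series_moebius_log[OF abs_pres_alg_hom])
qed

lemma E_of_cong: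
  assumes "\<And>n W. n \<ge> 1 \<Longrightarrow> \<tau> n W = \<tau>' n W" shows "E_of \<tau> W = E_of \<tau>' W"
proof -
  have "log_E \<tau> W = log_E \<tau>' W"
  proof (rule series_eqI)
    fix n
    have "(\<Sum>k | k dvd n. (1 / of_nat k) *\<^sub>Q \<tau> (n div k) (W ^ k)) = (\<Sum>k | k dvd n. (1 / of_nat k) *\<^sub>Q \<tau>' (n div k) (W ^ k))"
      if "n \<noteq> 0"
    proof (rule sum.cong[OF refl])
      fix k assume "k \<in> {k. k dvd n}"
      then have "n div k \<ge> 1" using that by (auto simp: Suc_le_eq elim!: dvdE)
      then show "(1 / of_nat k) *\<^sub>Q \<tau> (n div k) (W ^ k) = (1 / of_nat k) *\<^sub>Q \<tau>' (n div k) (W ^ k)"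
        by (simp only: assms)
    qed
    then show "coeff (log_E \<tau> W) n = coeff (log_E \<tau>' W) n" by (simp add: log_E_def)
  qed
  then show ?thesis by (simp add: E_of_def)
qed

lemma map_series_E_of:
  assumes h: "alg_hom h" shows "map_series h (E_of \<tau> W) = E_of (\<lambda>n W. h (\<tau> n W)) W"
proof -
  note lin = alg_hom_linear[OF h]
  have "map_series h (log_E \<tau> W) = log_E (\<lambda>n W. h (\<tau> n W)) W"
    by (rule series_eqI)
      (simp add: log_E_def rat_linear_0[OF lin] rat_linear_minus[OF lin] rat_linear_sum[OF lin] rat_linear_scaleQ[OF lin])
  then show ?thesis
    by (simp add: E_of_def map_series_flip_sign[OF lin] exp_series_def map_series_eval_series[OF h])
qed

text \<open>The Moebius coordinates \<tau> of the tautological family in the presented algebra are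
  additive and satisfy the bracket relations, so \<open>ginf_lift\<close> applies; the generators
  are recovered because \<tau> determines the series.\<close>

lemma ginf_to_pres:
  obtains h :: "'r::{ring,monoid_mult} ginf \<Rightarrow> 'r pres"
  where "alg_hom h" "\<And>W r. r \<ge> 1 \<Longrightarrow> h (e_ginf r W) = abs_pres (free_gen (W, r))"
proof -
  define E where "E W = map_series abs_pres (gen_series W)" for W :: 'r
  have E0: "coeff (E W) 0 = 1" for W by (simp add: E_def alg_hom_1[OF abs_pres_alg_hom])
  define \<tau> where "\<tau> n W = - coeff (moebius_log E W) n" for n W
  have E: "E_of \<tau> W = E W" for W
    unfolding \<tau>_def[abs_def] by (rule E_of_moebius_log[OF E0])
  have add: "\<tau> n (U + V) = \<tau> n U + \<tau> n V" for n U V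
    using moebius_additive_pres[where 'r = 'r] by (simp add: \<tau>_def E_def[abs_def] moebius_additive_def)
  have rel: "commutation_relator (E_of \<tau>) U V = 0" for U V
  proof -
    have "E_of \<tau> = E" by (rule ext) (rule E)
    then show ?thesis unfolding E_def[abs_def] by (simp only: commutation_relator_pres)
  qed
  obtain h :: "'r ginf \<Rightarrow> 'r pres" where h: "alg_hom h" and hT: "\<And>l x. l \<ge> 1 \<Longrightarrow> h (T_one l x) = \<tau> l x"
  proof (rule ginf_lift[of \<tau>])
    show "\<tau> k x * \<tau> l y - \<tau> l y * \<tau> k x = (if k = l then \<tau> k (x * y) - \<tau> k (y * x) else 0)"
      if "1 \<le> k" "1 \<le> l" for k l x y
      by (rule commutation_relator_imp_bracket[of \<tau>, OF add rel that])
  qed (rule add that; assumption?)+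
  have "map_series h (E_ginf W) = E W" for W
    unfolding E_ginf_E_of map_series_E_of[OF h] E[symmetric] by (rule E_of_cong) (rule hT)
  then have "h (e_ginf r W) = coeff (E W) r" for r W by (metis coeff_E_ginf coeff_map_series)
  then show ?thesis by (intro that[of h] h) (simp add: E_def gen_series_def)
qed

section \<open>The free algebra on a subset of the generators\<close>

lemma free_on_one [simp]: "1 \<in> free_on X"
  by (simp add: free_on_def flip: single_one)

lemma free_on_zero [simp]: "0 \<in> free_on X"
  by (simp add: free_on_def)

lemma free_on_add: "p \<in> free_on X \<Longrightarrow> q \<in> free_on X \<Longrightarrow> p + q \<in> free_on X"
  using keys_add[of p q] by (auto simp: free_on_def)

lemma free_on_scaleQ: "p \<in> free_on X \<Longrightarrow> c *\<^sub>Q p \<in> free_on X"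
  by (auto simp: free_on_def in_keys_iff)

lemma free_on_minus: "p \<in> free_on X \<Longrightarrow> - p \<in> free_on X"
  using free_on_scaleQ[of p X "-1"] by (simp add: scaleQ_minus_left scaleQ_one)

lemma free_on_diff: "p \<in> free_on X \<Longrightarrow> q \<in> free_on X \<Longrightarrow> p - q \<in> free_on X"
  using free_on_add[OF _ free_on_minus, of p X q] by simp

lemma free_on_mult:
  assumes "p \<in> free_on X" "q \<in> free_on X" shows "p * q \<in> free_on X"
  unfolding free_on_def
proof (clarify)
  fix w x assume "w \<in> Poly_Mapping.keys (p * q)" "x \<in> set (letters w)"
  then obtain a b where "w = a + b" "a \<in> Poly_Mapping.keys p" "b \<in> Poly_Mapping.keys q"
    using keys_mult[of p q] by blast
  then show "x \<in> X" using assms \<open>x \<in> set (letters w)\<close> by (auto simp: free_on_def)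
qed

lemma free_on_gen: "x \<in> X \<Longrightarrow> free_gen x \<in> free_on X"
  by (simp add: free_on_def free_gen_def)

text \<open>A retraction onto the subalgebra. It proves membership in \<open>free_on X\<close> by
  invariance and brings ideals of the whole free algebra back to the subalgebra.\<close>

definition restrict_gens :: "'x set \<Rightarrow> 'x free_alg \<Rightarrow> 'x free_alg" where
  "restrict_gens X = free_eval (\<lambda>x. if x \<in> X then free_gen x else 0)"

lemma restrict_gens_alg_hom: "alg_hom (restrict_gens X)"
  unfolding restrict_gens_def by (rule free_eval_alg_hom)

lemma restrict_gens_in: "restrict_gens X p \<in> free_on X"
proof -
  note h = restrict_gens_alg_hom[of X]
  have "p \<in> free_on UNIV" by simp
  then show ?thesis
  proof (induction p rule: free_on_induct)
    case (gen x p)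
    then show ?case
      by (auto simp: alg_hom_mult[OF h] restrict_gens_def[of X, THEN fun_cong, of "free_gen x"] free_on_gen intro!: free_on_mult)
  qed (simp_all add: alg_hom_1[OF h] rat_linear_add[OF alg_hom_linear[OF h]]
      rat_linear_scaleQ[OF alg_hom_linear[OF h]] free_on_add free_on_scaleQ)
qed

lemma restrict_gens_id: "p \<in> free_on X \<Longrightarrow> restrict_gens X p = p"
  by (rule alg_hom_free_eqI[OF restrict_gens_alg_hom, of "\<lambda>p. p" X])
    (auto simp: alg_hom_def rat_linear_def restrict_gens_def)

text \<open>The retraction fixes S and p and maps multipliers into the subalgebra, so an expression
  of p through S over the whole free algebra becomes one over the subalgebra.\<close>

lemma ideal_hull_free_on:
  assumes S: "S \<subseteq> free_on X" and p: "p \<in> free_on X" "p \<in> is_ideal UNIV hull S"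
  shows "p \<in> is_ideal (free_on X) hull S"
proof -
  let ?J = "is_ideal (free_on X) hull S"
  have "is_ideal (free_on X) (free_on X)"
    by (auto simp: is_ideal_def free_on_diff free_on_mult)
  then have sub: "?J \<subseteq> free_on X" using S by (intro hull_minimal) auto
  have J: "is_ideal (free_on X) ?J"
  proof -
    have "0 \<in> ?J" by (auto simp: hull_def is_ideal_def)
    moreover have "x - y \<in> ?J" if "x \<in> ?J" "y \<in> ?J" for x y using that by (fastforce simp: hull_def is_ideal_def)
    moreover have "a * x \<in> ?J" "x * a \<in> ?J" if "x \<in> ?J" "a \<in> free_on X" for x a
      using that by (fastforce simp: hull_def is_ideal_def)+
    ultimately show ?thesis using sub by (auto simp: is_ideal_def)
  qed
  note h = restrict_gens_alg_hom[of X]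
  note lin = alg_hom_linear[OF h]
  have "p - 0 \<in> {p. restrict_gens X p \<in> ?J}"
  proof (rule same_mod_ideal)
    show "same_mod S p 0" using p by (simp add: same_mod_def)
    show "S \<subseteq> {p. restrict_gens X p \<in> ?J}" using S by (auto simp: restrict_gens_id hull_inc)
    show "is_ideal UNIV {p. restrict_gens X p \<in> ?J}"
      using J by (auto simp: is_ideal_def rat_linear_0[OF lin] rat_linear_diff[OF lin] alg_hom_mult[OF h] restrict_gens_in)
  qed
  then show ?thesis using p by (simp add: restrict_gens_id)
qed

section \<open>Kernel and image of the evaluation map\<close>

context
  fixes I :: "'r::{ring,monoid_mult} set"
  assumes I: "is_int_basis I"
begin

abbreviation (input) "X \<equiv> I \<times> {1::nat..}"

abbreviation (input) "ev \<equiv> free_eval (\<lambda>(U, r). e_ginf r U)"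

text \<open>Deleting the other generators gives a family with the same coefficients on the basis,
  hence the same family by uniqueness. This is how the relators are seen to lie in
  \<open>free_on X\<close>.\<close>

lemma restrict_gens_E_free: "map_series (restrict_gens X) (E_free I W) = E_free I W"
proof -
  note h = restrict_gens_alg_hom[of X]
  have "(\<lambda>W. map_series (restrict_gens X) (E_free I W)) = E_free I"
  proof (rule E_family_unique[OF I])
    show "moebius_additive (\<lambda>W. map_series (restrict_gens X) (E_free I W))"
      by (rule moebius_additive_map[OF h coeff_E_free_0[OF I] moebius_additive_E_free[OF I]])
  qed (auto simp: coeff_E_free_0[OF I] coeff_E_free_gen[OF I] alg_hom_1[OF h] restrict_gens_id free_on_gen
      intro!: moebius_additive_E_free[OF I])
  then show ?thesis by metis
qed

lemma map_fixed_free_on: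
  assumes "map_series (restrict_gens X) x = x" shows "coeff x m \<in> free_on X"
  by (metis assms coeff_map_series restrict_gens_in)

lemma commutation_relator_free_on: "coeff (commutation_relator (E_free I) U V) k \<in> free_on X"
  by (rule map_fixed_free_on)
    (simp only: map_series_commutation_relator[OF restrict_gens_alg_hom coeff_E_free_0[OF I]] restrict_gens_E_free)

lemma moebius_log_free_on: "coeff (moebius_log (E_free I) U) k \<in> free_on X"
  by (rule map_fixed_free_on)
    (simp only: map_series_moebius_log[OF restrict_gens_alg_hom coeff_E_free_0[OF I]] restrict_gens_E_free)

lemma relators_free_on: "relators I \<subseteq> free_on X"
  using commutation_relator_free_on
  by (auto simp: relators_def moebius_additive_relator[OF moebius_additive_E_free[OF I]])

text \<open>Both families are additive in the sense of (2) and agree on I. Thus the polynomials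
  fixed recursively by (2) evaluate to the e_r(W) that were defined directly.\<close>

lemma ev_E_free: "map_series ev (E_free I W) = E_ginf W"
proof -
  note h = free_eval_alg_hom
  have "(\<lambda>W. map_series ev (E_free I W)) = E_ginf"
  proof (rule E_family_unique[OF I])
    show "moebius_additive (\<lambda>W. map_series ev (E_free I W))"
      by (rule moebius_additive_map[OF h coeff_E_free_0[OF I] moebius_additive_E_free[OF I]])
  qed (auto simp: coeff_E_free_0[OF I] coeff_E_free_gen[OF I] alg_hom_1[OF h] e_ginf_0
      intro!: moebius_additive_E_ginf)
  then show ?thesis by metis
qed

lemma ev_coeff_E_free: "ev (coeff (E_free I W) r) = e_ginf r W"
  by (metis coeff_E_ginf coeff_map_series ev_E_free)

lemma ev_relators: "p \<in> relators I \<Longrightarrow> ev p = 0"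
proof -
  note h = free_eval_alg_hom
  have "map_series ev (commutation_relator (E_free I) U V) = 0" for U V
    by (simp add: map_series_commutation_relator[OF h coeff_E_free_0[OF I]] ev_E_free commutation_relator_E_ginf)
  then have "ev (coeff (commutation_relator (E_free I) U V) k) = 0" for U V k
    by (metis coeff_0 coeff_map_series)
  then show "p \<in> relators I \<Longrightarrow> ev p = 0"
    by (auto simp: relators_def moebius_additive_relator[OF moebius_additive_E_free[OF I]]
        rat_linear_0[OF alg_hom_linear[OF h]])
qed

lemma kernel_subset:
  assumes p: "p \<in> free_on X" "ev p = 0"
  shows "p \<in> is_ideal UNIV hull relators I"
proof -
  obtain h :: "'r ginf \<Rightarrow> 'r pres" where h: "alg_hom h"
    "\<And>W r. r \<ge> 1 \<Longrightarrow> h (e_ginf r W) = abs_pres (free_gen (W, r))"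
    by (rule ginf_to_pres) (rule that; assumption)
  have "h (ev p) = abs_pres p"
    by (rule alg_hom_free_eqI[OF alg_hom_comp[OF h(1) free_eval_alg_hom] abs_pres_alg_hom _ p(1)]) (auto simp: h(2))
  then have "abs_pres p = 0" using p(2) rat_linear_0[OF alg_hom_linear[OF h(1)]] by simp
  then have "same_mod universal_relators p 0" by (simp add: abs_pres_eq_0 same_mod_def)
  \<comment> \<open>Sends the generator (W, r), for arbitrary W, to the polynomial in basis
    generators prescribed by (2). It carries the basis-free relators into the ideal of
    \<open>relators I\<close> and fixes p.\<close>
  moreover define \<theta> where "\<theta> = free_eval (\<lambda>(W, r). coeff (E_free I W) r)"
  have \<theta>: "alg_hom \<theta>" unfolding \<theta>_def by (rule free_eval_alg_hom)
  note lin = alg_hom_linear[OF \<theta>]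
  have gen: "map_series \<theta> (gen_series W) = E_free I W" for W
    by (rule series_eqI) (auto simp: gen_series_def alg_hom_1[OF \<theta>] coeff_E_free_0[OF I], simp add: \<theta>_def)
  let ?K = "{q. \<theta> q \<in> is_ideal UNIV hull relators I}"
  have "universal_relators \<subseteq> ?K"
  proof
    fix q :: "('r \<times> nat) free_alg" assume "q \<in> universal_relators"
    then consider U V k where "q = coeff (commutation_relator gen_series U V) k"
      | U V n where "q = coeff (moebius_log gen_series (U + V) - (moebius_log gen_series U + moebius_log gen_series V)) n"
      unfolding universal_relators_def by blast
    then show "q \<in> ?K"
    proof cases
      case 1
      have "\<theta> q = coeff (map_series \<theta> (commutation_relator gen_series U V)) k" by (simp add: 1)
      also have "\<dots> = coeff (commutation_relator (E_free I) U V) k"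
        by (simp add: map_series_commutation_relator[OF \<theta>] gen)
      finally have "\<theta> q \<in> relators I" unfolding relators_def by blast
      then show ?thesis by (simp add: hull_inc)
    next
      case 2
      have e: "\<theta> (coeff (moebius_log gen_series W) n) = coeff (moebius_log (E_free I) W) n" for W
        using map_series_moebius_log[OF \<theta>, of gen_series W] by (simp add: gen) (metis coeff_map_series)
      have "\<theta> q = 0"
        using moebius_additive_E_free[OF I]
        by (simp add: 2 rat_linear_diff[OF lin] rat_linear_add[OF lin] e moebius_additive_def)
      then show ?thesis by simp
    qed
  qed
  moreover have "is_ideal UNIV ?K"
    by (auto simp: is_ideal_def rat_linear_0[OF lin] rat_linear_diff[OF lin] alg_hom_mult[OF \<theta>]
        intro: hull_ideal_diff hull_ideal_mult)
  ultimately have "p - 0 \<in> ?K" by (rule same_mod_ideal)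
  moreover have "\<theta> p = p"
    by (rule alg_hom_free_eqI[OF \<theta> _ _ p(1)])
      (auto simp: alg_hom_def rat_linear_def \<theta>_def coeff_E_free_gen[OF I])
  ultimately show ?thesis by simp
qed

text \<open>\<open>T_one l U\<close> is minus a Moebius coordinate of \<open>E_ginf\<close>, hence
  the image of a coefficient over the free algebra, and these elements generate.\<close>

lemma ev_surjective: "ev ` free_on X = UNIV"
proof (rule ginf_generated)
  note h = free_eval_alg_hom[of "\<lambda>(U, r). e_ginf r U"]
  note lin = alg_hom_linear[OF h]
  show "1 \<in> ev ` free_on X" by (rule image_eqI[of _ _ 1]) (simp_all add: alg_hom_1[OF h])
  show "x + y \<in> ev ` free_on X" if "x \<in> ev ` free_on X" "y \<in> ev ` free_on X" for x y
    using that by (auto simp: rat_linear_add[OF lin, symmetric] free_on_add)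
  show "x * y \<in> ev ` free_on X" if "x \<in> ev ` free_on X" "y \<in> ev ` free_on X" for x y
    using that by (auto simp: alg_hom_mult[OF h, symmetric] free_on_mult)
  show "c *\<^sub>Q x \<in> ev ` free_on X" if "x \<in> ev ` free_on X" for c x
    using that by (auto simp: rat_linear_scaleQ[OF lin, symmetric] free_on_scaleQ)
  fix l :: nat and U :: 'r assume l: "1 \<le> l"
  have "T_one l U = - coeff (map_series ev (moebius_log (E_free I) U)) l"
    unfolding map_series_moebius_log[OF h coeff_E_free_0[OF I]] ev_E_free by (rule T_one_moebius_log[OF l])
  also have "\<dots> = ev (- coeff (moebius_log (E_free I) U) l)" by (simp add: rat_linear_minus[OF lin])
  finally show "T_one l U \<in> ev ` free_on X" using free_on_minus[OF moebius_log_free_on] by blast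
qed

lemma presentation: "is_presentation X (relators I) (\<lambda>(U, r). e_ginf r U)"
  unfolding is_presentation_def
proof (intro conjI relators_free_on ev_surjective equalityI subsetI)
  fix p assume "p \<in> {p \<in> free_on X. ev p = 0}"
  then show "p \<in> is_ideal (free_on X) hull relators I"
    using ideal_hull_free_on[OF relators_free_on] kernel_subset by blast
next
  note h = free_eval_alg_hom[of "\<lambda>(U, r). e_ginf r U"]
  note lin = alg_hom_linear[OF h]
  have "is_ideal (free_on X) hull relators I \<subseteq> {p \<in> free_on X. ev p = 0}"
  proof (rule hull_minimal)
    show "relators I \<subseteq> {p \<in> free_on X. ev p = 0}" using relators_free_on ev_relators by blast
    show "is_ideal (free_on X) {p \<in> free_on X. ev p = 0}"
      by (auto simp: is_ideal_def rat_linear_0[OF lin] rat_linear_diff[OF lin] alg_hom_mult[OF h]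
          free_on_diff free_on_mult)
  qed
  then show "p \<in> is_ideal (free_on X) hull relators I \<Longrightarrow> p \<in> {p \<in> free_on X. ev p = 0}" for p by blast
qed

end

section \<open>The product \<open>\<Phi>(X) = \<Prod>\<^sub>l \<Theta>\<^sub>l(\<psi>\<^sub>l X)\<close>\<close>

definition Phi :: "('m::graded_splits, 'r::{ring,monoid_mult} rat_tensor) series \<Rightarrow> ('m, 'r ginf) series" where
  "Phi x = theta_prod (\<lambda>l. adams l x)"

lemma near_one_adams: "coeff x 0 = 1 \<Longrightarrow> near_one (\<lambda>l. adams l x)"
  by (simp add: near_one_def ord_ge_adams)

lemma Phi_mult: "coeff x 0 = 1 \<Longrightarrow> coeff y 0 = 1 \<Longrightarrow> Phi (x * y) = Phi x * Phi y"
  unfolding Phi_def theta_prod_mult[OF near_one_adams near_one_adams]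
  by (rule theta_prod_cong) (simp add: subst_mult[OF monomial_map_adams])

lemma Phi_one [simp]: "Phi 1 = 1"
proof -
  have "Phi 1 = theta_prod (\<lambda>_. 1)"
    unfolding Phi_def by (rule theta_prod_cong) (simp add: subst_1[OF monomial_map_adams])
  then show ?thesis by simp
qed

lemma Phi_prod_list:
  "(\<And>x. x \<in> set xs \<Longrightarrow> coeff x 0 = 1) \<Longrightarrow> Phi (prod_list xs) = prod_list (map Phi xs)
    \<and> coeff (prod_list xs) (0::'m::graded_splits) = 1"
  by (induction xs) (auto simp: Phi_mult coeff_1)

lemma coeff_Phi_0: "coeff x 0 = 1 \<Longrightarrow> coeff (Phi x) 0 = 1"
  unfolding Phi_def by (rule coeff_theta_prod_0[OF near_one_adams])

lemma ord_ge_Phi: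
  assumes x: "ord_ge p (x - 1)" and p: "p \<ge> 1"
  shows "ord_ge p (Phi x - 1)"
proof -
  have x0: "coeff x 0 = 1" using x p by (force simp: ord_ge_def coeff_1)
  let ?f = "\<lambda>l. theta (T_map l) (adams l x)"
  have l: "ord_ge p (?f l - 1)" if "l \<ge> 1" for l
    using that x p by (intro ord_ge_theta T_map_linear ord_ge_adams_cong)
  have "ord_ge p (partial_prod ?f N - 1)" for N
  proof (induction N)
    case (Suc N)
    show ?case
    proof (cases "N \<ge> 1")
      case True
      then show ?thesis using ord_ge_cong_mult[OF Suc l[OF True]] by (simp add: partial_prod_Suc)
    qed (simp add: ord_ge_def)
  qed (simp add: ord_ge_def)
  then show ?thesis
    using prod_series_approx[OF near_one_theta[OF near_one_adams[OF x0]] p]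
    unfolding Phi_def theta_prod_def by (blast intro: ord_ge_trans)
qed

lemma subst_Phi:
  assumes \<chi>: "monomial_map \<chi> f" and idem: "\<And>m. \<chi> m * \<chi> m = \<chi> m" and x: "coeff x 0 = 1"
  shows "subst \<chi> f (Phi x) = Phi (subst \<chi> f x)"
  unfolding Phi_def subst_theta_prod[OF \<chi> near_one_adams[OF x]]
  by (rule theta_prod_cong) (rule subst_adams[OF \<chi> idem])

text \<open>The sign-free companion of e_r: the argument 1 + tW makes its generating series a value
  of \<open>Phi\<close>, a form that the alternating signs deny to the series of e_r.\<close>

definition g_elem :: "nat \<Rightarrow> 'r::{ring,monoid_mult} \<Rightarrow> 'r ginf" where
  "g_elem r W = coeff (Phi (1 + monom (1::nat) (tensor_one W))) r"

text \<open>Naturality under t -> x^k. The coefficients of \<open>Phi\<close> at a single factor are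
  therefore elements \<open>g_elem r W\<close>, sitting at the multiples of k.\<close>

lemma Phi_one_plus_monom:
  assumes k: "(k::'m::graded_splits) \<noteq> 0"
  shows "Phi (1 + monom k (tensor_one W)) =
    subst (\<lambda>_. 1) (\<lambda>n. nmul n k) (Series (\<lambda>r. g_elem r W))"
proof -
  have \<chi>: "monomial_map (\<lambda>_. 1) (\<lambda>n. nmul n k)" using monomial_map_power[OF k, where c = 1] by simp
  have "Series (\<lambda>r. g_elem r W) = Phi (1 + monom (1::nat) (tensor_one W))"
    by (rule series_eqI) (simp add: g_elem_def)
  then show ?thesis
    by (simp add: subst_Phi[OF \<chi>] coeff_1 coeff_monom rat_linear_add[OF subst_linear] subst_1[OF \<chi>]
        subst_monomial[OF \<chi>] scaleQ_one)
qed

lemma coeff_subst_nmul: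
  assumes k: "(k::'m::graded_splits) \<noteq> 0"
  shows "coeff (subst (\<lambda>_. 1) (\<lambda>n. nmul n k) x) (nmul n k) = coeff x n"
    "\<nexists>n. m = nmul n k \<Longrightarrow> coeff (subst (\<lambda>_. 1) (\<lambda>n. nmul n k) x) m = 0"
  using coeff_subst_monom[OF k, where c = 1 and x = x] by (simp_all add: subst_monom_eq[OF k] scaleQ_one)

lemma g_elem_0 [simp]: "g_elem 0 W = 1"
  unfolding g_elem_def by (rule coeff_Phi_0) (simp add: coeff_1 coeff_monom)

lemma g_elem_zero: "g_elem r 0 = (if r = 0 then 1 else 0)"
proof -
  have "monom (1::nat) (0::'a rat_tensor) = 0" by (rule series_eqI) (simp add: coeff_monom)
  then show ?thesis by (simp add: g_elem_def coeff_1)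
qed

text \<open>After t -> -t the arguments in the product for E_U are 1 - t^l U, which are the Adams
  images of 1 + t(-U).\<close>

lemma e_ginf_g_elem: "e_ginf r U = (-1) ^ r *\<^sub>Q g_elem r (- U)"
proof -
  have "flip_sign (E_ginf U) = theta_prod (\<lambda>l. 1 - monom (nmul l 1) (((-1) ^ l * (-1) ^ l) *\<^sub>Q tensor_one U))"
    unfolding flip_sign_def by (rule subst_monom_E_ginf) simp
  also have "\<dots> = Phi (1 + monom (1::nat) (tensor_one (- U)))"
    unfolding Phi_def
    by (rule theta_prod_cong)
      (simp add: rat_linear_diff[OF subst_linear] subst_1[OF monomial_map_adams] subst_monomial[OF monomial_map_adams]
        power_mult_distrib[symmetric] scaleQ_one tensor_one_minus monom_minus[symmetric])
  finally have "coeff (flip_sign (E_ginf U)) r = g_elem r (- U)" by (simp add: g_elem_def)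
  then have "(-1) ^ r *\<^sub>Q ((-1) ^ r *\<^sub>Q e_ginf r U) = (-1) ^ r *\<^sub>Q g_elem r (- U)" by simp
  then show ?thesis by (simp add: scaleQ_scaleQ power_mult_distrib[symmetric] scaleQ_one)
qed

section \<open>A filtration by integral spans\<close>

lemma zscale_closed:
  assumes "0 \<in> A" "\<And>x y. x \<in> A \<Longrightarrow> y \<in> A \<Longrightarrow> x + y \<in> A" "\<And>x. x \<in> A \<Longrightarrow> - x \<in> A" "x \<in> A"
  shows "zscale c x \<in> (A :: 'a::ab_group_add set)"
proof -
  have "(\<Sum>_<n. x) \<in> A" for n :: nat by (induction n) (auto simp: assms)
  then show ?thesis using assms(2,3) unfolding zscale_def diff_conv_add_uminus by blast
qed

lemma int_subspaceI:
  assumes "0 \<in> A" "\<And>x y. x \<in> A \<Longrightarrow> y \<in> A \<Longrightarrow> x + y \<in> A" "\<And>x. x \<in> A \<Longrightarrow> - x \<in> A"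
  shows "int_module.subspace (A :: 'a::ab_group_add set)"
  by (rule int_module.subspaceI) (auto intro: assms zscale_closed)

lemma int_span_mult:
  fixes x y :: "'a::{ring,monoid_mult}"
  assumes x: "x \<in> int_module.span A" and y: "y \<in> int_module.span B"
    and AB: "\<And>a b. a \<in> A \<Longrightarrow> b \<in> B \<Longrightarrow> a * b \<in> int_module.span C"
  shows "x * y \<in> int_module.span C"
  using x
proof (induction x rule: int_module.span_induct_alt)
  case base show ?case by (simp add: int_module.span_zero)
next
  case (step c a x)
  have "a * y \<in> int_module.span C"
    using y
  proof (induction y rule: int_module.span_induct_alt)
    case base show ?case by (simp add: int_module.span_zero)
  next
    case (step d b y)
    then show ?case
      using AB[OF \<open>a \<in> A\<close>, of b]
      by (simp add: distrib_left zscale_mult_right int_module.span_add int_module.span_scale)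
  qed
  then show ?case using step
    by (simp add: distrib_right zscale_mult_left int_module.span_add int_module.span_scale)
qed

abbreviation g_word :: "(nat \<times> 'r::{ring,monoid_mult}) list \<Rightarrow> 'r ginf" where
  "g_word ws \<equiv> prod_list (map (\<lambda>(r, W). g_elem r W) ws)"

text \<open>The grading is by the sum of the indices r, with letters taken from B; a letter with r =
  0 equals 1 and costs nothing.\<close>

definition gspan :: "'r::{ring,monoid_mult} set \<Rightarrow> nat \<Rightarrow> 'r ginf set" where
  "gspan B d = int_module.span {g_word ws | ws. snd ` set ws \<subseteq> B \<and> sum_list (map fst ws) \<le> d}"

lemma gspan_word: "snd ` set ws \<subseteq> B \<Longrightarrow> sum_list (map fst ws) \<le> d \<Longrightarrow> g_word ws \<in> gspan B d"
  unfolding gspan_def by (rule int_module.span_base) blast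

lemma gspan_mono: "B \<subseteq> B' \<Longrightarrow> d \<le> d' \<Longrightarrow> gspan B d \<subseteq> gspan B' d'"
  unfolding gspan_def by (rule int_module.span_mono) force

lemma gspan_0: "0 \<in> gspan B d"
  and gspan_add: "x \<in> gspan B d \<Longrightarrow> y \<in> gspan B d \<Longrightarrow> x + y \<in> gspan B d"
  and gspan_minus: "x \<in> gspan B d \<Longrightarrow> - x \<in> gspan B d"
  and gspan_diff: "x \<in> gspan B d \<Longrightarrow> y \<in> gspan B d \<Longrightarrow> x - y \<in> gspan B d"
  unfolding gspan_def
  by (simp_all only: int_module.span_zero int_module.span_add int_module.span_neg int_module.span_diff)

lemma gspan_sum: "(\<And>i. i \<in> A \<Longrightarrow> f i \<in> gspan B d) \<Longrightarrow> sum f A \<in> gspan B d"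
  unfolding gspan_def by (rule int_module.span_sum)

lemma gspan_1: "1 \<in> gspan B d"
  using gspan_word[of "[]" B d] by simp

lemma gspan_gen: "W \<in> B \<Longrightarrow> r \<le> d \<Longrightarrow> g_elem r W \<in> gspan B d"
  using gspan_word[of "[(r, W)]" B d] by simp

lemma gspan_mult:
  assumes "x \<in> gspan B d" "y \<in> gspan B d'" "d + d' \<le> e"
  shows "x * y \<in> gspan B e"
  using assms(1,2) unfolding gspan_def
proof (rule int_span_mult)
  fix a b assume "a \<in> {g_word ws | ws. snd ` set ws \<subseteq> B \<and> sum_list (map fst ws) \<le> d}"
    "b \<in> {g_word ws | ws. snd ` set ws \<subseteq> B \<and> sum_list (map fst ws) \<le> d'}"
  then obtain ws ws' where "a = g_word ws" "b = g_word ws'" "snd ` set ws \<subseteq> B" "snd ` set ws' \<subseteq> B"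
    "sum_list (map fst ws) \<le> d" "sum_list (map fst ws') \<le> d'" by blast
  then have "a * b = g_word (ws @ ws')" "snd ` set (ws @ ws') \<subseteq> B" "sum_list (map fst (ws @ ws')) \<le> e"
    using assms(3) by auto
  then show "a * b \<in> int_module.span {g_word ws | ws. snd ` set ws \<subseteq> B \<and> sum_list (map fst ws) \<le> e}"
    using gspan_word[of "ws @ ws'" B e] by (simp only: gspan_def)
qed

text \<open>The slope p measures the gain: in degree k only words of total index at most k / p
  occur. The cutoff D lets a series be factored in finitely many rounds.\<close>

definition filtered ::
    "'r::{ring,monoid_mult} set \<Rightarrow> nat \<Rightarrow> nat \<Rightarrow> ('m::graded_splits, 'r ginf) series \<Rightarrow> bool" where
  "filtered B D p x \<longleftrightarrow> (\<forall>k. mdeg k \<le> D \<longrightarrow> coeff x k \<in> gspan B (mdeg k div p))"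

lemma filtered_1: "filtered B D p 1"
  by (auto simp: filtered_def coeff_1 gspan_1 gspan_0)

lemma filtered_mult:
  assumes "filtered B D p x" "filtered B D p y" shows "filtered B D p (x * y)"
  unfolding filtered_def coeff_mult
proof (intro allI impI gspan_sum)
  fix k :: 'b and q assume k: "mdeg k \<le> D" and "q \<in> splits k"
  then obtain a b where q: "q = (a, b)" "a + b = k" by blast
  then have "coeff x a \<in> gspan B (mdeg a div p)" "coeff y b \<in> gspan B (mdeg b div p)"
    using assms k mdeg_add[of a b] by (auto simp: filtered_def)
  moreover have "mdeg a div p + mdeg b div p \<le> mdeg k div p"
    using div_add1_eq[of "mdeg a" "mdeg b" p] q(2) mdeg_add[of a b] by simp
  ultimately show "(case q of (a, b) \<Rightarrow> coeff x a * coeff y b) \<in> gspan B (mdeg k div p)"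
    unfolding q(1) prod.case by (rule gspan_mult)
qed

lemma filtered_prod_list: "(\<And>x. x \<in> set xs \<Longrightarrow> filtered B D p x) \<Longrightarrow> filtered B D p (prod_list xs)"
  by (induction xs) (auto simp: filtered_1 filtered_mult)

text \<open>Coefficients lie in the image of R, which keeps the factorisation free of denominators.
  N stands for a submonoid with finitely many monomials in each degree, such as those in finitely
  many variables.\<close>

definition integral_on :: "'m set \<Rightarrow> ('m::graded_splits, 'r::{ring,monoid_mult} rat_tensor) series \<Rightarrow> bool" where
  "integral_on N x \<longleftrightarrow> (\<forall>m. coeff x m \<in> range tensor_one \<and> (coeff x m \<noteq> 0 \<longrightarrow> m \<in> N))"

lemma range_tensor_one:
  fixes x y :: "'r::{ring,monoid_mult} rat_tensor"
  shows "(0 :: 'r rat_tensor) \<in> range tensor_one" "(1 :: 'r rat_tensor) \<in> range tensor_one"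
  "x \<in> range tensor_one \<Longrightarrow> y \<in> range tensor_one \<Longrightarrow> x + y \<in> range tensor_one"
  "x \<in> range tensor_one \<Longrightarrow> - x \<in> range tensor_one"
  "x \<in> range tensor_one \<Longrightarrow> y \<in> range tensor_one \<Longrightarrow> x * y \<in> range tensor_one"
proof -
  show "(0 :: 'r rat_tensor) \<in> range tensor_one" by (rule range_eqI[of _ tensor_one 0]) simp
  show "(1 :: 'r rat_tensor) \<in> range tensor_one" by (rule range_eqI[of _ tensor_one 1]) (simp add: tensor_one_1)
qed (auto simp: tensor_one_add[symmetric] tensor_one_minus[symmetric] tensor_one_mult[symmetric])

lemma range_tensor_one_sum:
  "(\<And>i. i \<in> A \<Longrightarrow> f i \<in> range tensor_one) \<Longrightarrow> sum f A \<in> range tensor_one"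
  by (induction A rule: infinite_finite_induct) (auto intro: range_tensor_one)

context
  fixes N :: "'m::graded_splits set"
  assumes N0: "0 \<in> N" and N_add: "\<And>a b. a \<in> N \<Longrightarrow> b \<in> N \<Longrightarrow> a + b \<in> N"
begin

lemma integral_on_1: "integral_on N 1"
  by (auto simp: integral_on_def coeff_1 N0 range_tensor_one)

lemma integral_on_monom: "m \<in> N \<Longrightarrow> integral_on N (monom m (tensor_one W))"
  by (auto simp: integral_on_def coeff_monom range_tensor_one)

lemma integral_on_add: "integral_on N x \<Longrightarrow> integral_on N y \<Longrightarrow> integral_on N (x + y)"
  by (auto simp: integral_on_def range_tensor_one) (metis add_0)

lemma integral_on_minus: "integral_on N x \<Longrightarrow> integral_on N (- x)"
  by (auto simp: integral_on_def range_tensor_one)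

lemma integral_on_mult:
  assumes "integral_on N x" "integral_on N y" shows "integral_on N (x * y)"
  unfolding integral_on_def
proof (intro allI conjI impI)
  fix m
  show "coeff (x * y) m \<in> range tensor_one"
    unfolding coeff_mult using assms
    by (intro range_tensor_one_sum) (auto simp: integral_on_def intro!: range_tensor_one(5))
  assume "coeff (x * y) m \<noteq> 0"
  then obtain p where "p \<in> splits m" "(case p of (a, b) \<Rightarrow> coeff x a * coeff y b) \<noteq> 0"
    unfolding coeff_mult by (rule sum.not_neutral_contains_not_neutral)
  then obtain a b where "m = a + b" "coeff x a * coeff y b \<noteq> 0" by auto
  then show "m \<in> N" using assms N_add[of a b] by (auto simp: integral_on_def) (metis mult_zero_left mult_zero_right)
qed

text \<open>The geometric series has coefficients 1 and -1 only.\<close>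

lemma integral_on_inv:
  assumes "integral_on N x" "coeff x 0 = 1" shows "integral_on N (inv_series x)"
proof -
  have y: "integral_on N (x - 1)"
    using integral_on_add[OF assms(1) integral_on_minus[OF integral_on_1]] by simp
  have pow: "integral_on N ((-1) ^ n *\<^sub>Q (x - 1) ^ n)" for n
  proof -
    have "integral_on N ((x - 1) ^ n)" by (induction n) (auto intro: integral_on_1 integral_on_mult y)
    then show ?thesis
      using integral_on_minus by (cases "even n") (auto simp: scaleQ_one scaleQ_minus_left)
  qed
  have x0: "coeff (x - 1) 0 = 0" using assms(2) by (simp add: coeff_1)
  show ?thesis
    unfolding integral_on_def
  proof (intro allI conjI impI)
    fix m
    have e: "coeff (inv_series x) m = (\<Sum>n\<le>mdeg m. coeff ((-1) ^ n *\<^sub>Q (x - 1) ^ n) m)"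
      by (simp add: inv_series_def coeff_eval_series[OF x0 order_refl])
    show "coeff (inv_series x) m \<in> range tensor_one"
      unfolding e using pow by (intro range_tensor_one_sum) (auto simp: integral_on_def)
    assume "coeff (inv_series x) m \<noteq> 0"
    then obtain n where "coeff ((-1) ^ n *\<^sub>Q (x - 1) ^ n) m \<noteq> 0"
      unfolding e by (rule sum.not_neutral_contains_not_neutral)
    then show "m \<in> N" using pow[of n] by (auto simp: integral_on_def)
  qed
qed

lemma integral_on_prod_list: "(\<And>x. x \<in> set xs \<Longrightarrow> integral_on N x) \<Longrightarrow> integral_on N (prod_list xs)"
  by (induction xs) (auto intro: integral_on_1 integral_on_mult)

end

lemma coeff_monom_mult_le:
  assumes "mdeg k \<le> mdeg (m::'m::graded_splits)"
  shows "coeff (monom m a * x) k = (if k = m then a * coeff x 0 else (0::'a::rat_algebra))"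
proof -
  have "coeff (monom m a * x) k = (\<Sum>p\<in>splits k. if p = (m, 0) then a * coeff x 0 else 0)"
    unfolding coeff_mult
  proof (rule sum.cong[OF refl])
    fix p assume "p \<in> splits k"
    then obtain b c where p: "p = (b, c)" "b + c = k" by blast
    have "c = 0" if "b = m" using assms p(2) that mdeg_add[of b c] by auto
    then show "(case p of (b, c) \<Rightarrow> coeff (monom m a) b * coeff x c) = (if p = (m, 0) then a * coeff x 0 else 0)"
      by (auto simp: p(1) coeff_monom)
  qed
  then show ?thesis by (auto simp: finite_splits)
qed

text \<open>All monomials have the same positive degree q, so cross terms start in degree 2q and the
  order of the factors is not felt up to degree q.\<close>

lemma coeff_prod_one_plus_monom:
  fixes a :: "'m::graded_splits \<Rightarrow> 'a::rat_algebra"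
  assumes "distinct ms" "\<And>m. m \<in> set ms \<Longrightarrow> mdeg m = q" "q \<ge> 1" "mdeg k \<le> q"
  shows "coeff (prod_list (map (\<lambda>m. 1 + monom m (a m)) ms)) k = coeff 1 k + (if k \<in> set ms then a k else 0)"
  using assms(1,2,4)
proof (induction ms arbitrary: k)
  case (Cons m ms)
  let ?P = "prod_list (map (\<lambda>m. 1 + monom m (a m)) ms)"
  have P: "coeff ?P k = coeff 1 k + (if k \<in> set ms then a k else 0)" if "mdeg k \<le> q" for k
    using Cons that by simp
  have "0 \<notin> set ms" using Cons.prems(2) assms(3) by (metis list.set_intros(2) mdeg_0 not_one_le_zero)
  then have P0: "coeff ?P 0 = 1" by (simp add: P coeff_1)
  have "coeff (monom m (a m) * ?P) k = (if k = m then a m else 0)"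
    using Cons.prems(2)[of m] Cons.prems(3) P0 by (simp add: coeff_monom_mult_le)
  then show ?case using Cons.prems P[OF Cons.prems(3)] by (auto simp: distrib_right)
qed simp

lemma filtered_Phi_monom:
  assumes "p \<ge> 1" "p \<le> mdeg m" "W \<in> B"
  shows "filtered B D p (Phi (1 + monom m (tensor_one W)))"
  unfolding filtered_def
proof (intro allI impI)
  fix k
  have m: "m \<noteq> 0" using assms by auto
  show "coeff (Phi (1 + monom m (tensor_one W))) k \<in> gspan B (mdeg k div p)"
  proof (cases "\<exists>n. k = nmul n m")
    case True
    then obtain n where n: "k = nmul n m" by blast
    have "n * p \<le> mdeg k" using assms(2) by (simp add: n mdeg_nmul)
    then have "n \<le> mdeg k div p" using assms(1) by (simp add: less_eq_div_iff_mult_less_eq)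
    then show ?thesis
      using gspan_gen[OF assms(3)] by (simp add: n Phi_one_plus_monom[OF m] coeff_subst_nmul(1)[OF m])
  next
    case False
    then show ?thesis by (simp add: Phi_one_plus_monom[OF m] coeff_subst_nmul(2)[OF m] gspan_0)
  qed
qed

text \<open>
  Peel off the factors \<open>1 + x\<^sup>m A\<^sub>m\<close> degree by degree. A factor with \<open>m\<close> of degree at least \<open>p\<close>
  contributes elements \<open>g\<^sub>r\<close> in degree at least \<open>p r\<close>.
\<close>

lemma filtered_Phi:
  fixes x :: "('m::graded_splits, 'r::{ring,monoid_mult} rat_tensor) series"
  assumes N0: "0 \<in> N" and N_add: "\<And>a b. a \<in> N \<Longrightarrow> b \<in> N \<Longrightarrow> a + b \<in> N"
    and fin: "\<And>n. finite {m \<in> N. mdeg m = n}"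
    and p: "p \<ge> 1" and x: "integral_on N x" "ord_ge p (x - 1)"
  shows "filtered UNIV D p (Phi x)"
proof -
  \<comment> \<open>Here q is the current order and j the number of degrees up to D still to be
    cleared. Once the order exceeds D, only the constant term is left in the range
    considered.\<close>
  have main: "filtered UNIV D p (Phi x)" if "integral_on N x" "ord_ge q (x - 1)" "p \<le> q" "j + q = Suc D" for j q
    and x :: "('m, 'r rat_tensor) series"
    using that
  proof (induction j arbitrary: q x)
    case 0
    then have "ord_ge (Suc D) (Phi x - 1)" by (intro ord_ge_Phi) auto
    then have "coeff (Phi x) k = coeff 1 k" if "mdeg k \<le> D" for k using that by (auto simp: ord_ge_def)
    then show ?case using filtered_1[of UNIV D p] by (simp add: filtered_def)
  next
    case (Suc j)
    have q: "q \<ge> 1" using Suc.prems(3) p by simp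
    have x0: "coeff x 0 = 1" using Suc.prems(2) q by (force simp: ord_ge_def coeff_1)
    obtain ms where ms: "set ms = {m \<in> N. mdeg m = q}" "distinct ms"
      using finite_distinct_list[OF fin] by blast
    let ?F = "map (\<lambda>m. 1 + monom m (coeff x m)) ms"
    let ?y = "prod_list ?F"
    have y: "coeff ?y k = coeff x k" if "mdeg k \<le> q" for k
    proof -
      have "coeff ?y k = coeff 1 k + (if k \<in> set ms then coeff x k else 0)"
        using that ms q by (intro coeff_prod_one_plus_monom) auto
      also have "\<dots> = coeff x k"
      proof (cases "mdeg k = q")
        case True
        then have "k \<noteq> 0" using q by auto
        then show ?thesis using True ms Suc.prems(1) by (auto simp: coeff_1 integral_on_def)
      next
        case False
        then have "coeff (x - 1) k = 0" using that Suc.prems(2) by (auto simp: ord_ge_def)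
        then show ?thesis using False ms by auto
      qed
      finally show ?thesis .
    qed
    have F0: "coeff z 0 = 1" if "z \<in> set ?F" for z
      using that ms q by (auto simp: coeff_1 coeff_monom)
    have y0: "coeff ?y 0 = 1" using y[of 0] x0 by simp
    \<comment> \<open>What remains after dividing by all factors of degree q: it is again integral,
      and its order has gone up by one.\<close>
    let ?z = "inv_series ?y * x"
    have iF: "integral_on N z" if "z \<in> set ?F" for z
    proof -
      from that obtain m where m: "m \<in> set ms" "z = 1 + monom m (coeff x m)" by auto
      moreover obtain W where "coeff x m = tensor_one W" using Suc.prems(1) by (auto simp: integral_on_def)
      ultimately show ?thesis using ms
        by (auto intro!: integral_on_add[OF N0 N_add] integral_on_1[OF N0 N_add] integral_on_monom[OF N0 N_add])
    qed
    have iy: "integral_on N ?y" by (rule integral_on_prod_list[OF N0 N_add iF])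
    have iz: "integral_on N ?z"
      by (intro integral_on_mult[OF N0 N_add] integral_on_inv[OF N0 N_add] iy y0 Suc.prems(1))
    have "ord_ge (Suc q) (x - ?y)" using y by (auto simp: ord_ge_def)
    then have "ord_ge (Suc q) (inv_series ?y * (x - ?y))" by (rule ord_ge_mult2)
    moreover have "inv_series ?y * (x - ?y) = ?z - 1"
      by (simp only: right_diff_distrib inv_series_inverse[OF y0])
    ultimately have "ord_ge (Suc q) (?z - 1)" by simp
    from Suc.IH[OF iz this] Suc.prems have z: "filtered UNIV D p (Phi ?z)" by simp
    have "x = ?y * ?z" by (simp add: mult.assoc[symmetric] inv_series_inverse[OF y0])
    moreover have "Phi (?y * ?z) = Phi ?y * Phi ?z"
      by (rule Phi_mult) (simp_all add: y0 x0 coeff_inv_series_0)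
    moreover have "Phi ?y = prod_list (map Phi ?F)" using Phi_prod_list[OF F0] by blast
    ultimately have e: "Phi x = prod_list (map Phi ?F) * Phi ?z" by simp
    have "filtered UNIV D p z" if "z \<in> set (map Phi ?F)" for z
    proof -
      from that obtain m where m: "m \<in> set ms" "z = Phi (1 + monom m (coeff x m))" by auto
      moreover obtain W where "coeff x m = tensor_one W" using Suc.prems(1) by (auto simp: integral_on_def)
      ultimately show ?thesis using ms p Suc.prems(3) by (auto intro!: filtered_Phi_monom)
    qed
    then show ?case unfolding e by (intro filtered_mult filtered_prod_list z)
  qed
  \<comment> \<open>In this case \<open>Suc D - p\<close> is truncated, so \<open>main\<close> does
    not apply.\<close>
  have "filtered UNIV D p (Phi x)" if "Suc D < p"
  proof -
    have "ord_ge p (Phi x - 1)" by (rule ord_ge_Phi[OF x(2) p])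
    then have "coeff (Phi x) k = coeff 1 k" if "mdeg k \<le> D" for k using that \<open>Suc D < p\<close> by (auto simp: ord_ge_def)
    then show ?thesis using filtered_1[of UNIV D p] by (simp add: filtered_def)
  qed
  then show ?thesis using main[OF x order_refl, of "Suc D - p"] by fastforce
qed

lemma filtered_Phi_nat:
  fixes x :: "(nat, 'r::{ring,monoid_mult} rat_tensor) series"
  assumes "p \<ge> 1" "integral_on UNIV x" "ord_ge p (x - 1)"
  shows "filtered UNIV D p (Phi x)"
  by (rule filtered_Phi[of UNIV]) (use assms in \<open>auto simp: mdeg_nat_def\<close>)

lemma integral_on_one_plus_monom: "integral_on UNIV (1 + monom m (tensor_one W))"
  by (intro integral_on_add[of UNIV] integral_on_1[of UNIV] integral_on_monom[of UNIV]) auto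

abbreviation g_series :: "'r::{ring,monoid_mult} \<Rightarrow> (nat, 'r ginf) series" where
  "g_series W \<equiv> Phi (1 + monom 1 (tensor_one W))"

lemma coeff_g_series: "coeff (g_series W) r = g_elem r W"
  by (simp add: g_elem_def)

text \<open>For fixed r, the W with g_r(W) in the span form a subgroup: 1 + t(U + V) and (1 + tU)(1
  + tV) differ by a factor of order 2, which contributes only words of at most half the degree, and
  these are known by induction.\<close>

lemma gspan_spanning:
  fixes B :: "'r::{ring,monoid_mult} set"
  assumes B: "int_module.span B = UNIV"
  shows "g_elem r W \<in> gspan B r"
proof (induction r arbitrary: W rule: less_induct)
  case (less r)
  note One_nat_def [simp del]
  have low: "gspan UNIV d \<subseteq> gspan B d" if "d < r" for d
    unfolding gspan_def[of UNIV]
  proof (rule int_module.span_minimal)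
    show "int_module.subspace (gspan B d)" by (simp add: gspan_def int_module.subspace_span)
    have "g_word ws \<in> gspan B (sum_list (map fst ws))" if "sum_list (map fst ws) < r" for ws
      using that
    proof (induction ws)
      case Nil then show ?case by (simp add: gspan_1)
    next
      case (Cons w ws)
      obtain s V where w: "w = (s, V)" by (cases w)
      have "g_elem s V * g_word ws \<in> gspan B (s + sum_list (map fst ws))"
        using Cons less(1)[of s V] by (intro gspan_mult[OF _ _ order_refl]) (auto simp: w)
      then show ?case by (simp add: w)
    qed
    then show "{g_word ws |ws. snd ` set ws \<subseteq> UNIV \<and> sum_list (map fst ws) \<le> d} \<subseteq> gspan B d"
      using that gspan_mono[of B B _ d] by force
  qed
  have filt: "filtered B r 1 (g_series U)" if "g_elem r U \<in> gspan B r" for U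
    using that less by (auto simp: filtered_def coeff_g_series mdeg_nat_def le_less)
  \<comment> \<open>Slope 2 over all letters gives slope 1 over B by the induction hypothesis.
    Degree 0 is treated apart, since 0 div 2 is not below r when r = 0.\<close>
  have half: "filtered B r 1 (Phi x)" if "integral_on UNIV x" "ord_ge 2 (x - 1)" for x :: "(nat, 'r rat_tensor) series"
    unfolding filtered_def
  proof (intro allI impI)
    fix k :: nat assume k: "mdeg k \<le> r"
    have x0: "coeff x 0 = 1" using that(2) by (force simp: ord_ge_def coeff_1)
    have "coeff (Phi x) k \<in> gspan UNIV (k div 2)"
      using filtered_Phi_nat[of 2 x r] that k by (simp add: filtered_def mdeg_nat_def)
    then have "coeff (Phi x) k \<in> gspan B k" if "k \<noteq> 0"
    proof -
      have "k div 2 < r" using k that by (simp add: mdeg_nat_def)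
      then have "gspan UNIV (k div 2) \<subseteq> gspan B (k div 2)" by (rule low)
      moreover have "gspan B (k div 2) \<subseteq> gspan B k" by (rule gspan_mono) auto
      ultimately show ?thesis using \<open>coeff (Phi x) k \<in> gspan UNIV (k div 2)\<close> by blast
    qed
    then show "coeff (Phi x) k \<in> gspan B (mdeg k div 1)"
      by (cases "k = 0") (simp_all add: coeff_Phi_0 x0 gspan_1 mdeg_nat_def)
  qed
  have one: "coeff (1 + monom 1 (tensor_one U)) (0::nat) = 1" for U :: 'r by (simp add: coeff_1 coeff_monom)
  let ?A = "{W. g_elem r W \<in> gspan B r}"
  have "int_module.subspace ?A"
  proof (rule int_subspaceI)
    show "0 \<in> ?A" by (simp add: g_elem_zero gspan_0 gspan_1)
    show "U + V \<in> ?A" if "U \<in> ?A" "V \<in> ?A" for U V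
    proof -
      let ?y = "(1 + monom (1::nat) (tensor_one U)) * (1 + monom 1 (tensor_one V))"
      let ?x = "1 + monom (1::nat) (tensor_one (U + V))"
      let ?z = "inv_series ?y * ?x"
      have y0: "coeff ?y 0 = 1" by (simp only: coeff_mult_0 one mult_1_left)
      have "?x - ?y = - monom 2 (tensor_one (U * V))"
        by (rule series_eqI) (simp add: algebra_simps monom_mult tensor_one_add tensor_one_mult coeff_1 coeff_monom numeral_2_eq_2)
      then have "ord_ge 2 (?x - ?y)" by (simp add: ord_ge_def coeff_monom mdeg_nat_def)
      then have "ord_ge 2 (inv_series ?y * (?x - ?y))" by (rule ord_ge_mult2)
      then have o: "ord_ge 2 (?z - 1)" by (simp only: right_diff_distrib inv_series_inverse[OF y0])
      have iy: "integral_on UNIV ?y" by (intro integral_on_mult[of UNIV] integral_on_one_plus_monom) auto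
      have i: "integral_on UNIV ?z"
        by (intro integral_on_mult[of UNIV] integral_on_inv[of UNIV] integral_on_one_plus_monom iy y0) auto
      have xe: "?x = ?y * ?z" by (simp only: mult.assoc[symmetric] inv_series_inverse[OF y0] mult_1_left)
      have z0: "coeff ?z 0 = 1" by (simp only: coeff_mult_0 coeff_inv_series_0[OF y0] one mult_1_left)
      have "g_series (U + V) = Phi (?y * ?z)" by (rule arg_cong[OF xe])
      then have "g_series (U + V) = g_series U * g_series V * Phi ?z"
        by (simp only: Phi_mult[OF y0 z0] Phi_mult[OF one one])
      then have "filtered B r 1 (g_series (U + V))"
        using that filt half[OF i o] by (auto intro: filtered_mult)
      then show ?thesis by (auto simp: filtered_def coeff_g_series mdeg_nat_def)
    qed
    show "- U \<in> ?A" if "U \<in> ?A" for U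
    proof (cases "r = 0")
      case True then show ?thesis by (simp add: gspan_1)
    next
      case False
      \<comment> \<open>The product is 1 - t^2 U^2, so the coefficient of t^r in its
        \<open>Phi\<close> is covered by \<open>half\<close>; solving for the summand a = 0
        expresses \<open>g_elem r (- U)\<close> through the g_a(U) and the g_b(-U) with b <
        r.\<close>
      let ?y = "(1 + monom (1::nat) (tensor_one U)) * (1 + monom 1 (tensor_one (- U)))"
      have "?y - 1 = - monom 2 (tensor_one (U * U))"
        by (rule series_eqI) (simp add: algebra_simps monom_mult tensor_one_minus tensor_one_mult coeff_1 coeff_monom numeral_2_eq_2)
      then have o: "ord_ge 2 (?y - 1)" by (simp add: ord_ge_def coeff_monom mdeg_nat_def)
      have i: "integral_on UNIV ?y" by (intro integral_on_mult[of UNIV] integral_on_one_plus_monom) auto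
      have "Phi ?y = g_series U * g_series (- U)" by (simp only: Phi_mult one)
      then have c: "coeff (Phi ?y) r = (\<Sum>(a, b)\<in>splits r. g_elem a U * g_elem b (- U))"
        by (simp only: coeff_mult coeff_g_series)
      also have "\<dots> = g_elem 0 U * g_elem r (- U) + (\<Sum>(a, b)\<in>splits r - {(0, r)}. g_elem a U * g_elem b (- U))"
        by (subst sum.remove[of _ "(0, r)"]) (auto simp: finite_splits)
      finally have e: "g_elem r (- U) = coeff (Phi ?y) r - (\<Sum>(a, b)\<in>splits r - {(0, r)}. g_elem a U * g_elem b (- U))"
        by simp
      have prod: "g_elem a U * g_elem b (- U) \<in> gspan B r" if "a + b = r" "a \<noteq> 0" for a b
      proof (rule gspan_mult)
        show "g_elem a U \<in> gspan B a" using \<open>U \<in> ?A\<close> less[of a U] that by (cases "a = r") auto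
        show "g_elem b (- U) \<in> gspan B b" using less[of b "- U"] that by auto
        show "a + b \<le> r" using that by simp
      qed
      have "(\<Sum>(a, b)\<in>splits r - {(0, r)}. g_elem a U * g_elem b (- U)) \<in> gspan B r"
      proof (rule gspan_sum)
        fix q assume q: "q \<in> splits r - {(0, r)}"
        then obtain a b where ab: "q = (a, b)" "a + b = r" by blast
        then have "a \<noteq> 0" using q by (cases "a = 0") simp_all
        then show "(case q of (a, b) \<Rightarrow> g_elem a U * g_elem b (- U)) \<in> gspan B r" using prod ab by simp
      qed
      moreover have "coeff (Phi ?y) r \<in> gspan B r" using half[OF i o] by (auto simp: filtered_def mdeg_nat_def)
      ultimately show ?thesis by (simp add: e gspan_diff)
    qed
  qed
  moreover have "B \<subseteq> ?A" by (auto intro: gspan_gen)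
  ultimately have "int_module.span B \<subseteq> ?A" by (intro int_module.span_minimal)
  then show ?case using B by auto
qed

lemma gspan_UNIV_eq:
  assumes B: "int_module.span B = UNIV"
  shows "gspan UNIV d = gspan B d"
proof
  show "gspan B d \<subseteq> gspan UNIV d" by (rule gspan_mono) auto
  show "gspan UNIV d \<subseteq> gspan B d"
    unfolding gspan_def[of UNIV]
  proof (rule int_module.span_minimal)
    show "int_module.subspace (gspan B d)" by (simp add: gspan_def int_module.subspace_span)
    have "g_word ws \<in> gspan B (sum_list (map fst ws))" for ws
    proof (induction ws)
      case (Cons w ws)
      then have "g_elem (fst w) (snd w) * g_word ws \<in> gspan B (fst w + sum_list (map fst ws))"
        by (intro gspan_mult[OF gspan_spanning[OF B] _ order_refl])
      then show ?case by (simp add: case_prod_unfold)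
    qed (simp add: gspan_1)
    then show "{g_word ws |ws. snd ` set ws \<subseteq> UNIV \<and> sum_list (map fst ws) \<le> d} \<subseteq> gspan B d"
      using gspan_mono[of B B _ d] by force
  qed
qed

section \<open>The coefficients of the generating series\<close>

text \<open>The series 1 + \<Sum> x_{U,i} U over U in I, given by its coefficients because the sum
  is infinite in general; \<open>the_elem\<close> recovers the variable from a singleton.\<close>

definition generic :: "'r::{ring,monoid_mult} set \<Rightarrow> (('r \<times> nat) multiset, 'r rat_tensor) series" where
  "generic I = Series (\<lambda>m. if m = 0 then 1 else
     if \<exists>v. m = {#v#} \<and> fst v \<in> I then tensor_one (fst (the_elem (set_mset m))) else 0)"

lemma coeff_generic:
  "coeff (generic I) 0 = 1"
  "coeff (generic I) {#v#} = (if fst v \<in> I then tensor_one (fst v) else 0)"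
  "m \<noteq> 0 \<Longrightarrow> (\<And>v. m \<noteq> {#v#}) \<Longrightarrow> coeff (generic I) m = 0"
  by (simp_all add: generic_def)

lemma coeff_generic_neq_0: "coeff (generic I) m \<noteq> 0 \<Longrightarrow> m = 0 \<or> (\<exists>v. m = {#v#} \<and> fst v \<in> I)"
  by (metis coeff_generic(2,3))

lemma nmul_single_mset: "nmul n {#v#} = replicate_mset n v"
  by (induction n) (simp_all add: nmul_Suc)

lemma mdeg_single_mset: "mdeg {#v#} = 1"
  by (simp add: mdeg_multiset_def)

lemma replicate_mset_inject: "n \<ge> 1 \<Longrightarrow> replicate_mset n v = replicate_mset n w \<longleftrightarrow> v = w"
  by (metis One_nat_def Suc_le_lessD in_replicate_mset)

lemma coeff_power_sum:
  assumes "l \<ge> 1"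
  shows "coeff (power_sum l U) m = (if \<exists>i. m = replicate_mset l (U, i) then 1 else 0)"
proof (cases "\<exists>i. m = replicate_mset l (U, i)")
  case True
  then obtain i where m: "m = replicate_mset l (U, i)" by blast
  have "Sum_any (\<lambda>j. coeff (monom (replicate_mset l (U, j)) (1::rat)) m) = (\<Sum>j\<in>{i}. coeff (monom (replicate_mset l (U, j)) 1) m)"
    by (rule Sum_any.expand_superset) (auto simp: coeff_monom m replicate_mset_inject[OF assms])
  then show ?thesis using True m by (simp add: power_sum_def sum_series_def coeff_monom)
next
  case False
  then have "coeff (monom (replicate_mset l (U, j)) (1::rat)) m = 0" for j by (auto simp: coeff_monom)
  then show ?thesis using False by (simp add: power_sum_def sum_series_def)
qed

lemma coeff_adams_generic:
  assumes l: "l \<ge> 1"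
  shows "coeff (adams l (generic I)) m = (if m = 0 then 1 else
     if \<exists>v. m = replicate_mset l v \<and> fst v \<in> I then tensor_one (fst (SOME v. m = replicate_mset l v)) else 0)"
proof (cases "\<exists>v. m = replicate_mset l v")
  case True
  then obtain v where m: "m = replicate_mset l v" by blast
  have some: "(SOME v. m = replicate_mset l v) = v"
    by (rule some_equality) (auto simp: m replicate_mset_inject[OF l])
  have m0: "m \<noteq> 0" using l m by (auto dest: arg_cong[of _ _ size])
  have "{k. nmul l k = m} = {{#v#}}"
  proof (intro equalityI subsetI)
    fix k assume "k \<in> {k. nmul l k = m}"
    then have k: "nmul l k = nmul l {#v#}" by (simp add: m nmul_single_mset)
    have c: "count (nmul l k) x = l * count k x" for k :: "('a \<times> nat) multiset" and x
      by (induction l) (simp_all add: nmul_Suc)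
    have "count k x = count {#v#} x" for x
      using c[of k x] c[of "{#v#}" x] l k by simp
    then show "k \<in> {{#v#}}" by (simp add: multiset_eq_iff)
  qed (simp add: m nmul_single_mset)
  then show ?thesis
  proof -
    assume fib: "{k. nmul l k = m} = {{#v#}}"
    have "(\<exists>w. m = replicate_mset l w \<and> fst w \<in> I) \<longleftrightarrow> fst v \<in> I"
      using replicate_mset_inject[OF l, of v] m by metis
    then show ?thesis by (simp only: coeff_subst fib m0 some if_False) (simp add: coeff_generic scaleQ_one)
  qed
next
  case False
  have "coeff (adams l (generic I)) m = (\<Sum>k | nmul l k = m. if k = 0 then 1 else 0)"
    unfolding coeff_subst
  proof (rule sum.cong[OF refl])
    fix k assume k: "k \<in> {k. nmul l k = m}"
    have "k \<noteq> {#v#}" for v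
    proof
      assume "k = {#v#}"
      then have "m = replicate_mset l v" using k by (simp add: nmul_single_mset)
      then show False using False by blast
    qed
    then show "1 *\<^sub>Q coeff (generic I) k = (if k = 0 then 1 else 0)"
      by (auto simp: coeff_generic scaleQ_one)
  qed
  also have "\<dots> = (if m = 0 then 1 else 0)"
    using monomial_map_adams[OF l, where 'm = "('a \<times> nat) multiset"] by (auto simp: monomial_map_def)
  finally show ?thesis using False by auto
qed

text \<open>p_l arises from p_1 by raising the variables to the power l, so the argument of the l-th
  logarithm is the l-th Adams image of \<open>generic I\<close>.\<close>

lemma Z_generating_Phi: "Z_generating I = Phi (generic I)"
proof -
  have "1 + sum_series (\<lambda>U. if U \<in> I then map_series (\<lambda>c. c *\<^sub>Q tensor_one U) (power_sum l U) else 0)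
      = adams l (generic I)" if l: "l \<ge> 1" for l
  proof (rule series_eqI)
    fix m :: "('a \<times> nat) multiset"
    let ?f = "\<lambda>U. coeff (if U \<in> I then map_series (\<lambda>c. c *\<^sub>Q tensor_one U) (power_sum l U) else 0) m"
    have f: "?f U = (if U \<in> I \<and> (\<exists>i. m = replicate_mset l (U, i)) then tensor_one U else 0)" for U
      by (simp add: coeff_power_sum[OF l] scaleQ_one)
    have "Sum_any ?f = (if \<exists>v. m = replicate_mset l v \<and> fst v \<in> I then tensor_one (fst (SOME v. m = replicate_mset l v)) else 0)"
    proof (cases "\<exists>v. m = replicate_mset l v \<and> fst v \<in> I")
      case True
      then obtain U i where m: "m = replicate_mset l (U, i)" "U \<in> I" by auto
      have some: "(SOME v. m = replicate_mset l v) = (U, i)"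
        by (rule some_equality) (auto simp: m replicate_mset_inject[OF l])
      have "Sum_any ?f = (\<Sum>U\<in>{U}. ?f U)"
        by (rule Sum_any.expand_superset) (unfold f, auto simp: m replicate_mset_inject[OF l])
      also have "\<dots> = tensor_one U" unfolding f using m by auto
      finally show ?thesis using True some by simp
    next
      case False
      then have "?f U = 0" for U unfolding f by force
      then show ?thesis unfolding if_not_P[OF False] by simp
    qed
    moreover have "m \<noteq> 0" if "m = replicate_mset l v" for v
      using l that by (auto dest: arg_cong[of _ _ size])
    ultimately show "coeff (1 + sum_series (\<lambda>U. if U \<in> I then map_series (\<lambda>c. c *\<^sub>Q tensor_one U) (power_sum l U) else 0)) m
      = coeff (adams l (generic I)) m"
      unfolding coeff_adams_generic[OF l] by (auto simp: coeff_1 sum_series_def)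
  qed
  then show ?thesis
    unfolding Z_generating_def Phi_def theta_prod_def theta_def by (intro prod_series_cong) simp
qed

text \<open>Sets the variables outside V to 0. For finite V each degree has finitely many monomials,
  as \<open>filtered_Phi\<close> requires, while coefficients at monomials in V are
  unchanged.\<close>

definition restrict_vars :: "'v set \<Rightarrow> ('v multiset, 'a::rat_algebra) series \<Rightarrow> ('v multiset, 'a) series" where
  "restrict_vars V = subst (\<lambda>m. if set_mset m \<subseteq> V then 1 else 0) (\<lambda>m. m)"

lemma monomial_map_restrict: "monomial_map (\<lambda>m. if set_mset m \<subseteq> V then 1 else 0) (\<lambda>m. m)"
  by (auto simp: monomial_map_def)

lemma coeff_restrict_vars: "coeff (restrict_vars V x) m = (if set_mset m \<subseteq> V then coeff x m else 0)"
  by (simp add: restrict_vars_def coeff_subst scaleQ_one)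

lemma restrict_vars_Phi:
  "coeff x 0 = 1 \<Longrightarrow> restrict_vars V (Phi x) = Phi (restrict_vars V x)"
  unfolding restrict_vars_def by (rule subst_Phi[OF monomial_map_restrict]) auto

lemma finite_multisets_over: "finite V \<Longrightarrow> finite {m \<in> {m. set_mset m \<subseteq> V}. mdeg m = n}"
  using finite_multisets_of_size[of V n] by (simp add: multisets_of_size_def mdeg_multiset_def)

lemma integral_on_restrict_generic:
  "integral_on {m. set_mset m \<subseteq> V} (restrict_vars V (generic I))"
  unfolding integral_on_def
proof (intro allI conjI impI)
  fix m
  have "coeff (generic I) m \<in> range tensor_one" for m
    by (cases "coeff (generic I) m = 0")
      (auto simp: range_tensor_one coeff_generic dest!: coeff_generic_neq_0)
  then show "coeff (restrict_vars V (generic I)) m \<in> range tensor_one"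
    by (simp add: coeff_restrict_vars range_tensor_one)
qed (auto simp: coeff_restrict_vars split: if_splits)

lemma coeff_Phi_generic_filtered: "coeff (Phi (generic I)) k \<in> gspan UNIV (mdeg k)"
proof -
  let ?V = "set_mset k"
  have "filtered UNIV (mdeg k) 1 (Phi (restrict_vars ?V (generic I)))"
  proof (rule filtered_Phi[of "{m. set_mset m \<subseteq> ?V}"])
    show "ord_ge 1 (restrict_vars ?V (generic I) - 1)"
      by (auto simp: ord_ge_def coeff_restrict_vars coeff_generic coeff_1)
  qed (auto simp: finite_multisets_over[simplified] integral_on_restrict_generic)
  then have "coeff (Phi (restrict_vars ?V (generic I))) k \<in> gspan UNIV (mdeg k)"
    by (simp add: filtered_def)
  then show ?thesis
    by (simp add: restrict_vars_Phi[symmetric] coeff_generic coeff_restrict_vars)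
qed

text \<open>Each variable occurs in one factor only, so the monomial determines the exponent
  contributed by every factor, and the order of the factors survives in the product of the
  coefficients.\<close>

lemma coeff_prod_separate:
  fixes F :: "'i \<Rightarrow> (nat, 'a::rat_algebra) series" and v :: "'i \<Rightarrow> 'v"
  assumes "distinct is" "inj_on v (set is)"
  shows "coeff (prod_list (map (\<lambda>i. subst (\<lambda>_. 1) (\<lambda>n. nmul n {#v i#}) (F i)) is)) (\<Sum>i\<leftarrow>is. nmul (r i) {#v i#}) =
      prod_list (map (\<lambda>i. coeff (F i) (r i)) is)" (is ?A)
    and "coeff (prod_list (map (\<lambda>i. subst (\<lambda>_. 1) (\<lambda>n. nmul n {#v i#}) (F i)) is)) m \<noteq> 0 \<Longrightarrow> set_mset m \<subseteq> v ` set is"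
proof -
  have "?A \<and> (\<forall>m. coeff (prod_list (map (\<lambda>i. subst (\<lambda>_. 1) (\<lambda>n. nmul n {#v i#}) (F i)) is)) m \<noteq> 0 \<longrightarrow> set_mset m \<subseteq> v ` set is)"
    using assms
  proof (induction "is")
    case Nil show ?case by (auto simp: coeff_1 split: if_splits)
  next
    case (Cons i "is")
    let ?s = "\<lambda>i. subst (\<lambda>_. 1) (\<lambda>n. nmul n {#v i#}) (F i)"
    let ?P = "prod_list (map ?s is)" and ?m = "\<Sum>i\<leftarrow>is. nmul (r i) {#v i#}"
    have nz: "{#v i#} \<noteq> 0" by simp
    have IH: "coeff ?P ?m = prod_list (map (\<lambda>i. coeff (F i) (r i)) is)"
      "\<And>m. coeff ?P m \<noteq> 0 \<Longrightarrow> set_mset m \<subseteq> v ` set is" using Cons by auto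
    have notin: "v i \<notin> v ` set is" using Cons.prems by auto
    have m: "set_mset ?m \<subseteq> v ` set is"
      by (induction "is") (auto simp: nmul_single_mset split: if_splits)
    have single: "\<exists>n. p = nmul n {#v i#}" if "coeff (?s i) p \<noteq> 0" for p
      using that coeff_subst_nmul(2)[OF nz] by blast
    have "coeff (?s i * ?P) (nmul (r i) {#v i#} + ?m) =
        (\<Sum>(p, q)\<in>{(nmul (r i) {#v i#}, ?m)}. coeff (?s i) p * coeff ?P q)"
      unfolding coeff_mult
    proof (rule sum.mono_neutral_right[OF finite_splits])
      have "coeff (?s i) p * coeff ?P q = 0"
        if pq: "p + q = nmul (r i) {#v i#} + ?m" and ne: "\<not> (p = nmul (r i) {#v i#} \<and> q = ?m)" for p q
      proof (rule ccontr)
        assume "coeff (?s i) p * coeff ?P q \<noteq> 0"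
        then have "coeff (?s i) p \<noteq> 0" "coeff ?P q \<noteq> 0" by auto
        then obtain n where n: "p = nmul n {#v i#}" and q: "set_mset q \<subseteq> v ` set is"
          using single IH(2) by blast
        have "count (p + q) (v i) = count (nmul (r i) {#v i#} + ?m) (v i)" by (simp only: pq)
        moreover have "count q (v i) = 0" "count ?m (v i) = 0"
          using notin q m by (meson count_eq_zero_iff subsetD)+
        ultimately have "n = r i" by (simp add: n nmul_single_mset)
        then show False using pq ne n by simp
      qed
      then show "\<forall>x\<in>splits (nmul (r i) {#v i#} + ?m) - {(nmul (r i) {#v i#}, ?m)}.
          (\<lambda>(p, q). coeff (?s i) p * coeff ?P q) x = 0" by auto
    qed simp
    also have "\<dots> = coeff (F i) (r i) * prod_list (map (\<lambda>i. coeff (F i) (r i)) is)"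
      by (simp add: coeff_subst_nmul(1)[OF nz] IH(1))
    finally have 1: "coeff (?s i * ?P) (nmul (r i) {#v i#} + ?m) = coeff (F i) (r i) * prod_list (map (\<lambda>i. coeff (F i) (r i)) is)" .
    have 2: "set_mset m \<subseteq> v ` set (i # is)" if "coeff (?s i * ?P) m \<noteq> 0" for m
    proof -
      from that obtain x where "x \<in> splits m" "(case x of (p, q) \<Rightarrow> coeff (?s i) p * coeff ?P q) \<noteq> 0"
        unfolding coeff_mult by (rule sum.not_neutral_contains_not_neutral)
      then obtain p q where m': "m = p + q" and ne: "coeff (?s i) p * coeff ?P q \<noteq> 0" by auto
      have pq: "m = p + q" "coeff (?s i) p \<noteq> 0" "coeff ?P q \<noteq> 0"
        using m' ne by (auto intro: ccontr)
      then show ?thesis using single[OF pq(2)] IH(2)[OF pq(3)]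
        by (auto simp: nmul_single_mset split: if_splits)
    qed
    show ?case using 1 2 by simp
  qed
  then show ?A and "coeff (prod_list (map (\<lambda>i. subst (\<lambda>_. 1) (\<lambda>n. nmul n {#v i#}) (F i)) is)) m \<noteq> 0 \<Longrightarrow> set_mset m \<subseteq> v ` set is"
    by blast+
qed

text \<open>Give each letter W_i its own variable v_i. The word is a coefficient of
  \<open>Phi\<close> at the ordered product of the 1 + v_i W_i, while 1 + \<Sum> v_i W_i is a
  restriction of \<open>generic I\<close>. The two agree through degree 1, so their quotient has
  order 2 and changes the word only by words of smaller total index.\<close>

lemma g_word_in_coeff_span:
  fixes I :: "'r::{ring,monoid_mult} set"
  assumes I: "int_module.span I = UNIV"
  shows "snd ` set ws \<subseteq> I \<Longrightarrow> g_word ws \<in> int_module.span (range (coeff (Phi (generic I))))"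
proof (induction "sum_list (map fst ws)" arbitrary: ws rule: less_induct)
  case less
  let ?G = "int_module.span (range (coeff (Phi (generic I))))"
  have low: "gspan UNIV e \<subseteq> ?G" if "e < sum_list (map fst ws)" for e
    unfolding gspan_UNIV_eq[OF I] unfolding gspan_def
  proof (rule int_module.span_minimal[OF _ int_module.subspace_span])
    show "{g_word ws |ws. snd ` set ws \<subseteq> I \<and> sum_list (map fst ws) \<le> e} \<subseteq> ?G"
      using less(1) that by fastforce
  qed
  define n where "n = length ws"
  \<comment> \<open>The second component is the position, which keeps the variables distinct when a
    letter is repeated; the first makes W_i the coefficient of v_i in
    \<open>generic I\<close>.\<close>
  define v where "v i = (snd (ws ! i), i)" for i
  define V where "V = v ` {0..<n}"
  define N where "N = {m. set_mset m \<subseteq> V}"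
  have N: "0 \<in> N" "\<And>a b. a \<in> N \<Longrightarrow> b \<in> N \<Longrightarrow> a + b \<in> N" "\<And>k. finite {m \<in> N. mdeg m = k}"
    unfolding N_def by (auto simp: V_def intro: finite_multisets_over[simplified])
  have vI: "fst (v i) \<in> I" if "i < n" for i
    using less(2) that by (auto simp: v_def n_def)
  define Q where "Q = restrict_vars V (generic I)"
  have Q0: "coeff Q 0 = 1" by (simp add: Q_def coeff_restrict_vars coeff_generic)
  have iQ: "integral_on N Q" unfolding Q_def N_def by (rule integral_on_restrict_generic)
  have Qv: "coeff Q {#v i#} = tensor_one (snd (ws ! i))" if "i < n" for i
    using that vI[OF that] by (simp add: Q_def coeff_restrict_vars coeff_generic V_def v_def)
  define ms where "ms = map (\<lambda>i. {#v i#}) [0..<n]"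
  have ms: "distinct ms" "\<And>m. m \<in> set ms \<Longrightarrow> mdeg m = 1" "set ms \<subseteq> N"
    by (auto simp: ms_def distinct_map inj_on_def v_def mdeg_multiset_def N_def V_def)
  let ?F = "map (\<lambda>m. 1 + monom m (coeff Q m)) ms"
  let ?y = "prod_list ?F"
  have y: "coeff ?y k = coeff Q k" if k2: "mdeg k < 2" for k
  proof -
    have "coeff ?y k = coeff 1 k + (if k \<in> set ms then coeff Q k else 0)"
      using k2 ms by (intro coeff_prod_one_plus_monom) auto
    also have "\<dots> = coeff Q k"
    proof (cases "k = 0")
      case True
      then show ?thesis using ms(2)[of 0] by (auto simp: Q0 coeff_1)
    next
      case False
      then have "mdeg k \<noteq> 0" using mdeg_eq_0 by blast
      then have "mdeg k = 1" using k2 by linarith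
      then have "size k = 1" by (simp only: mdeg_multiset_def)
      then obtain w where k: "k = {#w#}" using size_1_singleton_mset by blast
      have "coeff Q k = 0" if "k \<notin> set ms"
        using that by (auto simp: k ms_def Q_def coeff_restrict_vars V_def)
      then show ?thesis using False by (simp add: coeff_1)
    qed
    finally show ?thesis .
  qed
  have y0: "coeff ?y 0 = 1" using y[of 0] Q0 by simp
  let ?z = "inv_series Q * ?y"
  have iy: "integral_on N ?y"
  proof (rule integral_on_prod_list[OF N(1,2)])
    fix f assume "f \<in> set ?F"
    then obtain m where m: "m \<in> set ms" "f = 1 + monom m (coeff Q m)" by auto
    moreover obtain W where "coeff Q m = tensor_one W" using iQ by (auto simp: integral_on_def)
    ultimately show "integral_on N f" using ms(3)
      by (auto intro!: integral_on_add[OF N(1,2)] integral_on_1[OF N(1,2)] integral_on_monom[OF N(1,2)])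
  qed
  have iz: "integral_on N ?z"
    by (intro integral_on_mult[OF N(1,2)] integral_on_inv[OF N(1,2)] iy iQ Q0)
  have "ord_ge 2 (?y - Q)" using y by (auto simp: ord_ge_def)
  then have "ord_ge 2 (inv_series Q * (?y - Q))" by (rule ord_ge_mult2)
  then have oz: "ord_ge 2 (?z - 1)" by (simp only: right_diff_distrib inv_series_inverse[OF Q0])
  have z0: "coeff ?z 0 = 1" by (simp add: y0 Q0 coeff_inv_series_0)
  have oQ: "ord_ge 1 (Q - 1)" by (simp add: ord_ge_def Q0 coeff_1)
  define m0 where "m0 = (\<Sum>i\<leftarrow>[0..<n]. nmul (fst (ws ! i)) {#v i#})"
  have "mdeg (\<Sum>i\<leftarrow>is. nmul (r i) {#v i#}) = sum_list (map r is)" for "is" and r :: "nat \<Rightarrow> nat"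
    by (induction "is") (simp_all add: mdeg_add mdeg_nmul mdeg_single_mset)
  moreover have "map (\<lambda>i. fst (ws ! i)) [0..<n] = map fst ws"
    by (rule nth_equalityI) (simp_all add: n_def)
  ultimately have deg: "mdeg m0 = sum_list (map fst ws)" by (simp add: m0_def)
  have Phi_y: "Phi ?y = Phi Q * Phi ?z"
  proof -
    have "?y = Q * ?z" by (simp only: mult.assoc[symmetric] inv_series_inverse[OF Q0] mult_1_left)
    then have "Phi ?y = Phi (Q * ?z)" by (rule arg_cong)
    then show ?thesis by (simp only: Phi_mult[OF Q0 z0])
  qed
  have F0: "coeff f 0 = 1" if "f \<in> set ?F" for f
  proof -
    obtain m where m: "m \<in> set ms" "f = 1 + monom m (coeff Q m)" using \<open>f \<in> set ?F\<close> by auto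
    then have "m \<noteq> 0" using ms(2)[of m] by auto
    then show ?thesis by (simp add: m(2) coeff_1 coeff_monom)
  qed
  have "Phi ?y = prod_list (map Phi ?F)" using Phi_prod_list[OF F0] by blast
  also have "map Phi ?F = map (\<lambda>i. subst (\<lambda>_. 1) (\<lambda>n. nmul n {#v i#}) (Series (\<lambda>r. g_elem r (snd (ws ! i))))) [0..<n]"
    by (simp add: ms_def Qv Phi_one_plus_monom)
  finally have "coeff (Phi ?y) m0 = prod_list (map (\<lambda>i. coeff (Series (\<lambda>r. g_elem r (snd (ws ! i)))) (fst (ws ! i))) [0..<n])"
    unfolding m0_def by (simp only:) (rule coeff_prod_separate(1), auto simp: inj_on_def v_def)
  also have "\<dots> = g_word (map (\<lambda>i. ws ! i) [0..<n])" by (simp add: case_prod_unfold comp_def)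
  also have "map (\<lambda>i. ws ! i) [0..<n] = ws" by (simp add: n_def map_nth)
  finally have word: "g_word ws = (\<Sum>(a, b)\<in>splits m0. coeff (Phi Q) a * coeff (Phi ?z) b)"
    by (simp only: Phi_y coeff_mult)
  \<comment> \<open>The splitting b = 0 gives a coefficient of \<open>Phi (generic I)\<close> or 0.
    For b of positive degree, slope 2 of the second factor makes the total index strictly smaller
    than that of the word.\<close>
  have "(case q of (a, b) \<Rightarrow> coeff (Phi Q) a * coeff (Phi ?z) b) \<in> ?G" if "q \<in> splits m0" for q
  proof -
    obtain a b where q: "q = (a, b)" "a + b = m0" using \<open>q \<in> splits m0\<close> by auto
    show ?thesis
    proof (cases "b = 0")
      case True
      have "coeff (Phi Q) a = (if set_mset a \<subseteq> V then coeff (Phi (generic I)) a else 0)"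
        unfolding Q_def by (simp add: restrict_vars_Phi[symmetric] coeff_generic coeff_restrict_vars)
      moreover have "coeff (Phi ?z) 0 = 1" by (rule coeff_Phi_0[OF z0])
      ultimately show ?thesis
        using q(1) True by (auto intro: int_module.span_base int_module.span_zero)
    next
      case False
      have "filtered UNIV (mdeg m0) 1 (Phi Q)" by (rule filtered_Phi[of N]) (use N iQ oQ in auto)
      then have "coeff (Phi Q) a \<in> gspan UNIV (mdeg a)" using q mdeg_add[of a b] by (simp add: filtered_def)
      moreover have "filtered UNIV (mdeg m0) 2 (Phi ?z)" by (rule filtered_Phi[of N]) (use N iz oz in auto)
      then have "coeff (Phi ?z) b \<in> gspan UNIV (mdeg b div 2)" using q mdeg_add[of a b] by (simp add: filtered_def)
      ultimately have "coeff (Phi Q) a * coeff (Phi ?z) b \<in> gspan UNIV (mdeg a + mdeg b div 2)"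
        by (rule gspan_mult) simp
      moreover have "mdeg a + mdeg b div 2 < sum_list (map fst ws)"
      proof -
        have "mdeg b > 0" using False mdeg_eq_0 by blast
        then show ?thesis using q mdeg_add[of a b] deg by auto
      qed
      ultimately show ?thesis using low q(1) by auto
    qed
  qed
  then show ?case unfolding word by (rule int_module.span_sum)
qed

lemma span_uminus_basis:
  assumes I: "int_module.span I = (UNIV :: 'r::ab_group_add set)"
  shows "int_module.span (uminus ` I) = UNIV"
proof -
  have "U \<in> int_module.span (uminus ` I)" if "U \<in> I" for U
    using int_module.span_neg[OF int_module.span_base[of "- U" "uminus ` I"]] that by auto
  then have "int_module.span I \<subseteq> int_module.span (uminus ` I)"
    by (intro int_module.span_minimal int_module.subspace_span) auto
  then show ?thesis using I by auto
qed

lemma is_subring_hull: "is_subring (is_subring hull S)"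
  by (rule hull_in) (auto simp: is_subring_def)

text \<open>Words with letters in I lie in the span of the coefficients; words with letters in -I
  lie in the subring, because g_r(-U) is e_r(U) up to sign. That \<open>gspan\<close> is the same
  for both spanning sets joins the two.\<close>

lemma coeff_span_eq_subring:
  fixes I :: "'r::{ring,monoid_mult} set"
  assumes I: "int_module.span I = UNIV"
  shows "int_module.span (range (coeff (Phi (generic I)))) = is_subring hull {e_ginf i U | i U. i \<ge> 1 \<and> U \<in> I}"
    (is "?G = ?H")
proof
  note One_nat_def [simp del]
  let ?S = "\<Union>d. gspan UNIV d :: 'r ginf set"
  have sub: "is_subring ?S"
    unfolding is_subring_def
  proof (intro conjI ballI)
    show "1 \<in> ?S" using gspan_1 by blast
    fix x y assume "x \<in> ?S" "y \<in> ?S"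
    then obtain d d' where d: "x \<in> gspan UNIV d" "y \<in> gspan UNIV d'" by blast
    then show "x * y \<in> ?S" using gspan_mult[OF d order_refl] by blast
    have "x \<in> gspan UNIV (max d d')" "y \<in> gspan UNIV (max d d')"
      using d gspan_mono[of UNIV UNIV] by (meson max.cobounded1 max.cobounded2 order_refl subsetD)+
    then show "x - y \<in> ?S" using gspan_diff by blast
  qed
  have H: "is_subring ?H" by (rule is_subring_hull)
  then have H1: "1 \<in> ?H" and Hd: "\<And>x y. x \<in> ?H \<Longrightarrow> y \<in> ?H \<Longrightarrow> x - y \<in> ?H"
    and Hm: "\<And>x y. x \<in> ?H \<Longrightarrow> y \<in> ?H \<Longrightarrow> x * y \<in> ?H" by (auto simp: is_subring_def)
  have H0: "0 \<in> ?H" using Hd[OF H1 H1] by simp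
  have Hn: "- x \<in> ?H" if "x \<in> ?H" for x using Hd[OF H0 that] by simp
  have Ha: "x + y \<in> ?H" if "x \<in> ?H" "y \<in> ?H" for x y using Hd[OF that(1) Hn[OF that(2)]] by simp
  have Hsub: "int_module.subspace ?H" by (rule int_subspaceI) (rule H0 Ha Hn; assumption)+
  have sign: "(-1) ^ r *\<^sub>Q x = x \<or> (-1) ^ r *\<^sub>Q x = - x" for r and x :: "'r ginf"
    by (cases "even r") (simp_all add: scaleQ_one scaleQ_minus_left)
  show "?H \<subseteq> ?G"
  proof -
    have "?H \<subseteq> ?S"
    proof (rule hull_minimal[of _ ?S, rotated])
      show "is_subring ?S" by (rule sub)
      show "{e_ginf i U | i U. i \<ge> 1 \<and> U \<in> I} \<subseteq> ?S"
      proof clarify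
      fix i and U :: 'r
      have "g_elem i (- U) \<in> gspan UNIV i" by (rule gspan_gen) auto
      then have "e_ginf i U \<in> gspan UNIV i" using sign[of i "g_elem i (- U)"] gspan_minus by (auto simp: e_ginf_g_elem)
      then show "e_ginf i U \<in> ?S" by blast
      qed
    qed
    moreover have "gspan UNIV d \<subseteq> ?G" for d
      unfolding gspan_UNIV_eq[OF I] unfolding gspan_def
      by (rule int_module.span_minimal[OF _ int_module.subspace_span])
        (auto intro: g_word_in_coeff_span[OF I])
    ultimately show ?thesis by blast
  qed
  show "?G \<subseteq> ?H"
  proof -
    have g: "g_elem r W \<in> ?H" if W: "W \<in> uminus ` I" for r W
    proof (cases "r = 0")
      case True then show ?thesis by (simp add: H1)
    next
      case False
      obtain U where U: "W = - U" "U \<in> I" using W by blast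
      have "1 \<le> r" using False by linarith
      then have "e_ginf r U \<in> ?H" using U(2) by (intro hull_inc) blast
      moreover have "g_elem r W = (-1) ^ r *\<^sub>Q e_ginf r U"
        by (simp add: e_ginf_g_elem U scaleQ_scaleQ power_mult_distrib[symmetric] scaleQ_one)
      ultimately show ?thesis using sign[of r "e_ginf r U"] Hn by auto
    qed
    have "g_word ws \<in> ?H" if "snd ` set ws \<subseteq> uminus ` I" for ws
      using that
    proof (induction ws)
      case (Cons w ws)
      then show ?case using Hm[OF g[of "snd w" "fst w"]] by (auto simp: case_prod_unfold)
    qed (simp add: H1)
    then have "gspan (uminus ` I) d \<subseteq> ?H" for d
      unfolding gspan_def by (intro int_module.span_minimal Hsub) blast
    then have "coeff (Phi (generic I)) k \<in> ?H" for k
      using coeff_Phi_generic_filtered[of I k] gspan_UNIV_eq[OF span_uminus_basis[OF I]] by blast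
    then show ?thesis by (intro int_module.span_minimal Hsub) blast
  qed
qed

section \<open>Schur functions: symmetry and unitriangularity\<close>

text \<open>Extended by 0 below the last row, so that comparisons of neighbouring rows hold across
  the boundary.\<close>

definition rowlen :: "nat list \<Rightarrow> nat \<Rightarrow> nat" where
  "rowlen \<nu> i = (if i < length \<nu> then \<nu> ! i else 0)"

lemma cells_iff: "(i, j) \<in> cells \<nu> \<longleftrightarrow> j < rowlen \<nu> i"
  by (auto simp: cells_def rowlen_def)

lemma cells_Sigma: "cells \<nu> = (SIGMA i:{..<length \<nu>}. {..<rowlen \<nu> i})"
  by (auto simp: cells_def rowlen_def)

lemma finite_cells [simp]: "finite (cells \<nu>)"
  by (simp add: cells_Sigma)

lemma rowlen_Suc_le: "is_partition \<nu> \<Longrightarrow> rowlen \<nu> (Suc i) \<le> rowlen \<nu> i"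
  using sorted_wrt_nth_less[of "(\<ge>)" \<nu> i "Suc i"] by (auto simp: rowlen_def is_partition_def)

lemma rowlen_eq_0: "is_partition \<nu> \<Longrightarrow> rowlen \<nu> i = 0 \<longleftrightarrow> length \<nu> \<le> i"
proof -
  assume \<nu>: "is_partition \<nu>"
  have "\<nu> ! i \<noteq> 0" if "i < length \<nu>"
    using nth_mem[OF that] \<nu> unfolding is_partition_def by (intro notI) simp
  then show ?thesis by (auto simp: rowlen_def)
qed

text \<open>Lets an initial segment of the columns of a row be handled through its length.\<close>

lemma nat_downset_iff:
  assumes "finite S" "\<And>x y. y \<in> S \<Longrightarrow> x \<le> y \<Longrightarrow> x \<in> S"
  shows "j < card S \<longleftrightarrow> j \<in> (S :: nat set)"
proof -
  have "S \<subseteq> {..<card S}"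
  proof
    fix x assume "x \<in> S"
    then have "{..x} \<subseteq> S" using assms(2) by auto
    then have "card {..x} \<le> card S" by (rule card_mono[OF assms(1)])
    then show "x \<in> {..<card S}" by simp
  qed
  then have "S = {..<card S}" by (intro card_subset_eq) auto
  then show ?thesis by blast
qed

lemma nat_leI: "(\<And>j. j < x \<Longrightarrow> j < y) \<Longrightarrow> x \<le> (y::nat)"
  by (meson leI less_irrefl)

lemma ssyt_row:
  assumes "t \<in> ssyt \<nu>" "j \<le> j'" "j' < rowlen \<nu> i"
  shows "t (i, j) \<le> t (i, j')"
  using assms(2,3)
proof (induction j' rule: dec_induct)
  case (step n)
  then have "t (i, n) \<le> t (i, n + 1)" using assms(1) by (auto simp: ssyt_def cells_iff)
  then show ?case using step by simp
qed simp

lemma ssyt_col: "t \<in> ssyt \<nu> \<Longrightarrow> j < rowlen \<nu> (Suc i) \<Longrightarrow> t (i, j) < t (Suc i, j)"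
  by (auto simp: ssyt_def cells_iff)

text \<open>The shape formed by the entries less than a. Over all a this is the Gelfand--Tsetlin
  pattern of the tableau, and \<open>row_below_interlace\<close> is its interlacing
  condition.\<close>

definition row_below :: "nat list \<Rightarrow> (nat \<times> nat \<Rightarrow> nat) \<Rightarrow> nat \<Rightarrow> nat \<Rightarrow> nat" where
  "row_below \<nu> t a i = card {j. j < rowlen \<nu> i \<and> t (i, j) < a}"

lemma row_below_iff:
  assumes "t \<in> ssyt \<nu>"
  shows "j < row_below \<nu> t a i \<longleftrightarrow> j < rowlen \<nu> i \<and> t (i, j) < a"
proof -
  have "j < card {j. j < rowlen \<nu> i \<and> t (i, j) < a} \<longleftrightarrow> j \<in> {j. j < rowlen \<nu> i \<and> t (i, j) < a}"
    by (rule nat_downset_iff) (auto intro: le_less_trans ssyt_row[OF assms])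
  then show ?thesis by (simp add: row_below_def)
qed

lemma row_below_mono: "t \<in> ssyt \<nu> \<Longrightarrow> a \<le> b \<Longrightarrow> row_below \<nu> t a i \<le> row_below \<nu> t b i"
  by (rule nat_leI) (auto simp: row_below_iff)

lemma row_below_interlace:
  assumes "is_partition \<nu>" "t \<in> ssyt \<nu>"
  shows "row_below \<nu> t (Suc a) (Suc i) \<le> row_below \<nu> t a i"
proof (rule nat_leI)
  fix j assume "j < row_below \<nu> t (Suc a) (Suc i)"
  then have j: "j < rowlen \<nu> (Suc i)" "t (Suc i, j) < Suc a" by (simp_all add: row_below_iff[OF assms(2)])
  then have "t (i, j) < a" using ssyt_col[OF assms(2) j(1)] by simp
  then show "j < row_below \<nu> t a i"
    using j(1) rowlen_Suc_le[OF assms(1), of i] by (simp add: row_below_iff[OF assms(2)])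
qed

text \<open>
  The Bender--Knuth involution, in terms of the row counts: the number of entries at most \<open>k\<close> in row
  \<open>i\<close> ranges over an interval determined by the entries other than \<open>k\<close> and \<open>k + 1\<close>, and is reflected in it.
\<close>

definition bk_lo :: "nat list \<Rightarrow> nat \<Rightarrow> (nat \<times> nat \<Rightarrow> nat) \<Rightarrow> nat \<Rightarrow> nat" where
  "bk_lo \<nu> k t i = max (row_below \<nu> t k i) (row_below \<nu> t (Suc (Suc k)) (Suc i))"

definition bk_hi :: "nat list \<Rightarrow> nat \<Rightarrow> (nat \<times> nat \<Rightarrow> nat) \<Rightarrow> nat \<Rightarrow> nat" where
  "bk_hi \<nu> k t i = (case i of 0 \<Rightarrow> row_below \<nu> t (Suc (Suc k)) 0
     | Suc i' \<Rightarrow> min (row_below \<nu> t (Suc (Suc k)) i) (row_below \<nu> t k i'))"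

definition bk_row :: "nat list \<Rightarrow> nat \<Rightarrow> (nat \<times> nat \<Rightarrow> nat) \<Rightarrow> nat \<Rightarrow> nat" where
  "bk_row \<nu> k t i = bk_lo \<nu> k t i + bk_hi \<nu> k t i - row_below \<nu> t (Suc k) i"

definition bk :: "nat list \<Rightarrow> nat \<Rightarrow> (nat \<times> nat \<Rightarrow> nat) \<Rightarrow> (nat \<times> nat \<Rightarrow> nat)" where
  "bk \<nu> k t = restrict (\<lambda>(i, j). if row_below \<nu> t k i \<le> j \<and> j < row_below \<nu> t (Suc (Suc k)) i
     then (if j < bk_row \<nu> k t i then k else Suc k) else t (i, j)) (cells \<nu>)"

context
  fixes \<nu> :: "nat list" and k :: nat and t :: "nat \<times> nat \<Rightarrow> nat"
  assumes \<nu>: "is_partition \<nu>" and t: "t \<in> ssyt \<nu>"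
begin

lemma bk_bounds:
  "bk_lo \<nu> k t i \<le> row_below \<nu> t (Suc k) i" "row_below \<nu> t (Suc k) i \<le> bk_hi \<nu> k t i"
  "bk_lo \<nu> k t i \<le> bk_row \<nu> k t i" "bk_row \<nu> k t i \<le> bk_hi \<nu> k t i"
  "row_below \<nu> t k i \<le> bk_row \<nu> k t i" "bk_row \<nu> k t i \<le> row_below \<nu> t (Suc (Suc k)) i"
proof -
  show lo: "bk_lo \<nu> k t i \<le> row_below \<nu> t (Suc k) i"
    using row_below_mono[OF t, of k "Suc k"] row_below_interlace[OF \<nu> t] by (simp add: bk_lo_def)
  show hi: "row_below \<nu> t (Suc k) i \<le> bk_hi \<nu> k t i"
    using row_below_mono[OF t, of "Suc k" "Suc (Suc k)"] row_below_interlace[OF \<nu> t]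
    by (simp add: bk_hi_def split: nat.split)
  show b: "bk_lo \<nu> k t i \<le> bk_row \<nu> k t i" "bk_row \<nu> k t i \<le> bk_hi \<nu> k t i"
    using lo hi by (simp_all add: bk_row_def)
  show "row_below \<nu> t k i \<le> bk_row \<nu> k t i" using b(1) by (simp add: bk_lo_def)
  have "bk_hi \<nu> k t i \<le> row_below \<nu> t (Suc (Suc k)) i" by (simp add: bk_hi_def split: nat.split)
  then show "bk_row \<nu> k t i \<le> row_below \<nu> t (Suc (Suc k)) i" using b(2) by simp
qed

lemma bk_apply:
  assumes "j < rowlen \<nu> i"
  shows "bk \<nu> k t (i, j) = (if j < row_below \<nu> t k i then t (i, j)
    else if j < bk_row \<nu> k t i then k else if j < row_below \<nu> t (Suc (Suc k)) i then Suc k else t (i, j))"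
  using assms bk_bounds(5,6)[of i] by (auto simp: bk_def cells_iff)

lemma bk_cases:
  assumes j: "j < rowlen \<nu> i"
  obtains "j < row_below \<nu> t k i" "bk \<nu> k t (i, j) = t (i, j)" "t (i, j) < k"
    | "row_below \<nu> t k i \<le> j" "j < bk_row \<nu> k t i" "bk \<nu> k t (i, j) = k"
    | "bk_row \<nu> k t i \<le> j" "j < row_below \<nu> t (Suc (Suc k)) i" "bk \<nu> k t (i, j) = Suc k"
    | "row_below \<nu> t (Suc (Suc k)) i \<le> j" "bk \<nu> k t (i, j) = t (i, j)" "Suc (Suc k) \<le> t (i, j)"
proof -
  have r: "j < row_below \<nu> t a i \<longleftrightarrow> t (i, j) < a" for a using j by (simp add: row_below_iff[OF t])
  note app = bk_apply[OF j] and bounds = bk_bounds(5,6)[of i]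
  consider (1) "j < row_below \<nu> t k i" | (2) "row_below \<nu> t k i \<le> j" "j < bk_row \<nu> k t i"
    | (3) "bk_row \<nu> k t i \<le> j" "j < row_below \<nu> t (Suc (Suc k)) i" | (4) "row_below \<nu> t (Suc (Suc k)) i \<le> j"
    by linarith
  then show ?thesis
  proof cases
    case 1
    show ?thesis by (rule that(1)) (use 1 app r[of k] in simp_all)
  next
    case 2
    show ?thesis by (rule that(2)) (use 2 app in simp_all)
  next
    case 3
    show ?thesis by (rule that(3)) (use 3 app bounds in simp_all)
  next
    case 4
    show ?thesis by (rule that(4)) (use 4 app bounds r[of "Suc (Suc k)"] in simp_all)
  qed
qed

lemma bk_ssyt: "bk \<nu> k t \<in> ssyt \<nu>"
  unfolding ssyt_def
proof (intro CollectI conjI allI impI)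
  show "bk \<nu> k t \<in> extensional (cells \<nu>)" by (simp add: bk_def)
  fix i j
  {
    assume "(i, j + 1) \<in> cells \<nu>"
    then have j: "Suc j < rowlen \<nu> i" "j < rowlen \<nu> i" by (simp_all add: cells_iff)
    have "t (i, j) \<le> t (i, Suc j)" by (rule ssyt_row[OF t]) (use j in auto)
    then show "bk \<nu> k t (i, j) \<le> bk \<nu> k t (i, j + 1)"
      using bk_bounds(5,6)[of i] by (cases rule: bk_cases[OF j(1)]; cases rule: bk_cases[OF j(2)]) simp_all
  }
  {
    assume "(i + 1, j) \<in> cells \<nu>"
    then have j: "j < rowlen \<nu> (Suc i)" by (simp add: cells_iff)
    then have j': "j < rowlen \<nu> i" using rowlen_Suc_le[OF \<nu>, of i] by simp
    have lt: "t (i, j) < t (Suc i, j)" by (rule ssyt_col[OF t j])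
    \<comment> \<open>The ends of the interval encode column strictness: entries at most k + 1 in
      row i + 1 sit under new entries at most k, and new entries at most k in row i + 1 sit under
      entries less than k.\<close>
    have lo: "row_below \<nu> t (Suc (Suc k)) (Suc i) \<le> bk_row \<nu> k t i"
      using bk_bounds(3)[of i] by (simp add: bk_lo_def)
    have hi: "bk_row \<nu> k t (Suc i) \<le> row_below \<nu> t k i"
      using bk_bounds(4)[of "Suc i"] by (simp add: bk_hi_def)
    have low: "t (i, j) < k \<Longrightarrow> j < row_below \<nu> t k i" using j' by (simp add: row_below_iff[OF t])
    show "bk \<nu> k t (i, j) < bk \<nu> k t (i + 1, j)"
      using lt lo hi low bk_bounds(5,6)[of i] bk_bounds(5,6)[of "Suc i"]
      by (cases rule: bk_cases[OF j]; cases rule: bk_cases[OF j']) simp_all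
  }
qed

lemma row_below_bk:
  "row_below \<nu> (bk \<nu> k t) k i = row_below \<nu> t k i"
  "row_below \<nu> (bk \<nu> k t) (Suc (Suc k)) i = row_below \<nu> t (Suc (Suc k)) i"
  "row_below \<nu> (bk \<nu> k t) (Suc k) i = bk_row \<nu> k t i"
proof -
  have eqI: "x = y" if "\<And>j. j < x \<longleftrightarrow> j < y" for x y :: nat using that by (meson linorder_neqE_nat less_irrefl)
  have len: "j < row_below \<nu> t a i \<Longrightarrow> j < rowlen \<nu> i" for j a by (simp add: row_below_iff[OF t])
  have len': "j < bk_row \<nu> k t i \<Longrightarrow> j < rowlen \<nu> i" for j using len[of j "Suc (Suc k)"] bk_bounds(6)[of i] by simp
  show "row_below \<nu> (bk \<nu> k t) k i = row_below \<nu> t k i"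
  proof (rule eqI)
    fix j
    show "j < row_below \<nu> (bk \<nu> k t) k i \<longleftrightarrow> j < row_below \<nu> t k i"
    proof (cases "j < rowlen \<nu> i")
      case True
      then show ?thesis using bk_bounds(5,6)[of i]
        by (cases rule: bk_cases[OF True]) (simp_all add: row_below_iff[OF bk_ssyt])
    qed (use len in \<open>auto simp: row_below_iff[OF bk_ssyt]\<close>)
  qed
  show "row_below \<nu> (bk \<nu> k t) (Suc (Suc k)) i = row_below \<nu> t (Suc (Suc k)) i"
  proof (rule eqI)
    fix j
    show "j < row_below \<nu> (bk \<nu> k t) (Suc (Suc k)) i \<longleftrightarrow> j < row_below \<nu> t (Suc (Suc k)) i"
    proof (cases "j < rowlen \<nu> i")
      case True
      then show ?thesis using bk_bounds(5,6)[of i]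
        by (cases rule: bk_cases[OF True]) (simp_all add: row_below_iff[OF bk_ssyt])
    qed (use len in \<open>auto simp: row_below_iff[OF bk_ssyt]\<close>)
  qed
  show "row_below \<nu> (bk \<nu> k t) (Suc k) i = bk_row \<nu> k t i"
  proof (rule eqI)
    fix j
    show "j < row_below \<nu> (bk \<nu> k t) (Suc k) i \<longleftrightarrow> j < bk_row \<nu> k t i"
    proof (cases "j < rowlen \<nu> i")
      case True
      then show ?thesis using bk_bounds(5,6)[of i]
        by (cases rule: bk_cases[OF True]) (simp_all add: row_below_iff[OF bk_ssyt])
    qed (use len' in \<open>auto simp: row_below_iff[OF bk_ssyt]\<close>)
  qed
qed

text \<open>The maximum in the lower end for row i and the minimum in the upper end for row i + 1
  are taken of the same two numbers, so all the ends together sum to the counts of entries below k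
  and below k + 2. Hence the multiplicities of k and k + 1 are exchanged.\<close>

lemma sum_bk_row:
  "(\<Sum>i<length \<nu>. bk_row \<nu> k t i) + (\<Sum>i<length \<nu>. row_below \<nu> t (Suc k) i) =
    (\<Sum>i<length \<nu>. row_below \<nu> t k i) + (\<Sum>i<length \<nu>. row_below \<nu> t (Suc (Suc k)) i)"
proof -
  let ?\<mu> = "row_below \<nu> t k" and ?\<kappa> = "row_below \<nu> t (Suc k)" and ?l = "row_below \<nu> t (Suc (Suc k))"
  have row: "bk_row \<nu> k t i + ?\<kappa> i = bk_lo \<nu> k t i + bk_hi \<nu> k t i" for i
    using bk_bounds(1,2)[of i] by (simp add: bk_row_def)
  have step: "bk_lo \<nu> k t i + bk_hi \<nu> k t (Suc i) = ?\<mu> i + ?l (Suc i)" for i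
    by (simp add: bk_lo_def bk_hi_def max_def min_def)
  have key: "(\<Sum>i<n. bk_row \<nu> k t i + ?\<kappa> i) + bk_hi \<nu> k t n = (\<Sum>i<n. ?\<mu> i) + (\<Sum>i<Suc n. ?l i)" for n
  proof (induction n)
    case 0 show ?case by (simp add: bk_hi_def)
  next
    case (Suc n)
    then show ?case using step[of n] by (simp add: row)
  qed
  have l: "?l (length \<nu>) = 0" by (simp add: row_below_def rowlen_def)
  then have "bk_hi \<nu> k t (length \<nu>) = 0" by (auto simp: bk_hi_def split: nat.split)
  then show ?thesis using key[of "length \<nu>"] l by (simp add: sum.distrib)
qed

end

text \<open>The interval depends only on the counts below k and below k + 2, which \<open>bk\<close>
  leaves alone, and reflecting twice in one interval is the identity.\<close>

lemma bk_bk: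
  assumes "is_partition \<nu>" "t \<in> ssyt \<nu>" shows "bk \<nu> k (bk \<nu> k t) = t"
proof (rule extensionalityI[of _ "cells \<nu>"])
  note r = row_below_bk[OF assms, of k] and s = bk_ssyt[OF assms, of k]
  show "bk \<nu> k (bk \<nu> k t) \<in> extensional (cells \<nu>)" by (simp add: bk_def)
  show "t \<in> extensional (cells \<nu>)" using assms(2) by (simp add: ssyt_def)
  fix c assume "c \<in> cells \<nu>"
  then obtain i j where c: "c = (i, j)" and j: "j < rowlen \<nu> i" by (cases c) (auto simp: cells_iff)
  have row: "bk_row \<nu> k (bk \<nu> k t) i = row_below \<nu> t (Suc k) i"
  proof -
    have "bk_lo \<nu> k (bk \<nu> k t) i = bk_lo \<nu> k t i" by (simp add: bk_lo_def r row_below_bk[OF assms])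
    moreover have "bk_hi \<nu> k (bk \<nu> k t) i = bk_hi \<nu> k t i"
      by (simp add: bk_hi_def row_below_bk[OF assms] split: nat.split)
    ultimately show ?thesis using bk_bounds(1,2)[OF assms, of k i]
      by (simp add: bk_row_def[of \<nu> k "bk \<nu> k t"] r(3)) (simp add: bk_row_def)
  qed
  have b: "j < row_below \<nu> t a i \<longleftrightarrow> t (i, j) < a" for a using j by (simp add: row_below_iff[OF assms(2)])
  have X: "bk \<nu> k t (i, j) = t (i, j)" if "j < row_below \<nu> t k i \<or> \<not> j < row_below \<nu> t (Suc (Suc k)) i"
    using that bk_apply[OF assms j, of k] bk_bounds(6)[OF assms, of k i] by auto
  have Y: "bk \<nu> k (bk \<nu> k t) (i, j) = (if j < row_below \<nu> t k i then bk \<nu> k t (i, j)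
    else if j < row_below \<nu> t (Suc k) i then k else if j < row_below \<nu> t (Suc (Suc k)) i then Suc k
    else bk \<nu> k t (i, j))"
    using bk_apply[OF assms(1) s j, of k] unfolding r row .
  consider "j < row_below \<nu> t k i" | "\<not> j < row_below \<nu> t k i" "t (i, j) = k"
    | "\<not> j < row_below \<nu> t k i" "t (i, j) = Suc k" | "\<not> j < row_below \<nu> t (Suc (Suc k)) i" "\<not> j < row_below \<nu> t k i" "Suc (Suc k) \<le> t (i, j)"
    using b[of k] b[of "Suc (Suc k)"] by linarith
  then show "bk \<nu> k (bk \<nu> k t) c = t c"
    unfolding c Y using b[of "Suc k"] b[of "Suc (Suc k)"] X by cases simp_all
qed

section \<open>Contents of tableaux and the symmetry of Schur functions\<close>

lemma count_image_mset_set: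
  "finite A \<Longrightarrow> count (image_mset f (mset_set A)) x = card {a \<in> A. f a = x}"
proof (induction A rule: finite_induct)
  case (insert a A)
  have "{b \<in> insert a A. f b = x} = (if f a = x then insert a {b \<in> A. f b = x} else {b \<in> A. f b = x})" by auto
  then show ?case using insert by simp
qed simp

abbreviation content :: "'r \<Rightarrow> nat list \<Rightarrow> (nat \<times> nat \<Rightarrow> nat) \<Rightarrow> ('r \<times> nat) multiset" where
  "content U \<nu> t \<equiv> image_mset (\<lambda>c. (U, t c)) (mset_set (cells \<nu>))"

definition swap_var :: "'r \<Rightarrow> nat \<Rightarrow> 'r \<times> nat \<Rightarrow> 'r \<times> nat" where
  "swap_var U k v = (if v = (U, k) then (U, Suc k) else if v = (U, Suc k) then (U, k) else v)"

lemma swap_var_swap_var [simp]: "swap_var U k (swap_var U k v) = v"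
  by (auto simp: swap_var_def)

lemma image_swap_swap [simp]: "image_mset (swap_var U k) (image_mset (swap_var U k) m) = m"
  by (simp add: multiset.map_comp comp_def)

lemma count_image_swap: "count (image_mset (swap_var U k) m) v = count m (swap_var U k v)"
proof (induction m)
  case (add x m)
  have "swap_var U k x = v \<longleftrightarrow> x = swap_var U k v" using swap_var_swap_var by metis
  then show ?case using add by auto
qed simp

lemma count_content: "count (content U \<nu> t) (V, a) = (if V = U then card {c \<in> cells \<nu>. t c = a} else 0)"
  by (simp add: count_image_mset_set)

lemma card_entries:
  assumes "t \<in> ssyt \<nu>"
  shows "card {c \<in> cells \<nu>. t c = a} + (\<Sum>i<length \<nu>. row_below \<nu> t a i) = (\<Sum>i<length \<nu>. row_below \<nu> t (Suc a) i)"
proof -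
  have mem: "j < rowlen \<nu> i \<and> t (i, j) = a \<longleftrightarrow> j < row_below \<nu> t (Suc a) i \<and> \<not> j < row_below \<nu> t a i" for i j
    by (auto simp: row_below_iff[OF assms])
  have "{c \<in> cells \<nu>. t c = a} = (SIGMA i:{..<length \<nu>}. {row_below \<nu> t a i..<row_below \<nu> t (Suc a) i})"
  proof (rule set_eqI)
    fix c :: "nat \<times> nat"
    obtain i j where "c = (i, j)" by fastforce
    then show "c \<in> {c \<in> cells \<nu>. t c = a} \<longleftrightarrow> c \<in> (SIGMA i:{..<length \<nu>}. {row_below \<nu> t a i..<row_below \<nu> t (Suc a) i})"
      using mem[of j i] by (auto simp: cells_Sigma not_less)
  qed
  then have "card {c \<in> cells \<nu>. t c = a} = (\<Sum>i<length \<nu>. row_below \<nu> t (Suc a) i - row_below \<nu> t a i)"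
    by simp
  moreover have "row_below \<nu> t a i \<le> row_below \<nu> t (Suc a) i" for i by (rule row_below_mono[OF assms]) simp
  ultimately show ?thesis by (simp add: sum.distrib[symmetric])
qed

lemma content_bk:
  assumes "is_partition \<nu>" "t \<in> ssyt \<nu>"
  shows "content U \<nu> (bk \<nu> k t) = image_mset (swap_var U k) (content U \<nu> t)"
proof (rule multiset_eqI)
  fix v :: "'a \<times> nat"
  obtain V a where v: "v = (V, a)" by (cases v)
  note r = row_below_bk[OF assms, of k] and s = bk_ssyt[OF assms, of k] and sum = sum_bk_row[OF assms, of k]
  have k0: "card {c \<in> cells \<nu>. bk \<nu> k t c = k} = card {c \<in> cells \<nu>. t c = Suc k}"
    using card_entries[OF s, of k] card_entries[OF assms(2), of "Suc k"] sum unfolding r by simp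
  have k1: "card {c \<in> cells \<nu>. bk \<nu> k t c = Suc k} = card {c \<in> cells \<nu>. t c = k}"
    using card_entries[OF s, of "Suc k"] card_entries[OF assms(2), of k] sum unfolding r by simp
  have other: "{c \<in> cells \<nu>. bk \<nu> k t c = a} = {c \<in> cells \<nu>. t c = a}" if "a \<noteq> k" "a \<noteq> Suc k"
  proof -
    have "bk \<nu> k t (i, j) = a \<longleftrightarrow> t (i, j) = a" if "j < rowlen \<nu> i" for i j
    proof -
      have b: "j < row_below \<nu> t x i \<longleftrightarrow> t (i, j) < x" for x using that by (simp add: row_below_iff[OF assms(2)])
      show ?thesis using \<open>a \<noteq> k\<close> \<open>a \<noteq> Suc k\<close> b[of k] b[of "Suc (Suc k)"] bk_bounds(5,6)[OF assms, of k i]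
        by (auto simp: bk_apply[OF assms that])
    qed
    then have "bk \<nu> k t c = a \<longleftrightarrow> t c = a" if "c \<in> cells \<nu>" for c
      using that by (cases c) (simp add: cells_iff)
    then show ?thesis by (intro Collect_cong conj_cong refl)
  qed
  show "count (content U \<nu> (bk \<nu> k t)) v = count (image_mset (swap_var U k) (content U \<nu> t)) v"
    unfolding v count_image_swap
    using k0 k1 other by (auto simp: swap_var_def count_content)
qed

lemma coeff_schur:
  "coeff (schur \<nu> U) m = of_nat (card {t \<in> ssyt \<nu>. m = content U \<nu> t})"
  by (simp add: schur_def)

text \<open>For V = U the Bender--Knuth map is a bijection between the tableaux of the two contents;
  for V different from U no variable of a content is moved.\<close>

lemma coeff_schur_swap:
  assumes \<nu>: "is_partition \<nu>"
  shows "coeff (schur \<nu> U) (image_mset (swap_var V k) m) = coeff (schur \<nu> U) m"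
proof (cases "V = U")
  case True
  let ?s = "image_mset (swap_var U k)"
  have iff: "?s m = content U \<nu> t \<longleftrightarrow> m = content U \<nu> (bk \<nu> k t)" if "t \<in> ssyt \<nu>" for t
    using content_bk[OF \<nu> that, of U k] image_swap_swap[of U k] by metis
  have "bij_betw (bk \<nu> k) {t \<in> ssyt \<nu>. ?s m = content U \<nu> t} {t \<in> ssyt \<nu>. m = content U \<nu> t}"
  proof (rule bij_betw_byWitness[where f' = "bk \<nu> k"])
    show "bk \<nu> k ` {t \<in> ssyt \<nu>. ?s m = content U \<nu> t} \<subseteq> {t \<in> ssyt \<nu>. m = content U \<nu> t}"
      using iff bk_ssyt[OF \<nu>] by auto
    show "bk \<nu> k ` {t \<in> ssyt \<nu>. m = content U \<nu> t} \<subseteq> {t \<in> ssyt \<nu>. ?s m = content U \<nu> t}"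
      using iff[OF bk_ssyt[OF \<nu>]] bk_ssyt[OF \<nu>] bk_bk[OF \<nu>] by auto
  qed (auto simp: bk_bk[OF \<nu>])
  then show ?thesis using bij_betw_same_card True by (fastforce simp: coeff_schur)
next
  case False
  have fix_content: "image_mset (swap_var V k) (content U \<nu> t) = content U \<nu> t" for t
    using False by (auto simp: multiset.map_comp comp_def swap_var_def intro!: image_mset_cong)
  have "image_mset (swap_var V k) m = content U \<nu> t \<longleftrightarrow> m = content U \<nu> t" for t
    using fix_content[of t] image_swap_swap[of V k] by metis
  then show ?thesis by (simp add: coeff_schur)
qed

text \<open>Among the monomials obtained by permuting variables of one set, weakly decreasing
  exponents minimise this number, so it stands in for the dominance order.\<close>

definition weight :: "('r \<times> nat) multiset \<Rightarrow> nat" where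
  "weight m = \<Sum>\<^sub># (image_mset snd m)"

lemma weight_add [simp]: "weight (a + b) = weight a + weight b"
  by (simp add: weight_def)

abbreviation lead_mset :: "'r \<Rightarrow> nat list \<Rightarrow> ('r \<times> nat) multiset" where
  "lead_mset U \<nu> \<equiv> content U \<nu> fst"

lemma weight_content: "weight (content U \<nu> t) = (\<Sum>c\<in>cells \<nu>. t c)"
  by (simp add: weight_def multiset.map_comp comp_def sum_unfold_sum_mset)

lemma ssyt_ge:
  assumes \<nu>: "is_partition \<nu>" and t: "t \<in> ssyt \<nu>"
  shows "j < rowlen \<nu> i \<Longrightarrow> i \<le> t (i, j)"
proof (induction i)
  case (Suc i)
  then have "i \<le> t (i, j)" using rowlen_Suc_le[OF \<nu>, of i] by simp
  then show ?case using ssyt_col[OF t Suc.prems] by simp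
qed simp

text \<open>Natural coefficients serve the comparison of integral spans. The clause on first
  components bounds the Schur products in which a given monomial occurs and excludes variables
  outside I.\<close>

definition leading :: "(('r \<times> nat) multiset, rat) series \<Rightarrow> ('r \<times> nat) multiset \<Rightarrow> bool" where
  "leading f m0 \<longleftrightarrow> coeff f m0 = 1 \<and> (\<forall>m. coeff f m \<in> \<nat>) \<and>
     (\<forall>m. coeff f m \<noteq> 0 \<longrightarrow> weight m0 \<le> weight m \<and> (weight m = weight m0 \<longrightarrow> m = m0) \<and>
        image_mset fst m = image_mset fst m0)"

lemma leadingI:
  assumes "coeff f m0 = 1" "\<And>m. coeff f m \<in> \<nat>"
    "\<And>m. coeff f m \<noteq> 0 \<Longrightarrow> weight m0 \<le> weight m \<and> (weight m = weight m0 \<longrightarrow> m = m0) \<and>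
       image_mset fst m = image_mset fst m0"
  shows "leading f m0"
  unfolding leading_def by (intro conjI allI impI assms(1,2)) (use assms(3) in blast)+

lemma leadingD:
  assumes "leading f m0"
  shows "coeff f m0 = 1" "coeff f m \<in> \<nat>" "coeff f m \<noteq> 0 \<Longrightarrow> weight m0 \<le> weight m"
    "coeff f m \<noteq> 0 \<Longrightarrow> weight m = weight m0 \<Longrightarrow> m = m0"
    "coeff f m \<noteq> 0 \<Longrightarrow> image_mset fst m = image_mset fst m0"
  using assms unfolding leading_def by blast+

text \<open>Column strictness forces t(i, j) \<ge> i, so the weight is minimal exactly for the
  tableau with i throughout row i, rows being counted from 0.\<close>

lemma leading_schur:
  assumes \<nu>: "is_partition \<nu>"
  shows "leading (schur \<nu> U) (lead_mset U \<nu>)"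
proof -
  have ge: "fst c \<le> t c" if "t \<in> ssyt \<nu>" "c \<in> cells \<nu>" for t c
    using ssyt_ge[OF \<nu> that(1)] that(2) by (cases c) (simp add: cells_iff)
  have eq: "t = restrict fst (cells \<nu>)" if t: "t \<in> ssyt \<nu>" and w: "(\<Sum>c\<in>cells \<nu>. t c) = (\<Sum>c\<in>cells \<nu>. fst c)" for t
  proof -
    have "t c = fst c" if "c \<in> cells \<nu>" for c
    proof (rule ccontr)
      assume "t c \<noteq> fst c"
      then have "fst c < t c" using ge[OF t that] by simp
      then have "(\<Sum>c\<in>cells \<nu>. fst c) < (\<Sum>c\<in>cells \<nu>. t c)"
        using that ge[OF t] by (intro sum_strict_mono_ex1 finite_cells ballI bexI[of _ c])
      then show False using w by simp
    qed
    then show ?thesis using t by (intro extensionalityI[of _ "cells \<nu>"]) (auto simp: ssyt_def)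
  qed
  have restr: "restrict fst (cells \<nu>) \<in> ssyt \<nu>"
    unfolding ssyt_def
  proof (intro CollectI conjI allI impI)
    fix i j
    show "restrict fst (cells \<nu>) (i, j) \<le> restrict fst (cells \<nu>) (i, j + 1)" if "(i, j + 1) \<in> cells \<nu>"
      using that by (simp add: cells_iff)
    show "restrict fst (cells \<nu>) (i, j) < restrict fst (cells \<nu>) (i + 1, j)" if "(i + 1, j) \<in> cells \<nu>"
      using that rowlen_Suc_le[OF \<nu>, of i] by (simp add: cells_iff)
  qed simp
  have content_restr: "content U \<nu> (restrict fst (cells \<nu>)) = lead_mset U \<nu>"
    by (rule image_mset_cong) simp
  have "{t \<in> ssyt \<nu>. lead_mset U \<nu> = content U \<nu> t} = {restrict fst (cells \<nu>)}"
  proof (intro equalityI subsetI)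
    fix t assume "t \<in> {t \<in> ssyt \<nu>. lead_mset U \<nu> = content U \<nu> t}"
    then have t: "t \<in> ssyt \<nu>" and c: "lead_mset U \<nu> = content U \<nu> t" by auto
    from arg_cong[OF c, of weight] have "(\<Sum>c\<in>cells \<nu>. t c) = (\<Sum>c\<in>cells \<nu>. fst c)" by (simp add: weight_content)
    then show "t \<in> {restrict fst (cells \<nu>)}" using eq[OF t] by simp
  qed (use restr content_restr in auto)
  then have one: "coeff (schur \<nu> U) (lead_mset U \<nu>) = 1" by (simp add: coeff_schur)
  have "weight (lead_mset U \<nu>) \<le> weight m \<and> (weight m = weight (lead_mset U \<nu>) \<longrightarrow> m = lead_mset U \<nu>) \<and>
        image_mset fst m = image_mset fst (lead_mset U \<nu>)" if "coeff (schur \<nu> U) m \<noteq> 0" for m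
  proof -
    have "{t \<in> ssyt \<nu>. m = content U \<nu> t} \<noteq> {}" using that unfolding coeff_schur by (auto simp del: Collect_empty_eq)
    then obtain t where t: "t \<in> ssyt \<nu>" and m: "m = content U \<nu> t" by blast
    have "weight (lead_mset U \<nu>) \<le> weight m"
      unfolding m weight_content by (rule sum_mono) (rule ge[OF t])
    moreover have "m = lead_mset U \<nu>" if "weight m = weight (lead_mset U \<nu>)"
    proof -
      have "t = restrict fst (cells \<nu>)" using eq[OF t] that unfolding m weight_content by blast
      then show ?thesis using content_restr m by simp
    qed
    moreover have "image_mset fst m = image_mset fst (lead_mset U \<nu>)"
      by (simp add: m multiset.map_comp comp_def)
    ultimately show ?thesis by blast
  qed
  then show ?thesis by (intro leadingI one) (simp_all add: coeff_schur)
qed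

lemma sum_in_Nats: "(\<And>x. x \<in> A \<Longrightarrow> f x \<in> \<nat>) \<Longrightarrow> sum f A \<in> \<nat>"
  by (induction A rule: infinite_finite_induct) auto

text \<open>Weights add, so minimal weight in the product forces minimal weight in both
  factors.\<close>

lemma leading_mult:
  assumes f: "leading f a" and g: "leading g b"
  shows "leading (f * g) (a + b)"
proof -
  have nat: "coeff (f * g) m \<in> \<nat>" for m
    unfolding coeff_mult by (intro sum_in_Nats) (simp add: case_prod_unfold leadingD(2)[OF f] leadingD(2)[OF g])
  have split: "\<exists>p q. p + q = m \<and> coeff f p \<noteq> 0 \<and> coeff g q \<noteq> 0" if nz: "coeff (f * g) m \<noteq> 0" for m
  proof -
    obtain x where "x \<in> splits m" "(case x of (p, q) \<Rightarrow> coeff f p * coeff g q) \<noteq> 0"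
      using nz unfolding coeff_mult by (rule sum.not_neutral_contains_not_neutral)
    then show ?thesis by (intro exI[of _ "fst x"] exI[of _ "snd x"]) (auto simp: case_prod_unfold)
  qed
  have "coeff (f * g) (a + b) = (\<Sum>(p, q)\<in>{(a, b)}. coeff f p * coeff g q)"
    unfolding coeff_mult
  proof (rule sum.mono_neutral_right[OF finite_splits])
    have "p = a \<and> q = b" if "p + q = a + b" "coeff f p \<noteq> 0" "coeff g q \<noteq> 0" for p q
    proof -
      have "weight a \<le> weight p" "weight b \<le> weight q" using leadingD(3)[OF f] leadingD(3)[OF g] that by blast+
      moreover have "weight p + weight q = weight a + weight b" using arg_cong[OF that(1), of weight] by simp
      ultimately have "weight p = weight a" "weight q = weight b" by linarith+
      then show ?thesis using leadingD(4)[OF f] leadingD(4)[OF g] that by blast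
    qed
    then show "\<forall>i\<in>splits (a + b) - {(a, b)}. (\<lambda>(p, q). coeff f p * coeff g q) i = 0" by auto
  qed simp
  then have one: "coeff (f * g) (a + b) = 1" by (simp add: leadingD(1)[OF f] leadingD(1)[OF g])
  have "weight (a + b) \<le> weight m \<and> (weight m = weight (a + b) \<longrightarrow> m = a + b) \<and>
      image_mset fst m = image_mset fst (a + b)" if nz: "coeff (f * g) m \<noteq> 0" for m
  proof -
    obtain p q where m: "p + q = m" and pq: "coeff f p \<noteq> 0" "coeff g q \<noteq> 0" using split[OF nz] by blast
    have p: "weight a \<le> weight p" "weight p = weight a \<Longrightarrow> p = a" "image_mset fst p = image_mset fst a"
      and q: "weight b \<le> weight q" "weight q = weight b \<Longrightarrow> q = b" "image_mset fst q = image_mset fst b"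
      using leadingD(3-5)[OF f pq(1)] leadingD(3-5)[OF g pq(2)] by blast+
    have "m = a + b" if "weight m = weight (a + b)"
    proof -
      have "weight p = weight a" "weight q = weight b" using that m[symmetric] p(1) q(1) by simp_all
      then show ?thesis using p q m by simp
    qed
    then show ?thesis using p q m[symmetric] by simp
  qed
  then show ?thesis by (intro leadingI one nat)
qed

lemma leading_prod:
  assumes "finite A" "\<And>U. U \<in> A \<Longrightarrow> leading (f U) (m U)"
  shows "leading (\<Prod>U\<in>A. f U) (\<Sum>U\<in>A. m U)"
  using assms
proof (induction A rule: finite_induct)
  case empty
  show ?case
  proof (intro leadingI)
    show "coeff (prod f {}) (sum m {}) = 1" "coeff (prod f {}) k \<in> \<nat>" for k by (simp_all add: coeff_1)
    fix k assume "coeff (prod f {}) k \<noteq> 0"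
    then have "k = sum m {}" by (simp add: coeff_1 split: if_split_asm)
    then show "weight (sum m {}) \<le> weight k \<and> (weight k = weight (sum m {}) \<longrightarrow> k = sum m {}) \<and>
        image_mset fst k = image_mset fst (sum m {})" by simp
  qed
next
  case (insert U A) then show ?case by (simp add: leading_mult)
qed

section \<open>The elements \<open>Z\<close>\<close>

lemma scale_Nats_in_subspace:
  assumes "int_module.subspace A" "c \<in> \<nat>" "x \<in> A"
  shows "c *\<^sub>Q x \<in> (A :: 'a::rat_algebra set)"
proof -
  obtain n where "c = of_nat n" using assms(2) by (rule Nats_cases)
  moreover have "of_nat n *\<^sub>Q x \<in> A"
  proof (induction n)
    case 0
    show ?case using int_module.subspace_0[OF assms(1)] by simp
  next
    case (Suc n)
    then show ?case using int_module.subspace_add[OF assms(1) assms(3)] by (simp add: scaleQ_add_left scaleQ_one)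
  qed
  ultimately show ?thesis by simp
qed

text \<open>A linear system, possibly infinite, that is unitriangular along the weight. There is one
  equation for every monomial, and \<open>red\<close> disposes of those at non-leading monomials:
  each repeats an equation of smaller weight or reads 0 = 0.\<close>

locale unitriangular =
  fixes P :: "'p set" and lead :: "'p \<Rightarrow> 'm" and w :: "'m \<Rightarrow> nat" and K :: "'p \<Rightarrow> 'm \<Rightarrow> rat" and \<Omega> :: "'m \<Rightarrow> 'a::rat_algebra"
  assumes fin: "\<And>m. finite {p \<in> P. K p m \<noteq> 0}"
    and one: "\<And>p. p \<in> P \<Longrightarrow> K p (lead p) = 1"
    and le: "\<And>p m. p \<in> P \<Longrightarrow> K p m \<noteq> 0 \<Longrightarrow> w (lead p) \<le> w m"
    and eq: "\<And>p m. p \<in> P \<Longrightarrow> K p m \<noteq> 0 \<Longrightarrow> w m = w (lead p) \<Longrightarrow> m = lead p"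
    and inj: "inj_on lead P"
    and red: "\<And>m. (\<exists>p\<in>P. m = lead p) \<or> (\<exists>m'. w m' < w m \<and> \<Omega> m' = \<Omega> m \<and> (\<forall>p\<in>P. K p m' = K p m)) \<or>
       (\<Omega> m = 0 \<and> (\<forall>p\<in>P. K p m = 0))"
begin

definition expands :: "('p \<Rightarrow> 'a) \<Rightarrow> bool" where
  "expands z \<longleftrightarrow> (\<forall>p. p \<notin> P \<longrightarrow> z p = 0) \<and> (\<forall>m. (\<Sum>p | p \<in> P \<and> K p m \<noteq> 0. K p m *\<^sub>Q z p) = \<Omega> m)"

lemma expansion_at_lead:
  assumes "p \<in> P"
  shows "(\<Sum>q | q \<in> P \<and> K q (lead p) \<noteq> 0. K q (lead p) *\<^sub>Q z q) =
      z p + (\<Sum>q | q \<in> P \<and> K q (lead p) \<noteq> 0 \<and> w (lead q) < w (lead p). K q (lead p) *\<^sub>Q z q)"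
proof -
  have "{q. q \<in> P \<and> K q (lead p) \<noteq> 0} - {p} = {q. q \<in> P \<and> K q (lead p) \<noteq> 0 \<and> w (lead q) < w (lead p)}"
  proof (intro equalityI subsetI)
    fix q assume q: "q \<in> {q. q \<in> P \<and> K q (lead p) \<noteq> 0} - {p}"
    then have "lead p \<noteq> lead q" using inj_onD[OF inj, of p q] assms by blast
    then show "q \<in> {q. q \<in> P \<and> K q (lead p) \<noteq> 0 \<and> w (lead q) < w (lead p)}"
      using le[of q "lead p"] eq[of q "lead p"] q by (auto simp: order.order_iff_strict)
  qed auto
  then show ?thesis
    using sum.remove[of "{q. q \<in> P \<and> K q (lead p) \<noteq> 0}" p "\<lambda>q. K q (lead p) *\<^sub>Q z q"] fin[of "lead p"] assms
    by (simp add: one scaleQ_one)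
qed

lemma expands_exists: "\<exists>z. expands z"
proof -
  let ?R = "measure (\<lambda>p. w (lead p))"
  define F where "F z p = (if p \<in> P then \<Omega> (lead p) -
    (\<Sum>q | q \<in> P \<and> K q (lead p) \<noteq> 0 \<and> w (lead q) < w (lead p). K q (lead p) *\<^sub>Q z q) else 0)" for z p
  \<comment> \<open>Recursion on the weight solves the equations at leading monomials; the remaining
    ones follow by induction through \<open>red\<close>.\<close>
  define z where "z = wfrec ?R F"
  have "adm_wf ?R F"
    unfolding adm_wf_def F_def by (auto intro!: sum.cong)
  then have z: "z = F z" unfolding z_def by (intro wfrec_fixpoint) auto
  have zp: "\<Omega> (lead p) = (\<Sum>q | q \<in> P \<and> K q (lead p) \<noteq> 0. K q (lead p) *\<^sub>Q z q)" if "p \<in> P" for p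
    using fun_cong[OF z, of p] that by (simp add: expansion_at_lead F_def)
  have "(\<Sum>p | p \<in> P \<and> K p m \<noteq> 0. K p m *\<^sub>Q z p) = \<Omega> m" for m
  proof (induction "w m" arbitrary: m rule: less_induct)
    case less
    consider (lead) p where "p \<in> P" "m = lead p"
      | (sym) m' where "w m' < w m" "\<Omega> m' = \<Omega> m" "\<forall>p\<in>P. K p m' = K p m"
      | (zero) "\<Omega> m = 0" "\<forall>p\<in>P. K p m = 0" using red[of m] by blast
    then show ?case
    proof cases
      case lead then show ?thesis using zp by simp
    next
      case sym
      then have "(\<Sum>p | p \<in> P \<and> K p m \<noteq> 0. K p m *\<^sub>Q z p) = (\<Sum>p | p \<in> P \<and> K p m' \<noteq> 0. K p m' *\<^sub>Q z p)"
        by (intro sum.cong) auto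
      then show ?thesis using less[OF sym(1)] sym(2) by simp
    next
      case zero then show ?thesis by (simp add: sum.neutral)
    qed
  qed
  moreover have "z p = 0" if "p \<notin> P" for p using fun_cong[OF z, of p] that by (simp add: F_def)
  ultimately show ?thesis unfolding expands_def by blast
qed

lemma expands_unique:
  assumes "expands y" "expands z" shows "y = z"
proof
  fix p
  show "y p = z p"
  proof (induction "w (lead p)" arbitrary: p rule: less_induct)
    case less
    show ?case
    proof (cases "p \<in> P")
      case True
      have "(\<Sum>q | q \<in> P \<and> K q (lead p) \<noteq> 0 \<and> w (lead q) < w (lead p). K q (lead p) *\<^sub>Q y q) =
          (\<Sum>q | q \<in> P \<and> K q (lead p) \<noteq> 0 \<and> w (lead q) < w (lead p). K q (lead p) *\<^sub>Q z q)"
        by (rule sum.cong) (simp_all add: less)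
      moreover have "(\<Sum>q | q \<in> P \<and> K q (lead p) \<noteq> 0. K q (lead p) *\<^sub>Q y q) = (\<Sum>q | q \<in> P \<and> K q (lead p) \<noteq> 0. K q (lead p) *\<^sub>Q z q)"
        using assms by (simp add: expands_def)
      ultimately show ?thesis by (simp add: expansion_at_lead[OF True])
    next
      case False
      then show ?thesis using assms by (simp add: expands_def)
    qed
  qed
qed

text \<open>The diagonal entries are 1 and the others natural numbers, so each family is an integral
  combination of the other.\<close>

lemma expands_span:
  assumes z: "expands z" and nat: "\<And>p m. p \<in> P \<Longrightarrow> K p m \<in> \<nat>"
  shows "int_module.span (z ` P) = int_module.span (range \<Omega>)"
proof
  have sub: "int_module.subspace (int_module.span A)" for A :: "'a set" by (rule int_module.subspace_span)
  have "\<Omega> m \<in> int_module.span (z ` P)" for m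
  proof -
    have "(\<Sum>p | p \<in> P \<and> K p m \<noteq> 0. K p m *\<^sub>Q z p) \<in> int_module.span (z ` P)"
      by (intro int_module.span_sum scale_Nats_in_subspace[OF sub] int_module.span_base nat) auto
    then show ?thesis using z by (simp add: expands_def)
  qed
  then show "int_module.span (range \<Omega>) \<subseteq> int_module.span (z ` P)"
    by (intro int_module.span_minimal sub) blast
  have "z p \<in> int_module.span (range \<Omega>)" if "p \<in> P" for p
    using that
  proof (induction "w (lead p)" arbitrary: p rule: less_induct)
    case less
    have "z p = \<Omega> (lead p) - (\<Sum>q | q \<in> P \<and> K q (lead p) \<noteq> 0 \<and> w (lead q) < w (lead p). K q (lead p) *\<^sub>Q z q)"
      using z expansion_at_lead[OF less(2), of z] by (simp add: expands_def)
    moreover have "(\<Sum>q | q \<in> P \<and> K q (lead p) \<noteq> 0 \<and> w (lead q) < w (lead p). K q (lead p) *\<^sub>Q z q) \<in> int_module.span (range \<Omega>)"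
      by (rule int_module.span_sum, rule scale_Nats_in_subspace[OF sub]) (auto intro: nat less(1))
    moreover have "\<Omega> (lead p) \<in> int_module.span (range \<Omega>)" by (rule int_module.span_base) simp
    ultimately show ?case by (simp only: int_module.span_diff)
  qed
  then show "int_module.span (z ` P) \<subseteq> int_module.span (range \<Omega>)"
    by (intro int_module.span_minimal sub) blast
qed

end

section \<open>Leading monomials of products of Schur functions\<close>

definition lead :: "('r \<Rightarrow> nat list) \<Rightarrow> ('r \<times> nat) multiset" where
  "lead \<nu> = (\<Sum>U | \<nu> U \<noteq> []. lead_mset U (\<nu> U))"

lemma multi_partitionsD:
  assumes "\<nu> \<in> multi_partitions I"
  shows "is_partition (\<nu> U)" "finite {U. \<nu> U \<noteq> []}" "\<nu> U \<noteq> [] \<Longrightarrow> U \<in> I"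
  using assms by (auto simp: multi_partitions_def)

lemma leading_schur_product:
  "\<nu> \<in> multi_partitions I \<Longrightarrow> leading (schur_product \<nu>) (lead \<nu>)"
  unfolding schur_product_def lead_def
  by (intro leading_prod leading_schur multi_partitionsD(1,2))

text \<open>The tableau with i throughout row i has as many entries i as row i has cells; hence the
  leading monomial determines \<nu>.\<close>

lemma count_lead:
  assumes "finite {U. \<nu> U \<noteq> []}"
  shows "count (lead \<nu>) (U, i) = rowlen (\<nu> U) i"
proof -
  have c: "count (lead_mset V (\<nu> V)) (U, i) = (if V = U then rowlen (\<nu> U) i else 0)" for V
  proof -
    have "{c \<in> cells (\<nu> U). fst c = i} = {i} \<times> {..<rowlen (\<nu> U) i}" by (auto simp: cells_iff)
    then show ?thesis unfolding count_content by (auto simp: card_cartesian_product)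
  qed
  have "count (lead \<nu>) (U, i) = (\<Sum>V | \<nu> V \<noteq> []. if V = U then rowlen (\<nu> U) i else 0)"
    by (simp only: lead_def count_sum c)
  also have "\<dots> = rowlen (\<nu> U) i"
    using assms by (auto simp: rowlen_def)
  finally show ?thesis .
qed

lemma rowlen_inject:
  assumes "is_partition \<nu>" "is_partition \<kappa>" "\<And>i. rowlen \<nu> i = rowlen \<kappa> i"
  shows "\<nu> = \<kappa>"
proof (rule nth_equalityI)
  have "length \<nu> \<le> i \<longleftrightarrow> length \<kappa> \<le> i" for i
    using rowlen_eq_0[OF assms(1), of i] rowlen_eq_0[OF assms(2), of i] assms(3) by simp
  then show len: "length \<nu> = length \<kappa>" by (meson order.refl le_antisym)
  fix i assume "i < length \<nu>"
  then show "\<nu> ! i = \<kappa> ! i" using assms(3)[of i] len by (simp add: rowlen_def)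
qed

lemma inj_on_lead: "inj_on lead (multi_partitions I)"
proof (rule inj_onI, rule ext)
  fix \<nu> \<kappa> U assume a: "\<nu> \<in> multi_partitions I" "\<kappa> \<in> multi_partitions I" "lead \<nu> = lead \<kappa>"
  have "rowlen (\<nu> U) i = rowlen (\<kappa> U) i" for i
    using count_lead[OF multi_partitionsD(2)[OF a(1)], of U i] count_lead[OF multi_partitionsD(2)[OF a(2)], of U i] a(3)
    by simp
  then show "\<nu> U = \<kappa> U" by (rule rowlen_inject[OF multi_partitionsD(1)[OF a(1)] multi_partitionsD(1)[OF a(2)]])
qed

lemma snd_le_weight: "v \<in># m \<Longrightarrow> snd v \<le> weight m"
  by (auto simp: weight_def dest!: multi_member_split)

lemma fst_lead: "\<nu> \<in> multi_partitions I \<Longrightarrow> v \<in># lead \<nu> \<Longrightarrow> fst v \<in> I"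
proof -
  assume \<nu>: "\<nu> \<in> multi_partitions I" and v: "v \<in># lead \<nu>"
  then have "count (lead \<nu>) (fst v, snd v) \<noteq> 0" by simp
  then have "\<nu> (fst v) \<noteq> []" unfolding count_lead[OF multi_partitionsD(2)[OF \<nu>]] by (auto simp: rowlen_def)
  then show ?thesis by (rule multi_partitionsD(3)[OF \<nu>])
qed

text \<open>The leading monomial of such a \<nu> has the same first components as m and no larger
  weight, so its variables come from a finite set and its degree is that of m; moreover
  \<open>lead\<close> is injective.\<close>

lemma finite_schur_product_support:
  "finite {\<nu> \<in> multi_partitions I. coeff (schur_product \<nu>) m \<noteq> 0}" (is "finite ?S")
proof -
  let ?V = "fst ` set_mset m \<times> {..weight m}"
  have "lead ` ?S \<subseteq> {n \<in> {n. set_mset n \<subseteq> ?V}. mdeg n = size m}"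
  proof clarify
    fix \<nu> assume \<nu>: "\<nu> \<in> multi_partitions I" and nz: "coeff (schur_product \<nu>) m \<noteq> 0"
    note lead = leadingD[OF leading_schur_product[OF \<nu>]]
    have img: "image_mset fst m = image_mset fst (lead \<nu>)" by (rule lead(5)[OF nz])
    have "v \<in> ?V" if "v \<in># lead \<nu>" for v
    proof -
      have "fst v \<in># image_mset fst (lead \<nu>)" using that by simp
      then have "fst v \<in> fst ` set_mset m" unfolding img[symmetric] by simp
      moreover have "snd v \<le> weight m" using snd_le_weight[OF that] lead(3)[OF nz] by (rule order_trans)
      ultimately show ?thesis by (cases v) auto
    qed
    moreover have "size (lead \<nu>) = size m" using arg_cong[OF img, of size] by simp
    ultimately show "lead \<nu> \<in> {n. set_mset n \<subseteq> ?V} \<and> mdeg (lead \<nu>) = size m" by (auto simp: mdeg_multiset_def)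
  qed
  moreover have "finite {n \<in> {n. set_mset n \<subseteq> ?V}. mdeg n = size m}" by (rule finite_multisets_over) simp
  ultimately have "finite (lead ` ?S)" by (rule finite_subset)
  moreover have "inj_on lead ?S" by (rule inj_on_subset[OF inj_on_lead]) blast
  ultimately show ?thesis by (rule finite_imageD)
qed

section \<open>Invariance under swaps and reduction to dominant monomials\<close>

abbreviation swap_mset :: "'r \<Rightarrow> nat \<Rightarrow> ('r \<times> nat) multiset \<Rightarrow> ('r \<times> nat) multiset" where
  "swap_mset U k \<equiv> image_mset (swap_var U k)"

lemma swap_mset_eq_iff: "swap_mset U k m = n \<longleftrightarrow> m = swap_mset U k n"
  by (metis image_swap_swap)

lemma monomial_map_swap: "monomial_map (\<lambda>_. 1) (swap_mset U k)"
  unfolding monomial_map_def swap_mset_eq_iff by (simp add: mdeg_multiset_def)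

lemma coeff_subst_swap: "coeff (subst (\<lambda>_. 1) (swap_mset U k) x) m = coeff x (swap_mset U k m)"
  unfolding coeff_subst swap_mset_eq_iff by (simp add: scaleQ_one)

lemma swap_fixed_iff:
  "subst (\<lambda>_. 1) (swap_mset U k) x = x \<longleftrightarrow> (\<forall>m. coeff x (swap_mset U k m) = coeff x m)"
  using coeff_subst_swap[of U k x] by (metis series_eqI)

lemma alg_hom_prod_fixed:
  fixes f :: "'i \<Rightarrow> ('m::finite_splits, rat) series"
  assumes "alg_hom h" "\<And>i. i \<in> A \<Longrightarrow> h (f i) = f i"
  shows "h (\<Prod>i\<in>A. f i) = (\<Prod>i\<in>A. f i)"
  using assms(2) by (induction A rule: infinite_finite_induct)
    (simp_all add: assms(1)[unfolded alg_hom_def])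

lemma coeff_schur_product_swap:
  assumes "\<nu> \<in> multi_partitions I"
  shows "coeff (schur_product \<nu>) (swap_mset U k m) = coeff (schur_product \<nu>) m"
proof -
  have "subst (\<lambda>_. 1) (swap_mset U k) (schur (\<nu> V) V) = schur (\<nu> V) V" for V
    unfolding swap_fixed_iff by (intro allI coeff_schur_swap multi_partitionsD(1)[OF assms])
  then have "subst (\<lambda>_. 1) (swap_mset U k) (schur_product \<nu>) = schur_product \<nu>"
    unfolding schur_product_def by (intro alg_hom_prod_fixed subst_alg_hom monomial_map_swap)
  then show ?thesis unfolding swap_fixed_iff by blast
qed

lemma fst_swap_var [simp]: "fst (swap_var U k v) = fst v"
  by (auto simp: swap_var_def)

lemma coeff_generic_swap: "coeff (generic I) (swap_mset U k m) = coeff (generic I) m"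
proof -
  consider "m = 0" | v where "m = {#v#}" | "m \<noteq> 0" "\<And>v. m \<noteq> {#v#}" by blast
  then show ?thesis
  proof cases
    case 1 then show ?thesis by simp
  next
    case 2 then show ?thesis by (simp add: coeff_generic(2))
  next
    case 3
    have "swap_mset U k m \<noteq> {#v#}" for v using 3(2)[of "swap_var U k v"] by (simp add: swap_mset_eq_iff)
    moreover have "swap_mset U k m \<noteq> 0" using 3(1) by simp
    ultimately show ?thesis using coeff_generic(3)[OF 3] coeff_generic(3) by metis
  qed
qed

text \<open>\<open>generic I\<close> treats all variables of one set alike, and \<open>Phi\<close>
  commutes with permutations of the variables.\<close>

lemma coeff_Z_generating_swap: "coeff (Z_generating I) (swap_mset U k m) = coeff (Z_generating I) m"
proof -
  have "subst (\<lambda>_. 1) (swap_mset U k) (generic I) = generic I"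
    unfolding swap_fixed_iff by (intro allI coeff_generic_swap)
  then have "subst (\<lambda>_. 1) (swap_mset U k) (Z_generating I) = Z_generating I"
    unfolding Z_generating_Phi using subst_Phi[OF monomial_map_swap, of "generic I" U k] by (simp add: coeff_generic)
  then show ?thesis unfolding swap_fixed_iff by blast
qed

lemma coeff_Z_generating_eq_0:
  assumes "v \<in># m" "fst v \<notin> I" shows "coeff (Z_generating I) m = 0"
proof -
  have "restrict_vars (I \<times> UNIV) (generic I) = generic I"
  proof (rule series_eqI)
    fix n
    show "coeff (restrict_vars (I \<times> UNIV) (generic I)) n = coeff (generic I) n"
      using coeff_generic_neq_0[of I n] by (auto simp: coeff_restrict_vars)
  qed
  then have "coeff (Z_generating I) m = coeff (restrict_vars (I \<times> UNIV) (Z_generating I)) m"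
    unfolding Z_generating_Phi using restrict_vars_Phi[of "generic I" "I \<times> UNIV"] by (simp add: coeff_generic)
  moreover have "\<not> set_mset m \<subseteq> I \<times> UNIV" using assms by (auto simp: mem_Times_iff)
  ultimately show ?thesis unfolding coeff_restrict_vars by simp
qed

text \<open>A swap of neighbouring exponents towards decreasing order lowers the weight, so sorting
  by swaps terminates.\<close>

lemma weight_swap:
  "weight (swap_mset U k m) + count m (U, Suc k) = weight m + count m (U, k)"
proof (induction m)
  case empty show ?case by simp
next
  case (add v m)
  have "weight (add_mset (swap_var U k v) (swap_mset U k m)) = snd (swap_var U k v) + weight (swap_mset U k m)"
    "weight (add_mset v m) = snd v + weight m" by (simp_all add: weight_def)
  moreover have "count (add_mset v m) u = count m u + (if u = v then 1 else 0)" for u by simp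
  moreover have "snd (swap_var U k v) + (if (U, Suc k) = v then 1 else 0) = snd v + (if (U, k) = v then 1 else 0)"
    by (auto simp: swap_var_def)
  ultimately show ?case using add by (simp only: image_mset_add_mset)
qed

lemma dominant_is_lead:
  assumes I: "\<And>v. v \<in># m \<Longrightarrow> fst v \<in> I" and dom: "\<And>U k. count m (U, Suc k) \<le> count m (U, k)"
  shows "\<exists>\<nu>\<in>multi_partitions I. m = lead \<nu>"
proof -
  have anti: "count m (U, j) \<le> count m (U, i)" if "i \<le> j" for U i j
    using lift_Suc_antimono_le[of "\<lambda>k. count m (U, k)", OF dom that] .
  \<comment> \<open>The positions of nonzero exponents form an initial segment because the exponents
    decrease; its size is the number of parts.\<close>
  define S where "S U = {i. count m (U, i) \<noteq> 0}" for U
  have S: "i < card (S U) \<longleftrightarrow> i \<in> S U" for i U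
  proof (rule nat_downset_iff)
    have "S U \<subseteq> snd ` set_mset m" unfolding S_def by force
    then show "finite (S U)" by (rule finite_subset) simp
    show "x \<in> S U" if "y \<in> S U" "x \<le> y" for x y 
      using that anti[of x y U] unfolding S_def mem_Collect_eq by linarith
  qed
  define \<nu> where "\<nu> U = map (\<lambda>i. count m (U, i)) [0..<card (S U)]" for U
  have row: "rowlen (\<nu> U) i = count m (U, i)" for U i
    
  proof (cases "i < card (S U)")
    case True
    then show ?thesis by (simp add: rowlen_def \<nu>_def)
  next
    case False
    then have "count m (U, i) = 0" unfolding S by (simp only: S_def mem_Collect_eq not_not)
    then show ?thesis using False by (simp add: rowlen_def \<nu>_def)
  qed
  have part: "is_partition (\<nu> U)" for U
    unfolding is_partition_def
  proof
    show "sorted_wrt (\<ge>) (\<nu> U)" 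
      unfolding sorted_wrt_iff_nth_less
    proof (intro allI impI)
      fix i j assume "i < j" "j < length (\<nu> U)"
      then show "\<nu> U ! j \<le> \<nu> U ! i" using anti[of i j U] by (simp add: \<nu>_def)
    qed
    show "0 \<notin> set (\<nu> U)" 
    proof
      assume "0 \<in> set (\<nu> U)"
      then obtain i where i: "i < card (S U)" "count m (U, i) = 0" by (auto simp: \<nu>_def simp del: count_eq_zero_iff)
      then show False unfolding S by (simp only: S_def mem_Collect_eq)
    qed
  qed
  have supp: "U \<in> fst ` set_mset m" if "\<nu> U \<noteq> []" for U
  proof -
    have "card (S U) \<noteq> 0" using that by (auto simp: \<nu>_def)
    then have "0 \<in> S U" using S[of 0 U] by simp
    then have "(U, 0) \<in># m" by (simp only: S_def mem_Collect_eq count_eq_zero_iff not_not)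
    then show ?thesis by force
  qed
  have fin: "finite {U. \<nu> U \<noteq> []}"
    by (rule finite_subset[of _ "fst ` set_mset m"]) (use supp in auto)
  have "{U. \<nu> U \<noteq> []} \<subseteq> I" using supp I by blast
  then have "\<nu> \<in> multi_partitions I" unfolding multi_partitions_def using part fin by simp
  moreover have "m = lead \<nu>"
  proof (rule multiset_eqI)
    fix v show "count m v = count (lead \<nu>) v" by (cases v) (simp add: count_lead[OF fin] row)
  qed
  ultimately show ?thesis by blast
qed

text \<open>A variable outside I forces all coefficients to vanish. Otherwise two neighbouring
  exponents are out of order and their swap lowers the weight, or the exponents form
  partitions.\<close>

lemma monomial_reduction:
  "(\<exists>\<nu>\<in>multi_partitions I. m = lead \<nu>) \<or>
   (\<exists>m'. weight m' < weight m \<and> coeff (Z_generating I) m' = coeff (Z_generating I) m \<and>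
      (\<forall>\<nu>\<in>multi_partitions I. coeff (schur_product \<nu>) m' = coeff (schur_product \<nu>) m)) \<or>
   (coeff (Z_generating I) m = 0 \<and> (\<forall>\<nu>\<in>multi_partitions I. coeff (schur_product \<nu>) m = 0))"
proof -
  consider (out) v where "v \<in># m" "fst v \<notin> I" | (swap) U k where "count m (U, k) < count m (U, Suc k)"
    | (dom) "\<And>v. v \<in># m \<Longrightarrow> fst v \<in> I" "\<And>U k. count m (U, Suc k) \<le> count m (U, k)"
    by (meson not_le)
  then show ?thesis
  proof cases
    case out
    have "coeff (schur_product \<nu>) m = 0" if \<nu>: "\<nu> \<in> multi_partitions I" for \<nu>
    proof (rule ccontr)
      assume "coeff (schur_product \<nu>) m \<noteq> 0"
      then have "image_mset fst m = image_mset fst (lead \<nu>)" by (rule leadingD(5)[OF leading_schur_product[OF \<nu>]])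
      moreover have "fst v \<in># image_mset fst m" using out(1) by simp
      ultimately have "fst v \<in> fst ` set_mset (lead \<nu>)" by simp
      then show False using fst_lead[OF \<nu>] out(2) by auto
    qed
    then show ?thesis using coeff_Z_generating_eq_0[OF out] by blast
  next
    case swap
    then have "weight (swap_mset U k m) < weight m" using weight_swap[of U k m] by linarith
    moreover have "coeff (Z_generating I) (swap_mset U k m) = coeff (Z_generating I) m" by (rule coeff_Z_generating_swap)
    moreover have "\<forall>\<nu>\<in>multi_partitions I. coeff (schur_product \<nu>) (swap_mset U k m) = coeff (schur_product \<nu>) m"
      by (intro ballI coeff_schur_product_swap)
    ultimately show ?thesis by blast
  next
    case dom
    then show ?thesis using dominant_is_lead by blast
  qed
qed

text \<open>\<open>Z_elem\<close> is a definite description, so existence and uniqueness must come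
  first. Both are supplied by the unitriangular system, whose predicate \<open>expands\<close> is
  the defining equation read coefficientwise.\<close>

lemma G_int_span: "G_int I = int_module.span (range (coeff (Z_generating I)))"
proof -
  let ?P = "multi_partitions I" and ?K = "\<lambda>\<nu>. coeff (schur_product \<nu>)" and ?\<Omega> = "coeff (Z_generating I)"
  note lead = leadingD[OF leading_schur_product]
  interpret unitriangular ?P lead weight ?K ?\<Omega>
    by unfold_locales
      (rule finite_schur_product_support inj_on_lead monomial_reduction | (rule lead(1,3,4); assumption))+
  have ex: "expands z \<longleftrightarrow> (\<forall>\<nu>. \<nu> \<notin> ?P \<longrightarrow> z \<nu> = 0) \<and>
      sum_series (\<lambda>\<nu>. map_series (\<lambda>c. c *\<^sub>Q z \<nu>) (schur_product \<nu>)) = Z_generating I" for z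
  proof -
    have Z: "coeff (sum_series (\<lambda>\<nu>. map_series (\<lambda>c. c *\<^sub>Q z \<nu>) (schur_product \<nu>))) m =
        (\<Sum>\<nu> | \<nu> \<in> ?P \<and> ?K \<nu> m \<noteq> 0. ?K \<nu> m *\<^sub>Q z \<nu>)" if z: "\<forall>\<nu>. \<nu> \<notin> ?P \<longrightarrow> z \<nu> = 0" for m
    proof -
      have "Sum_any (\<lambda>\<nu>. ?K \<nu> m *\<^sub>Q z \<nu>) = (\<Sum>\<nu> | \<nu> \<in> ?P \<and> ?K \<nu> m \<noteq> 0. ?K \<nu> m *\<^sub>Q z \<nu>)"
        by (rule Sum_any.expand_superset[OF finite_schur_product_support]) (use z in auto)
      then show ?thesis by (simp add: sum_series_def)
    qed
    show ?thesis
    proof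
      assume e: "expands z"
      then have z0: "\<forall>\<nu>. \<nu> \<notin> ?P \<longrightarrow> z \<nu> = 0" unfolding expands_def by blast
      have "sum_series (\<lambda>\<nu>. map_series (\<lambda>c. c *\<^sub>Q z \<nu>) (schur_product \<nu>)) = Z_generating I"
        by (rule series_eqI) (use e Z[OF z0] in \<open>simp add: expands_def\<close>)
      then show "(\<forall>\<nu>. \<nu> \<notin> ?P \<longrightarrow> z \<nu> = 0) \<and>
        sum_series (\<lambda>\<nu>. map_series (\<lambda>c. c *\<^sub>Q z \<nu>) (schur_product \<nu>)) = Z_generating I"
        using z0 by blast
    next
      assume a: "(\<forall>\<nu>. \<nu> \<notin> ?P \<longrightarrow> z \<nu> = 0) \<and>
        sum_series (\<lambda>\<nu>. map_series (\<lambda>c. c *\<^sub>Q z \<nu>) (schur_product \<nu>)) = Z_generating I"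
      then have z0: "\<forall>\<nu>. \<nu> \<notin> ?P \<longrightarrow> z \<nu> = 0" by blast
      show "expands z"
        unfolding expands_def Z[OF z0, symmetric] conjunct2[OF a] using z0 by blast
    qed
  qed
  obtain z where z: "expands z" using expands_exists by blast
  have "Z_elem I = z"
    unfolding Z_elem_def ex[symmetric]
  proof (rule the_equality)
    show "expands z" by (rule z)
    show "y = z" if "expands y" for y by (rule expands_unique[OF that z])
  qed
  then show ?thesis
    unfolding G_int_def using expands_span[OF z lead(2)] by simp
qed

text \<open>The middle conjunct ties the polynomials that (2) prescribes for W outside I to the
  actual elements e_r(W), so that the relators speak of these elements.\<close>

theorem theorem6p5:
  fixes I :: "'r::{ring,monoid_mult} set"
  assumes "is_int_basis I"
  shows "is_presentation (I \<times> {1..}) (relators I) (\<lambda>(U, r). e_ginf r U) \<and>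
    (\<forall>W r. free_eval (\<lambda>(U, r). e_ginf r U) (coeff (E_free I W) r) = e_ginf r W) \<and>
    G_int I = is_subring hull {e_ginf i U | i U. i \<ge> 1 \<and> U \<in> I}"
proof -
  have "int_module.span I = UNIV" using assms by (simp add: is_int_basis_def)
  then have "G_int I = is_subring hull {e_ginf i U | i U. i \<ge> 1 \<and> U \<in> I}"
    unfolding G_int_span Z_generating_Phi by (rule coeff_span_eq_subring)
  then show ?thesis using presentation[OF assms] ev_coeff_E_free[OF assms] by blast
qed

end
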